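(* Let $H$ be a quasitriangular quasi-Hopf algebra and $A$ any braided commutative algebra in ${}^H\mathscr{M}$. Then the braiding $\tau$ in the closed monoidal category ${}^H\mathscr{M}$ descends to a braiding $\tau^A$ in the closed monoidal category ${}^H{}_A\mathscr{M}^{\mathrm{sym}}_A$. Explicitly, $$\tau^A_{V,W}:V\otimes_AW\to W\otimes_AV,\quad v\otimes_Aw\mapsto(R^{(2)}\triangleright_Ww)\otimes_A(R^{(1)}\triangleright_Vv),$$ for any two objects $V,W$ in ${}^H{}_A\mathscr{M}^{\mathrm{sym}}_A$. As a consequence, ${}^H{}_A\mathscr{M}^{\mathrm{sym}}_A$ is a braided closed monoidal category.
   Context: Fix a commutative ring $k$ with unit; $\otimes=\otimes_k$. A quasi-bialgebra is an associative unital $k$-algebra $H$ with algebra homomorphisms $\Delta:H\to H\otimes H$, $\epsilon:H\to k$ and an invertible $\phi\in H^{\otimes 3}$ such that for all $h\in H$: $(\epsilon\otimes\mathrm{id})\Delta(h)=h=(\mathrm{id}\otimes\epsilon)\Delta(h)$; $(\mathrm{id}\otimes\Delta)\Delta(h)\cdot\phi=\phi\cdot(\Delta\otimes\mathrm{id})\Delta(h)$; $(\mathrm{id}\otimes\mathrm{id}\otimes\Delta)(\phi)\cdot(\Delta\otimes\mathrm{id}\otimes\mathrm{id})(\phi)=(1\otimes\phi)\cdot(\mathrm{id}\otimes\Delta\otimes\mathrm{id})(\phi)\cdot(\phi\otimes1)$; $(\mathrm{id}\otimes\epsilon\otimes\mathrm{id})(\phi)=1\otimes1$. Notation (summation understood):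 $\Delta(h)=h_{(1)}\otimes h_{(2)}$, $\phi=\phi^{(1)}\otimes\phi^{(2)}\otimes\phi^{(3)}$, $\phi^{-1}=\phi^{(-1)}\otimes\phi^{(-2)}\otimes\phi^{(-3)}$. A quasi-Hopf algebra is a quasi-bialgebra with a quasi-antipode $(S,\alpha,\beta)$: an algebra anti-automorphism $S:H\to H$ and $\alpha,\beta\in H$ with $S(h_{(1)})\alpha h_{(2)}=\epsilon(h)\alpha$, $h_{(1)}\beta S(h_{(2)})=\epsilon(h)\beta$ for all $h$, $\phi^{(1)}\beta S(\phi^{(2)})\alpha\phi^{(3)}=1$, $S(\phi^{(-1)})\alpha\phi^{(-2)}\beta S(\phi^{(-3)})=1$. It is quasitriangular if equipped with an invertible $R=R^{(1)}\otimes R^{(2)}\in H\otimes H$ with $\Delta^{\mathrm{op}}(h)=R\Delta(h)R^{-1}$, $(\mathrm{id}\otimes\Delta)(R)=\phi_{231}^{-1}R_{13}\phi_{213}R_{12}\phi_{123}^{-1}$ and $(\Delta\otimes\mathrm{id})(R)=\phi_{312}R_{13}\phi_{132}^{-1}R_{23}\phi_{123}$, where $\Delta^{\mathrm{op}}(h)=h_{(2)}\otimes h_{(1)}$ and $X_{i_1\dots i_p}$ denotes the element with $j$-th leg of $X$ placed in tensor position $i_j$ and $1$ elsewhere. ${}^H\mathscr{M}$ is the category of left $H$-modules (action $\triangleright$) and $H$-equivariant $k$-linear maps, monoidal with $h\triangleright(v\otimes w)=(h_{(1)}\triangleright v)\otimes(h_{(2)}\triangleright w)$, unit $I=k$ (action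 via $\epsilon$), associator $\Phi_{V,W,X}((v\otimes w)\otimes x)=(\phi^{(1)}\triangleright v)\otimes((\phi^{(2)}\triangleright w)\otimes(\phi^{(3)}\triangleright x))$ and braiding $\tau_{V,W}(v\otimes w)=(R^{(2)}\triangleright w)\otimes(R^{(1)}\triangleright v)$. It is closed with internal hom $\hom(V,W)=\mathrm{Hom}_k(V,W)$, $h\triangleright L=(h_{(1)}\triangleright\cdot)\circ L\circ(S(h_{(2)})\triangleright\cdot)$, evaluation $\mathrm{ev}_{V,W}(L\otimes v)=\phi^{(1)}\triangleright L\big((S(\phi^{(2)})\alpha\phi^{(3)})\triangleright v\big)$ and composition $\bullet_{V,W,X}:\hom(W,X)\otimes\hom(V,W)\to\hom(V,X)$, the unique ${}^H\mathscr{M}$-morphism with $\mathrm{ev}_{V,X}\circ(\bullet_{V,W,X}\otimes\mathrm{id}_V)=\mathrm{ev}_{W,X}\circ(\mathrm{id}\otimes\mathrm{ev}_{V,W})\circ\Phi_{\hom(W,X),\hom(V,W),V}$. An algebra in ${}^H\mathscr{M}$ is an object $A$ with ${}^H\mathscr{M}$-morphisms $\mu_A:A\otimes A\to A$ (written $aa'$) and $\eta_A:I\to A$ ($1_A=\eta_A(1)$) such that $(aa')a''=(\phi^{(1)}\triangleright a)\big((\phi^{(2)}\triangleright a')(\phi^{(3)}\triangleright a'')\big)$ and $1_Aa=a=a1_A$. An $A$-bimodule in ${}^H\mathscr{M}$ is an object $V$ with ${}^H\mathscr{M}$-morphisms $l_V:A\otimes V\to V$ (written $av$) and $r_V:V\otimes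 A\to V$ (written $va$) such that $(va)a'=(\phi^{(1)}\triangleright v)\big((\phi^{(2)}\triangleright a)(\phi^{(3)}\triangleright a')\big)$, $a(a'v)=\big((\phi^{(-1)}\triangleright a)(\phi^{(-2)}\triangleright a')\big)(\phi^{(-3)}\triangleright v)$, $a(va')=\big((\phi^{(-1)}\triangleright a)(\phi^{(-2)}\triangleright v)\big)(\phi^{(-3)}\triangleright a')$, $1_Av=v=v1_A$. ${}^H{}_A\mathscr{M}_A$ is the category of these with $H$-equivariant, left and right $A$-linear maps. ${}^H{}_A\mathscr{M}_A$ is monoidal: $V\otimes_A W=(V\otimes W)/\mathrm{Im}\big(r_V\otimes\mathrm{id}-(\mathrm{id}\otimes l_W)\circ\Phi_{V,A,W}\big)$, $v\otimes_A w$ the class of $v\otimes w$, with $a(v\otimes_A w)=\big((\phi^{(-1)}\triangleright a)(\phi^{(-2)}\triangleright v)\big)\otimes_A(\phi^{(-3)}\triangleright w)$, $(v\otimes_A w)a=(\phi^{(1)}\triangleright v)\otimes_A\big((\phi^{(2)}\triangleright w)(\phi^{(3)}\triangleright a)\big)$; associator induced by $\Phi$; unit object $A$; unitors induced by $l_V$, $r_V$. It is closed with internal hom $\hom_A$: $\hom(V,W)$ is an $A$-bimodule via $aL=\widehat{l}_W(a)\bullet_{V,W,W}L$, $La=L\bullet_{V,V,W}\widehat{l}_V(a)$ with $\widehat{l}_V(a)=(\phi^{(-1)}\triangleright a)\big((\phi^{(-2)}\beta S(\phi^{(-3)}))\triangleright(\,\cdot\,)\big)$; $\mathrm{ev}_{V,W}$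 descends to $\mathrm{ev}^A_{V,W}:\hom(V,W)\otimes_A V\to W$; with $f_1(L\otimes_A(v\otimes a))=\mathrm{ev}^A_{V,W}(L\otimes_A(va))$, $f_2(L\otimes_A(v\otimes a))=\mathrm{ev}^A_{V,W}\big((\phi^{(-1)}\triangleright L)\otimes_A(\phi^{(-2)}\triangleright v)\big)(\phi^{(-3)}\triangleright a)$ and $D_i:\hom(V,W)\to\hom(V\otimes A,W)$, $D_i(L)=f_i\big((\phi^{(-1)}\triangleright L)\otimes_A((\phi^{(-2)}\beta S(\phi^{(-3)}))\triangleright_{V\otimes A}(\,\cdot\,))\big)$, one sets $\hom_A(V,W)=\mathrm{Ker}(D_1-D_2)$ with induced structures. $A$ is braided commutative if $\mu_A\circ\tau_{A,A}=\mu_A$. For such $A$, an $A$-bimodule $V$ is symmetric if $r_V\circ\tau_{A,V}=l_V$ and $l_V\circ\tau_{V,A}=r_V$. ${}^H{}_A\mathscr{M}^{\mathrm{sym}}_A$ is the full subcategory of ${}^H{}_A\mathscr{M}_A$ of symmetric $A$-bimodules; it is a closed monoidal subcategory (contains $A$, and is stable under $\otimes_A$ and $\hom_A$). *)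

theory Defs
  imports "HOL-Algebra.Module" "HOL-Algebra.RingHom" "HOL-Algebra.Free_Abelian_Groups"
begin

section \<open>Tensor products of modules over a commutative ring\<close>

text \<open>
  Modules are records in the sense of \<^theory>\<open>HOL-Algebra.Module\<close>; their fields \<open>mult\<close> and \<open>one\<close>
  are irrelevant unless the module is used as an algebra.

  The module \<open>V \<otimes> W\<close> is the free abelian group on \<open>carrier V \<times> carrier W\<close> modulo the usual bilinear
  and balanced relators.  Its elements are cosets.  A map out of a set of cosets is
  computed on a chosen representative; all such maps below are independent of this choice.
\<close>

type_synonym ('a, 'b) tens = "('a \<times> 'b \<Rightarrow>\<^sub>0 int) set"

definition rep :: "'a set \<Rightarrow> 'a" where
  "rep X = (SOME x. x \<in> X)"

definition tensor_free ::
  "('k, 'v, 'm) module_scheme \<Rightarrow> ('k, 'w, 'n) module_scheme \<Rightarrow> ('v \<times> 'w \<Rightarrow>\<^sub>0 int) monoid" where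
  "tensor_free V W = free_Abelian_group (carrier V \<times> carrier W)"

definition tensor_null ::
  "('k, 'r) ring_scheme \<Rightarrow> ('k, 'v, 'm) module_scheme \<Rightarrow> ('k, 'w, 'n) module_scheme \<Rightarrow> ('v, 'w) tens" where
  "tensor_null K V W = generate (tensor_free V W)
     ({frag_of (v \<oplus>\<^bsub>V\<^esub> v', w) - frag_of (v, w) - frag_of (v', w) | v v' w.
         v \<in> carrier V \<and> v' \<in> carrier V \<and> w \<in> carrier W} \<union>
      {frag_of (v, w \<oplus>\<^bsub>W\<^esub> w') - frag_of (v, w) - frag_of (v, w') | v w w'.
         v \<in> carrier V \<and> w \<in> carrier W \<and> w' \<in> carrier W} \<union>
      {frag_of (c \<odot>\<^bsub>V\<^esub> v, w) - frag_of (v, c \<odot>\<^bsub>W\<^esub> w) | c v w.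
         c \<in> carrier K \<and> v \<in> carrier V \<and> w \<in> carrier W})"

definition ptens ::
  "('k, 'r) ring_scheme \<Rightarrow> ('k, 'v, 'm) module_scheme \<Rightarrow> ('k, 'w, 'n) module_scheme \<Rightarrow> 'v \<Rightarrow> 'w \<Rightarrow> ('v, 'w) tens" where
  "ptens K V W v w = tensor_null K V W #>\<^bsub>tensor_free V W\<^esub> frag_of (v, w)"

text \<open>
  \<open>tsum2 P X (\<lambda>v w. f v w)\<close> is the sum of the \<open>f v w\<close> in \<open>P\<close> for \<open>X\<close> the sum of the \<open>v \<otimes> w\<close>, that is,
  the value at \<open>X\<close> of the linear extension of the bilinear map \<open>f\<close>.  Applied to comultiplications,
  reassociators and R-matrices it renders Sweedler-type notation.
\<close>

definition tsum2 :: "('p, 'm) ring_scheme \<Rightarrow> ('a, 'b) tens \<Rightarrow> ('a \<Rightarrow> 'b \<Rightarrow> 'p) \<Rightarrow> 'p" where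
  "tsum2 P X f = (\<Oplus>\<^bsub>P\<^esub> p \<in> Poly_Mapping.keys (rep X).
     [Poly_Mapping.lookup (rep X) p] \<cdot>\<^bsub>P\<^esub> f (fst p) (snd p))"

definition tsum3 :: "('p, 'm) ring_scheme \<Rightarrow> ('a, ('b, 'c) tens) tens \<Rightarrow> ('a \<Rightarrow> 'b \<Rightarrow> 'c \<Rightarrow> 'p) \<Rightarrow> 'p" where
  "tsum3 P X f = tsum2 P X (\<lambda>a Y. tsum2 P Y (f a))"

definition tensor_mod ::
  "('k, 'r) ring_scheme \<Rightarrow> ('k, 'v, 'm) module_scheme \<Rightarrow> ('k, 'w, 'n) module_scheme \<Rightarrow> ('k, ('v, 'w) tens) module" where
  "tensor_mod K V W =
     \<lparr>carrier = rcosets\<^bsub>tensor_free V W\<^esub> tensor_null K V W,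
      monoid.mult = undefined,
      one = undefined,
      ring.zero = tensor_null K V W,
      add = (\<lambda>X Y. X <#>\<^bsub>tensor_free V W\<^esub> Y),
      smult = (\<lambda>c X. tensor_null K V W #>\<^bsub>tensor_free V W\<^esub>
                       frag_extend (\<lambda>(v, w). frag_of (c \<odot>\<^bsub>V\<^esub> v, w)) (rep X))\<rparr>"

text \<open>The fields \<open>mult\<close> and \<open>one\<close> hold the tensor product algebra structure, to be used only if
  \<open>V\<close> and \<open>W\<close> are algebras.\<close>

definition tensor ::
  "('k, 'r) ring_scheme \<Rightarrow> ('k, 'v, 'm) module_scheme \<Rightarrow> ('k, 'w, 'n) module_scheme \<Rightarrow> ('k, ('v, 'w) tens) module" where
  "tensor K V W = (tensor_mod K V W)
     \<lparr>mult := (\<lambda>X Y. tsum2 (tensor_mod K V W) X (\<lambda>a b. tsum2 (tensor_mod K V W) Y (\<lambda>c d.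
                ptens K V W (a \<otimes>\<^bsub>V\<^esub> c) (b \<otimes>\<^bsub>W\<^esub> d)))),
      one := ptens K V W \<one>\<^bsub>V\<^esub> \<one>\<^bsub>W\<^esub>\<rparr>"

text \<open>\<open>tmap K V W f g\<close> is \<open>f \<otimes> g\<close> with codomain \<open>V \<otimes> W\<close>.\<close>

definition tmap ::
  "('k, 'r) ring_scheme \<Rightarrow> ('k, 'v, 'm) module_scheme \<Rightarrow> ('k, 'w, 'n) module_scheme \<Rightarrow>
   ('a \<Rightarrow> 'v) \<Rightarrow> ('b \<Rightarrow> 'w) \<Rightarrow> ('a, 'b) tens \<Rightarrow> ('v, 'w) tens" where
  "tmap K V W f g X = tsum2 (tensor K V W) X (\<lambda>a b. ptens K V W (f a) (g b))"

definition klin ::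
  "('k, 'r) ring_scheme \<Rightarrow> ('k, 'v, 'm) module_scheme \<Rightarrow> ('k, 'w, 'n) module_scheme \<Rightarrow> ('v \<Rightarrow> 'w) set" where
  "klin K V W = {f \<in> carrier V \<rightarrow> carrier W.
     (\<forall>x\<in>carrier V. \<forall>y\<in>carrier V. f (x \<oplus>\<^bsub>V\<^esub> y) = f x \<oplus>\<^bsub>W\<^esub> f y) \<and>
     (\<forall>c\<in>carrier K. \<forall>x\<in>carrier V. f (c \<odot>\<^bsub>V\<^esub> x) = c \<odot>\<^bsub>W\<^esub> f x)}"

definition base_module :: "('k, 'r) ring_scheme \<Rightarrow> ('k, 'k) module" where
  "base_module K = \<lparr>carrier = carrier K, monoid.mult = monoid.mult K, one = one K,
     ring.zero = ring.zero K, add = add K, smult = monoid.mult K\<rparr>"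

section \<open>Quasitriangular quasi-Hopf algebras\<close>

record ('k, 'h) quasi_hopf_data = "('k, 'h) module" +
  comult :: "'h \<Rightarrow> ('h, 'h) tens"
  counit :: "'h \<Rightarrow> 'k"
  phi :: "('h, ('h, 'h) tens) tens"
  antipode :: "'h \<Rightarrow> 'h"
  qalpha :: 'h
  qbeta :: 'h
  rmatrix :: "('h, 'h) tens"

text \<open>The tensor powers of \<open>H\<close> are bracketed to the right.\<close>

abbreviation "pow2 K H \<equiv> tensor K H H"
abbreviation "pow3 K H \<equiv> tensor K H (pow2 K H)"
abbreviation "pow4 K H \<equiv> tensor K H (pow3 K H)"

definition pt3 :: "('k, 'r) ring_scheme \<Rightarrow> ('k, 'h, 'm) module_scheme \<Rightarrow>
    'h \<Rightarrow> 'h \<Rightarrow> 'h \<Rightarrow> ('h, ('h, 'h) tens) tens" where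
  "pt3 K H a b c = ptens K H (pow2 K H) a (ptens K H H b c)"

definition pt4 :: "('k, 'r) ring_scheme \<Rightarrow> ('k, 'h, 'm) module_scheme \<Rightarrow>
    'h \<Rightarrow> 'h \<Rightarrow> 'h \<Rightarrow> 'h \<Rightarrow> ('h, ('h, ('h, 'h) tens) tens) tens" where
  "pt4 K H a b c d = ptens K H (pow3 K H) a (pt3 K H b c d)"

definition phi_inv :: "('k, 'r) ring_scheme \<Rightarrow> ('k, 'h, 'm) quasi_hopf_data_scheme \<Rightarrow>
    ('h, ('h, 'h) tens) tens" where
  "phi_inv K H = inv\<^bsub>pow3 K H\<^esub> (phi H)"

definition k_algebra :: "('k, 'r) ring_scheme \<Rightarrow> ('k, 'h, 'm) module_scheme \<Rightarrow> bool" where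
  "k_algebra K H \<longleftrightarrow> module K H \<and> ring H \<and>
     (\<forall>c\<in>carrier K. \<forall>x\<in>carrier H. \<forall>y\<in>carrier H.
        (c \<odot>\<^bsub>H\<^esub> x) \<otimes>\<^bsub>H\<^esub> y = c \<odot>\<^bsub>H\<^esub> (x \<otimes>\<^bsub>H\<^esub> y) \<and> x \<otimes>\<^bsub>H\<^esub> (c \<odot>\<^bsub>H\<^esub> y) = c \<odot>\<^bsub>H\<^esub> (x \<otimes>\<^bsub>H\<^esub> y))"

definition quasi_bialgebra :: "('k, 'r) ring_scheme \<Rightarrow> ('k, 'h, 'm) quasi_hopf_data_scheme \<Rightarrow> bool" where
  "quasi_bialgebra K H \<longleftrightarrow>
     k_algebra K H \<and>
     comult H \<in> klin K H (pow2 K H) \<inter> ring_hom H (pow2 K H) \<and>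
     counit H \<in> klin K H (base_module K) \<inter> ring_hom H K \<and>
     phi H \<in> Units (pow3 K H) \<and>
     (\<forall>h\<in>carrier H.
        tsum2 H (comult H h) (\<lambda>a b. counit H a \<odot>\<^bsub>H\<^esub> b) = h \<and>
        tsum2 H (comult H h) (\<lambda>a b. counit H b \<odot>\<^bsub>H\<^esub> a) = h \<and>
        tsum2 (pow3 K H) (comult H h) (\<lambda>a b. ptens K H (pow2 K H) a (comult H b))
            \<otimes>\<^bsub>pow3 K H\<^esub> phi H
          = phi H \<otimes>\<^bsub>pow3 K H\<^esub>
            tsum2 (pow3 K H) (comult H h) (\<lambda>a b. tsum2 (pow3 K H) (comult H a) (\<lambda>a1 a2. pt3 K H a1 a2 b))) \<and>
     tsum3 (pow4 K H) (phi H) (\<lambda>a b c. tsum2 (pow4 K H) (comult H c) (\<lambda>c1 c2. pt4 K H a b c1 c2))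
         \<otimes>\<^bsub>pow4 K H\<^esub>
       tsum3 (pow4 K H) (phi H) (\<lambda>a b c. tsum2 (pow4 K H) (comult H a) (\<lambda>a1 a2. pt4 K H a1 a2 b c))
       = ptens K H (pow3 K H) \<one>\<^bsub>H\<^esub> (phi H)
         \<otimes>\<^bsub>pow4 K H\<^esub>
         tsum3 (pow4 K H) (phi H) (\<lambda>a b c. tsum2 (pow4 K H) (comult H b) (\<lambda>b1 b2. pt4 K H a b1 b2 c))
         \<otimes>\<^bsub>pow4 K H\<^esub>
         tsum3 (pow4 K H) (phi H) (\<lambda>a b c. pt4 K H a b c \<one>\<^bsub>H\<^esub>) \<and>
     tsum3 (pow2 K H) (phi H) (\<lambda>a b c. ptens K H H a (counit H b \<odot>\<^bsub>H\<^esub> c)) = ptens K H H \<one>\<^bsub>H\<^esub> \<one>\<^bsub>H\<^esub>"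

definition quasi_hopf_algebra :: "('k, 'r) ring_scheme \<Rightarrow> ('k, 'h, 'm) quasi_hopf_data_scheme \<Rightarrow> bool" where
  "quasi_hopf_algebra K H \<longleftrightarrow>
     quasi_bialgebra K H \<and>
     antipode H \<in> klin K H H \<and>
     bij_betw (antipode H) (carrier H) (carrier H) \<and>
     antipode H \<one>\<^bsub>H\<^esub> = \<one>\<^bsub>H\<^esub> \<and>
     (\<forall>g\<in>carrier H. \<forall>h\<in>carrier H. antipode H (g \<otimes>\<^bsub>H\<^esub> h) = antipode H h \<otimes>\<^bsub>H\<^esub> antipode H g) \<and>
     qalpha H \<in> carrier H \<and>
     qbeta H \<in> carrier H \<and>
     (\<forall>h\<in>carrier H.
        tsum2 H (comult H h) (\<lambda>a b. antipode H a \<otimes>\<^bsub>H\<^esub> qalpha H \<otimes>\<^bsub>H\<^esub> b) = counit H h \<odot>\<^bsub>H\<^esub> qalpha H \<and>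
        tsum2 H (comult H h) (\<lambda>a b. a \<otimes>\<^bsub>H\<^esub> qbeta H \<otimes>\<^bsub>H\<^esub> antipode H b) = counit H h \<odot>\<^bsub>H\<^esub> qbeta H) \<and>
     tsum3 H (phi H) (\<lambda>a b c.
        a \<otimes>\<^bsub>H\<^esub> qbeta H \<otimes>\<^bsub>H\<^esub> antipode H b \<otimes>\<^bsub>H\<^esub> qalpha H \<otimes>\<^bsub>H\<^esub> c) = \<one>\<^bsub>H\<^esub> \<and>
     tsum3 H (phi_inv K H) (\<lambda>a b c.
        antipode H a \<otimes>\<^bsub>H\<^esub> qalpha H \<otimes>\<^bsub>H\<^esub> b \<otimes>\<^bsub>H\<^esub> qbeta H \<otimes>\<^bsub>H\<^esub> antipode H c) = \<one>\<^bsub>H\<^esub>"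

text \<open>Leg notation in the third tensor power: \<open>leg3 K H i j l X\<close> is $X_{ijl}$ and \<open>leg2 K H i j X\<close>
  is $X_{ij}$.  The first leg goes to tensor position \<open>i\<close>, the second to \<open>j\<close>, the third to \<open>l\<close>.\<close>

definition leg3 :: "('k, 'r) ring_scheme \<Rightarrow> ('k, 'h, 'm) module_scheme \<Rightarrow> nat \<Rightarrow> nat \<Rightarrow> nat \<Rightarrow>
    ('h, ('h, 'h) tens) tens \<Rightarrow> ('h, ('h, 'h) tens) tens" where
  "leg3 K H i j l X = tsum3 (pow3 K H) X (\<lambda>a b c.
     let p = (\<lambda>n. if n = i then a else if n = j then b else if n = l then c else \<one>\<^bsub>H\<^esub>)
     in pt3 K H (p 1) (p 2) (p 3))"

definition leg2 :: "('k, 'r) ring_scheme \<Rightarrow> ('k, 'h, 'm) module_scheme \<Rightarrow> nat \<Rightarrow> nat \<Rightarrow>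
    ('h, 'h) tens \<Rightarrow> ('h, ('h, 'h) tens) tens" where
  "leg2 K H i j X = tsum2 (pow3 K H) X (\<lambda>a b.
     let p = (\<lambda>n. if n = i then a else if n = j then b else \<one>\<^bsub>H\<^esub>)
     in pt3 K H (p 1) (p 2) (p 3))"

definition quasitriangular_quasi_hopf_algebra ::
  "('k, 'r) ring_scheme \<Rightarrow> ('k, 'h, 'm) quasi_hopf_data_scheme \<Rightarrow> bool" where
  "quasitriangular_quasi_hopf_algebra K H \<longleftrightarrow>
     quasi_hopf_algebra K H \<and>
     rmatrix H \<in> Units (pow2 K H) \<and>
     (\<forall>h\<in>carrier H.
        tsum2 (pow2 K H) (comult H h) (\<lambda>a b. ptens K H H b a)
          = rmatrix H \<otimes>\<^bsub>pow2 K H\<^esub> comult H h \<otimes>\<^bsub>pow2 K H\<^esub> inv\<^bsub>pow2 K H\<^esub> (rmatrix H)) \<and>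
     tsum2 (pow3 K H) (rmatrix H) (\<lambda>r s. ptens K H (pow2 K H) r (comult H s))
       = inv\<^bsub>pow3 K H\<^esub> (leg3 K H 2 3 1 (phi H)) \<otimes>\<^bsub>pow3 K H\<^esub> leg2 K H 1 3 (rmatrix H)
         \<otimes>\<^bsub>pow3 K H\<^esub> leg3 K H 2 1 3 (phi H) \<otimes>\<^bsub>pow3 K H\<^esub> leg2 K H 1 2 (rmatrix H)
         \<otimes>\<^bsub>pow3 K H\<^esub> inv\<^bsub>pow3 K H\<^esub> (leg3 K H 1 2 3 (phi H)) \<and>
     tsum2 (pow3 K H) (rmatrix H) (\<lambda>r s. tsum2 (pow3 K H) (comult H r) (\<lambda>r1 r2. pt3 K H r1 r2 s))
       = leg3 K H 3 1 2 (phi H) \<otimes>\<^bsub>pow3 K H\<^esub> leg2 K H 1 3 (rmatrix H)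
         \<otimes>\<^bsub>pow3 K H\<^esub> inv\<^bsub>pow3 K H\<^esub> (leg3 K H 1 3 2 (phi H)) \<otimes>\<^bsub>pow3 K H\<^esub> leg2 K H 2 3 (rmatrix H)
         \<otimes>\<^bsub>pow3 K H\<^esub> leg3 K H 1 2 3 (phi H)"

section \<open>The category of left H-modules\<close>

record ('k, 'h, 'v) hmod = "('k, 'v) module" +
  act :: "'h \<Rightarrow> 'v \<Rightarrow> 'v" (infixr \<open>\<triangleright>\<index>\<close> 75)

definition hmodule ::
  "('k, 'r) ring_scheme \<Rightarrow> ('k, 'h, 'm) quasi_hopf_data_scheme \<Rightarrow> ('k, 'h, 'v, 'n) hmod_scheme \<Rightarrow> bool" where
  "hmodule K H V \<longleftrightarrow>
     module K V \<and>
     (\<forall>h\<in>carrier H. act V h \<in> klin K V V) \<and>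
     (\<forall>v\<in>carrier V. (\<lambda>h. h \<triangleright>\<^bsub>V\<^esub> v) \<in> klin K H V) \<and>
     (\<forall>g\<in>carrier H. \<forall>h\<in>carrier H. \<forall>v\<in>carrier V. g \<triangleright>\<^bsub>V\<^esub> (h \<triangleright>\<^bsub>V\<^esub> v) = (g \<otimes>\<^bsub>H\<^esub> h) \<triangleright>\<^bsub>V\<^esub> v) \<and>
     (\<forall>v\<in>carrier V. \<one>\<^bsub>H\<^esub> \<triangleright>\<^bsub>V\<^esub> v = v)"

definition hmor :: "('k, 'r) ring_scheme \<Rightarrow> ('k, 'h, 'm) quasi_hopf_data_scheme \<Rightarrow>
    ('k, 'h, 'v, 'n) hmod_scheme \<Rightarrow> ('k, 'h, 'w, 'p) hmod_scheme \<Rightarrow> ('v \<Rightarrow> 'w) set" where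
  "hmor K H V W = {f \<in> klin K V W. \<forall>h\<in>carrier H. \<forall>v\<in>carrier V. f (h \<triangleright>\<^bsub>V\<^esub> v) = h \<triangleright>\<^bsub>W\<^esub> f v}"

definition hunit :: "('k, 'r) ring_scheme \<Rightarrow> ('k, 'h, 'm) quasi_hopf_data_scheme \<Rightarrow> ('k, 'h, 'k) hmod" where
  "hunit K H = module.extend (base_module K) (hmod.fields (\<lambda>h c. counit H h \<otimes>\<^bsub>K\<^esub> c))"

definition htensor :: "('k, 'r) ring_scheme \<Rightarrow> ('k, 'h, 'm) quasi_hopf_data_scheme \<Rightarrow>
    ('k, 'h, 'v, 'n) hmod_scheme \<Rightarrow> ('k, 'h, 'w, 'p) hmod_scheme \<Rightarrow> ('k, 'h, ('v, 'w) tens) hmod" where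
  "htensor K H V W = module.extend (tensor K V W) (hmod.fields
     (\<lambda>h t. tsum2 (tensor K V W) (comult H h) (\<lambda>h1 h2. tmap K V W (act V h1) (act W h2) t)))"

definition assoc :: "('k, 'r) ring_scheme \<Rightarrow> ('k, 'h, 'm) quasi_hopf_data_scheme \<Rightarrow>
    ('k, 'h, 'v, 'n) hmod_scheme \<Rightarrow> ('k, 'h, 'w, 'p) hmod_scheme \<Rightarrow> ('k, 'h, 'x, 'q) hmod_scheme \<Rightarrow>
    (('v, 'w) tens, 'x) tens \<Rightarrow> ('v, ('w, 'x) tens) tens" where
  "assoc K H V W X t =
     (let T = tensor K V (tensor K W X) in
      tsum2 T t (\<lambda>vw x. tsum2 T vw (\<lambda>v w. tsum3 T (phi H) (\<lambda>a b c.
        ptens K V (tensor K W X) (a \<triangleright>\<^bsub>V\<^esub> v) (ptens K W X (b \<triangleright>\<^bsub>W\<^esub> w) (c \<triangleright>\<^bsub>X\<^esub> x))))))"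

definition braid :: "('k, 'r) ring_scheme \<Rightarrow> ('k, 'h, 'm) quasi_hopf_data_scheme \<Rightarrow>
    ('k, 'h, 'v, 'n) hmod_scheme \<Rightarrow> ('k, 'h, 'w, 'p) hmod_scheme \<Rightarrow> ('v, 'w) tens \<Rightarrow> ('w, 'v) tens" where
  "braid K H V W t = tsum2 (tensor K W V) t (\<lambda>v w. tsum2 (tensor K W V) (rmatrix H) (\<lambda>r s.
     ptens K W V (s \<triangleright>\<^bsub>W\<^esub> w) (r \<triangleright>\<^bsub>V\<^esub> v)))"

text \<open>Elements of the internal hom are linear maps, made unique as functions by requiring them to be
  extensional on the carrier.\<close>

definition hhom :: "('k, 'r) ring_scheme \<Rightarrow> ('k, 'h, 'm) quasi_hopf_data_scheme \<Rightarrow>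
    ('k, 'h, 'v, 'n) hmod_scheme \<Rightarrow> ('k, 'h, 'w, 'p) hmod_scheme \<Rightarrow> ('k, 'h, 'v \<Rightarrow> 'w) hmod" where
  "hhom K H V W =
     \<lparr>carrier = klin K V W \<inter> extensional (carrier V),
      monoid.mult = undefined,
      one = undefined,
      ring.zero = (\<lambda>v\<in>carrier V. \<zero>\<^bsub>W\<^esub>),
      add = (\<lambda>L M. \<lambda>v\<in>carrier V. L v \<oplus>\<^bsub>W\<^esub> M v),
      smult = (\<lambda>c L. \<lambda>v\<in>carrier V. c \<odot>\<^bsub>W\<^esub> L v),
      act = (\<lambda>h L. \<lambda>v\<in>carrier V. tsum2 W (comult H h) (\<lambda>h1 h2. h1 \<triangleright>\<^bsub>W\<^esub> L (antipode H h2 \<triangleright>\<^bsub>V\<^esub> v)))\<rparr>"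

definition heval :: "('k, 'r) ring_scheme \<Rightarrow> ('k, 'h, 'm) quasi_hopf_data_scheme \<Rightarrow>
    ('k, 'h, 'v, 'n) hmod_scheme \<Rightarrow> ('k, 'h, 'w, 'p) hmod_scheme \<Rightarrow> ('v \<Rightarrow> 'w, 'v) tens \<Rightarrow> 'w" where
  "heval K H V W t = tsum2 W t (\<lambda>L v. tsum3 W (phi H) (\<lambda>a b c.
     a \<triangleright>\<^bsub>W\<^esub> L ((antipode H b \<otimes>\<^bsub>H\<^esub> qalpha H \<otimes>\<^bsub>H\<^esub> c) \<triangleright>\<^bsub>V\<^esub> v)))"

definition hcomp :: "('k, 'r) ring_scheme \<Rightarrow> ('k, 'h, 'm) quasi_hopf_data_scheme \<Rightarrow>
    ('k, 'h, 'v, 'n) hmod_scheme \<Rightarrow> ('k, 'h, 'w, 'p) hmod_scheme \<Rightarrow> ('k, 'h, 'x, 'q) hmod_scheme \<Rightarrow>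
    ('w \<Rightarrow> 'x, 'v \<Rightarrow> 'w) tens \<Rightarrow> ('v \<Rightarrow> 'x)" where
  "hcomp K H V W X = (THE m.
     m \<in> hmor K H (htensor K H (hhom K H W X) (hhom K H V W)) (hhom K H V X) \<and>
     m \<in> extensional (carrier (htensor K H (hhom K H W X) (hhom K H V W))) \<and>
     (\<forall>t\<in>carrier (htensor K H (htensor K H (hhom K H W X) (hhom K H V W)) V).
        heval K H V X (tmap K (hhom K H V X) V m id t) =
        heval K H W X (tmap K (hhom K H W X) W id (heval K H V W)
          (assoc K H (hhom K H W X) (hhom K H V W) V t))))"

section \<open>Algebras and bimodules in the category of H-modules\<close>

record ('k, 'h, 'a) halg = "('k, 'h, 'a) hmod" +
  mu :: "('a, 'a) tens \<Rightarrow> 'a"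
  eta :: "'k \<Rightarrow> 'a"

definition amul :: "('k, 'r) ring_scheme \<Rightarrow> ('k, 'h, 'a, 'm) halg_scheme \<Rightarrow> 'a \<Rightarrow> 'a \<Rightarrow> 'a" where
  "amul K A a b = mu A (ptens K A A a b)"

definition algebra_in :: "('k, 'r) ring_scheme \<Rightarrow> ('k, 'h, 'm) quasi_hopf_data_scheme \<Rightarrow>
    ('k, 'h, 'a, 'n) halg_scheme \<Rightarrow> bool" where
  "algebra_in K H A \<longleftrightarrow>
     hmodule K H A \<and>
     mu A \<in> hmor K H (htensor K H A A) A \<and>
     eta A \<in> hmor K H (hunit K H) A \<and>
     (\<forall>a\<in>carrier A. \<forall>a'\<in>carrier A. \<forall>a''\<in>carrier A.
        amul K A (amul K A a a') a'' =
        tsum3 A (phi H) (\<lambda>p q r. amul K A (p \<triangleright>\<^bsub>A\<^esub> a) (amul K A (q \<triangleright>\<^bsub>A\<^esub> a') (r \<triangleright>\<^bsub>A\<^esub> a'')))) \<and>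
     (\<forall>a\<in>carrier A. amul K A (eta A \<one>\<^bsub>K\<^esub>) a = a \<and> amul K A a (eta A \<one>\<^bsub>K\<^esub>) = a)"

definition braided_commutative :: "('k, 'r) ring_scheme \<Rightarrow> ('k, 'h, 'm) quasi_hopf_data_scheme \<Rightarrow>
    ('k, 'h, 'a, 'n) halg_scheme \<Rightarrow> bool" where
  "braided_commutative K H A \<longleftrightarrow> (\<forall>t\<in>carrier (htensor K H A A). mu A (braid K H A A t) = mu A t)"

record ('k, 'h, 'a, 'v) bimod = "('k, 'h, 'v) hmod" +
  lmap :: "('a, 'v) tens \<Rightarrow> 'v"
  rmap :: "('v, 'a) tens \<Rightarrow> 'v"

definition lmul :: "('k, 'r) ring_scheme \<Rightarrow> ('k, 'h, 'a, 'm) halg_scheme \<Rightarrow>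
    ('k, 'h, 'a, 'v, 'n) bimod_scheme \<Rightarrow> 'a \<Rightarrow> 'v \<Rightarrow> 'v" where
  "lmul K A V a v = lmap V (ptens K A V a v)"

definition rmul :: "('k, 'r) ring_scheme \<Rightarrow> ('k, 'h, 'a, 'm) halg_scheme \<Rightarrow>
    ('k, 'h, 'a, 'v, 'n) bimod_scheme \<Rightarrow> 'v \<Rightarrow> 'a \<Rightarrow> 'v" where
  "rmul K A V v a = rmap V (ptens K V A v a)"

definition bimodule :: "('k, 'r) ring_scheme \<Rightarrow> ('k, 'h, 'm) quasi_hopf_data_scheme \<Rightarrow>
    ('k, 'h, 'a, 'n) halg_scheme \<Rightarrow> ('k, 'h, 'a, 'v, 'p) bimod_scheme \<Rightarrow> bool" where
  "bimodule K H A V \<longleftrightarrow>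
     hmodule K H V \<and>
     lmap V \<in> hmor K H (htensor K H A V) V \<and>
     rmap V \<in> hmor K H (htensor K H V A) V \<and>
     (\<forall>v\<in>carrier V. \<forall>a\<in>carrier A. \<forall>a'\<in>carrier A.
        rmul K A V (rmul K A V v a) a' =
          tsum3 V (phi H) (\<lambda>p q r. rmul K A V (p \<triangleright>\<^bsub>V\<^esub> v) (amul K A (q \<triangleright>\<^bsub>A\<^esub> a) (r \<triangleright>\<^bsub>A\<^esub> a'))) \<and>
        lmul K A V a (lmul K A V a' v) =
          tsum3 V (phi_inv K H) (\<lambda>p q r. lmul K A V (amul K A (p \<triangleright>\<^bsub>A\<^esub> a) (q \<triangleright>\<^bsub>A\<^esub> a')) (r \<triangleright>\<^bsub>V\<^esub> v)) \<and>
        lmul K A V a (rmul K A V v a') =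
          tsum3 V (phi_inv K H) (\<lambda>p q r. rmul K A V (lmul K A V (p \<triangleright>\<^bsub>A\<^esub> a) (q \<triangleright>\<^bsub>V\<^esub> v)) (r \<triangleright>\<^bsub>A\<^esub> a'))) \<and>
     (\<forall>v\<in>carrier V. lmul K A V (eta A \<one>\<^bsub>K\<^esub>) v = v \<and> rmul K A V v (eta A \<one>\<^bsub>K\<^esub>) = v)"

definition bimor :: "('k, 'r) ring_scheme \<Rightarrow> ('k, 'h, 'm) quasi_hopf_data_scheme \<Rightarrow>
    ('k, 'h, 'a, 'n) halg_scheme \<Rightarrow> ('k, 'h, 'a, 'v, 'p) bimod_scheme \<Rightarrow>
    ('k, 'h, 'a, 'w, 'q) bimod_scheme \<Rightarrow> ('v \<Rightarrow> 'w) set" where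
  "bimor K H A V W = {f \<in> hmor K H V W. \<forall>a\<in>carrier A. \<forall>v\<in>carrier V.
     f (lmul K A V a v) = lmul K A W a (f v) \<and> f (rmul K A V v a) = rmul K A W (f v) a}"

definition bimod_iso :: "('k, 'r) ring_scheme \<Rightarrow> ('k, 'h, 'm) quasi_hopf_data_scheme \<Rightarrow>
    ('k, 'h, 'a, 'n) halg_scheme \<Rightarrow> ('k, 'h, 'a, 'v, 'p) bimod_scheme \<Rightarrow>
    ('k, 'h, 'a, 'w, 'q) bimod_scheme \<Rightarrow> ('v \<Rightarrow> 'w) \<Rightarrow> bool" where
  "bimod_iso K H A V W f \<longleftrightarrow> f \<in> bimor K H A V W \<and>
     (\<exists>g\<in>bimor K H A W V. (\<forall>v\<in>carrier V. g (f v) = v) \<and> (\<forall>w\<in>carrier W. f (g w) = w))"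

definition sym_bimodule :: "('k, 'r) ring_scheme \<Rightarrow> ('k, 'h, 'm) quasi_hopf_data_scheme \<Rightarrow>
    ('k, 'h, 'a, 'n) halg_scheme \<Rightarrow> ('k, 'h, 'a, 'v, 'p) bimod_scheme \<Rightarrow> bool" where
  "sym_bimodule K H A V \<longleftrightarrow> bimodule K H A V \<and>
     (\<forall>t\<in>carrier (htensor K H A V). rmap V (braid K H A V t) = lmap V t) \<and>
     (\<forall>t\<in>carrier (htensor K H V A). lmap V (braid K H V A t) = rmap V t)"

section \<open>The monoidal structure on bimodules\<close>

definition unit_bimod :: "('k, 'h, 'a, 'm) halg_scheme \<Rightarrow> ('k, 'h, 'a, 'a) bimod" where
  "unit_bimod A = hmod.extend (hmod.truncate A) (bimod.fields (mu A) (mu A))"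

definition quotient_hmod :: "('k, 'h, 'v, 'm) hmod_scheme \<Rightarrow> 'v set \<Rightarrow> ('k, 'h, 'v set) hmod" where
  "quotient_hmod V N =
     \<lparr>carrier = a_rcosets\<^bsub>V\<^esub> N,
      monoid.mult = undefined,
      one = undefined,
      ring.zero = N,
      add = (\<lambda>X Y. X <+>\<^bsub>V\<^esub> Y),
      smult = (\<lambda>c X. N +>\<^bsub>V\<^esub> (c \<odot>\<^bsub>V\<^esub> rep X)),
      act = (\<lambda>h X. N +>\<^bsub>V\<^esub> (h \<triangleright>\<^bsub>V\<^esub> rep X))\<rparr>"

type_synonym ('v, 'w) btens = "('v, 'w) tens set"

definition btensor_null :: "('k, 'r) ring_scheme \<Rightarrow> ('k, 'h, 'm) quasi_hopf_data_scheme \<Rightarrow>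
    ('k, 'h, 'a, 'n) halg_scheme \<Rightarrow> ('k, 'h, 'a, 'v, 'p) bimod_scheme \<Rightarrow>
    ('k, 'h, 'a, 'w, 'q) bimod_scheme \<Rightarrow> ('v, 'w) btens" where
  "btensor_null K H A V W =
     {tmap K V W (rmap V) id t \<ominus>\<^bsub>htensor K H V W\<^esub> tmap K V W id (lmap W) (assoc K H V A W t) | t.
        t \<in> carrier (htensor K H (htensor K H V A) W)}"

definition bproj :: "('k, 'r) ring_scheme \<Rightarrow> ('k, 'h, 'm) quasi_hopf_data_scheme \<Rightarrow>
    ('k, 'h, 'a, 'n) halg_scheme \<Rightarrow> ('k, 'h, 'a, 'v, 'p) bimod_scheme \<Rightarrow>
    ('k, 'h, 'a, 'w, 'q) bimod_scheme \<Rightarrow> ('v, 'w) tens \<Rightarrow> ('v, 'w) btens" where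
  "bproj K H A V W t = btensor_null K H A V W +>\<^bsub>htensor K H V W\<^esub> t"

definition bpt :: "('k, 'r) ring_scheme \<Rightarrow> ('k, 'h, 'm) quasi_hopf_data_scheme \<Rightarrow>
    ('k, 'h, 'a, 'n) halg_scheme \<Rightarrow> ('k, 'h, 'a, 'v, 'p) bimod_scheme \<Rightarrow>
    ('k, 'h, 'a, 'w, 'q) bimod_scheme \<Rightarrow> 'v \<Rightarrow> 'w \<Rightarrow> ('v, 'w) btens" where
  "bpt K H A V W v w = bproj K H A V W (ptens K V W v w)"

definition btensor_hmod :: "('k, 'r) ring_scheme \<Rightarrow> ('k, 'h, 'm) quasi_hopf_data_scheme \<Rightarrow>
    ('k, 'h, 'a, 'n) halg_scheme \<Rightarrow> ('k, 'h, 'a, 'v, 'p) bimod_scheme \<Rightarrow>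
    ('k, 'h, 'a, 'w, 'q) bimod_scheme \<Rightarrow> ('k, 'h, ('v, 'w) btens) hmod" where
  "btensor_hmod K H A V W = quotient_hmod (htensor K H V W) (btensor_null K H A V W)"

definition btensor :: "('k, 'r) ring_scheme \<Rightarrow> ('k, 'h, 'm) quasi_hopf_data_scheme \<Rightarrow>
    ('k, 'h, 'a, 'n) halg_scheme \<Rightarrow> ('k, 'h, 'a, 'v, 'p) bimod_scheme \<Rightarrow>
    ('k, 'h, 'a, 'w, 'q) bimod_scheme \<Rightarrow> ('k, 'h, 'a, ('v, 'w) btens) bimod" where
  "btensor K H A V W =
     (let Q = btensor_hmod K H A V W in
      hmod.extend Q (bimod.fields
        (\<lambda>t. tsum2 Q t (\<lambda>a Z. tsum2 Q (rep Z) (\<lambda>v w. tsum3 Q (phi_inv K H) (\<lambda>p q r.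
           bpt K H A V W (lmul K A V (p \<triangleright>\<^bsub>A\<^esub> a) (q \<triangleright>\<^bsub>V\<^esub> v)) (r \<triangleright>\<^bsub>W\<^esub> w)))))
        (\<lambda>t. tsum2 Q t (\<lambda>Z a. tsum2 Q (rep Z) (\<lambda>v w. tsum3 Q (phi H) (\<lambda>p q r.
           bpt K H A V W (p \<triangleright>\<^bsub>V\<^esub> v) (rmul K A W (q \<triangleright>\<^bsub>W\<^esub> w) (r \<triangleright>\<^bsub>A\<^esub> a))))))))"

text \<open>\<open>bmap K H A V W f g\<close> is $f \otimes_A g$ with codomain $V \otimes_A W$.\<close>

definition bmap :: "('k, 'r) ring_scheme \<Rightarrow> ('k, 'h, 'm) quasi_hopf_data_scheme \<Rightarrow>
    ('k, 'h, 'a, 'n) halg_scheme \<Rightarrow> ('k, 'h, 'a, 'v, 'p) bimod_scheme \<Rightarrow>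
    ('k, 'h, 'a, 'w, 'q) bimod_scheme \<Rightarrow> ('x \<Rightarrow> 'v) \<Rightarrow> ('y \<Rightarrow> 'w) \<Rightarrow> ('x, 'y) btens \<Rightarrow> ('v, 'w) btens" where
  "bmap K H A V W f g Z = bproj K H A V W (tmap K V W f g (rep Z))"

definition bassoc :: "('k, 'r) ring_scheme \<Rightarrow> ('k, 'h, 'm) quasi_hopf_data_scheme \<Rightarrow>
    ('k, 'h, 'a, 'n) halg_scheme \<Rightarrow> ('k, 'h, 'a, 'v, 'p) bimod_scheme \<Rightarrow>
    ('k, 'h, 'a, 'w, 'q) bimod_scheme \<Rightarrow> ('k, 'h, 'a, 'x, 's) bimod_scheme \<Rightarrow>
    (('v, 'w) btens, 'x) btens \<Rightarrow> ('v, ('w, 'x) btens) btens" where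
  "bassoc K H A V W X Z =
     (let Q = btensor K H A V (btensor K H A W X) in
      tsum2 Q (rep Z) (\<lambda>Y x. tsum2 Q (rep Y) (\<lambda>v w. tsum3 Q (phi H) (\<lambda>p q r.
        bpt K H A V (btensor K H A W X) (p \<triangleright>\<^bsub>V\<^esub> v) (bpt K H A W X (q \<triangleright>\<^bsub>W\<^esub> w) (r \<triangleright>\<^bsub>X\<^esub> x))))))"

definition lunitor :: "('k, 'h, 'a, 'v, 'm) bimod_scheme \<Rightarrow> ('a, 'v) btens \<Rightarrow> 'v" where
  "lunitor V Z = lmap V (rep Z)"

definition runitor :: "('k, 'h, 'a, 'v, 'm) bimod_scheme \<Rightarrow> ('v, 'a) btens \<Rightarrow> 'v" where
  "runitor V Z = rmap V (rep Z)"

definition bbraid :: "('k, 'r) ring_scheme \<Rightarrow> ('k, 'h, 'm) quasi_hopf_data_scheme \<Rightarrow>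
    ('k, 'h, 'a, 'n) halg_scheme \<Rightarrow> ('k, 'h, 'a, 'v, 'p) bimod_scheme \<Rightarrow>
    ('k, 'h, 'a, 'w, 'q) bimod_scheme \<Rightarrow> ('v, 'w) btens \<Rightarrow> ('w, 'v) btens" where
  "bbraid K H A V W Z = bproj K H A W V (braid K H V W (rep Z))"

section \<open>Internal homs of bimodules\<close>

definition lhat :: "('k, 'r) ring_scheme \<Rightarrow> ('k, 'h, 'm) quasi_hopf_data_scheme \<Rightarrow>
    ('k, 'h, 'a, 'n) halg_scheme \<Rightarrow> ('k, 'h, 'a, 'v, 'p) bimod_scheme \<Rightarrow> 'a \<Rightarrow> ('v \<Rightarrow> 'v)" where
  "lhat K H A V a = (\<lambda>v\<in>carrier V. tsum3 V (phi_inv K H) (\<lambda>p q r.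
     lmul K A V (p \<triangleright>\<^bsub>A\<^esub> a) ((q \<otimes>\<^bsub>H\<^esub> qbeta H \<otimes>\<^bsub>H\<^esub> antipode H r) \<triangleright>\<^bsub>V\<^esub> v)))"

definition bhom :: "('k, 'r) ring_scheme \<Rightarrow> ('k, 'h, 'm) quasi_hopf_data_scheme \<Rightarrow>
    ('k, 'h, 'a, 'n) halg_scheme \<Rightarrow> ('k, 'h, 'a, 'v, 'p) bimod_scheme \<Rightarrow>
    ('k, 'h, 'a, 'w, 'q) bimod_scheme \<Rightarrow> ('k, 'h, 'a, 'v \<Rightarrow> 'w) bimod" where
  "bhom K H A V W = hmod.extend (hhom K H V W) (bimod.fields
     (\<lambda>t. tsum2 (hhom K H V W) t (\<lambda>a L.
        hcomp K H V W W (ptens K (hhom K H W W) (hhom K H V W) (lhat K H A W a) L)))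
     (\<lambda>t. tsum2 (hhom K H V W) t (\<lambda>L a.
        hcomp K H V V W (ptens K (hhom K H V W) (hhom K H V V) L (lhat K H A V a)))))"

text \<open>The map $\mathrm{ev}^A_{V,W}$; the same formula serves for the evaluation on the kernel
  $\hom_A(V,W)$ defined below.\<close>

definition beval :: "('k, 'r) ring_scheme \<Rightarrow> ('k, 'h, 'm) quasi_hopf_data_scheme \<Rightarrow>
    ('k, 'h, 'a, 'v, 'p) bimod_scheme \<Rightarrow> ('k, 'h, 'a, 'w, 'q) bimod_scheme \<Rightarrow>
    ('v \<Rightarrow> 'w, 'v) btens \<Rightarrow> 'w" where
  "beval K H V W Z = heval K H V W (rep Z)"

text \<open>\<open>hom_f1\<close> and \<open>hom_f2\<close> give the values of $f_1$ and $f_2$ on $L \otimes_A t$ for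
  $t \in V \otimes A$, that is, they are $f_1$ and $f_2$ precomposed with the projection from
  $\hom(V,W) \otimes (V \otimes A)$, as bilinear maps.  \<open>hom_D\<close> turns such a map into the
  corresponding $D_i$.\<close>

definition hom_f1 :: "('k, 'r) ring_scheme \<Rightarrow> ('k, 'h, 'm) quasi_hopf_data_scheme \<Rightarrow>
    ('k, 'h, 'a, 'n) halg_scheme \<Rightarrow> ('k, 'h, 'a, 'v, 'p) bimod_scheme \<Rightarrow>
    ('k, 'h, 'a, 'w, 'q) bimod_scheme \<Rightarrow> ('v \<Rightarrow> 'w) \<Rightarrow> ('v, 'a) tens \<Rightarrow> 'w" where
  "hom_f1 K H A V W L t = tsum2 W t (\<lambda>v a.
     beval K H V W (bpt K H A (bhom K H A V W) V L (rmul K A V v a)))"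

definition hom_f2 :: "('k, 'r) ring_scheme \<Rightarrow> ('k, 'h, 'm) quasi_hopf_data_scheme \<Rightarrow>
    ('k, 'h, 'a, 'n) halg_scheme \<Rightarrow> ('k, 'h, 'a, 'v, 'p) bimod_scheme \<Rightarrow>
    ('k, 'h, 'a, 'w, 'q) bimod_scheme \<Rightarrow> ('v \<Rightarrow> 'w) \<Rightarrow> ('v, 'a) tens \<Rightarrow> 'w" where
  "hom_f2 K H A V W L t = tsum2 W t (\<lambda>v a. tsum3 W (phi_inv K H) (\<lambda>p q r.
     rmul K A W (beval K H V W (bpt K H A (bhom K H A V W) V (p \<triangleright>\<^bsub>bhom K H A V W\<^esub> L) (q \<triangleright>\<^bsub>V\<^esub> v)))
       (r \<triangleright>\<^bsub>A\<^esub> a)))"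

definition hom_D :: "('k, 'r) ring_scheme \<Rightarrow> ('k, 'h, 'm) quasi_hopf_data_scheme \<Rightarrow>
    ('k, 'h, 'a, 'n) halg_scheme \<Rightarrow> ('k, 'h, 'a, 'v, 'p) bimod_scheme \<Rightarrow>
    ('k, 'h, 'a, 'w, 'q) bimod_scheme \<Rightarrow>
    (('v \<Rightarrow> 'w) \<Rightarrow> ('v, 'a) tens \<Rightarrow> 'w) \<Rightarrow> ('v \<Rightarrow> 'w) \<Rightarrow> (('v, 'a) tens \<Rightarrow> 'w)" where
  "hom_D K H A V W f L = (\<lambda>t\<in>carrier (htensor K H V A). tsum3 W (phi_inv K H) (\<lambda>p q r.
     f (p \<triangleright>\<^bsub>bhom K H A V W\<^esub> L)
       ((q \<otimes>\<^bsub>H\<^esub> qbeta H \<otimes>\<^bsub>H\<^esub> antipode H r) \<triangleright>\<^bsub>htensor K H V A\<^esub> t)))"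

definition bihom :: "('k, 'r) ring_scheme \<Rightarrow> ('k, 'h, 'm) quasi_hopf_data_scheme \<Rightarrow>
    ('k, 'h, 'a, 'n) halg_scheme \<Rightarrow> ('k, 'h, 'a, 'v, 'p) bimod_scheme \<Rightarrow>
    ('k, 'h, 'a, 'w, 'q) bimod_scheme \<Rightarrow> ('k, 'h, 'a, 'v \<Rightarrow> 'w) bimod" where
  "bihom K H A V W = (bhom K H A V W)
     \<lparr>carrier := {L \<in> carrier (bhom K H A V W).
        hom_D K H A V W (hom_f1 K H A V W) L = hom_D K H A V W (hom_f2 K H A V W) L}\<rparr>"

section \<open>Coherence conditions\<close>

definition pentagon :: "('k, 'r) ring_scheme \<Rightarrow> ('k, 'h, 'm) quasi_hopf_data_scheme \<Rightarrow>
    ('k, 'h, 'a, 'n) halg_scheme \<Rightarrow> ('k, 'h, 'a, 'v, 'p) bimod_scheme \<Rightarrow>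
    ('k, 'h, 'a, 'w, 'q) bimod_scheme \<Rightarrow> ('k, 'h, 'a, 'x, 's) bimod_scheme \<Rightarrow>
    ('k, 'h, 'a, 'y, 't) bimod_scheme \<Rightarrow> bool" where
  "pentagon K H A V W X Y \<longleftrightarrow>
     (\<forall>Z\<in>carrier (btensor K H A (btensor K H A (btensor K H A V W) X) Y).
        bassoc K H A V W (btensor K H A X Y) (bassoc K H A (btensor K H A V W) X Y Z) =
        bmap K H A V (btensor K H A W (btensor K H A X Y)) id (bassoc K H A W X Y)
          (bassoc K H A V (btensor K H A W X) Y
            (bmap K H A (btensor K H A V (btensor K H A W X)) Y (bassoc K H A V W X) id Z)))"

definition triangle :: "('k, 'r) ring_scheme \<Rightarrow> ('k, 'h, 'm) quasi_hopf_data_scheme \<Rightarrow>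
    ('k, 'h, 'a, 'n) halg_scheme \<Rightarrow> ('k, 'h, 'a, 'v, 'p) bimod_scheme \<Rightarrow>
    ('k, 'h, 'a, 'w, 'q) bimod_scheme \<Rightarrow> bool" where
  "triangle K H A V W \<longleftrightarrow>
     (\<forall>Z\<in>carrier (btensor K H A (btensor K H A V (unit_bimod A)) W).
        bmap K H A V W id (lunitor W) (bassoc K H A V (unit_bimod A) W Z) =
        bmap K H A V W (runitor V) id Z)"

definition hexagon1 :: "('k, 'r) ring_scheme \<Rightarrow> ('k, 'h, 'm) quasi_hopf_data_scheme \<Rightarrow>
    ('k, 'h, 'a, 'n) halg_scheme \<Rightarrow> ('k, 'h, 'a, 'v, 'p) bimod_scheme \<Rightarrow>
    ('k, 'h, 'a, 'w, 'q) bimod_scheme \<Rightarrow> ('k, 'h, 'a, 'x, 's) bimod_scheme \<Rightarrow> bool" where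
  "hexagon1 K H A V W X \<longleftrightarrow>
     (\<forall>Z\<in>carrier (btensor K H A (btensor K H A V W) X).
        bassoc K H A W X V (bbraid K H A V (btensor K H A W X) (bassoc K H A V W X Z)) =
        bmap K H A W (btensor K H A X V) id (bbraid K H A V X)
          (bassoc K H A W V X (bmap K H A (btensor K H A W V) X (bbraid K H A V W) id Z)))"

definition bassoc_inv :: "('k, 'r) ring_scheme \<Rightarrow> ('k, 'h, 'm) quasi_hopf_data_scheme \<Rightarrow>
    ('k, 'h, 'a, 'n) halg_scheme \<Rightarrow> ('k, 'h, 'a, 'v, 'p) bimod_scheme \<Rightarrow>
    ('k, 'h, 'a, 'w, 'q) bimod_scheme \<Rightarrow> ('k, 'h, 'a, 'x, 's) bimod_scheme \<Rightarrow>
    ('v, ('w, 'x) btens) btens \<Rightarrow> (('v, 'w) btens, 'x) btens" where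
  "bassoc_inv K H A V W X =
     inv_into (carrier (btensor K H A (btensor K H A V W) X)) (bassoc K H A V W X)"

definition hexagon2 :: "('k, 'r) ring_scheme \<Rightarrow> ('k, 'h, 'm) quasi_hopf_data_scheme \<Rightarrow>
    ('k, 'h, 'a, 'n) halg_scheme \<Rightarrow> ('k, 'h, 'a, 'v, 'p) bimod_scheme \<Rightarrow>
    ('k, 'h, 'a, 'w, 'q) bimod_scheme \<Rightarrow> ('k, 'h, 'a, 'x, 's) bimod_scheme \<Rightarrow> bool" where
  "hexagon2 K H A V W X \<longleftrightarrow>
     (\<forall>Z\<in>carrier (btensor K H A V (btensor K H A W X)).
        bassoc_inv K H A X V W (bbraid K H A (btensor K H A V W) X (bassoc_inv K H A V W X Z)) =
        bmap K H A (btensor K H A X V) W (bbraid K H A V X) id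
          (bassoc_inv K H A V X W (bmap K H A V (btensor K H A X W) id (bbraid K H A W X) Z)))"

end

theory Submission
 imports Defs
begin

text \<open>
 The proof is a calculus in which the quasi-associative category looks strict. All iterated tensor
 products are bracketed to the right, \<open>V \<otimes> (W \<otimes> (X \<otimes> M))\<close>, and a binary operation \<open>f\<close> on the first two factors
 is applied through the inverse associator, \<open>rtl f = (f \<otimes> M) \<circ> \<Phi>\<^sup>-\<^sup>1\<close>. The pentagon then yields one
 principle, \<open>rtl_tail\<close>: an identity \<open>k \<circ> rtl g = k' \<circ> (U \<otimes> g')\<close> between maps on \<open>U \<otimes> (V \<otimes> W)\<close> may be
 used with any further factor \<open>M\<close> on the right. The hexagons become two formulas for the braiding
 past such operations, \<open>braid_rtl\<close> and \<open>braid_wl_pair\<close>, together with \<open>yang_baxter\<close>.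

 In this language the axioms of a bimodule, the relation defining \<open>V \<otimes>\<^sub>A W\<close> (with projection \<open>\<pi>\<close>) and the
 formulas for its actions are plain associativity laws:
 \<open>\<pi> (rtl r\<^sub>V) = \<pi> (V \<otimes> l\<^sub>W)\<close>, \<open>l (A \<otimes> \<pi>) = \<pi> (rtl l\<^sub>V)\<close>, \<open>r (rtl \<pi>) = \<pi> (V \<otimes> r\<^sub>W)\<close>, and the associator over \<open>A\<close>
 is determined by \<open>\<pi> (rtl \<pi>) \<mapsto> \<pi> (V \<otimes> \<pi>)\<close>. Every coherence statement follows by evaluating both sides
 on such representatives. The braiding descends because it carries the two ends \<open>rtl r\<^sub>V\<close> and
 \<open>V \<otimes> l\<^sub>W\<close> of the relation for \<open>(V, W)\<close> to the two ends of the relation for \<open>(W, V)\<close>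
 (\<open>braid_balanced\<close>); this uses Yang--Baxter and the symmetry of both bimodules. As it matches the two
 relations exactly, the descended map is invertible.

 For the internal hom, currying (\<open>heval_curry_wr\<close>, \<open>heval_separates\<close>) reduces identities in \<open>hom(V, W)\<close> to
 identities of evaluations. The actions satisfy \<open>ev (rtl l) = l\<^sub>W (A \<otimes> ev)\<close> and \<open>ev (rtl r) = ev (L \<otimes> l\<^sub>V)\<close>,
 and \<open>hom\<^sub>A\<close> is the largest submodule on which \<open>ev (L \<otimes> r\<^sub>V) = r\<^sub>W (rtl ev)\<close>; stability, symmetry and the universal
 property are consequences of these three laws.

 Notation: \<open>x:.M\<close> is membership in the carrier, \<open>x +[M] y\<close>, \<open>x *[M] y\<close>, \<open>c \<odot>[M] x\<close> are the operations of \<open>M\<close>;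
 for a fixed \<open>H\<close>, \<open>*.\<close>, \<open>*2\<close>, \<open>*3\<close>, \<open>*4\<close> are the products of the tensor powers, \<open>p2\<close>, \<open>p3\<close>, \<open>q3\<close>, \<open>q4\<close> build
 pure tensors in them, \<open>V**W\<close> is the tensor product of modules and \<open>pt\<close> its pure tensors;
 \<open>mor\<close> are the equivariant maps, \<open>br\<close> and \<open>hev\<close> the braiding and the evaluation of \<open>H\<close>-modules; \<open>sb\<close> and \<open>pm\<close> say that \<open>V\<close> is a
 symmetric bimodule, or merely a module with two equivariant actions; \<open>BT\<close>, \<open>hb\<close>, \<open>Bh\<close> are \<open>V \<otimes>\<^sub>A W\<close>, \<open>hom(V, W)\<close> and \<open>hom\<^sub>A(V, W)\<close>.
\<close>

abbreviation (input) in_carrier (infix \<open>:.\<close> 50) where "x :. M == x \<in> carrier M"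
abbreviation (input) add_in ("(_/ +[_]/ _)" [65,0,66] 65) where "x +[M] y == add M x y"
abbreviation (input) minus_in ("(_/ \<ominus>[_]/ _)" [65,0,66] 65) where "x \<ominus>[M] y == a_minus M x y"
abbreviation (input) uminus_in ("\<ominus>[_] _" [0,81] 80) where "\<ominus>[M] x == a_inv M x"
abbreviation (input) mult_in ("(_/ *[_]/ _)" [70,0,71] 70) where "x *[M] y == monoid.mult M x y"
abbreviation (input) smult_in ("(_/ \<odot>[_]/ _)" [70,0,71] 70) where "c \<odot>[M] x == smult M c x"
abbreviation (input) zero_in ("\<zero>[_]") where "\<zero>[M] == ring.zero M"
abbreviation (input) one_in ("\<one>[_]") where "\<one>[M] == one M"

section \<open>Tensor products of modules\<close>

definition fsum :: "('p, 'm) ring_scheme => ('a => 'p) => ('a \<Rightarrow>\<^sub>0 int) => 'p" where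
 "fsum P f x = (\<Oplus>\<^bsub>P\<^esub> p \<in> Poly_Mapping.keys x. [Poly_Mapping.lookup x p] \<cdot>\<^bsub>P\<^esub> f p)"

lemma tsum2_fsum: "tsum2 P X f = fsum P (%p. f (fst p) (snd p)) (rep X)"
 by (simp add: tsum2_def fsum_def)

lemmas frag_induct = free_Abelian_group_induct [consumes 1, case_names zero diff frag_of]

context abelian_group
begin

lemma fsum_superset:
 assumes "finite S" "Poly_Mapping.keys x \<subseteq> S" "f \<in> S \<rightarrow> carrier G"
 shows "fsum G f x = (\<Oplus> p \<in> S. [Poly_Mapping.lookup x p] \<cdot> f p)"
 unfolding fsum_def
proof (rule add.finprod_mono_neutral_cong_left)
 show "[Poly_Mapping.lookup x i] \<cdot> f i = \<zero>" if "i \<in> S - Poly_Mapping.keys x" for i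
  using that by (auto simp: in_keys_iff add_pow_def)
qed (use assms in "auto simp: Pi_def")

lemma fsum_closed: "f \<in> Poly_Mapping.keys x \<rightarrow> carrier G ==> fsum G f x:.G"
 unfolding fsum_def by (rule finsum_closed) (auto simp: Pi_def)

lemma fsum_0 [simp]: "fsum G f 0 = \<zero>"
 by (simp add: fsum_def)

lemma fsum_frag_of: "f p:.G ==> fsum G f (frag_of p) = f p"
 by (subst fsum_superset[of "{p}"]) (auto simp: add.finprod_singleton)

lemma fsum_add:
 assumes "f \<in> Poly_Mapping.keys x \<rightarrow> carrier G" "f \<in> Poly_Mapping.keys y \<rightarrow> carrier G"
 shows "fsum G f (x + y) = fsum G f x \<oplus> fsum G f y"
proof -
 let ?S = "Poly_Mapping.keys x \<union> Poly_Mapping.keys y"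
 have f: "f \<in> ?S \<rightarrow> carrier G" using assms by auto
 have "fsum G f (x + y) = (\<Oplus> p \<in> ?S. [(Poly_Mapping.lookup x p + Poly_Mapping.lookup y p)] \<cdot> f p)"
  using f Poly_Mapping.keys_add[of x y] by (subst fsum_superset[of ?S]) (auto simp: lookup_add)
 also have "... = (\<Oplus> p \<in> ?S. [Poly_Mapping.lookup x p] \<cdot> f p \<oplus> [Poly_Mapping.lookup y p] \<cdot> f p)"
  by (rule finsum_cong') (use f in "auto simp: add.int_pow_mult Pi_def")
 also have "... = fsum G f x \<oplus> fsum G f y"
  using f by (subst finsum_addf)
   (auto simp: Pi_def fsum_superset[of ?S x] fsum_superset[of ?S y])
 finally show ?thesis .
qed

lemma fsum_uminus:
 assumes "f \<in> Poly_Mapping.keys x \<rightarrow> carrier G"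
 shows "fsum G f (- x) = \<ominus> fsum G f x"
proof -
 have "fsum G f (- x) \<oplus> fsum G f x = \<zero>"
  using fsum_add[of f "- x" x] assms by simp
 then show ?thesis using assms by (intro minus_equality[symmetric]) (auto intro!: fsum_closed)
qed

lemma fsum_diff:
 assumes "f \<in> Poly_Mapping.keys x \<rightarrow> carrier G" "f \<in> Poly_Mapping.keys y \<rightarrow> carrier G"
 shows "fsum G f (x - y) = fsum G f x \<ominus> fsum G f y"
 using fsum_add[of f x "- y"] fsum_uminus[of f y] assms by (simp add: a_minus_def)

lemma fsum_cong:
 assumes "!!p. p \<in> Poly_Mapping.keys x ==> f p = g p" "g \<in> Poly_Mapping.keys x \<rightarrow> carrier G"
 shows "fsum G f x = fsum G g x"
 unfolding fsum_def by (rule finsum_cong') (use assms in auto)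

lemma fsum_plus:
 assumes "f \<in> Poly_Mapping.keys x \<rightarrow> carrier G" "g \<in> Poly_Mapping.keys x \<rightarrow> carrier G"
 shows "fsum G (%p. f p \<oplus> g p) x = fsum G f x \<oplus> fsum G g x"
proof -
 have "fsum G (%p. f p \<oplus> g p) x =
   (\<Oplus> p \<in> Poly_Mapping.keys x. [Poly_Mapping.lookup x p] \<cdot> f p \<oplus> [Poly_Mapping.lookup x p] \<cdot> g p)"
  unfolding fsum_def by (rule finsum_cong') (use assms in "auto simp: add.int_pow_mult_distrib a_comm Pi_def")
 also have "... = fsum G f x \<oplus> fsum G g x"
  unfolding fsum_def by (rule finsum_addf) (use assms in auto)
 finally show ?thesis .
qed

end

lemma fsum_hom:
 fixes f :: "'e => 'a"
 assumes "abelian_group P" "abelian_group Q"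
  and L: "L \<in> carrier P \<rightarrow> carrier Q" "!!x y. x:.P ==> y:.P ==> L (x +[P] y) = L x +[Q] L y"
  and f: "f \<in> Poly_Mapping.keys x \<rightarrow> carrier P"
 shows "L (fsum P f x) = fsum Q (%p. L (f p)) x"
proof -
 interpret P: abelian_group P by fact
 interpret Q: abelian_group Q by fact
 have L0: "L \<zero>[P] = \<zero>[Q]"
  using L(2)[of "\<zero>[P]" "\<zero>[P]"] L(1) by (metis P.r_zero P.zero_closed PiE Q.add.r_cancel_one)
 have Lm: "L (\<ominus>[P] u) = \<ominus>[Q] L u" if "u:.P" for u
  using L(2)[of "\<ominus>[P] u" u] that L(1) L0 by (metis P.add.inv_closed P.l_neg PiE Q.minus_equality)
 have "\<forall>x :: 'e \<Rightarrow>\<^sub>0 int. Poly_Mapping.keys x \<subseteq> {p. f p:.P} \<longrightarrow> L (fsum P f x) = fsum Q (%p. L (f p)) x"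
 proof (intro allI impI)
  fix x :: "'e \<Rightarrow>\<^sub>0 int" assume "Poly_Mapping.keys x \<subseteq> {p. f p:.P}"
  then show "L (fsum P f x) = fsum Q (%p. L (f p)) x"
  proof (induction rule: frag_induct)
   case (diff x y)
   have "f \<in> Poly_Mapping.keys x \<rightarrow> carrier P" "f \<in> Poly_Mapping.keys y \<rightarrow> carrier P"
    "(%p. L (f p)) \<in> Poly_Mapping.keys x \<rightarrow> carrier Q" "(%p. L (f p)) \<in> Poly_Mapping.keys y \<rightarrow> carrier Q"
    using diff L(1) by auto
   then show ?case using diff L(2)
    by (simp add: P.fsum_diff Q.fsum_diff a_minus_def Lm P.fsum_closed)
  qed (use L L0 in "auto simp: P.fsum_frag_of Q.fsum_frag_of Pi_def")
 qed
 then show ?thesis using f by auto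
qed

definition bal :: "('k, 'r) ring_scheme => ('k, 'v, 'm) module_scheme => ('k, 'w, 'n) module_scheme =>
  ('p, 'q) ring_scheme => ('v => 'w => 'p) => bool" where
 "bal K V W P f \<longleftrightarrow>
   (\<forall>v\<in>carrier V. \<forall>w\<in>carrier W. f v w:.P) \<and>
   (\<forall>v\<in>carrier V. \<forall>v'\<in>carrier V. \<forall>w\<in>carrier W. f (v +[V] v') w = f v w +[P] f v' w) \<and>
   (\<forall>v\<in>carrier V. \<forall>w\<in>carrier W. \<forall>w'\<in>carrier W. f v (w +[W] w') = f v w +[P] f v w') \<and>
   (\<forall>c\<in>carrier K. \<forall>v\<in>carrier V. \<forall>w\<in>carrier W. f (c \<odot>[V] v) w = f v (c \<odot>[W] w))"

definition bilin :: "('k, 'r) ring_scheme => ('k, 'v, 'm) module_scheme => ('k, 'w, 'n) module_scheme =>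
  ('k, 'p, 'q) module_scheme => ('v => 'w => 'p) => bool" where
 "bilin K V W P f \<longleftrightarrow> (\<forall>v\<in>carrier V. f v : klin K W P) \<and> (\<forall>w\<in>carrier W. (%v. f v w) : klin K V P)"

lemma bilin_bal: "bilin K V W P f ==> bal K V W P f"
 unfolding bilin_def bal_def klin_def by (auto simp: Pi_def)

lemma module_ag: "module K V ==> abelian_group V"
 by (simp add: module_def)

lemma module_add_closed: "module K V ==> x:.V ==> y:.V ==> x +[V] y:.V"
 by (simp add: module_def abelian_group_def abelian_monoid.a_closed)

lemma module_zero_closed: "module K V ==> \<zero>[V]:.V"
 by (simp add: module_def abelian_group_def abelian_monoid.zero_closed)

lemma klinI:
 assumes "!!x. x:.V ==> f x:.W"
  "!!x y. x:.V ==> y:.V ==> f (x +[V] y) = f x +[W] f y"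
  "!!c x. c:.K ==> x:.V ==> f (c \<odot>[V] x) = c \<odot>[W] f x"
 shows "f : klin K V W"
 using assms by (auto simp: klin_def)

lemma klin_closed: "f : klin K V W ==> x:.V ==> f x:.W"
 by (auto simp: klin_def)

lemma klin_add: "f : klin K V W ==> x:.V ==> y:.V ==> f (x +[V] y) = f x +[W] f y"
 by (auto simp: klin_def)

lemma klin_smult: "f : klin K V W ==> c:.K ==> x:.V ==> f (c \<odot>[V] x) = c \<odot>[W] f x"
 by (auto simp: klin_def)

lemma klin_id: "id : klin K V V" "(%x. x) : klin K V V"
 by (auto simp: klin_def)

lemma klin_comp: "f : klin K V W ==> g : klin K W X ==> (%x. g (f x)) : klin K V X"
 by (auto simp: klin_def Pi_def)

lemma klin_cong: "f : klin K V W ==> module K V ==> (!!x. x:.V ==> f x = g x) ==> g : klin K V W"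
 by (auto simp: klin_def Pi_def module.smult_closed module_add_closed)

lemma bilin_comp1: "bilin K V W P f ==> g : klin K U V ==> w:.W ==> (%x. f (g x) w) : klin K U P"
 unfolding bilin_def using klin_comp by fastforce

lemma bilin_comp2: "bilin K V W P f ==> v:.V ==> g : klin K U W ==> (%x. f v (g x)) : klin K U P"
 unfolding bilin_def using klin_comp by fastforce

lemma bilinI:
 assumes "!!v. v:.V ==> (%w. f v w) : klin K W P" "!!w. w:.W ==> (%v. f v w) : klin K V P"
 shows "bilin K V W P f"
 using assms by (auto simp: bilin_def)

lemma bilin_closed: "bilin K V W P f ==> v:.V ==> w:.W ==> f v w:.P"
 by (auto simp: bilin_def klin_def)

lemma bilin_klin: "bilin K V W P f ==> g : klin K P Q ==> bilin K V W Q (%v w. g (f v w))"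
 by (auto simp: bilin_def intro: klin_comp)

lemma klin_uminus:
 assumes "module K V" "module K W" "f : klin K V W" "x:.V"
 shows "f (\<ominus>[V] x) = \<ominus>[W] f x"
proof -
 interpret V: module K V by fact
 interpret W: module K W by fact
 have "f (\<ominus>[V] x) = f ((\<ominus>[K] \<one>[K]) \<odot>[V] x)" using assms by (simp add: V.smult_l_minus)
 also have "... = \<ominus>[W] f x" using assms klin_smult[OF assms(3)] klin_closed[OF assms(3)]
  by (simp add: W.smult_l_minus)
 finally show ?thesis .
qed

lemma klin_zero:
 assumes "module K V" "module K W" "f : klin K V W"
 shows "f \<zero>[V] = \<zero>[W]"
proof -
 interpret V: module K V by fact
 interpret W: module K W by fact
 have "f (\<zero>[K] \<odot>[V] \<zero>[V]) = \<zero>[W]"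
  using klin_smult[OF assms(3), of "\<zero>[K]" "\<zero>[V]"] klin_closed[OF assms(3)] by simp
 then show ?thesis by simp
qed

lemma klin_minus:
 assumes "module K V" "module K W" "f : klin K V W" "x:.V" "y:.V"
 shows "f (x \<ominus>[V] y) = f x \<ominus>[W] f y"
 using assms klin_uminus[OF assms(1-3,5)] klin_add[OF assms(3)] abelian_group.a_inv_closed[OF module_ag[OF assms(1)]]
 by (simp add: a_minus_def)

subsection \<open>The tensor product as a quotient group\<close>

locale two_modules =
 V: module K V + W: module K W
 for K :: "('k, 'r) ring_scheme"
  and V :: "('k, 'v, 'm) module_scheme" and W :: "('k, 'w, 'n) module_scheme"
begin

abbreviation "F \<equiv> tensor_free V W"
abbreviation "N \<equiv> tensor_null K V W"
abbreviation "T \<equiv> tensor_mod K V W"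

lemma carrier_F: "x:.F \<longleftrightarrow> Poly_Mapping.keys x \<subseteq> carrier V \<times> carrier W"
 by (simp add: tensor_free_def)

lemma F_simps [simp]: "x *[F] y = x + y" "\<one>[F] = 0"
 by (simp_all add: tensor_free_def)

lemma F_comm_group: "comm_group F"
 by (simp add: tensor_free_def abelian_free_Abelian_group)

sublocale F: comm_group F by (rule F_comm_group)

lemma frag_of_carrier [simp]: "frag_of (v, w):.F \<longleftrightarrow> v:.V \<and> w:.W"
 by (simp add: carrier_F)

lemma F_closed:
 "x:.F ==> y:.F ==> x + y:.F"
 "x:.F ==> y:.F ==> x - y:.F"
 "x:.F ==> - x:.F"
 "0:.F"
 using keys_add[of x y] keys_diff[of x y] by (auto simp: carrier_F)

lemma F_inv: "x:.F ==> inv\<^bsub>F\<^esub> x = - x"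
 by (simp add: tensor_free_def)

abbreviation (input) "relators \<equiv>
   ({frag_of (v +[V] v', w) - frag_of (v, w) - frag_of (v', w) | v v' w.
     v:.V \<and> v':.V \<and> w:.W} \<union>
   {frag_of (v, w +[W] w') - frag_of (v, w) - frag_of (v, w') | v w w'.
     v:.V \<and> w:.W \<and> w':.W} \<union>
   {frag_of (c \<odot>[V] v, w) - frag_of (v, c \<odot>[W] w) | c v w.
     c:.K \<and> v:.V \<and> w:.W})"

lemma relators_carrier: "relators \<subseteq> carrier F"
 by (auto intro!: F_closed(2))

lemma N_subgroup: "subgroup N F"
 unfolding tensor_null_def by (rule F.generate_is_subgroup[OF relators_carrier])

lemma N_normal: "N \<lhd> F"
 by (rule F.normal_iff_subgroup[THEN iffD2, OF N_subgroup])

sublocale N: normal N F by (rule N_normal)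

lemma relator_N: "x \<in> relators ==> x \<in> N"
 unfolding tensor_null_def by (rule generate.incl)

lemma coset_eq_iff: "x:.F ==> y:.F ==> N #>\<^bsub>F\<^esub> x = N #>\<^bsub>F\<^esub> y \<longleftrightarrow> x - y \<in> N"
 using N.rcos_module[OF F.is_group, of y x] F.repr_independence[OF _ _ N_subgroup, of x y]
  F.rcos_self[OF _ N_subgroup, of x]
 by (auto simp: F_inv)

text \<open>A biadditive balanced map kills the relators, so its extension is defined on cosets.\<close>

lemma fsum_null:
 assumes P: "abelian_group P" and f: "bal K V W P f" and x: "x \<in> N"
 shows "fsum P (%p. f (fst p) (snd p)) x = \<zero>[P]"
proof -
 interpret P: abelian_group P by fact
 let ?f = "%p. f (fst p) (snd p)"
 have cl: "?f \<in> Poly_Mapping.keys y \<rightarrow> carrier P" if "y:.F" for y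
  using that f unfolding carrier_F bal_def by fastforce
 have fo: "fsum P ?f (frag_of (v, w)) = f v w" if "v:.V" "w:.W" for v w
  using f that by (subst P.fsum_frag_of) (auto simp: bal_def)
 have rel: "fsum P ?f y = \<zero>[P]" if "y \<in> relators" for y
 proof -
  have z: "(a +[P] b) +[P] \<ominus>[P] a +[P] \<ominus>[P] b = \<zero>[P]" if "a:.P" "b:.P" for a b
   using that by (metis P.a_assoc P.a_closed P.a_inv_closed P.minus_add P.r_neg)
  show ?thesis
   using that f unfolding bal_def
   by (auto simp: P.fsum_diff cl F_closed fo a_minus_def z P.r_neg)
 qed
 have "x \<in> generate F relators" using x by (simp add: tensor_null_def)
 then show ?thesis
 proof (induction rule: generate.induct)
  case (inv h)
  have "h:.F" by (rule subsetD[OF relators_carrier inv])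
  then show ?case by (simp add: F_inv P.fsum_uminus cl rel[OF inv])
 next
  case (eng h1 h2)
  have "h1:.F" "h2:.F"
   by (rule F.generate_in_carrier[OF relators_carrier eng(1)], rule F.generate_in_carrier[OF relators_carrier eng(2)])
  then show ?case by (simp add: P.fsum_add cl eng(3,4))
 qed (auto simp: rel)
qed

lemma rep_coset:
 assumes "x:.F"
 shows "rep (N #>\<^bsub>F\<^esub> x):.F" "rep (N #>\<^bsub>F\<^esub> x) - x \<in> N"
proof -
 have "rep (N #>\<^bsub>F\<^esub> x) \<in> N #>\<^bsub>F\<^esub> x"
  unfolding rep_def by (rule someI, rule F.rcos_self[OF assms N_subgroup])
 then obtain n where n: "n \<in> N" "rep (N #>\<^bsub>F\<^esub> x) = n + x"
  by (auto simp: r_coset_def)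
 then show "rep (N #>\<^bsub>F\<^esub> x):.F" "rep (N #>\<^bsub>F\<^esub> x) - x \<in> N"
  using N.subset assms by (auto intro!: F_closed)
qed

lemma tsum2_coset:
 assumes P: "abelian_group P" and f: "bal K V W P f" and x: "x:.F"
 shows "tsum2 P (N #>\<^bsub>F\<^esub> x) f = fsum P (%p. f (fst p) (snd p)) x"
proof -
 interpret P: abelian_group P by fact
 let ?f = "%p. f (fst p) (snd p)"
 have cl: "?f \<in> Poly_Mapping.keys y \<rightarrow> carrier P" if "y:.F" for y
  using that f unfolding carrier_F bal_def by fastforce
 have "fsum P ?f (rep (N #>\<^bsub>F\<^esub> x)) +[P] \<ominus>[P] fsum P ?f x = \<zero>[P]"
  using fsum_null[OF P f rep_coset(2)[OF x]] rep_coset(1)[OF x] cl x by (simp add: P.fsum_diff a_minus_def)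
 then have "\<ominus>[P] (\<ominus>[P] fsum P ?f x) = fsum P ?f (rep (N #>\<^bsub>F\<^esub> x))"
  by (rule P.minus_equality) (simp_all add: P.fsum_closed cl rep_coset(1) x)
 then show ?thesis unfolding tsum2_fsum by (simp add: P.fsum_closed cl x)
qed

lemma T_abelian_group: "abelian_group T"
proof -
 interpret Q: comm_group "F Mod N" by (rule F.abelian_FactGroup[OF N_subgroup])
 have eq: "carrier T = carrier (F Mod N)" "\<zero>[T] = \<one>[F Mod N]" "!!X Y. X +[T] Y = X *[F Mod N] Y"
  by (simp_all add: tensor_mod_def FactGroup_def)
 show ?thesis
 proof (rule abelian_groupI)
  show "\<exists>Y\<in>carrier T. Y +[T] X = \<zero>[T]" if "X:.T" for X
   using that Q.l_inv_ex unfolding eq by blast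
  show "X +[T] Y = Y +[T] X" if "X:.T" "Y:.T" for X Y
   using that unfolding eq by (rule Q.m_comm)
  show "X +[T] Y +[T] Z = X +[T] (Y +[T] Z)"
   if "X:.T" "Y:.T" "Z:.T" for X Y Z
   using that unfolding eq by (rule Q.m_assoc)
 qed (unfold eq, simp_all del: mult_FactGroup one_FactGroup)
qed

sublocale T: abelian_group T by (rule T_abelian_group)

lemma T_carrier: "X:.T \<longleftrightarrow> (\<exists>x\<in>carrier F. X = N #>\<^bsub>F\<^esub> x)"
 by (auto simp: tensor_mod_def RCOSETS_def)

lemma T_add: "x:.F ==> y:.F ==> (N #>\<^bsub>F\<^esub> x) +[T] (N #>\<^bsub>F\<^esub> y) = N #>\<^bsub>F\<^esub> (x + y)"
 using N.rcos_sum[of x y] by (simp add: tensor_mod_def)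

lemma T_zero: "\<zero>[T] = N #>\<^bsub>F\<^esub> 0"
 using F.coset_mult_one[OF N.subset] by (simp add: tensor_mod_def)

lemma T_neg: "x:.F ==> \<ominus>[T] (N #>\<^bsub>F\<^esub> x) = N #>\<^bsub>F\<^esub> (- x)"
 by (rule T.minus_equality) (auto simp: T_add T_zero T_carrier F_closed)

lemma ptens_closed0: "v:.V ==> w:.W ==> ptens K V W v w:.T"
 by (auto simp: T_carrier ptens_def)

lemma ptens_bal: "bal K V W T (ptens K V W)"
 unfolding bal_def
proof (intro conjI ballI)
 fix v v' w assume a: "v:.V" "v':.V" "w:.W"
 have "frag_of (v +[V] v', w) - frag_of (v, w) - frag_of (v', w) \<in> N"
  using a by (intro relator_N) blast
 then show "ptens K V W (v +[V] v') w = ptens K V W v w +[T] ptens K V W v' w"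
  using a by (simp add: ptens_def T_add coset_eq_iff F_closed diff_diff_eq)
next
 fix v w w' assume a: "v:.V" "w:.W" "w':.W"
 have "frag_of (v, w +[W] w') - frag_of (v, w) - frag_of (v, w') \<in> N"
  using a by (intro relator_N) blast
 then show "ptens K V W v (w +[W] w') = ptens K V W v w +[T] ptens K V W v w'"
  using a by (simp add: ptens_def T_add coset_eq_iff F_closed diff_diff_eq)
next
 fix c v w assume a: "c:.K" "v:.V" "w:.W"
 have "frag_of (c \<odot>[V] v, w) - frag_of (v, c \<odot>[W] w) \<in> N"
  using a by (intro relator_N) blast
 then show "ptens K V W (c \<odot>[V] v) w = ptens K V W v (c \<odot>[W] w)"
  using a by (simp add: ptens_def coset_eq_iff)
qed (auto intro: ptens_closed0)

lemma T_induct [consumes 1, case_names pure add]: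
 assumes "X:.T"
  and pure: "!!v w. v:.V ==> w:.W ==> Q (ptens K V W v w)"
  and add: "!!X Y. X:.T ==> Y:.T ==> Q X ==> Q Y ==> Q (X +[T] Y)"
 shows "Q X"
proof -
 have p0: "ptens K V W \<zero>[V] w = \<zero>[T]" if "w:.W" for w
  using ptens_bal that unfolding bal_def by (metis T.add.r_cancel_one V.M.r_zero V.M.zero_closed)
 have pm: "ptens K V W (\<ominus>[V] v) w = \<ominus>[T] ptens K V W v w" if "v:.V" "w:.W" for v w
 proof (rule T.minus_equality[symmetric])
  have "ptens K V W (\<ominus>[V] v +[V] v) w = ptens K V W (\<ominus>[V] v) w +[T] ptens K V W v w"
   using ptens_bal that V.M.a_inv_closed[OF that(1)] unfolding bal_def by blast
  then show "ptens K V W (\<ominus>[V] v) w +[T] ptens K V W v w = \<zero>[T]"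
   using that p0 by (simp add: V.M.l_neg)
 qed (use that in "simp_all add: ptens_closed0")
 have "Q (N #>\<^bsub>F\<^esub> x) \<and> Q (N #>\<^bsub>F\<^esub> (- x))" if "x:.F" for x
 proof -
  have "Poly_Mapping.keys x \<subseteq> carrier V \<times> carrier W" using that by (simp add: carrier_F)
  then show ?thesis
  proof (induction rule: frag_induct)
   case zero
   then show ?case using pure[OF V.M.zero_closed W.M.zero_closed] p0[OF W.M.zero_closed] by (simp add: T_zero)
  next
   case (diff x y)
   then have c: "x:.F" "y:.F" by (auto simp: carrier_F)
   have e: "N #>\<^bsub>F\<^esub> (x - y) = (N #>\<^bsub>F\<^esub> x) +[T] (N #>\<^bsub>F\<^esub> (- y))"
    "N #>\<^bsub>F\<^esub> (- (x - y)) = (N #>\<^bsub>F\<^esub> (- x)) +[T] (N #>\<^bsub>F\<^esub> y)"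
    using c by (simp_all add: T_add F_closed)
   have "N #>\<^bsub>F\<^esub> x:.T" "N #>\<^bsub>F\<^esub> y:.T"
    "N #>\<^bsub>F\<^esub> (- x):.T" "N #>\<^bsub>F\<^esub> (- y):.T"
    unfolding T_carrier using c F_closed(3) by blast+
   then show ?case using diff(3,4) add unfolding e by blast
  next
   case (frag_of a)
   obtain v w where [simp]: "a = (v, w)" by force
   have "N #>\<^bsub>F\<^esub> (- frag_of (v, w)) = ptens K V W (\<ominus>[V] v) w"
    using frag_of by (simp add: pm) (simp add: ptens_def T_neg)
   then show ?case using frag_of pure by (simp add: ptens_def[symmetric])
  qed
 qed
 then show ?thesis using assms(1) by (auto simp: T_carrier)
qed

lemma tsum2_ptens0:
 assumes P: "abelian_group P" and f: "bal K V W P f" and "v:.V" "w:.W"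
 shows "tsum2 P (ptens K V W v w) f = f v w"
proof -
 interpret P: abelian_group P by fact
 show ?thesis using assms by (simp add: ptens_def tsum2_coset) (subst P.fsum_frag_of, auto simp: bal_def)
qed

lemma tsum2_add0:
 assumes P: "abelian_group P" and f: "bal K V W P f" and "X:.T" "Y:.T"
 shows "tsum2 P (X +[T] Y) f = tsum2 P X f +[P] tsum2 P Y f"
proof -
 interpret P: abelian_group P by fact
 have cl: "(%p. f (fst p) (snd p)) \<in> Poly_Mapping.keys y \<rightarrow> carrier P" if "y:.F" for y
  using that f unfolding carrier_F bal_def by fastforce
 show ?thesis using assms unfolding T_carrier
  by (auto simp: T_add tsum2_coset F_closed P.fsum_add cl)
qed

lemma rep_T: "X:.T ==> Poly_Mapping.keys (rep X) \<subseteq> carrier V \<times> carrier W"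
 unfolding T_carrier carrier_F[symmetric] using rep_coset(1) by blast

lemma T_smult:
 assumes c: "c:.K" and X: "X:.T"
 shows "c \<odot>[T] X = tsum2 T X (%v w. ptens K V W (c \<odot>[V] v) w)"
proof -
 define g where "g = (\<lambda>(v, w). frag_of (c \<odot>[V] v, w :: 'w))"
 define f where "f = (%p. ptens K V W (c \<odot>[V] fst p) (snd p))"
 have g: "g (v, w) = frag_of (c \<odot>[V] v, w)" for v w by (simp add: g_def)
 have f: "f (v, w) = N #>\<^bsub>F\<^esub> g (v, w)" for v w by (simp add: f_def g_def ptens_def)
 have fc: "f p:.T" if "p \<in> carrier V \<times> carrier W" for p
  using that c by (auto simp: f_def intro!: ptens_closed0)
 have gc: "g p:.F" if "p \<in> carrier V \<times> carrier W" for p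
  using that c by (auto simp: g_def)
 have "frag_extend g x:.F \<and> N #>\<^bsub>F\<^esub> frag_extend g x = fsum T f x"
  if "Poly_Mapping.keys x \<subseteq> carrier V \<times> carrier W" for x
  using that
 proof (induction rule: frag_induct)
  case zero
  show ?case using F_closed(4) by (simp add: T_zero)
 next
  case (diff x y)
  have cl: "f \<in> Poly_Mapping.keys x \<rightarrow> carrier T" "f \<in> Poly_Mapping.keys y \<rightarrow> carrier T"
   using diff(1,2) fc by blast+
  have e: "frag_extend g x:.F" "frag_extend g y:.F"
   using diff(3,4) by blast+
  have "N #>\<^bsub>F\<^esub> (frag_extend g x - frag_extend g y) = (N #>\<^bsub>F\<^esub> frag_extend g x) +[T] (N #>\<^bsub>F\<^esub> (- frag_extend g y))"
   using e F_closed(3)[OF e(2)] by (simp add: T_add)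
  also have "... = fsum T f (x - y)"
   using diff(3,4) unfolding T.fsum_diff[OF cl] a_minus_def T_neg[OF e(2), symmetric] by metis
  finally show ?case using F_closed(2)[OF e] by (simp add: frag_extend_diff)
 next
  case (frag_of a)
  then show ?case using T.fsum_frag_of[of f a, OF fc] gc f by (cases a) simp
 qed
 from this[OF rep_T[OF X]] show ?thesis
  by (simp add: tsum2_fsum f_def tensor_mod_def g_def)
qed

lemma bal_smult:
 assumes c: "c:.K"
 shows "bal K V W T (%v w. ptens K V W (c \<odot>[V] v) w)"
proof -
 have "c \<odot>[V] (d \<odot>[V] v) = d \<odot>[V] (c \<odot>[V] v)" if "d:.K" "v:.V" for d v
  using c that by (simp add: V.smult_assoc1[symmetric] V.R.m_comm)
 then show ?thesis using ptens_bal c unfolding bal_def by (simp add: V.smult_r_distr)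
qed

lemma T_module: "module K T"
proof (rule moduleI)
 have sc: "c \<odot>[T] X:.T" if "c:.K" "X:.T" for c X
 proof -
  have "(%p. ptens K V W (c \<odot>[V] fst p) (snd p)) \<in> Poly_Mapping.keys (rep X) \<rightarrow> carrier T"
  proof
   fix p assume "p \<in> Poly_Mapping.keys (rep X)"
   then have "p \<in> carrier V \<times> carrier W" by (rule subsetD[OF rep_T[OF that(2)]])
   then have p: "fst p:.V" "snd p:.W" by (simp_all add: mem_Times_iff)
   show "ptens K V W (c \<odot>[V] fst p) (snd p):.T"
    by (rule ptens_closed0[OF V.smult_closed[OF that(1) p(1)] p(2)])
  qed
  then show ?thesis unfolding T_smult[OF that] tsum2_fsum by (rule T.fsum_closed)
 qed
 show sc': "!!c X. c:.K ==> X:.T ==> c \<odot>[T] X:.T" by (rule sc)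
 have sp: "c \<odot>[T] ptens K V W v w = ptens K V W (c \<odot>[V] v) w"
  if "c:.K" "v:.V" "w:.W" for c v w
  using that by (simp add: T_smult ptens_closed0 tsum2_ptens0[OF T_abelian_group bal_smult])
 show sa: "c \<odot>[T] (X +[T] Y) = c \<odot>[T] X +[T] c \<odot>[T] Y"
  if "c:.K" "X:.T" "Y:.T" for c X Y
  using that by (simp add: T_smult tsum2_add0[OF T_abelian_group bal_smult])
 have pa: "ptens K V W (v +[V] v') w = ptens K V W v w +[T] ptens K V W v' w"
  if "v:.V" "v':.V" "w:.W" for v v' w
  using ptens_bal that by (simp add: bal_def)
 show "(a +[K] b) \<odot>[T] X = a \<odot>[T] X +[T] b \<odot>[T] X"
  if "a:.K" "b:.K" "X:.T" for a b X
  using that(3)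
 proof (induction rule: T_induct)
  case (add X Y)
  have "a \<odot>[T] X:.T" "b \<odot>[T] X:.T" "a \<odot>[T] Y:.T" "b \<odot>[T] Y:.T"
   using that(1,2) add(1,2) sc by auto
  then show ?case using add that(1,2) by (simp add: sa T.a_ac)
 qed (use that in "simp add: sp pa V.smult_l_distr")
 show "(a *[K] b) \<odot>[T] X = a \<odot>[T] (b \<odot>[T] X)"
  if "a:.K" "b:.K" "X:.T" for a b X
  using that(3) by (induction rule: T_induct) (use that in "simp_all add: sp sa sc V.smult_assoc1")
 show "\<one>[K] \<odot>[T] X = X" if "X:.T" for X
  using that by (induction rule: T_induct) (simp_all add: sp sa)
qed (rule V.R.is_cring T_abelian_group)+

lemma ptens_smult0:
 assumes "c:.K" "v:.V" "w:.W"
 shows "c \<odot>[T] ptens K V W v w = ptens K V W (c \<odot>[V] v) w"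
 using assms by (simp add: T_smult ptens_closed0 tsum2_ptens0[OF T_abelian_group bal_smult])

end

subsection \<open>Universal property\<close>

lemma tensor_mod_eq:
 "carrier (tensor K V W) = carrier (tensor_mod K V W)"
 "\<zero>[tensor K V W] = \<zero>[tensor_mod K V W]"
 "X +[tensor K V W] Y = X +[tensor_mod K V W] Y"
 "c \<odot>[tensor K V W] X = c \<odot>[tensor_mod K V W] X"
 by (simp_all add: tensor_def)

text \<open>Sums only depend on the additive group of the target, up to the values of its zero and carrier.\<close>

lemma tsum2_target_cong:
 assumes "carrier P = carrier P'" "add P = add P'" "ring.zero P = ring.zero P'"
 shows "tsum2 P = tsum2 P'"
proof -
 have "finsum P f S = finsum P' f S" for f and S :: "'z set"
  using assms by (simp add: finsum_def finprod_def)
 moreover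
 have i: "m_inv (add_monoid P) y = m_inv (add_monoid P') y" for y
  using assms by (simp add: m_inv_def)
 then have "add_pow P n x = add_pow P' n x" for n :: int and x
  using assms by (simp add: add_pow_def int_pow_def nat_pow_def i Let_def cong del: if_weak_cong)
 ultimately show ?thesis by (intro ext) (simp add: tsum2_def)
qed

lemma tsum2_tensor_mod: "tsum2 (tensor_mod K V W) = tsum2 (tensor K V W)"
 by (rule tsum2_target_cong) (simp_all add: tensor_def)

lemma two_modulesI: "module K V ==> module K W ==> two_modules K V W"
 by (simp add: two_modules_def)

lemma tensor_module [simp, intro]:
 assumes "module K V" "module K W"
 shows "module K (tensor K V W)"
proof -
 interpret module K "tensor_mod K V W"
  using assms by (intro two_modules.T_module two_modulesI)
 have "abelian_group (tensor K V W)"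
 proof (rule abelian_groupI)
  show "\<exists>y\<in>carrier (tensor K V W). y +[tensor K V W] x = \<zero>[tensor K V W]"
   if "x:.tensor K V W" for x
   using that M.l_neg by (intro bexI[of _ "\<ominus>[tensor_mod K V W] x"]) (auto simp: tensor_mod_eq)
  show "x +[tensor K V W] y = y +[tensor K V W] x"
   if "x:.tensor K V W" "y:.tensor K V W" for x y
   using that by (simp add: tensor_mod_eq M.a_comm)
 qed (simp_all add: tensor_mod_eq M.a_assoc)
 then show ?thesis
  by (intro moduleI) (auto simp: tensor_mod_eq smult_l_distr smult_r_distr smult_assoc1 R.is_cring)
qed

lemma ptens_closed [simp, intro]:
 "module K V ==> module K W ==> v:.V ==> w:.W ==> ptens K V W v w:.tensor K V W"
 using two_modules.ptens_closed0[OF two_modulesI] by (simp add: tensor_mod_eq)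

lemma ptens_bilin:
 assumes "module K V" "module K W"
 shows "bilin K V W (tensor K V W) (ptens K V W)"
proof -
 interpret two_modules K V W using assms by (rule two_modulesI)
 show ?thesis
  using ptens_bal assms by (auto intro!: bilinI klinI simp: tensor_mod_eq bal_def ptens_smult0)
qed

text \<open>Negatives and zero are absorbed into pure tensors, so sums suffice.\<close>

lemma tensor_induct [consumes 3, case_names pure add]:
 assumes "module K V" "module K W" "X:.tensor K V W"
  and "!!v w. v:.V ==> w:.W ==> Q (ptens K V W v w)"
  and "!!X Y. X:.tensor K V W ==> Y:.tensor K V W ==> Q X ==> Q Y ==> Q (X +[tensor K V W] Y)"
 shows "Q X"
 using two_modules.T_induct[OF two_modulesI[OF assms(1,2)], of X Q] assms(3-) by (simp add: tensor_mod_eq)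

lemma tsum2_ptens:
 assumes "module K V" "module K W" "module K P" "bilin K V W P f" "v:.V" "w:.W"
 shows "tsum2 P (ptens K V W v w) f = f v w"
 using two_modules.tsum2_ptens0[OF two_modulesI[OF assms(1,2)] module_ag[OF assms(3)] bilin_bal] assms by blast

lemma tsum2_add:
 assumes "module K V" "module K W" "module K P" "bilin K V W P f"
  "X:.tensor K V W" "Y:.tensor K V W"
 shows "tsum2 P (X +[tensor K V W] Y) f = tsum2 P X f +[P] tsum2 P Y f"
 using two_modules.tsum2_add0[OF two_modulesI[OF assms(1,2)] module_ag[OF assms(3)] bilin_bal] assms
 by (simp add: tensor_mod_eq)

lemma rep_tensor:
 assumes "module K V" "module K W" "X:.tensor K V W" "p \<in> Poly_Mapping.keys (rep X)"
 shows "fst p:.V" "snd p:.W"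
 using two_modules.rep_T[OF two_modulesI[OF assms(1,2)], of X] assms(3,4) by (auto simp: tensor_mod_eq)

text \<open>The sums below range over one fixed representative, so linearity in an extra parameter is inherited termwise.\<close>

lemma tsum2_closed:
 assumes "module K V" "module K W" "X:.tensor K V W" "module K P"
  "!!v w. v:.V ==> w:.W ==> f v w:.P"
 shows "tsum2 P X f:.P"
 unfolding tsum2_fsum
 by (rule abelian_group.fsum_closed[OF module_ag[OF assms(4)]]) (use rep_tensor[OF assms(1-3)] assms(5) in auto)

lemma tsum2_cong:
 assumes "module K V" "module K W" "X:.tensor K V W" "module K P"
  "!!v w. v:.V ==> w:.W ==> f v w = g v w"
  "!!v w. v:.V ==> w:.W ==> g v w:.P"
 shows "tsum2 P X f = tsum2 P X g"
 unfolding tsum2_fsum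
 by (rule abelian_group.fsum_cong[OF module_ag[OF assms(4)]]) (use rep_tensor[OF assms(1-3)] assms(5,6) in auto)

lemma tsum2_hom:
 assumes "module K V" "module K W" "X:.tensor K V W" "module K P" "module K Q" "L : klin K P Q"
  "!!v w. v:.V ==> w:.W ==> f v w:.P"
 shows "L (tsum2 P X f) = tsum2 Q X (%v w. L (f v w))"
 unfolding tsum2_fsum
 by (rule fsum_hom[OF module_ag[OF assms(4)] module_ag[OF assms(5)]])
  (use assms(6) rep_tensor[OF assms(1-3)] assms(7) in "auto simp: klin_closed klin_add")

lemma lin_tsum2_fun:
 assumes "module K V" "module K W" "X:.tensor K V W" "module K P"
  "!!v w. v:.V ==> w:.W ==> (%x. f x v w) : klin K U P"
 shows "(%x. tsum2 P X (f x)) : klin K U P"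
proof (rule klinI)
 interpret P: module K P by fact
 fix x y assume xy: "x:.U" "y:.U"
 have c: "(%p. f u (fst p) (snd p)) \<in> Poly_Mapping.keys (rep X) \<rightarrow> carrier P" if "u:.U" for u
  using klin_closed[OF assms(5) that] rep_tensor[OF assms(1-3)] by auto
 have "tsum2 P X (f (x +[U] y)) = tsum2 P X (%v w. f x v w +[P] f y v w)"
  using xy klin_closed[OF assms(5)] by (intro tsum2_cong[OF assms(1-4)]) (simp_all add: klin_add[OF assms(5)])
 also have "... = tsum2 P X (f x) +[P] tsum2 P X (f y)"
  unfolding tsum2_fsum by (rule P.M.fsum_plus[OF c[OF xy(1)] c[OF xy(2)]])
 finally show "tsum2 P X (f (x +[U] y)) = tsum2 P X (f x) +[P] tsum2 P X (f y)" .
next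
 interpret P: module K P by fact
 fix c x assume cx: "c:.K" "x:.U"
 have "(%u. c \<odot>[P] u) : klin K P P"
  using cx by (auto intro!: klinI simp: P.smult_r_distr P.smult_assoc1[symmetric] P.R.m_comm)
 from tsum2_hom[OF assms(1-4,4) this, of "f x"]
 have "c \<odot>[P] tsum2 P X (f x) = tsum2 P X (%v w. c \<odot>[P] f x v w)"
  using klin_closed[OF assms(5)] cx by simp
 also have "... = tsum2 P X (f (c \<odot>[U] x))"
  using cx klin_closed[OF assms(5)] klin_smult[OF assms(5), symmetric]
  by (intro tsum2_cong[OF assms(1-4)])
   (simp_all add: klin_smult[OF assms(5)])
 finally show "tsum2 P X (f (c \<odot>[U] x)) = c \<odot>[P] tsum2 P X (f x)" ..
qed (use klin_closed[OF assms(5)] in "simp add: tsum2_closed[OF assms(1-4)]")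

lemma tensor_eqI:
 assumes "module K V" "module K W" "f : klin K (tensor K V W) P" "g : klin K (tensor K V W) P"
  "!!v w. v:.V ==> w:.W ==> f (ptens K V W v w) = g (ptens K V W v w)"
  "X:.tensor K V W"
 shows "f X = g X"
 using assms(1,2,6)
 by (induction rule: tensor_induct) (simp_all add: assms(5) klin_add[OF assms(3)] klin_add[OF assms(4)])

lemma tensor3_eqI:
 assumes "module K V" "module K W" "module K X"
  "f : klin K (tensor K V (tensor K W X)) P" "g : klin K (tensor K V (tensor K W X)) P"
  "!!v w x. v:.V ==> w:.W ==> x:.X ==>
    f (ptens K V (tensor K W X) v (ptens K W X w x)) = g (ptens K V (tensor K W X) v (ptens K W X w x))"
  "t:.tensor K V (tensor K W X)"
 shows "f t = g t"
proof (rule tensor_eqI[OF assms(1) tensor_module[OF assms(2,3)] assms(4,5) _ assms(7)])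
 fix v s assume v: "v:.V" and s: "s:.tensor K W X"
 have b: "(%s. ptens K V (tensor K W X) v s) : klin K (tensor K W X) (tensor K V (tensor K W X))"
  using ptens_bilin[OF assms(1) tensor_module[OF assms(2,3)]] v by (simp add: bilin_def)
 show "f (ptens K V (tensor K W X) v s) = g (ptens K V (tensor K W X) v s)"
  by (rule tensor_eqI[OF assms(2,3) klin_comp[OF b assms(4)] klin_comp[OF b assms(5)] assms(6)[OF v] s])
qed

lemma tensor3_left_eqI:
 assumes "module K V" "module K W" "module K X"
  "f : klin K (tensor K (tensor K V W) X) P" "g : klin K (tensor K (tensor K V W) X) P"
  "!!v w x. v:.V ==> w:.W ==> x:.X ==>
    f (ptens K (tensor K V W) X (ptens K V W v w) x) = g (ptens K (tensor K V W) X (ptens K V W v w) x)"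
  "t:.tensor K (tensor K V W) X"
 shows "f t = g t"
proof (rule tensor_eqI[OF tensor_module[OF assms(1,2)] assms(3) assms(4,5) _ assms(7)])
 fix s x assume s: "s:.tensor K V W" and x: "x:.X"
 have b: "(%s. ptens K (tensor K V W) X s x) : klin K (tensor K V W) (tensor K (tensor K V W) X)"
  using ptens_bilin[OF tensor_module[OF assms(1,2)] assms(3)] x by (simp add: bilin_def)
 show "f (ptens K (tensor K V W) X s x) = g (ptens K (tensor K V W) X s x)"
  by (rule tensor_eqI[OF assms(1,2) klin_comp[OF b assms(4)] klin_comp[OF b assms(5)] assms(6)[OF _ _ x] s])
qed

lemma lin_tsum2:
 assumes "module K V" "module K W" "module K P" "bilin K V W P f"
 shows "(%X. tsum2 P X f) : klin K (tensor K V W) P"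
proof (rule klinI)
 fix c X assume c: "c:.K" and X: "X:.tensor K V W"
 interpret P: module K P by fact
 interpret T: module K "tensor K V W" using assms by simp
 show "tsum2 P (c \<odot>[tensor K V W] X) f = c \<odot>[P] tsum2 P X f"
  using assms(1,2) X
 proof (induction rule: tensor_induct)
  case (pure v w)
  have "c \<odot>[tensor K V W] ptens K V W v w = ptens K V W (c \<odot>[V] v) w"
   using klin_smult[of "%v. ptens K V W v w" K V "tensor K V W" c v] ptens_bilin[OF assms(1,2)] pure c
   by (simp add: bilin_def)
  moreover have "f (c \<odot>[V] v) w = c \<odot>[P] f v w"
   using klin_smult[of "%v. f v w" K V P c v] assms(4) pure c by (simp add: bilin_def)
  ultimately show ?case using pure c assms module.smult_closed[OF assms(1)] by (simp add: tsum2_ptens)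
 next
  case (add X Y)
  have "tsum2 P X f:.P" "tsum2 P Y f:.P"
   using tsum2_closed[OF assms(1,2) _ assms(3) bilin_closed[OF assms(4)]] add by simp_all
  then show ?case using add c assms by (simp add: tsum2_add T.smult_r_distr P.smult_r_distr)
 qed
qed (use tsum2_closed[OF assms(1,2) _ assms(3) bilin_closed[OF assms(4)]] in "simp_all add: tsum2_add[OF assms]")

lemma tsum2_ptens_id:
 assumes "module K V" "module K W" "X:.tensor K V W"
 shows "tsum2 (tensor K V W) X (ptens K V W) = X"
 using assms by (intro tensor_eqI[OF assms(1,2) lin_tsum2[OF _ _ _ ptens_bilin] klin_id(2) _ assms(3)])
  (simp_all add: tsum2_ptens[OF _ _ _ ptens_bilin])

subsection \<open>Linearity rules\<close>

lemma lin_ptens1: "module K V ==> module K W ==> g : klin K U V ==> w:.W ==>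
  (%x. ptens K V W (g x) w) : klin K U (tensor K V W)"
 by (rule bilin_comp1[OF ptens_bilin])

lemma lin_ptens2: "module K V ==> module K W ==> g : klin K U W ==> v:.V ==>
  (%x. ptens K V W v (g x)) : klin K U (tensor K V W)"
 by (rule bilin_comp2[OF ptens_bilin])

lemma module_smult_bilin:
 assumes "module K V"
 shows "bilin K (base_module K) V V (%c v. c \<odot>[V] v)"
proof -
 interpret module K V by fact
 have "c \<odot>[V] (d \<odot>[V] v) = d \<odot>[V] (c \<odot>[V] v)"
  if "c:.K" "d:.K" "v:.V" for c d v
  using that by (simp add: smult_assoc1[symmetric] R.m_comm)
 then show ?thesis
  by (intro bilinI klinI) (simp_all add: base_module_def smult_l_distr smult_r_distr smult_assoc1)
qed

lemma tmap_eq: "tmap K V' W' f g X = tsum2 (tensor K V' W') X (%v w. ptens K V' W' (f v) (g w))"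
 by (simp add: tmap_def)

lemma tmap_bilin:
 assumes "module K V" "module K W" "module K V'" "module K W'" "f : klin K V V'" "g : klin K W W'"
 shows "bilin K V W (tensor K V' W') (%v w. ptens K V' W' (f v) (g w))"
 using assms by (intro bilinI lin_ptens1 lin_ptens2) (auto simp: klin_closed)

lemma tmap_lin:
 assumes "module K V" "module K W" "module K V'" "module K W'" "f : klin K V V'" "g : klin K W W'"
 shows "tmap K V' W' f g : klin K (tensor K V W) (tensor K V' W')"
 using lin_tsum2[OF assms(1,2) _ tmap_bilin[OF assms]] assms by (simp add: tmap_eq[abs_def])

lemma tmap_ptens:
 assumes "module K V" "module K W" "module K V'" "module K W'" "f : klin K V V'" "g : klin K W W'"
  "v:.V" "w:.W"
 shows "tmap K V' W' f g (ptens K V W v w) = ptens K V' W' (f v) (g w)"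
 using assms by (simp add: tmap_eq tsum2_ptens[OF _ _ _ tmap_bilin[OF assms(1-6)]])

lemma tmap_id:
 assumes "module K V" "module K W" "X:.tensor K V W"
 shows "tmap K V W id id X = X" "tmap K V W (%x. x) (%x. x) X = X"
 using tsum2_ptens_id[OF assms] by (simp_all add: tmap_eq)

lemma tmap_cong:
 assumes "module K V" "module K W" "module K V'" "module K W'" "f : klin K V V'" "g : klin K W W'"
  "!!v. v:.V ==> f' v = f v" "!!w. w:.W ==> g' w = g w" "X:.tensor K V W"
 shows "tmap K V' W' f' g' X = tmap K V' W' f g X"
 unfolding tmap_eq using assms by (intro tsum2_cong) (auto simp: klin_closed)

lemma tmap_comp:
 assumes "module K V" "module K W" "module K V'" "module K W'" "module K V''" "module K W''"
  "f : klin K V V'" "g : klin K W W'" "f' : klin K V' V''" "g' : klin K W' W''" "X:.tensor K V W"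
 shows "tmap K V'' W'' f' g' (tmap K V' W' f g X) = tmap K V'' W'' (%v. f' (f v)) (%w. g' (g w)) X"
 by (rule tensor_eqI[of K V W _ "tensor K V'' W''"])
  (use assms in "auto intro!: klin_comp[OF tmap_lin tmap_lin] tmap_lin intro: klin_comp simp: tmap_ptens klin_closed klin_comp")

definition flip :: "('k, 'r) ring_scheme => ('k, 'v, 'm) module_scheme => ('k, 'w, 'n) module_scheme =>
  ('v, 'w) tens => ('w, 'v) tens" where
 "flip K V W X = tsum2 (tensor K W V) X (%v w. ptens K W V w v)"

definition rebr :: "('k, 'r) ring_scheme => ('k, 'v, 'm) module_scheme => ('k, 'w, 'n) module_scheme =>
  ('k, 'x, 'p) module_scheme => (('v, 'w) tens, 'x) tens => ('v, ('w, 'x) tens) tens" where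
 "rebr K V W X t = tsum2 (tensor K V (tensor K W X)) t (%s x. tsum2 (tensor K V (tensor K W X)) s (%v w.
   ptens K V (tensor K W X) v (ptens K W X w x)))"

definition lebr :: "('k, 'r) ring_scheme => ('k, 'v, 'm) module_scheme => ('k, 'w, 'n) module_scheme =>
  ('k, 'x, 'p) module_scheme => ('v, ('w, 'x) tens) tens => (('v, 'w) tens, 'x) tens" where
 "lebr K V W X t = tsum2 (tensor K (tensor K V W) X) t (%v s. tsum2 (tensor K (tensor K V W) X) s (%w x.
   ptens K (tensor K V W) X (ptens K V W v w) x))"

lemma flip_lin: "module K V ==> module K W ==> flip K V W : klin K (tensor K V W) (tensor K W V)"
 unfolding flip_def[abs_def] by (intro lin_tsum2 bilinI lin_ptens1 lin_ptens2 klin_id) simp_all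

lemma flip_ptens: "module K V ==> module K W ==> v:.V ==> w:.W ==>
  flip K V W (ptens K V W v w) = ptens K W V w v"
 unfolding flip_def[abs_def] by (subst tsum2_ptens) (auto intro!: bilinI lin_ptens1 lin_ptens2 klin_id)

lemma flip_flip:
 assumes "module K V" "module K W" "t:.tensor K V W"
 shows "flip K W V (flip K V W t) = t"
 by (rule tensor_eqI[OF assms(1,2) klin_comp[OF flip_lin flip_lin] klin_id(2) _ assms(3)])
  (simp_all add: assms flip_ptens)

lemma rebr_bilin:
 assumes "module K V" "module K W" "module K X"
 shows "x:.X ==> bilin K V W (tensor K V (tensor K W X)) (%v w. ptens K V (tensor K W X) v (ptens K W X w x))"
  "bilin K (tensor K V W) X (tensor K V (tensor K W X))
    (%s x. tsum2 (tensor K V (tensor K W X)) s (%v w. ptens K V (tensor K W X) v (ptens K W X w x)))"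
proof -
 show b: "bilin K V W (tensor K V (tensor K W X)) (%v w. ptens K V (tensor K W X) v (ptens K W X w x))"
  if "x:.X" for x
  using assms that by (intro bilinI lin_ptens1 lin_ptens2 klin_id) simp_all
 show "bilin K (tensor K V W) X (tensor K V (tensor K W X))
    (%s x. tsum2 (tensor K V (tensor K W X)) s (%v w. ptens K V (tensor K W X) v (ptens K W X w x)))"
  using assms b by (intro bilinI lin_tsum2 lin_tsum2_fun[of K V W] lin_ptens1 lin_ptens2 klin_id) simp_all
qed

lemma rebr_lin: "module K V ==> module K W ==> module K X ==>
  rebr K V W X : klin K (tensor K (tensor K V W) X) (tensor K V (tensor K W X))"
 unfolding rebr_def[abs_def] by (intro lin_tsum2 rebr_bilin) simp_all

lemma rebr_ptens: "module K V ==> module K W ==> module K X ==> v:.V ==> w:.W ==> x:.X ==>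
  rebr K V W X (ptens K (tensor K V W) X (ptens K V W v w) x) = ptens K V (tensor K W X) v (ptens K W X w x)"
 by (simp add: rebr_def tsum2_ptens[OF _ _ _ rebr_bilin(1)] tsum2_ptens[OF _ _ _ rebr_bilin(2)])

lemma lebr_bilin:
 assumes "module K V" "module K W" "module K X"
 shows "v:.V ==> bilin K W X (tensor K (tensor K V W) X) (%w x. ptens K (tensor K V W) X (ptens K V W v w) x)"
  "bilin K V (tensor K W X) (tensor K (tensor K V W) X)
    (%v s. tsum2 (tensor K (tensor K V W) X) s (%w x. ptens K (tensor K V W) X (ptens K V W v w) x))"
proof -
 show b: "bilin K W X (tensor K (tensor K V W) X) (%w x. ptens K (tensor K V W) X (ptens K V W v w) x)"
  if "v:.V" for v
  using assms that by (intro bilinI lin_ptens1 lin_ptens2 klin_id) simp_all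
 show "bilin K V (tensor K W X) (tensor K (tensor K V W) X)
    (%v s. tsum2 (tensor K (tensor K V W) X) s (%w x. ptens K (tensor K V W) X (ptens K V W v w) x))"
  using assms b by (intro bilinI lin_tsum2 lin_tsum2_fun[of K W X] lin_ptens1 lin_ptens2 klin_id) simp_all
qed

lemma lebr_lin: "module K V ==> module K W ==> module K X ==>
  lebr K V W X : klin K (tensor K V (tensor K W X)) (tensor K (tensor K V W) X)"
 unfolding lebr_def[abs_def] by (intro lin_tsum2 lebr_bilin) simp_all

lemma lebr_ptens: "module K V ==> module K W ==> module K X ==> v:.V ==> w:.W ==> x:.X ==>
  lebr K V W X (ptens K V (tensor K W X) v (ptens K W X w x)) = ptens K (tensor K V W) X (ptens K V W v w) x"
 by (simp add: lebr_def tsum2_ptens[OF _ _ _ lebr_bilin(1)] tsum2_ptens[OF _ _ _ lebr_bilin(2)])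

lemma rebr_lebr:
 assumes "module K V" "module K W" "module K X"
 shows "t:.tensor K V (tensor K W X) ==> rebr K V W X (lebr K V W X t) = t"
  "s:.tensor K (tensor K V W) X ==> lebr K V W X (rebr K V W X s) = s"
proof -
 assume t: "t:.tensor K V (tensor K W X)"
 show "rebr K V W X (lebr K V W X t) = t"
  by (rule tensor3_eqI[OF assms klin_comp[OF lebr_lin rebr_lin] klin_id(2) _ t])
   (simp_all add: assms lebr_ptens rebr_ptens)
next
 assume s: "s:.tensor K (tensor K V W) X"
 show "lebr K V W X (rebr K V W X s) = s"
  by (rule tensor3_left_eqI[OF assms klin_comp[OF rebr_lin lebr_lin] klin_id(2) _ s])
   (simp_all add: assms lebr_ptens rebr_ptens)
qed

section \<open>Algebras, their tensor products, and modules over them\<close>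

lemma alg_module: "k_algebra K B ==> module K B"
 by (simp add: k_algebra_def)

lemma alg_ring: "k_algebra K B ==> ring B"
 by (simp add: k_algebra_def)

lemma alg_closed:
 assumes "k_algebra K B"
 shows "a:.B ==> b:.B ==> a *[B] b:.B" "\<one>[B]:.B"
proof -
 interpret ring B using assms by (rule alg_ring)
 show "a:.B ==> b:.B ==> a *[B] b:.B" "\<one>[B]:.B" by simp_all
qed

lemma alg_mult:
 assumes "k_algebra K B"
 shows "a:.B ==> \<one>[B] *[B] a = a" "a:.B ==> a *[B] \<one>[B] = a"
  "a:.B ==> b:.B ==> c:.B ==> a *[B] b *[B] c = a *[B] (b *[B] c)"
proof -
 interpret ring B using assms by (rule alg_ring)
 show "a:.B ==> \<one>[B] *[B] a = a" "a:.B ==> a *[B] \<one>[B] = a"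
  "a:.B ==> b:.B ==> c:.B ==> a *[B] b *[B] c = a *[B] (b *[B] c)"
  by (simp_all add: m_assoc)
qed

lemma mult_bilin:
 assumes "k_algebra K B"
 shows "bilin K B B B (%a b. a *[B] b)"
proof -
 interpret ring B using assms by (rule alg_ring)
 show ?thesis using assms by (intro bilinI klinI) (auto simp: k_algebra_def l_distr r_distr)
qed

lemmas lin_mult1 = bilin_comp1[OF mult_bilin] and lin_mult2 = bilin_comp2[OF mult_bilin]

lemma bilin_eqI:
 assumes "module K A" "module K B" "module K C" "module K D"
  and f: "bilin K (tensor K A B) (tensor K C D) P f" and g: "bilin K (tensor K A B) (tensor K C D) P g"
  and "!!a b c d. a:.A ==> b:.B ==> c:.C ==> d:.D ==>
   f (ptens K A B a b) (ptens K C D c d) = g (ptens K A B a b) (ptens K C D c d)"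
  and X: "X:.tensor K A B" and Y: "Y:.tensor K C D"
 shows "f X Y = g X Y"
proof (rule tensor_eqI[OF assms(1,2) _ _ _ X])
 show "(%X. f X Y) : klin K (tensor K A B) P" "(%X. g X Y) : klin K (tensor K A B) P"
  using f g Y by (auto simp: bilin_def)
 fix a b assume ab: "a:.A" "b:.B"
 show "f (ptens K A B a b) Y = g (ptens K A B a b) Y"
  by (rule tensor_eqI[OF assms(3,4) _ _ _ Y, of _ P])
   (use f g ab assms in "auto simp: bilin_def")
qed

lemma tensor_one: "\<one>[tensor K B C] = ptens K B C \<one>[B] \<one>[C]"
 by (simp add: tensor_def)

lemma tensor_mult:
 "X *[tensor K B C] Y = tsum2 (tensor K B C) X (%a b. tsum2 (tensor K B C) Y (%c d.
   ptens K B C (a *[B] c) (b *[C] d)))"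
 by (subst (1 2) tsum2_tensor_mod[symmetric]) (simp add: tensor_def)

context
 fixes K :: "('k, 'r) ring_scheme" and B :: "('k, 'b, 'm) module_scheme" and C :: "('k, 'c, 'n) module_scheme"
 assumes B: "k_algebra K B" and C: "k_algebra K C"
begin

lemma tensor_mult_bilins:
 "a:.B ==> b:.C ==> bilin K B C (tensor K B C) (%c d. ptens K B C (a *[B] c) (b *[C] d))"
 "Y:.tensor K B C ==> bilin K B C (tensor K B C) (%a b. tsum2 (tensor K B C) Y (%c d.
   ptens K B C (a *[B] c) (b *[C] d)))"
 using B C by (auto intro!: bilinI lin_ptens1 lin_ptens2 lin_mult1 lin_mult2 klin_id lin_tsum2_fun[of K B C]
   alg_closed simp: alg_module)

lemma tensor_mult_bilin: "bilin K (tensor K B C) (tensor K B C) (tensor K B C) (%X Y. X *[tensor K B C] Y)"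
 unfolding tensor_mult
 by (intro bilinI lin_tsum2_fun[of K B C] lin_tsum2 tensor_mult_bilins)
  (simp_all add: B C alg_module tensor_mult_bilins)

lemma tensor_mult_ptens:
 assumes "a:.B" "b:.C" "c:.B" "d:.C"
 shows "ptens K B C a b *[tensor K B C] ptens K B C c d = ptens K B C (a *[B] c) (b *[C] d)"
 using assms B C unfolding tensor_mult
 by (simp add: tsum2_ptens[OF _ _ _ tensor_mult_bilins(2)] tsum2_ptens[OF _ _ _ tensor_mult_bilins(1)] alg_module)

lemma alg_tensor: "k_algebra K (tensor K B C)"
proof -
 note m = alg_module[OF B] alg_module[OF C]
 interpret T: module K "tensor K B C" using m by simp
 note bl = tensor_mult_bilin
 have cl: "X *[tensor K B C] Y:.tensor K B C"
  if "X:.tensor K B C" "Y:.tensor K B C" for X Y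
  by (rule bilin_closed[OF bl that])
 have one: "\<one>[tensor K B C]:.tensor K B C"
  using m B C by (simp add: tensor_one alg_closed)
 have l1: "\<one>[tensor K B C] *[tensor K B C] X = X" and r1: "X *[tensor K B C] \<one>[tensor K B C] = X"
  if X: "X:.tensor K B C" for X
 proof -
  show "\<one>[tensor K B C] *[tensor K B C] X = X"
   by (rule tensor_eqI[OF m bilin_comp2[OF bl one klin_id(2)] klin_id(2) _ X])
    (simp add: tensor_one tensor_mult_ptens alg_closed[OF B] alg_closed[OF C] alg_mult[OF B] alg_mult[OF C])
  show "X *[tensor K B C] \<one>[tensor K B C] = X"
   by (rule tensor_eqI[OF m bilin_comp1[OF bl klin_id(2) one] klin_id(2) _ X])
    (simp add: tensor_one tensor_mult_ptens alg_closed[OF B] alg_closed[OF C] alg_mult[OF B] alg_mult[OF C])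
 qed
 have assoc: "X *[tensor K B C] Y *[tensor K B C] Z = X *[tensor K B C] (Y *[tensor K B C] Z)"
  if X: "X:.tensor K B C" and Y: "Y:.tensor K B C" and Z: "Z:.tensor K B C" for X Y Z
 proof (rule bilin_eqI[OF m m _ _ _ X Y])
  show "bilin K (tensor K B C) (tensor K B C) (tensor K B C) (%X Y. X *[tensor K B C] Y *[tensor K B C] Z)"
   using Z by (intro bilinI bilin_comp1[OF bl] bilin_comp2[OF bl] klin_id)
  show "bilin K (tensor K B C) (tensor K B C) (tensor K B C) (%X Y. X *[tensor K B C] (Y *[tensor K B C] Z))"
   using Z cl by (intro bilinI bilin_comp1[OF bl] bilin_comp2[OF bl] klin_id)
  fix a b c d assume abcd: "a:.B" "b:.C" "c:.B" "d:.C"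
  show "ptens K B C a b *[tensor K B C] ptens K B C c d *[tensor K B C] Z =
    ptens K B C a b *[tensor K B C] (ptens K B C c d *[tensor K B C] Z)"
   by (rule tensor_eqI[OF m bilin_comp2[OF bl _ klin_id(2)] bilin_comp2[OF bl _ bilin_comp2[OF bl _ klin_id(2)]] _ Z])
    (use m B C abcd in "auto simp: tensor_mult_ptens alg_closed alg_mult cl")
 qed
 have "ring (tensor K B C)"
 proof (rule ringI)
  show "Group.monoid (tensor K B C)" by (rule monoidI) (auto simp: cl one l1 r1 assoc)
 qed (use T.abelian_group_axioms bl in "auto simp: bilin_def klin_def")
 then show ?thesis using T.module_axioms bl unfolding k_algebra_def
  by (auto simp: bilin_def klin_def)
qed

end

definition ahom :: "('k, 'r) ring_scheme => ('k, 'b, 'm) module_scheme => ('k, 'c, 'n) module_scheme => ('b => 'c) set" where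
 "ahom K B C = klin K B C \<inter> ring_hom B C"

lemma ahom_lin: "f \<in> ahom K B C ==> f : klin K B C"
 by (simp add: ahom_def)

lemma ahom_mult: "f \<in> ahom K B C ==> x:.B ==> y:.B ==> f (x *[B] y) = f x *[C] f y"
 by (simp add: ahom_def ring_hom_def)

lemma ahom_one: "f \<in> ahom K B C ==> f \<one>[B] = \<one>[C]"
 by (simp add: ahom_def ring_hom_def)

lemma ahomI:
 assumes "f : klin K B C" "!!x y. x:.B ==> y:.B ==> f (x *[B] y) = f x *[C] f y"
  "f \<one>[B] = \<one>[C]"
 shows "f \<in> ahom K B C"
 using assms by (auto simp: ahom_def ring_hom_def klin_closed klin_add)

lemma ahom_id: "id \<in> ahom K B B" "(%x. x) \<in> ahom K B B"
 by (auto intro!: ahomI klin_id)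

lemma ahom_comp: "f \<in> ahom K B C ==> g \<in> ahom K C D ==> (%x. g (f x)) \<in> ahom K B D"
 by (intro ahomI) (auto intro: klin_comp ahom_lin simp: ahom_mult ahom_one klin_closed[OF ahom_lin])

text \<open>It suffices to check multiplicativity on pure tensors.\<close>

lemma ahom_tensorI:
 assumes B: "k_algebra K B" and C: "k_algebra K C" and D: "k_algebra K D" and f: "f : klin K (tensor K B C) D"
  and m: "!!a b c d. a:.B ==> b:.C ==> c:.B ==> d:.C ==>
   f (ptens K B C (a *[B] c) (b *[C] d)) = f (ptens K B C a b) *[D] f (ptens K B C c d)"
  and o: "f (ptens K B C \<one>[B] \<one>[C]) = \<one>[D]"
 shows "f \<in> ahom K (tensor K B C) D"
proof (rule ahomI[OF f])
 note mm = alg_module[OF B] alg_module[OF C]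
 show "f \<one>[tensor K B C] = \<one>[D]" using o by (simp add: tensor_one)
 fix X Y assume XY: "X:.tensor K B C" "Y:.tensor K B C"
 show "f (X *[tensor K B C] Y) = f X *[D] f Y"
 proof (rule bilin_eqI[OF mm mm _ _ _ XY, of D])
  show "bilin K (tensor K B C) (tensor K B C) D (%X Y. f (X *[tensor K B C] Y))"
   by (rule bilin_klin[OF tensor_mult_bilin[OF B C] f])
  show "bilin K (tensor K B C) (tensor K B C) D (%X Y. f X *[D] f Y)"
   using f D by (intro bilinI lin_mult1 lin_mult2) (auto simp: klin_closed)
 qed (simp add: tensor_mult_ptens[OF B C] m)
qed

lemma ahom_tmap:
 assumes B: "k_algebra K B" and C: "k_algebra K C" and B': "k_algebra K B'" and C': "k_algebra K C'"
  and f: "f \<in> ahom K B B'" and g: "g \<in> ahom K C C'"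
 shows "tmap K B' C' f g \<in> ahom K (tensor K B C) (tensor K B' C')"
proof -
 note m = alg_module[OF B] alg_module[OF C] alg_module[OF B'] alg_module[OF C']
 note t = tmap_ptens[OF m ahom_lin[OF f] ahom_lin[OF g]]
 show ?thesis
  by (rule ahom_tensorI[OF B C alg_tensor[OF B' C'] tmap_lin[OF m ahom_lin[OF f] ahom_lin[OF g]]])
   (simp_all add: t alg_closed[OF B] alg_closed[OF C] ahom_mult[OF f] ahom_mult[OF g] ahom_one[OF f] ahom_one[OF g]
    tensor_mult_ptens[OF B' C'] tensor_one klin_closed[OF ahom_lin[OF f]] klin_closed[OF ahom_lin[OF g]])
qed

lemma ahom_flip:
 assumes B: "k_algebra K B" and C: "k_algebra K C"
 shows "flip K B C \<in> ahom K (tensor K B C) (tensor K C B)"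
 using alg_module[OF B] alg_module[OF C]
 by (intro ahom_tensorI[OF B C alg_tensor[OF C B]] flip_lin)
  (simp_all add: flip_ptens alg_closed[OF B] alg_closed[OF C] tensor_mult_ptens[OF C B] tensor_one)

lemma ahom_rebr:
 assumes B: "k_algebra K B" and C: "k_algebra K C" and D: "k_algebra K D"
 shows "rebr K B C D \<in> ahom K (tensor K (tensor K B C) D) (tensor K B (tensor K C D))"
proof (rule ahom_tensorI[OF alg_tensor[OF B C] D alg_tensor[OF B alg_tensor[OF C D]]])
 note m = alg_module[OF B] alg_module[OF C] alg_module[OF D]
 note c = alg_closed[OF B] alg_closed[OF C] alg_closed[OF D]
 show l: "rebr K B C D : klin K (tensor K (tensor K B C) D) (tensor K B (tensor K C D))"
  by (rule rebr_lin[OF m])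
 show "rebr K B C D (ptens K (tensor K B C) D \<one>[tensor K B C] \<one>[D]) = \<one>[tensor K B (tensor K C D)]"
  using m c by (simp add: tensor_one rebr_ptens)
 fix X y Z w assume X: "X:.tensor K B C" and y: "y:.D" and Z: "Z:.tensor K B C" and w: "w:.D"
 let ?T = "tensor K B (tensor K C D)"
 note mb = tensor_mult_bilin[OF B C]
 have T: "module K (tensor K B C)" using m by simp
 have p: "(%X. rebr K B C D (ptens K (tensor K B C) D X d)) : klin K (tensor K B C) ?T" if "d:.D" for d
  by (rule klin_comp[OF lin_ptens1[OF T m(3) klin_id(2) that] l])
 show "rebr K B C D (ptens K (tensor K B C) D (X *[tensor K B C] Z) (y *[D] w)) =
   rebr K B C D (ptens K (tensor K B C) D X y) *[?T] rebr K B C D (ptens K (tensor K B C) D Z w)"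
 proof (rule bilin_eqI[OF m(1,2) m(1,2) _ _ _ X Z, of ?T])
  show "bilin K (tensor K B C) (tensor K B C) ?T (%X Z. rebr K B C D (ptens K (tensor K B C) D (X *[tensor K B C] Z) (y *[D] w)))"
   by (rule bilin_klin[OF mb p]) (use y w c in auto)
  show "bilin K (tensor K B C) (tensor K B C) ?T (%X Z. rebr K B C D (ptens K (tensor K B C) D X y) *[?T] rebr K B C D (ptens K (tensor K B C) D Z w))"
   using p[OF y] p[OF w] klin_closed[OF p[OF y]] klin_closed[OF p[OF w]]
   by (intro bilinI lin_mult1 lin_mult2 alg_tensor B C D) auto
 qed (use m c y w in "simp add: tensor_mult_ptens[OF B C] rebr_ptens tensor_mult_ptens[OF B alg_tensor[OF C D]] tensor_mult_ptens[OF C D]")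
qed

lemma ahom_lebr:
 assumes B: "k_algebra K B" and C: "k_algebra K C" and D: "k_algebra K D"
 shows "lebr K B C D \<in> ahom K (tensor K B (tensor K C D)) (tensor K (tensor K B C) D)"
proof (rule ahomI)
 note m = alg_module[OF B] alg_module[OF C] alg_module[OF D]
 note h = ahom_rebr[OF B C D]
 show l: "lebr K B C D : klin K (tensor K B (tensor K C D)) (tensor K (tensor K B C) D)" by (rule lebr_lin[OF m])
 have inj: "s = lebr K B C D t" if "s:.tensor K (tensor K B C) D" "rebr K B C D s = t" for s t
  using that rebr_lebr(2)[OF m, of s] by simp
 note A1 = alg_tensor[OF alg_tensor[OF B C] D]
 show "lebr K B C D (x *[tensor K B (tensor K C D)] y) = lebr K B C D x *[tensor K (tensor K B C) D] lebr K B C D y"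
  if "x:.tensor K B (tensor K C D)" "y:.tensor K B (tensor K C D)" for x y
  using that klin_closed[OF l]
  by (intro inj[symmetric]) (simp_all add: alg_closed[OF A1] ahom_mult[OF h] rebr_lebr(1)[OF m])
 show "lebr K B C D \<one>[tensor K B (tensor K C D)] = \<one>[tensor K (tensor K B C) D]"
  by (intro inj[symmetric]) (simp_all add: alg_closed[OF A1] ahom_one[OF h])
qed

definition amod :: "('k, 'r) ring_scheme => ('k, 'b, 'm) module_scheme => ('k, 'v, 'n) module_scheme =>
  ('b => 'v => 'v) => bool" where
 "amod K B V \<alpha> \<longleftrightarrow> module K V \<and> bilin K B V V \<alpha> \<and>
   (\<forall>a\<in>carrier B. \<forall>b\<in>carrier B. \<forall>v\<in>carrier V. \<alpha> (a *[B] b) v = \<alpha> a (\<alpha> b v)) \<and>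
   (\<forall>v\<in>carrier V. \<alpha> \<one>[B] v = v)"

lemma amodD:
 assumes "amod K B V \<alpha>"
 shows "module K V" "bilin K B V V \<alpha>"
  "a:.B ==> b:.B ==> v:.V ==> \<alpha> (a *[B] b) v = \<alpha> a (\<alpha> b v)"
  "v:.V ==> \<alpha> \<one>[B] v = v"
  "a:.B ==> v:.V ==> \<alpha> a v:.V"
  "a:.B ==> \<alpha> a : klin K V V"
  "v:.V ==> (%a. \<alpha> a v) : klin K B V"
 using assms by (auto simp: amod_def bilin_def klin_closed)

definition act2 :: "('k, 'r) ring_scheme => ('k, 'v, 'm) module_scheme => ('k, 'w, 'n) module_scheme =>
  ('b => 'v => 'v) => ('c => 'w => 'w) => ('b, 'c) tens => ('v, 'w) tens => ('v, 'w) tens" where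
 "act2 K V W \<alpha> \<beta> X t = tsum2 (tensor K V W) X (%b c. tmap K V W (\<alpha> b) (\<beta> c) t)"

context
 fixes K :: "('k, 'r) ring_scheme" and B :: "('k, 'b, 'm) module_scheme" and C :: "('k, 'c, 'n) module_scheme"
  and V :: "('k, 'v, 'p) module_scheme" and W :: "('k, 'w, 'q) module_scheme" and \<alpha> \<beta>
 assumes B: "k_algebra K B" and C: "k_algebra K C" and V: "amod K B V \<alpha>" and W: "amod K C W \<beta>"
begin

lemma act2_summand_bilin:
 assumes t: "t:.tensor K V W"
 shows "bilin K B C (tensor K V W) (%b c. tmap K V W (\<alpha> b) (\<beta> c) t)"
 unfolding tmap_eq
 using amodD[OF V] amodD[OF W] B C t
 by (intro bilinI lin_tsum2_fun[OF amodD(1)[OF V] amodD(1)[OF W]] lin_ptens1 lin_ptens2) auto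

lemma act2_bilin: "bilin K (tensor K B C) (tensor K V W) (tensor K V W) (act2 K V W \<alpha> \<beta>)"
proof (rule bilinI)
 note m = amodD(1)[OF V] amodD(1)[OF W] alg_module[OF B] alg_module[OF C]
 show "act2 K V W \<alpha> \<beta> X : klin K (tensor K V W) (tensor K V W)" if "X:.tensor K B C" for X
  unfolding act2_def[abs_def] using that m amodD(6)[OF V] amodD(6)[OF W]
  by (intro lin_tsum2_fun[OF m(3,4)] tmap_lin) auto
 show "(%X. act2 K V W \<alpha> \<beta> X t) : klin K (tensor K B C) (tensor K V W)" if "t:.tensor K V W" for t
  unfolding act2_def using that m by (intro lin_tsum2 act2_summand_bilin) auto
qed

lemma act2_ptens:
 assumes "b:.B" "c:.C" "t:.tensor K V W"
 shows "act2 K V W \<alpha> \<beta> (ptens K B C b c) t = tmap K V W (\<alpha> b) (\<beta> c) t"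
 unfolding act2_def using assms B C amodD(1)[OF V] amodD(1)[OF W]
 by (subst tsum2_ptens[OF _ _ _ act2_summand_bilin]) (simp_all add: alg_module)

lemma act2_ptens_ptens:
 assumes "b:.B" "c:.C" "v:.V" "w:.W"
 shows "act2 K V W \<alpha> \<beta> (ptens K B C b c) (ptens K V W v w) = ptens K V W (\<alpha> b v) (\<beta> c w)"
 using assms amodD[OF V] amodD[OF W] by (simp add: act2_ptens tmap_ptens)

lemma amod_tensor: "amod K (tensor K B C) (tensor K V W) (act2 K V W \<alpha> \<beta>)"
 unfolding amod_def
proof (intro conjI ballI)
 note mv = amodD(1)[OF V] amodD(1)[OF W] and ma = alg_module[OF B] alg_module[OF C]
 note cl = alg_closed[OF B] alg_closed[OF C] amodD(5)[OF V] amodD(5)[OF W]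
 note bl = act2_bilin and T = alg_tensor[OF B C]
 show "module K (tensor K V W)" using mv by simp
 show "bilin K (tensor K B C) (tensor K V W) (tensor K V W) (act2 K V W \<alpha> \<beta>)" by (rule bl)
 show "act2 K V W \<alpha> \<beta> \<one>[tensor K B C] t = t" if t: "t:.tensor K V W" for t
  by (rule tensor_eqI[OF mv bilin_comp2[OF bl alg_closed(2)[OF T] klin_id(2)] klin_id(2) _ t])
   (simp_all add: tensor_one act2_ptens_ptens cl amodD(4)[OF V] amodD(4)[OF W])
 fix X Y t assume X: "X:.tensor K B C" and Y: "Y:.tensor K B C" and t: "t:.tensor K V W"
 show "act2 K V W \<alpha> \<beta> (X *[tensor K B C] Y) t = act2 K V W \<alpha> \<beta> X (act2 K V W \<alpha> \<beta> Y t)"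
 proof (rule bilin_eqI[OF ma ma _ _ _ X Y, of "tensor K V W"])
  show "bilin K (tensor K B C) (tensor K B C) (tensor K V W) (%X Y. act2 K V W \<alpha> \<beta> (X *[tensor K B C] Y) t)"
   using t bl by (intro bilin_klin[OF tensor_mult_bilin[OF B C]]) (simp add: bilin_def)
  show "bilin K (tensor K B C) (tensor K B C) (tensor K V W) (%X Y. act2 K V W \<alpha> \<beta> X (act2 K V W \<alpha> \<beta> Y t))"
   using t by (intro bilinI bilin_comp1[OF bl] bilin_comp2[OF bl] klin_id) (auto simp: bilin_closed[OF bl])
  fix a b c d assume abcd: "a:.B" "b:.C" "c:.B" "d:.C"
  have p: "ptens K B C a b:.tensor K B C" "ptens K B C c d:.tensor K B C"
   "ptens K B C (a *[B] c) (b *[C] d):.tensor K B C"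
   using abcd ma cl by simp_all
  show "act2 K V W \<alpha> \<beta> (ptens K B C a b *[tensor K B C] ptens K B C c d) t =
    act2 K V W \<alpha> \<beta> (ptens K B C a b) (act2 K V W \<alpha> \<beta> (ptens K B C c d) t)"
   unfolding tensor_mult_ptens[OF B C abcd]
   by (rule tensor_eqI[OF mv bilin_comp2[OF bl p(3) klin_id(2)] bilin_comp2[OF bl p(1) bilin_comp2[OF bl p(2) klin_id(2)]] _ t])
    (simp add: abcd act2_ptens_ptens cl amodD(3)[OF V] amodD(3)[OF W])
 qed
qed

end

lemma amod_ahom: "k_algebra K B ==> k_algebra K C ==> D \<in> ahom K B C ==> amod K C V \<gamma> ==> amod K B V (%b. \<gamma> (D b))"
 unfolding amod_def[of K B]
 by (auto intro!: bilinI simp: amodD klin_closed[OF ahom_lin] ahom_mult ahom_one intro: klin_comp[OF ahom_lin amodD(7)])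

lemma act2_tmap:
 assumes B: "k_algebra K B" and C: "k_algebra K C" and V: "amod K B V \<alpha>" and W: "amod K C W \<beta>"
  and B': "k_algebra K B'" and C': "k_algebra K C'" and V': "amod K B' V' \<alpha>'" and W': "amod K C' W' \<beta>'"
  and F: "F : klin K B B'" and G: "G : klin K C C'" and f: "f : klin K V V'" and g: "g : klin K W W'"
  and cf: "!!b v. b:.B ==> v:.V ==> f (\<alpha> b v) = \<alpha>' (F b) (f v)"
  and cg: "!!c w. c:.C ==> w:.W ==> g (\<beta> c w) = \<beta>' (G c) (g w)"
  and X: "X:.tensor K B C" and t: "t:.tensor K V W"
 shows "tmap K V' W' f g (act2 K V W \<alpha> \<beta> X t) = act2 K V' W' \<alpha>' \<beta>' (tmap K B' C' F G X) (tmap K V' W' f g t)"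
proof (rule bilin_eqI[OF alg_module[OF B] alg_module[OF C] amodD(1)[OF V] amodD(1)[OF W] _ _ _ X t])
 note m = amodD(1)[OF V] amodD(1)[OF W] amodD(1)[OF V'] amodD(1)[OF W']
 note ma = alg_module[OF B] alg_module[OF C] alg_module[OF B'] alg_module[OF C']
 note tl = tmap_lin[OF m f g] and ta = tmap_lin[OF ma F G]
 show "bilin K (tensor K B C) (tensor K V W) (tensor K V' W') (%X t. tmap K V' W' f g (act2 K V W \<alpha> \<beta> X t))"
  by (rule bilin_klin[OF act2_bilin[OF B C V W] tl])
 show "bilin K (tensor K B C) (tensor K V W) (tensor K V' W') (%X t. act2 K V' W' \<alpha>' \<beta>' (tmap K B' C' F G X) (tmap K V' W' f g t))"
  using tl ta by (intro bilinI bilin_comp1[OF act2_bilin[OF B' C' V' W']] bilin_comp2[OF act2_bilin[OF B' C' V' W']])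
   (auto simp: klin_closed)
 fix b c v w assume a: "b:.B" "c:.C" "v:.V" "w:.W"
 show "tmap K V' W' f g (act2 K V W \<alpha> \<beta> (ptens K B C b c) (ptens K V W v w)) =
   act2 K V' W' \<alpha>' \<beta>' (tmap K B' C' F G (ptens K B C b c)) (tmap K V' W' f g (ptens K V W v w))"
  using a amodD(5)[OF V] amodD(5)[OF W]
  by (simp add: act2_ptens_ptens[OF B C V W] tmap_ptens[OF m f g] tmap_ptens[OF ma F G]
    act2_ptens_ptens[OF B' C' V' W'] cf cg klin_closed[OF f] klin_closed[OF g] klin_closed[OF F] klin_closed[OF G])
qed

lemma act2_rebr:
 assumes B: "k_algebra K B" and C: "k_algebra K C" and D: "k_algebra K D"
  and V: "amod K B V \<alpha>" and W: "amod K C W \<beta>" and X: "amod K D X \<gamma>"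
  and Z: "Z:.tensor K (tensor K B C) D" and t: "t:.tensor K (tensor K V W) X"
 shows "rebr K V W X (act2 K (tensor K V W) X (act2 K V W \<alpha> \<beta>) \<gamma> Z t) =
  act2 K V (tensor K W X) \<alpha> (act2 K W X \<beta> \<gamma>) (rebr K B C D Z) (rebr K V W X t)" (is "?l Z t = ?r Z t")
proof -
 note m = amodD(1)[OF V] amodD(1)[OF W] amodD(1)[OF X]
 note ma = alg_module[OF B] alg_module[OF C] alg_module[OF D]
 note BC = alg_tensor[OF B C] and CD = alg_tensor[OF C D]
 note VW = amod_tensor[OF B C V W] and WX = amod_tensor[OF C D W X]
 have l: "bilin K (tensor K (tensor K B C) D) (tensor K (tensor K V W) X) (tensor K V (tensor K W X)) ?l"
  by (rule bilin_klin[OF act2_bilin[OF BC D VW X] rebr_lin[OF m]])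
 have r: "bilin K (tensor K (tensor K B C) D) (tensor K (tensor K V W) X) (tensor K V (tensor K W X)) ?r"
  using rebr_lin[OF m] rebr_lin[OF ma]
  by (intro bilinI bilin_comp1[OF act2_bilin[OF B CD V WX]] bilin_comp2[OF act2_bilin[OF B CD V WX]]) (auto simp: klin_closed)
 show ?thesis
 proof (rule tensor3_left_eqI[OF ma _ _ _ Z, of _ "tensor K V (tensor K W X)"])
  show "(%Z. ?l Z t) : klin K (tensor K (tensor K B C) D) (tensor K V (tensor K W X))"
   "(%Z. ?r Z t) : klin K (tensor K (tensor K B C) D) (tensor K V (tensor K W X))"
   using l r t unfolding bilin_def by blast+
  fix b c d assume a: "b:.B" "c:.C" "d:.D"
  let ?Z = "ptens K (tensor K B C) D (ptens K B C b c) d"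
  have Z: "?Z:.tensor K (tensor K B C) D" using a ma by simp
  show "?l ?Z t = ?r ?Z t"
  proof (rule tensor3_left_eqI[OF m _ _ _ t, of _ "tensor K V (tensor K W X)"])
   show "(%t. ?l ?Z t) : klin K (tensor K (tensor K V W) X) (tensor K V (tensor K W X))"
    "(%t. ?r ?Z t) : klin K (tensor K (tensor K V W) X) (tensor K V (tensor K W X))"
    using l r Z unfolding bilin_def by blast+
  qed (use a m ma amodD(5)[OF V] amodD(5)[OF W] amodD(5)[OF X] in "simp add: rebr_ptens act2_ptens_ptens[OF BC D VW X]
    act2_ptens_ptens[OF B CD V WX] act2_ptens_ptens[OF B C V W] act2_ptens_ptens[OF C D W X]")
 qed
qed

lemma act2_lebr:
 assumes B: "k_algebra K B" and C: "k_algebra K C" and D: "k_algebra K D"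
  and V: "amod K B V \<alpha>" and W: "amod K C W \<beta>" and X: "amod K D X \<gamma>"
  and Z: "Z:.tensor K (tensor K B C) D" and t: "t:.tensor K V (tensor K W X)"
 shows "act2 K (tensor K V W) X (act2 K V W \<alpha> \<beta>) \<gamma> Z (lebr K V W X t) =
  lebr K V W X (act2 K V (tensor K W X) \<alpha> (act2 K W X \<beta> \<gamma>) (rebr K B C D Z) t)"
proof -
 note m = amodD(1)[OF V] amodD(1)[OF W] amodD(1)[OF X]
 have u: "lebr K V W X t:.tensor K (tensor K V W) X" by (rule klin_closed[OF lebr_lin[OF m] t])
 have "act2 K (tensor K V W) X (act2 K V W \<alpha> \<beta>) \<gamma> Z (lebr K V W X t):.tensor K (tensor K V W) X"
  by (rule bilin_closed[OF act2_bilin[OF alg_tensor[OF B C] D amod_tensor[OF B C V W] X] Z u])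
 from rebr_lebr(2)[OF m this] show ?thesis
  by (simp add: act2_rebr[OF assms(1-7) u] rebr_lebr(1)[OF m t])
qed

lemma act2_flip:
 assumes B: "k_algebra K B" and C: "k_algebra K C" and V: "amod K B V \<alpha>" and W: "amod K C W \<beta>"
  and X: "X:.tensor K B C" and t: "t:.tensor K V W"
 shows "flip K V W (act2 K V W \<alpha> \<beta> X t) = act2 K W V \<beta> \<alpha> (flip K B C X) (flip K V W t)"
proof (rule bilin_eqI[OF alg_module[OF B] alg_module[OF C] amodD(1)[OF V] amodD(1)[OF W] _ _ _ X t])
 note m = amodD(1)[OF V] amodD(1)[OF W]  alg_module[OF B] alg_module[OF C]
 show "bilin K (tensor K B C) (tensor K V W) (tensor K W V) (%X t. flip K V W (act2 K V W \<alpha> \<beta> X t))"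
  by (rule bilin_klin[OF act2_bilin[OF B C V W] flip_lin[OF m(1,2)]])
 show "bilin K (tensor K B C) (tensor K V W) (tensor K W V) (%X t. act2 K W V \<beta> \<alpha> (flip K B C X) (flip K V W t))"
  using flip_lin[OF m(1,2)] flip_lin[OF m(3,4)]
  by (intro bilinI bilin_comp1[OF act2_bilin[OF C B W V]] bilin_comp2[OF act2_bilin[OF C B W V]]) (auto simp: klin_closed)
qed (use amodD[OF V] amodD[OF W] alg_module[OF B] alg_module[OF C] in "simp add: act2_ptens_ptens[OF B C V W]
  act2_ptens_ptens[OF C B W V] flip_ptens")

lemma tsum3_closed:
 assumes "module K A" "module K B" "module K C" "X:.tensor K A (tensor K B C)" "module K P"
  "!!a b c. a:.A ==> b:.B ==> c:.C ==> f a b c:.P"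
 shows "tsum3 P X f:.P"
 unfolding tsum3_def using assms(6)
 by (intro tsum2_closed[OF assms(1) tensor_module[OF assms(2,3)] assms(4,5)] tsum2_closed[OF assms(2,3) _ assms(5)])

lemma tsum3_cong:
 assumes "module K A" "module K B" "module K C" "X:.tensor K A (tensor K B C)" "module K P"
  "!!a b c. a:.A ==> b:.B ==> c:.C ==> f a b c = g a b c"
  "!!a b c. a:.A ==> b:.B ==> c:.C ==> g a b c:.P"
 shows "tsum3 P X f = tsum3 P X g"
 unfolding tsum3_def using assms(6,7)
 by (intro tsum2_cong[OF assms(1) tensor_module[OF assms(2,3)] assms(4,5)] tsum2_cong[OF assms(2,3) _ assms(5)]
   tsum2_closed[OF assms(2,3) _ assms(5)])

definition trilin :: "('k, 'r) ring_scheme => ('k, 'a, 'm) module_scheme => ('k, 'b, 'n) module_scheme =>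
  ('k, 'c, 'o) module_scheme => ('k, 'p, 'q) module_scheme => ('a => 'b => 'c => 'p) => bool" where
 "trilin K A B C P f \<longleftrightarrow> (\<forall>a\<in>carrier A. bilin K B C P (f a)) \<and>
   (\<forall>b\<in>carrier B. \<forall>c\<in>carrier C. (%a. f a b c) : klin K A P)"

lemma trilinI:
 assumes "!!a b. a:.A ==> b:.B ==> (%c. f a b c) : klin K C P"
  "!!a c. a:.A ==> c:.C ==> (%b. f a b c) : klin K B P"
  "!!b c. b:.B ==> c:.C ==> (%a. f a b c) : klin K A P"
 shows "trilin K A B C P f"
 using assms by (auto simp: trilin_def intro: bilinI)

lemma trilin_bilin:
 assumes "module K A" "module K B" "module K C" "module K P" "trilin K A B C P f"
 shows "bilin K A (tensor K B C) P (%a Y. tsum2 P Y (f a))"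
 using assms(5) unfolding trilin_def
 by (intro bilinI lin_tsum2[OF assms(2-4)] lin_tsum2_fun[OF assms(2,3) _ assms(4)]) (auto simp: bilin_def)

lemma tsum3_ptens:
 assumes "module K A" "module K B" "module K C" "module K P" "trilin K A B C P f"
  "a:.A" "b:.B" "c:.C"
 shows "tsum3 P (ptens K A (tensor K B C) a (ptens K B C b c)) f = f a b c"
 using assms unfolding tsum3_def
 by (simp add: tsum2_ptens[OF _ _ _ trilin_bilin[OF assms(1-5)]] tsum2_ptens trilin_def)

lemma lin_tsum3:
 assumes "module K A" "module K B" "module K C" "module K P" "trilin K A B C P f"
 shows "(%X. tsum3 P X f) : klin K (tensor K A (tensor K B C)) P"
 unfolding tsum3_def using assms by (intro lin_tsum2 trilin_bilin) simp_all

lemma lin_tsum3_fun: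
 assumes "module K A" "module K B" "module K C" "X:.tensor K A (tensor K B C)" "module K P"
  "!!a b c. a:.A ==> b:.B ==> c:.C ==> (%x. f x a b c) : klin K U P"
 shows "(%x. tsum3 P X (f x)) : klin K U P"
 unfolding tsum3_def using assms(6)
 by (intro lin_tsum2_fun[OF assms(1) tensor_module[OF assms(2,3)] assms(4,5)] lin_tsum2_fun[OF assms(2,3) _ assms(5)])

lemma lin2_expand:
 assumes "module K A" "module K B" "module K P" "L : klin K (tensor K A B) P" "X:.tensor K A B"
 shows "L X = tsum2 P X (%a b. L (ptens K A B a b))"
 using tsum2_hom[OF assms(1,2,5) _ assms(3,4), of "ptens K A B"] tsum2_ptens_id[OF assms(1,2,5)] assms by simp

lemma lin3_expand:
 assumes "module K A" "module K B" "module K C" "module K P" "L : klin K (tensor K A (tensor K B C)) P"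
  "X:.tensor K A (tensor K B C)"
 shows "L X = tsum3 P X (%a b c. L (ptens K A (tensor K B C) a (ptens K B C b c)))"
proof -
 note BC = tensor_module[OF assms(2,3)]
 have "L X = tsum2 P X (%a Y. L (ptens K A (tensor K B C) a Y))"
  by (rule lin2_expand[OF assms(1) BC assms(4-6)])
 also have "... = tsum2 P X (%a Y. tsum2 P Y (%b c. L (ptens K A (tensor K B C) a (ptens K B C b c))))"
 proof (rule tsum2_cong[OF assms(1) BC assms(6,4)])
  fix a Y assume a: "a:.A" "Y:.tensor K B C"
  have l: "(%Y. L (ptens K A (tensor K B C) a Y)) : klin K (tensor K B C) P"
   by (rule klin_comp[OF lin_ptens2[OF assms(1) BC klin_id(2) a(1)] assms(5)])
  show "L (ptens K A (tensor K B C) a Y) = tsum2 P Y (%b c. L (ptens K A (tensor K B C) a (ptens K B C b c)))"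
   by (rule lin2_expand[OF assms(2,3,4) l a(2)])
  then show "tsum2 P Y (%b c. L (ptens K A (tensor K B C) a (ptens K B C b c))):.P"
   using klin_closed[OF l a(2)] by simp
 qed
 finally show ?thesis by (simp add: tsum3_def)
qed

section \<open>Quasitriangular quasi-Hopf algebras in leg-free form\<close>

lemma ahom_inv:
 assumes "k_algebra K B" "f \<in> ahom K B C" "x \<in> Units B" "f x = \<one>[C]" "k_algebra K C"
 shows "f (inv\<^bsub>B\<^esub> x) = \<one>[C]"
proof -
 interpret B: ring B using assms(1) by (rule alg_ring)
 interpret C: ring C using assms(5) by (rule alg_ring)
 have i: "inv\<^bsub>B\<^esub> x:.B" "x:.B" using assms(3) by auto
 have "f (inv\<^bsub>B\<^esub> x) = f (x *[B] inv\<^bsub>B\<^esub> x)"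
  using i klin_closed[OF ahom_lin[OF assms(2)]] by (simp only: ahom_mult[OF assms(2) i(2,1)] assms(4)) simp
 then show ?thesis using assms(3) ahom_one[OF assms(2)] by simp
qed

lemma ahom_inv':
 assumes "k_algebra K B" "f \<in> ahom K B C" "x \<in> Units B" "k_algebra K C"
 shows "f x \<in> Units C" "inv\<^bsub>C\<^esub> (f x) = f (inv\<^bsub>B\<^esub> x)"
proof -
 interpret B: ring B using assms(1) by (rule alg_ring)
 interpret C: ring C using assms(4) by (rule alg_ring)
 have i: "inv\<^bsub>B\<^esub> x:.B" "x:.B" using assms(3) by auto
 have c: "f x:.C" "f (inv\<^bsub>B\<^esub> x):.C" using i klin_closed[OF ahom_lin[OF assms(2)]] by auto
 have e: "f x *[C] f (inv\<^bsub>B\<^esub> x) = \<one>[C]" "f (inv\<^bsub>B\<^esub> x) *[C] f x = \<one>[C]"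
  using i assms(3) by (simp_all add: ahom_mult[OF assms(2), symmetric] ahom_one[OF assms(2)])
 show u: "f x \<in> Units C" using c e unfolding Units_def by auto
 show "inv\<^bsub>C\<^esub> (f x) = f (inv\<^bsub>B\<^esub> x)" by (rule C.inv_unique[of _ "f x"]) (use c e u in auto)
qed

locale qtqh =
 fixes K :: "'k ring" and H :: "('k, 'h) quasi_hopf_data"
 assumes cringK: "cring K" and qtqh: "quasitriangular_quasi_hopf_algebra K H"
begin

abbreviation "P2 \<equiv> tensor K H H"
abbreviation "P3 \<equiv> tensor K H (tensor K H H)"
abbreviation "P4 \<equiv> tensor K H (tensor K H (tensor K H H))"
abbreviation "\<phi> \<equiv> phi H"
abbreviation "\<psi> \<equiv> phi_inv K H"
abbreviation "\<Delta> \<equiv> comult H"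
abbreviation "R \<equiv> rmatrix H"
abbreviation (input) "p2 == ptens K H H"
abbreviation (input) "q3 == ptens K H P2"
abbreviation (input) "q4 == ptens K H P3"
abbreviation (input) "p3 a b c == q3 a (p2 b c)"
abbreviation (input) mult1 (infixl \<open>*.\<close> 70) where "a *. b == a *[H] b"
abbreviation (input) mult2 (infixl \<open>*2\<close> 70) where "a *2 b == a *[P2] b"
abbreviation (input) mult3 (infixl \<open>*3\<close> 70) where "a *3 b == a *[P3] b"
abbreviation (input) mult4 (infixl \<open>*4\<close> 70) where "a *4 b == a *[P4] b"
abbreviation (input) unit1 (\<open>1H\<close>) where "1H == \<one>[H]"
abbreviation (input) tns (infixr \<open>**\<close> 72) where "V ** W == tensor K V W"
abbreviation (input) "pt == ptens K"
abbreviation (input) "mor == hmor K H"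
abbreviation (input) "br == braid K H"
abbreviation (input) "hev == heval K H"
abbreviation (input) "bbr A == bbraid K H A"
abbreviation (input) "bmp A == bmap K H A"
abbreviation (input) "bas A == bassoc K H A"
abbreviation (input) "QM == quotient_hmod"

lemma qh: "quasi_hopf_algebra K H" and qb: "quasi_bialgebra K H"
 using qtqh by (simp_all add: quasitriangular_quasi_hopf_algebra_def quasi_hopf_algebra_def)

lemma aH [simp]: "k_algebra K H"
 using qb by (simp add: quasi_bialgebra_def)

lemma aP [simp]: "k_algebra K P2" "k_algebra K P3" "k_algebra K P4"
 by (simp_all add: alg_tensor)

lemma aHP [simp]: "k_algebra K (tensor K P2 H)" "k_algebra K (tensor K P2 P2)" "k_algebra K (tensor K P3 H)"
 "k_algebra K (tensor K H (tensor K P2 H))"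
 by (simp_all add: alg_tensor)

lemma mH [simp]: "module K H"
 by (simp add: alg_module)

lemma H_closed [simp]: "a:.H ==> b:.H ==> a *. b:.H" "1H:.H"
 by (simp_all add: alg_closed[OF aH])

lemma H_mult: "a:.H ==> 1H *. a = a" "a:.H ==> a *. 1H = a"
 "a:.H ==> b:.H ==> c:.H ==> a *. b *. c = a *. (b *. c)"
 by (simp_all add: alg_mult[OF aH])

lemma phi_unit: "\<phi> \<in> Units P3"
 using qb by (simp add: quasi_bialgebra_def)

lemma phi_closed [simp]: "\<phi>:.P3" "\<psi>:.P3"
 and phi_phi_inv: "\<phi> *3 \<psi> = \<one>[P3]" "\<psi> *3 \<phi> = \<one>[P3]"
proof -
 interpret ring P3 by (rule alg_ring[OF aP(2)])
 show "\<phi>:.P3" "\<psi>:.P3" "\<phi> *3 \<psi> = \<one>[P3]" "\<psi> *3 \<phi> = \<one>[P3]"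
  using phi_unit by (auto simp: phi_inv_def)
qed

lemma R_unit: "R \<in> Units P2"
 using qtqh by (simp add: quasitriangular_quasi_hopf_algebra_def)

abbreviation "Ri \<equiv> inv\<^bsub>P2\<^esub> R"

lemma R_closed [simp]: "R:.P2" "Ri:.P2"
 and R_R_inv: "R *2 Ri = \<one>[P2]" "Ri *2 R = \<one>[P2]"
proof -
 interpret ring P2 by (rule alg_ring[OF aP(1)])
 show "R:.P2" "Ri:.P2" "R *2 Ri = \<one>[P2]" "Ri *2 R = \<one>[P2]"
  using R_unit by auto
qed

lemma D_ahom: "\<Delta> \<in> ahom K H P2"
 using qb by (simp add: quasi_bialgebra_def ahom_def)

lemma D_lin [simp]: "\<Delta> : klin K H P2"
 by (rule ahom_lin[OF D_ahom])

lemma D_closed [simp]: "h:.H ==> \<Delta> h:.P2"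
 by (rule klin_closed[OF D_lin])

abbreviation "\<epsilon> \<equiv> counit H"

lemma eps_lin: "\<epsilon> : klin K H (base_module K)"
 using qb by (simp add: quasi_bialgebra_def)

lemma eps_closed [simp]: "h:.H ==> \<epsilon> h:.K"
 using klin_closed[OF eps_lin] by (simp add: base_module_def)

lemma eps_mult: "g:.H ==> h:.H ==> \<epsilon> (g *. h) = \<epsilon> g *[K] \<epsilon> h"
 and eps_one: "\<epsilon> 1H = \<one>[K]"
 using qb by (auto simp: quasi_bialgebra_def ring_hom_def)

definition epsl :: "('k, 'b, 'm) module_scheme => ('h, 'b) tens => 'b" where
 "epsl B X = tsum2 B X (%a b. \<epsilon> a \<odot>[B] b)"

definition epsr :: "('k, 'b, 'm) module_scheme => ('b, 'h) tens => 'b" where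
 "epsr B X = tsum2 B X (%b a. \<epsilon> a \<odot>[B] b)"

lemma eps_bilin:
 assumes "module K B"
 shows "bilin K H B B (%a b. \<epsilon> a \<odot>[B] b)" "bilin K B H B (%b a. \<epsilon> a \<odot>[B] b)"
 using bilin_comp1[OF module_smult_bilin[OF assms] eps_lin] module_smult_bilin[OF assms] eps_closed
 by (auto intro!: bilinI simp: bilin_def base_module_def)

lemma epsl_lin: "module K B ==> epsl B : klin K (tensor K H B) B"
 unfolding epsl_def[abs_def] by (intro lin_tsum2 eps_bilin) simp_all

lemma epsr_lin: "module K B ==> epsr B : klin K (tensor K B H) B"
 unfolding epsr_def[abs_def] by (intro lin_tsum2 eps_bilin) simp_all

lemma epsl_ptens: "module K B ==> a:.H ==> b:.B ==> epsl B (ptens K H B a b) = \<epsilon> a \<odot>[B] b"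
 by (simp add: epsl_def tsum2_ptens[OF _ _ _ eps_bilin(1)])

lemma epsr_ptens: "module K B ==> a:.H ==> b:.B ==> epsr B (ptens K B H b a) = \<epsilon> a \<odot>[B] b"
 by (simp add: epsr_def tsum2_ptens[OF _ _ _ eps_bilin(2)])

lemma alg_smult:
 assumes "k_algebra K B" "c:.K" "d:.K" "x:.B" "y:.B"
 shows "(c \<odot>[B] x) *[B] (d \<odot>[B] y) = (c *[K] d) \<odot>[B] (x *[B] y)"
proof -
 have "(c \<odot>[B] x) *[B] (d \<odot>[B] y) = c \<odot>[B] (x *[B] (d \<odot>[B] y))"
  "x *[B] (d \<odot>[B] y) = d \<odot>[B] (x *[B] y)"
  using assms module.smult_closed[OF alg_module[OF assms(1)]] unfolding k_algebra_def by blast+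
 then show ?thesis
  using assms alg_closed(1)[OF assms(1)] by (simp add: module.smult_assoc1[OF alg_module[OF assms(1)]])
qed

lemma epsl_ahom: "k_algebra K B ==> epsl B \<in> ahom K (tensor K H B) B"
 by (rule ahom_tensorI)
  (simp_all add: epsl_lin epsl_ptens alg_module alg_closed alg_smult eps_mult eps_one module.smult_one[OF alg_module])

lemma epsr_ahom: "k_algebra K B ==> epsr B \<in> ahom K (tensor K B H) B"
 by (rule ahom_tensorI)
  (simp_all add: epsr_lin epsr_ptens alg_module alg_closed alg_smult eps_mult eps_one module.smult_one[OF alg_module])

lemma eps_D: "h:.H ==> epsl H (\<Delta> h) = h" "h:.H ==> epsr H (\<Delta> h) = h"
 using qb by (simp_all add: quasi_bialgebra_def epsl_def epsr_def)

lemma smult_closedH [simp]: "c:.K ==> a:.H ==> c \<odot>[H] a:.H"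
 by (rule module.smult_closed[OF mH])

lemma one_smult [simp]: "module K B ==> x:.B ==> \<one>[K] \<odot>[B] x = x"
 by (rule module.smult_one)

lemma ptens_smult:
 assumes "module K V" "module K W" "c:.K" "v:.V" "w:.W"
 shows "ptens K V W (c \<odot>[V] v) w = c \<odot>[tensor K V W] ptens K V W v w"
  "ptens K V W v (c \<odot>[W] w) = c \<odot>[tensor K V W] ptens K V W v w"
 using klin_smult[OF lin_ptens1[OF assms(1,2) klin_id(2) assms(5)] assms(3,4)]
  klin_smult[OF lin_ptens2[OF assms(1,2) klin_id(2) assms(4)] assms(3,5)] by simp_all

subsection \<open>Reassociator axioms\<close>

text \<open>The coproduct applied to the first, the second, or the third leg of an element of \<open>H\<close>-cubed, and
 the two ways to add a trivial outer leg.\<close>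

definition "Dl s = rebr K H H H (tmap K P2 H \<Delta> id s)"
definition "Dr s = tmap K H P2 id \<Delta> s"
definition "D1 X = rebr K H H P2 (tmap K P2 P2 \<Delta> id X)"
definition "D2 X = tmap K H P3 id Dl X"
definition "D3 X = tmap K H P3 id Dr X"
definition "I1 X = q4 1H X"
definition "I4 X = tmap K H P3 id (rebr K H H H) (rebr K H P2 H (ptens K P3 H X 1H))"

lemma ahom_ptens1: "k_algebra K B ==> k_algebra K C ==> (%X. ptens K B C \<one>[B] X) \<in> ahom K C (tensor K B C)"
 by (rule ahomI) (simp_all add: lin_ptens2 alg_module alg_closed klin_id tensor_mult_ptens tensor_one alg_mult)

lemma ahom_ptens2: "k_algebra K B ==> k_algebra K C ==> (%X. ptens K B C X \<one>[C]) \<in> ahom K B (tensor K B C)"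
 by (rule ahomI) (simp_all add: lin_ptens1 alg_module alg_closed klin_id tensor_mult_ptens tensor_one alg_mult)

lemma Dl_ahom: "Dl \<in> ahom K P2 P3" and Dr_ahom: "Dr \<in> ahom K P2 P3"
 unfolding Dl_def[abs_def] Dr_def[abs_def]
 by (intro ahom_comp[OF ahom_tmap ahom_rebr] ahom_tmap ahom_id D_ahom aH aP)+

lemma D1_ahom: "D1 \<in> ahom K P3 P4" and D2_ahom: "D2 \<in> ahom K P3 P4" and D3_ahom: "D3 \<in> ahom K P3 P4"
 unfolding D1_def[abs_def] D2_def[abs_def] D3_def[abs_def]
 by (intro ahom_comp[OF ahom_tmap ahom_rebr] ahom_tmap ahom_id D_ahom Dl_ahom Dr_ahom aH aP)+

lemma I1_ahom: "I1 \<in> ahom K P3 P4"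
 unfolding I1_def[abs_def] by (rule ahom_ptens1[OF aH aP(2)])

lemma I4_ahom: "I4 \<in> ahom K P3 P4"
 unfolding I4_def[abs_def]
 by (rule ahom_comp[OF ahom_comp[OF ahom_ptens2[OF aP(2) aH] ahom_rebr[OF aH aP(1) aH]]
  ahom_tmap[OF aH aHP(1) aH aP(2) ahom_id(1) ahom_rebr[OF aH aH aH]]])

lemmas D_lins = Dl_ahom[THEN ahom_lin] Dr_ahom[THEN ahom_lin] D1_ahom[THEN ahom_lin] D2_ahom[THEN ahom_lin]
 D3_ahom[THEN ahom_lin] I1_ahom[THEN ahom_lin] I4_ahom[THEN ahom_lin]
lemmas D_closeds [simp] = D_lins[THEN klin_closed]

lemma D_ptens:
 assumes "a:.H" "b:.H"
 shows "Dl (p2 a b) = rebr K H H H (ptens K P2 H (\<Delta> a) b)"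
  "Dr (p2 a b) = q3 a (\<Delta> b)"
  "Y:.P2 ==> D1 (q3 a Y) = rebr K H H P2 (ptens K P2 P2 (\<Delta> a) Y)"
  "Y:.P2 ==> D2 (q3 a Y) = q4 a (Dl Y)"
  "Y:.P2 ==> D3 (q3 a Y) = q4 a (Dr Y)"
proof -
 show "Dl (p2 a b) = rebr K H H H (ptens K P2 H (\<Delta> a) b)"
  "Dr (p2 a b) = q3 a (\<Delta> b)"
  using assms by (simp_all add: Dl_def Dr_def tmap_ptens klin_id)
 show "Y:.P2 ==> D1 (q3 a Y) = rebr K H H P2 (ptens K P2 P2 (\<Delta> a) Y)"
  "Y:.P2 ==> D2 (q3 a Y) = q4 a (Dl Y)"
  "Y:.P2 ==> D3 (q3 a Y) = q4 a (Dr Y)"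
  using assms by (simp_all add: D1_def D2_def D3_def tmap_ptens klin_id D_lins)
qed

lemma I4_ptens: "a:.H ==> b:.H ==> c:.H ==>
  I4 (p3 a b c) = q4 a (q3 b (p2 c 1H))"
 by (simp add: I4_def rebr_ptens tmap_ptens klin_id rebr_lin)

lemma Dl_expand:
 assumes X: "X:.P2"
 shows "Dl X = tsum2 P3 X (%a b. tsum2 P3 (\<Delta> a) (%a1 a2. pt3 K H a1 a2 b))"
proof -
 have "Dl X = tsum2 P3 X (%a b. Dl (p2 a b))"
  by (rule lin2_expand[OF mH mH _ D_lins(1)]) (use X in auto)
 also have "... = tsum2 P3 X (%a b. tsum2 P3 (\<Delta> a) (%a1 a2. pt3 K H a1 a2 b))"
  unfolding D_ptens(1)
 proof (rule tsum2_cong[OF mH mH X])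
  fix a b assume ab: "a:.H" "b:.H"
  have "rebr K H H H (ptens K P2 H (\<Delta> a) b) =
   tsum2 P3 (\<Delta> a) (%a1 a2. rebr K H H H (ptens K P2 H (p2 a1 a2) b))"
   by (rule lin2_expand[OF mH mH _ klin_comp[OF lin_ptens1[OF _ mH klin_id(2) ab(2)] rebr_lin]]) (use ab in auto)
  also have "... = tsum2 P3 (\<Delta> a) (%a1 a2. pt3 K H a1 a2 b)"
   by (rule tsum2_cong[OF mH mH]) (use ab in "auto simp: rebr_ptens pt3_def")
  finally show "Dl (p2 a b) = tsum2 P3 (\<Delta> a) (%a1 a2. pt3 K H a1 a2 b)"
   using ab by (simp add: D_ptens)
  show "tsum2 P3 (\<Delta> a) (%a1 a2. pt3 K H a1 a2 b):.P3"
   by (rule tsum2_closed[OF mH mH]) (use ab in "auto simp: pt3_def")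
 qed simp
 finally show ?thesis .
qed

lemma coassoc:
 assumes h: "h:.H"
 shows "Dr (\<Delta> h) *3 \<phi> = \<phi> *3 Dl (\<Delta> h)"
proof -
 have 1: "Dr (\<Delta> h) = tsum2 P3 (\<Delta> h) (%a b. q3 a (\<Delta> b))"
  by (simp add: Dr_def tmap_eq)
 show ?thesis unfolding 1 Dl_expand[OF D_closed[OF h]] using qb h by (simp add: quasi_bialgebra_def)
qed

lemma pentagon_phi: "D3 \<phi> *4 D1 \<phi> = I1 \<phi> *4 D2 \<phi> *4 I4 \<phi>"
proof -
 have pc: "pt4 K H a b c d:.P4" if "a:.H" "b:.H" "c:.H" "d:.H" for a b c d
  using that by (simp add: pt4_def pt3_def)
 have 3: "D3 \<phi> = tsum3 P4 \<phi> (%a b c. tsum2 P4 (\<Delta> c) (%c1 c2. pt4 K H a b c1 c2))"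
  unfolding lin3_expand[OF mH mH mH _ D_lins(5) phi_closed(1), simplified]
 proof (rule tsum3_cong[OF mH mH mH phi_closed(1)])
  fix a b c assume abc: "a:.H" "b:.H" "c:.H"
  have "q4 a (q3 b (\<Delta> c)) = tsum2 P4 (\<Delta> c) (%c1 c2. q4 a (p3 b c1 c2))"
   by (rule lin2_expand[OF mH mH _ lin_ptens2[OF _ _ lin_ptens2[OF _ _ klin_id(2)]]]) (use abc in auto)
  then show "D3 (p3 a b c) = tsum2 P4 (\<Delta> c) (%c1 c2. pt4 K H a b c1 c2)"
   using abc by (simp add: D_ptens pt4_def pt3_def)
  show "tsum2 P4 (\<Delta> c) (%c1 c2. pt4 K H a b c1 c2):.P4"
   by (rule tsum2_closed[OF mH mH]) (use abc pc in auto)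
 qed simp
 have 2: "D2 \<phi> = tsum3 P4 \<phi> (%a b c. tsum2 P4 (\<Delta> b) (%b1 b2. pt4 K H a b1 b2 c))"
  unfolding lin3_expand[OF mH mH mH _ D_lins(4) phi_closed(1), simplified]
 proof (rule tsum3_cong[OF mH mH mH phi_closed(1)])
  fix a b c assume abc: "a:.H" "b:.H" "c:.H"
  have "q4 a (rebr K H H H (ptens K P2 H (\<Delta> b) c)) =
    tsum2 P4 (\<Delta> b) (%c1 c2. q4 a (rebr K H H H (ptens K P2 H (p2 c1 c2) c)))"
   by (rule lin2_expand[OF mH mH _ lin_ptens2[OF _ _ klin_comp[OF lin_ptens1[OF _ mH klin_id(2)] rebr_lin]]]) (use abc in auto)
  also have "... = tsum2 P4 (\<Delta> b) (%b1 b2. pt4 K H a b1 b2 c)"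
   by (rule tsum2_cong[OF mH mH]) (use abc pc in "auto simp: rebr_ptens pt4_def pt3_def")
  finally show "D2 (p3 a b c) = tsum2 P4 (\<Delta> b) (%b1 b2. pt4 K H a b1 b2 c)"
   using abc by (simp add: D_ptens)
  show "tsum2 P4 (\<Delta> b) (%b1 b2. pt4 K H a b1 b2 c):.P4"
   by (rule tsum2_closed[OF mH mH]) (use abc pc in auto)
 qed simp
 have 1: "D1 \<phi> = tsum3 P4 \<phi> (%a b c. tsum2 P4 (\<Delta> a) (%a1 a2. pt4 K H a1 a2 b c))"
  unfolding lin3_expand[OF mH mH mH _ D_lins(3) phi_closed(1), simplified]
 proof (rule tsum3_cong[OF mH mH mH phi_closed(1)])
  fix a b c assume abc: "a:.H" "b:.H" "c:.H"
  have "rebr K H H P2 (ptens K P2 P2 (\<Delta> a) (p2 b c)) =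
    tsum2 P4 (\<Delta> a) (%c1 c2. rebr K H H P2 (ptens K P2 P2 (p2 c1 c2) (p2 b c)))"
   by (rule lin2_expand[OF mH mH _ klin_comp[OF lin_ptens1[OF _ _ klin_id(2)] rebr_lin]]) (use abc in auto)
  also have "... = tsum2 P4 (\<Delta> a) (%a1 a2. pt4 K H a1 a2 b c)"
   by (rule tsum2_cong[OF mH mH]) (use abc pc in "auto simp: rebr_ptens pt4_def pt3_def")
  finally show "D1 (p3 a b c) = tsum2 P4 (\<Delta> a) (%a1 a2. pt4 K H a1 a2 b c)"
   using abc by (simp add: D_ptens)
  show "tsum2 P4 (\<Delta> a) (%a1 a2. pt4 K H a1 a2 b c):.P4"
   by (rule tsum2_closed[OF mH mH]) (use abc pc in auto)
 qed simp
 have 4: "I4 \<phi> = tsum3 P4 \<phi> (%a b c. pt4 K H a b c 1H)"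
  unfolding lin3_expand[OF mH mH mH _ D_lins(7) phi_closed(1), simplified]
  by (rule tsum3_cong[OF mH mH mH phi_closed(1)]) (auto simp: I4_ptens pt4_def pt3_def)
 show ?thesis unfolding 1 2 3 4 I1_def using qb by (simp add: quasi_bialgebra_def)
qed

definition "N1 = epsl P2"
definition "N2 = tmap K H H id (epsl H)"
definition "N3 = tmap K H H id (epsr H)"

lemma N_ahom: "N1 \<in> ahom K P3 P2" "N2 \<in> ahom K P3 P2" "N3 \<in> ahom K P3 P2"
 unfolding N1_def N2_def N3_def by (intro epsl_ahom ahom_tmap ahom_id epsr_ahom aH aP)+

lemmas N_closed [simp] = N_ahom[THEN ahom_lin, THEN klin_closed]

lemma N_ptens:
 assumes "a:.H" "b:.H" "c:.H"
 shows "N1 (p3 a b c) = \<epsilon> a \<odot>[P2] p2 b c"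
  "N2 (p3 a b c) = p2 a (\<epsilon> b \<odot>[H] c)"
  "N3 (p3 a b c) = p2 a (\<epsilon> c \<odot>[H] b)"
 using assms by (simp_all add: N1_def N2_def N3_def epsl_ptens epsr_ptens tmap_ptens klin_id epsl_lin epsr_lin)

lemma N2_phi: "N2 \<phi> = \<one>[P2]"
proof -
 have "N2 \<phi> = tsum3 P2 \<phi> (%a b c. p2 a (\<epsilon> b \<odot>[H] c))"
  unfolding lin3_expand[OF mH mH mH _ ahom_lin[OF N_ahom(2)] phi_closed(1), simplified]
  by (rule tsum3_cong[OF mH mH mH phi_closed(1)]) (auto simp: N_ptens)
 also have "... = \<one>[P2]" using qb by (simp add: quasi_bialgebra_def tensor_one)
 finally show ?thesis .
qed

text \<open>Only the middle counit contraction of \<open>\<phi>\<close> is an axiom. Contracting the second or third leg of the pentagon with the counit leaves a factor \<open>1 \<otimes> N1 \<phi>\<close> or \<open>N3 \<phi> \<otimes> 1\<close> beside invertible elements, which forces it to be trivial.\<close>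

lemma N_phi: "N1 \<phi> = \<one>[P2]" "N3 \<phi> = \<one>[P2]"
proof -
 interpret P3: ring P3 by (rule alg_ring[OF aP(2)])
 interpret P2: ring P2 by (rule alg_ring[OF aP(1)])
 define G2 where "G2 = tmap K H P2 id (epsl P2)"
 define G3 where "G3 = tmap K H P2 id (tmap K H H id (epsl H))"
 have G2: "G2 \<in> ahom K P4 P3" and G3: "G3 \<in> ahom K P4 P3"
  unfolding G2_def G3_def by (intro epsl_ahom ahom_tmap ahom_id aH aP)+
 note g2 = ahom_lin[OF G2] and g3 = ahom_lin[OF G3]
 have p2: "G2 (q4 a (q3 b Y)) = q3 a (\<epsilon> b \<odot>[P2] Y)"
  if "a:.H" "b:.H" "Y:.P2" for a b Y
  using that by (simp add: G2_def tmap_ptens klin_id epsl_lin epsl_ptens)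
 have p3: "G3 (q4 a (q3 b Y)) = p3 a b (epsl H Y)"
  if "a:.H" "b:.H" "Y:.P2" for a b Y
  using that by (simp add: G3_def tmap_ptens klin_id epsl_lin tmap_lin)
 have rebr_l: "(%s. rebr K H H X (ptens K P2 X s y)) : klin K P2 (tensor K H (tensor K H X))"
  if "y:.X" "module K X" for y and X :: "('k, 'z, 'zz) module_scheme"
  by (rule klin_comp[OF lin_ptens1[OF _ that(2) klin_id(2) that(1)] rebr_lin]) (use that in auto)
 have sc: "x:.P2 ==> c:.K ==> c \<odot>[P2] x:.P2" for c x
  by (rule module.smult_closed[of K]) simp_all
 \<comment> \<open>contract the second leg of the pentagon identity\<close>
 have a1: "G2 (D3 \<phi>) = Dr (N2 \<phi>)"
  by (rule tensor3_eqI[OF mH mH mH klin_comp[OF D_lins(5) g2] klin_comp[OF ahom_lin[OF N_ahom(2)] D_lins(2)] _ phi_closed(1)])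
   (simp add: D_ptens p2 N_ptens klin_smult[OF D_lin])
 have a2': "G2 (rebr K H H P2 (ptens K P2 P2 s Y)) = q3 (epsr H s) Y" if s: "s:.P2" and Y: "Y:.P2" for s Y
  by (rule tensor_eqI[OF mH mH klin_comp[OF rebr_l g2] lin_ptens1[OF _ _ epsr_lin] _ s])
   (use Y in "simp_all add: rebr_ptens p2 epsr_ptens ptens_smult")
 have a2: "G2 (D1 \<phi>) = \<phi>"
  by (rule tensor3_eqI[OF mH mH mH klin_comp[OF D_lins(3) g2] klin_id(2) _ phi_closed(1)])
   (simp add: D_ptens a2' eps_D)
 have a3: "G2 (I1 \<phi>) = q3 1H (N1 \<phi>)"
  by (rule tensor3_eqI[OF mH mH mH klin_comp[OF D_lins(6) g2] lin_ptens2[OF _ _ ahom_lin[OF N_ahom(1)]] _ phi_closed(1)])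
   (simp_all add: I1_def p2 N_ptens)
 have a4': "epsl P2 (rebr K H H H (ptens K P2 H s c)) = p2 (epsl H s) c" if s: "s:.P2" and c: "c:.H" for s c
  by (rule tensor_eqI[OF mH mH klin_comp[OF rebr_l[OF c mH] epsl_lin] lin_ptens1[OF _ _ epsl_lin] _ s])
   (use c in "simp_all add: rebr_ptens epsl_ptens ptens_smult")
 have a4: "G2 (D2 \<phi>) = \<phi>"
  by (rule tensor3_eqI[OF mH mH mH klin_comp[OF D_lins(4) g2] klin_id(2) _ phi_closed(1)])
   (simp add: D_ptens G2_def tmap_ptens klin_id epsl_lin a4' eps_D klin_closed[OF rebr_l[OF _ mH]])
 have a5: "G2 (I4 \<phi>) = tmap K H P2 id (%b. p2 b 1H) (N2 \<phi>)"
  by (rule tensor3_eqI[OF mH mH mH klin_comp[OF D_lins(7) g2]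
     klin_comp[OF ahom_lin[OF N_ahom(2)] tmap_lin[OF mH mH mH _ klin_id(1) lin_ptens1[OF mH mH klin_id(2)]]] _ phi_closed(1)])
   (simp_all add: I4_ptens p2 N_ptens tmap_ptens klin_id lin_ptens1 ptens_smult
    klin_smult[OF tmap_lin[OF mH mH mH _ klin_id(1) lin_ptens1[OF mH mH klin_id(2)]]])
 have j: "tmap K H P2 id (%b. p2 b 1H) \<one>[P2] = \<one>[P3]"
  by (rule ahom_one[OF ahom_tmap[OF aH aH aH aP(1) ahom_id(1) ahom_ptens2[OF aH aH]]])
 have "Dr \<one>[P2] *3 \<phi> = q3 1H (N1 \<phi>) *3 \<phi> *3 \<one>[P3]"
  using arg_cong[OF pentagon_phi, of G2] N2_phi j
  by (simp add: ahom_mult[OF G2] alg_closed[OF aP(3)] a1 a2 a3 a4 a5)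
 then have "\<phi> = q3 1H (N1 \<phi>) *3 \<phi>"
  by (simp add: ahom_one[OF Dr_ahom])
 then have "\<phi> *3 \<psi> = q3 1H (N1 \<phi>) *3 \<phi> *3 \<psi>" by simp
 then have "q3 1H (N1 \<phi>) = \<one>[P3]" by (simp add: P3.m_assoc phi_phi_inv)
 then have "epsl P2 (q3 1H (N1 \<phi>)) = \<one>[P2]" by (simp add: ahom_one[OF epsl_ahom])
 then show "N1 \<phi> = \<one>[P2]" by (simp add: epsl_ptens eps_one)
 \<comment> \<open>contract the third leg of the pentagon identity\<close>
 have b1: "G3 (D3 \<phi>) = \<phi>"
  by (rule tensor3_eqI[OF mH mH mH klin_comp[OF D_lins(5) g3] klin_id(2) _ phi_closed(1)])
   (simp add: D_ptens p3 eps_D)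
 have b2': "G3 (rebr K H H P2 (ptens K P2 P2 s Y)) = rebr K H H H (ptens K P2 H s (epsl H Y))" if s: "s:.P2" and Y: "Y:.P2" for s Y
  by (rule tensor_eqI[OF mH mH klin_comp[OF rebr_l g3] rebr_l _ s])
   (use Y in "simp_all add: rebr_ptens p3 klin_closed[OF epsl_lin]")
 have b2: "G3 (D1 \<phi>) = Dl (N2 \<phi>)"
  by (rule tensor3_eqI[OF mH mH mH klin_comp[OF D_lins(3) g3] klin_comp[OF ahom_lin[OF N_ahom(2)] D_lins(1)] _ phi_closed(1)])
   (simp add: D_ptens b2' epsl_ptens N_ptens)
 have b3: "G3 (I1 \<phi>) = q3 1H (N2 \<phi>)"
  by (rule tensor3_eqI[OF mH mH mH klin_comp[OF D_lins(6) g3] lin_ptens2[OF _ _ ahom_lin[OF N_ahom(2)]] _ phi_closed(1)])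
   (simp_all add: I1_def p3 N_ptens epsl_ptens)
 have b4': "tmap K H H id (epsl H) (rebr K H H H (ptens K P2 H s c)) = p2 (epsr H s) c" if s: "s:.P2" and c: "c:.H" for s c
  by (rule tensor_eqI[OF mH mH klin_comp[OF rebr_l[OF c mH] tmap_lin[OF _ _ _ _ klin_id(1) epsl_lin]] lin_ptens1[OF _ _ epsr_lin] _ s])
   (use c in "simp_all add: rebr_ptens epsl_ptens epsr_ptens ptens_smult tmap_ptens klin_id epsl_lin")
 have b4: "G3 (D2 \<phi>) = \<phi>"
  by (rule tensor3_eqI[OF mH mH mH klin_comp[OF D_lins(4) g3] klin_id(2) _ phi_closed(1)])
   (simp add: D_ptens G3_def tmap_ptens klin_id epsl_lin tmap_lin b4' eps_D klin_closed[OF rebr_l[OF _ mH]])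
 have b5: "G3 (I4 \<phi>) = tmap K H P2 id (%b. p2 b 1H) (N3 \<phi>)"
  by (rule tensor3_eqI[OF mH mH mH klin_comp[OF D_lins(7) g3]
     klin_comp[OF ahom_lin[OF N_ahom(3)] tmap_lin[OF mH mH mH _ klin_id(1) lin_ptens1[OF mH mH klin_id(2)]]] _ phi_closed(1)])
   (simp_all add: I4_ptens p3 N_ptens tmap_ptens klin_id lin_ptens1 ptens_smult epsl_ptens
    klin_smult[OF tmap_lin[OF mH mH mH _ klin_id(1) lin_ptens1[OF mH mH klin_id(2)]]])
 have m3: "N3 \<phi>:.P2" by simp
 have jc: "tmap K H P2 id (%b. p2 b 1H) (N3 \<phi>):.P3"
  by (rule klin_closed[OF tmap_lin[OF mH mH mH _ klin_id(1) lin_ptens1[OF mH mH klin_id(2)]] m3]) simp_all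
 have "\<phi> *3 \<one>[P3] = \<one>[P3] *3 \<phi> *3 tmap K H P2 id (%b. p2 b 1H) (N3 \<phi>)"
  using arg_cong[OF pentagon_phi, of G3] N2_phi
  by (simp add: ahom_mult[OF G3] alg_closed[OF aP(3)] b1 b2 b3 b4 b5 ahom_one[OF Dl_ahom] tensor_one[symmetric])
 then have "\<psi> *3 \<phi> = \<psi> *3 (\<phi> *3 tmap K H P2 id (%b. p2 b 1H) (N3 \<phi>))" by simp
 then have e: "tmap K H P2 id (%b. p2 b 1H) (N3 \<phi>) = \<one>[P3]"
  using jc by (simp add: P3.m_assoc[symmetric] phi_phi_inv)
 have "N3 \<phi> = tmap K H H id (epsr H) (tmap K H P2 id (%b. p2 b 1H) (N3 \<phi>))"
  by (rule tensor_eqI[OF mH mH klin_id(2) klin_comp[OF tmap_lin[OF mH mH mH _ klin_id(1) lin_ptens1[OF mH mH klin_id(2)]]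
     tmap_lin[OF _ _ _ _ klin_id(1) epsr_lin]] _ m3])
   (simp_all add: tmap_ptens klin_id lin_ptens1 epsr_lin epsr_ptens eps_one)
 then show "N3 \<phi> = \<one>[P2]"
  unfolding e using ahom_one[OF N_ahom(3)] by (simp add: N3_def)
qed

lemma N_psi: "N1 \<psi> = \<one>[P2]" "N2 \<psi> = \<one>[P2]" "N3 \<psi> = \<one>[P2]"
 unfolding phi_inv_def
 by (rule ahom_inv[OF aP(2) N_ahom(1) phi_unit N_phi(1) aP(1)] ahom_inv[OF aP(2) N_ahom(2) phi_unit N2_phi aP(1)]
   ahom_inv[OF aP(2) N_ahom(3) phi_unit N_phi(2) aP(1)])+

end

section \<open>The braided monoidal category of modules\<close>

lemma module_fields_cong:
 assumes "module K V" "carrier V' = carrier V" "add V' = add V" "ring.zero V' = ring.zero V" "smult V' = smult V"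
 shows "module K V'"
proof -
 interpret module K V by fact
 have "abelian_group V'"
 proof (rule abelian_groupI)
  show "\<exists>y\<in>carrier V'. y +[V'] x = \<zero>[V']" if "x:.V'" for x
   using that M.l_neg assms(2-4) by (intro bexI[of _ "\<ominus>[V] x"]) auto
  show "x +[V'] y = y +[V'] x" if "x:.V'" "y:.V'" for x y
   using that by (simp add: assms(2-4) M.a_comm)
 qed (simp_all add: assms(2-4) M.a_assoc)
 then show ?thesis
  by (intro moduleI) (simp_all add: assms(2-5) smult_l_distr smult_r_distr smult_assoc1 R.is_cring)
qed

lemma tensor_fields_cong:
 assumes "carrier V' = carrier V" "add V' = add V" "smult V' = smult V"
 shows "ptens K V' W = ptens K V W" "ptens K W V' = ptens K W V"
  "tensor_mod K V' W = tensor_mod K V W" "tensor_mod K W V' = tensor_mod K W V"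
  "monoid.mult V' = monoid.mult V ==> one V' = one V ==> tensor K V' W = tensor K V W"
  "monoid.mult V' = monoid.mult V ==> one V' = one V ==> tensor K W V' = tensor K W V"
proof -
 have f: "tensor_free V' W = tensor_free V W" "tensor_free W V' = tensor_free W V"
  by (simp_all add: tensor_free_def assms)
 have n: "tensor_null K V' W = tensor_null K V W" "tensor_null K W V' = tensor_null K W V"
  by (simp_all add: tensor_null_def assms f)
 show p: "ptens K V' W = ptens K V W" "ptens K W V' = ptens K W V"
  by (simp_all add: ptens_def[abs_def] f n)
 show m: "tensor_mod K V' W = tensor_mod K V W" "tensor_mod K W V' = tensor_mod K W V"
  by (simp_all add: tensor_mod_def f n assms)
 show "monoid.mult V' = monoid.mult V ==> one V' = one V ==> tensor K V' W = tensor K V W"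
  "monoid.mult V' = monoid.mult V ==> one V' = one V ==> tensor K W V' = tensor K W V"
  by (simp_all add: tensor_def p m)
qed

lemma klin_fields_cong:
 assumes "carrier V' = carrier V" "add V' = add V" "smult V' = smult V"
 shows "klin K V' W = klin K V W" "klin K W V' = klin K W V"
 by (simp_all add: klin_def assms)

text \<open>Tensoring actions pulled back along algebra maps is pulling back along the tensor product of the maps. This converts the action of a coproduct leg on a tensor product into an action of a higher tensor power.\<close>

lemma act2_change:
 assumes B: "k_algebra K B" and C: "k_algebra K C" and V: "amod K B V \<alpha>" and W: "amod K C W \<beta>"
  and B': "k_algebra K B'" and C': "k_algebra K C'" and V': "amod K B' V \<alpha>'" and W': "amod K C' W \<beta>'"
  and F: "F : klin K B B'" and G: "G : klin K C C'"
  and cf: "!!b v. b:.B ==> v:.V ==> \<alpha> b v = \<alpha>' (F b) v"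
  and cg: "!!c w. c:.C ==> w:.W ==> \<beta> c w = \<beta>' (G c) w"
  and X: "X:.tensor K B C" and t: "t:.tensor K V W"
 shows "act2 K V W \<alpha> \<beta> X t = act2 K V W \<alpha>' \<beta>' (tmap K B' C' F G X) t"
 using act2_tmap[OF B C V W B' C' V' W' F G klin_id(1) klin_id(1) _ _ X t] cf cg
  tmap_id(1)[OF amodD(1)[OF V] amodD(1)[OF W]] t bilin_closed[OF act2_bilin[OF B C V W] X t]
 by simp

context qtqh
begin

abbreviation "T V W \<equiv> htensor K H V W"
abbreviation "hm V \<equiv> hmodule K H V"
abbreviation "asc V W X \<equiv> assoc K H V W X"

lemma htensor_fields [simp]:
 "carrier (T V W) = carrier (V**W)" "add (T V W) = add (V**W)" "ring.zero (T V W) = ring.zero (V**W)"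
 "smult (T V W) = smult (V**W)" "monoid.mult (T V W) = monoid.mult (V**W)" "one (T V W) = one (V**W)"
 by (simp_all add: htensor_def module.extend_def hmod.fields_def)

lemma act_T: "act (T V W) h = act2 K V W (act V) (act W) (\<Delta> h)"
 by (simp add: htensor_def module.extend_def hmod.fields_def act2_def[abs_def])

lemma htensor_reduce [simp]:
 "(T V W)**X = (V**W)**X" "X**(T V W) = X**V**W"
 "pt (T V W) X = pt (V**W) X" "pt X (T V W) = pt X (V**W)"
 "klin K (T V W) Y = klin K (V**W) Y" "klin K Y (T V W) = klin K Y (V**W)"
 "tsum2 (T V W) = tsum2 (V**W)"
 by (simp_all add: tensor_fields_cong[of "T V W" "V**W"] klin_fields_cong[of "T V W" "V**W"]
   tsum2_target_cong[of "T V W" "V**W"])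

lemma htensor_reduce2 [simp]:
 "tmap K (T V W) X = tmap K (V**W) X" "tmap K X (T V W) = tmap K X (V**W)"
 "flip K (T V W) X = flip K (V**W) X" "flip K X (T V W) = flip K X (V**W)"
 "rebr K (T V W) X Y = rebr K (V**W) X Y" "rebr K X (T V W) Y = rebr K X (V**W) Y"
 "rebr K X Y (T V W) = rebr K X Y (V**W)"
 "lebr K (T V W) X Y = lebr K (V**W) X Y" "lebr K X (T V W) Y = lebr K X (V**W) Y"
 "lebr K X Y (T V W) = lebr K X Y (V**W)"
 "act2 K (T V W) X = act2 K (V**W) X" "act2 K X (T V W) = act2 K X (V**W)"
 by (simp_all add: fun_eq_iff tmap_def flip_def rebr_def lebr_def act2_def)

lemma hmodule_amod: "hm V \<longleftrightarrow> amod K H V (act V)"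
 unfolding hmodule_def amod_def bilin_def by auto

lemma hm_amod: "hm V ==> amod K H V (act V)"
 by (simp add: hmodule_amod)

lemma hm_module [simp]: "hm V ==> module K V"
 by (simp add: hmodule_def)

lemma act_closed [simp]: "hm V ==> h:.H ==> v:.V ==> act V h v:.V"
 by (rule amodD(5)[OF hm_amod])

lemma hm_fields_cong:
 assumes "hm V" "carrier V' = carrier V" "add V' = add V" "ring.zero V' = ring.zero V" "smult V' = smult V" "act V' = act V"
 shows "hm V'"
 using assms module_fields_cong[of K, OF _ assms(2-5)] unfolding hmodule_def
 by (simp add: klin_fields_cong[OF assms(2,3,5)] klin_def)

lemma amod_T:
 assumes "hm V" "hm W"
 shows "amod K H (V**W) (act (T V W))"
 unfolding act_T[abs_def]
 by (rule amod_ahom[OF aH aP(1) D_ahom amod_tensor[OF aH aH hm_amod[OF assms(1)] hm_amod[OF assms(2)]]])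

lemma hm_T [simp]:
 assumes "hm V" "hm W"
 shows "hm (T V W)"
 using amod_T[OF assms] module_fields_cong[of K "V**W" "T V W"] assms
 unfolding hmodule_amod amod_def bilin_def by simp

definition "a2 V W = act2 K V W (act V) (act W)"
definition "a3 V W X = act2 K V (W**X) (act V) (a2 W X)"
definition "a4 V W X Y = act2 K V (W**X**Y) (act V) (a3 W X Y)"

lemma amod_a2: "hm V ==> hm W ==> amod K P2 (V**W) (a2 V W)"
 unfolding a2_def by (intro amod_tensor aH hm_amod)

lemma amod_a3: "hm V ==> hm W ==> hm X ==> amod K P3 (V**W**X) (a3 V W X)"
 unfolding a3_def by (intro amod_tensor aH aP hm_amod amod_a2)

lemma amod_a4: "hm V ==> hm W ==> hm X ==> hm Y ==>
  amod K P4 (V**W**X**Y) (a4 V W X Y)"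
 unfolding a4_def by (intro amod_tensor aH aP hm_amod amod_a3)

lemma a_ptens:
 assumes "hm V" "hm W" "a:.H" "b:.H" "v:.V" "w:.W"
 shows "a2 V W (p2 a b) (pt V W v w) = pt V W (act V a v) (act W b w)"
  "hm X ==> c:.H ==> x:.X ==>
   a3 V W X (p3 a b c) (pt V (W**X) v (pt W X w x)) =
   pt V (W**X) (act V a v) (pt W X (act W b w) (act X c x))"
proof -
 show "a2 V W (p2 a b) (pt V W v w) = pt V W (act V a v) (act W b w)"
  using assms by (simp add: a2_def act2_ptens_ptens[OF aH aH hm_amod hm_amod])
 have "a2 W X (p2 b c) (pt W X w x) = pt W X (act W b w) (act X c x)"
  if "hm X" "c:.H" "x:.X"
  using that assms by (simp add: a2_def act2_ptens_ptens[OF aH aH hm_amod hm_amod])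
 then show "hm X ==> c:.H ==> x:.X ==>
   a3 V W X (p3 a b c) (pt V (W**X) v (pt W X w x)) =
   pt V (W**X) (act V a v) (pt W X (act W b w) (act X c x))"
  using assms by (simp add: a3_def act2_ptens_ptens[OF aH aP(1) hm_amod amod_a2])
qed

lemma a3_expand:
 assumes "hm V" "hm W" "hm X" "Z:.P3" "v:.V" "w:.W" "x:.X"
  and P: "module K P" and L: "L : klin K (V**W**X) P"
 shows "L (a3 V W X Z (pt V (W**X) v (pt W X w x))) =
  tsum3 P Z (%a b c. L (pt V (W**X) (act V a v) (pt W X (act W b w) (act X c x))))"
proof -
 let ?t = "pt V (W**X) v (pt W X w x)"
 have t: "?t:.V**W**X" using assms by simp
 have l: "(%Z. L (a3 V W X Z ?t)) : klin K P3 P"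
  by (rule klin_comp[OF amodD(7)[OF amod_a3 t] L]) (use assms in auto)
 have "L (a3 V W X Z ?t) = tsum3 P Z (%a b c. L (a3 V W X (p3 a b c) ?t))"
  by (rule lin3_expand[OF mH mH mH P l assms(4)])
 also have "... = tsum3 P Z (%a b c. L (pt V (W**X) (act V a v) (pt W X (act W b w) (act X c x))))"
  by (rule tsum3_cong[OF mH mH mH assms(4) P]) (use assms klin_closed[OF L] in "auto simp: a_ptens")
 finally show ?thesis .
qed

lemma a2_expand:
 assumes "hm V" "hm W" "Z:.P2" "v:.V" "w:.W"
  and P: "module K P" and L: "L : klin K (V**W) P"
 shows "L (a2 V W Z (pt V W v w)) = tsum2 P Z (%a b. L (pt V W (act V a v) (act W b w)))"
proof -
 let ?t = "pt V W v w"
 have t: "?t:.V**W" using assms by simp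
 have l: "(%Z. L (a2 V W Z ?t)) : klin K P2 P"
  by (rule klin_comp[OF amodD(7)[OF amod_a2 t] L]) (use assms in auto)
 have "L (a2 V W Z ?t) = tsum2 P Z (%a b. L (a2 V W (p2 a b) ?t))"
  by (rule lin2_expand[OF mH mH P l assms(3)])
 also have "... = tsum2 P Z (%a b. L (pt V W (act V a v) (act W b w)))"
  by (rule tsum2_cong[OF mH mH assms(3) P]) (use assms klin_closed[OF L] in "auto simp: a_ptens")
 finally show ?thesis .
qed

subsection \<open>The associator\<close>

lemma assoc_lin0: "hm V ==> hm W ==> hm X ==> Z:.P3 ==>
  (%t. a3 V W X Z (rebr K V W X t)) : klin K ((V**W)**X) (V**W**X)"
 by (rule klin_comp[OF rebr_lin amodD(6)[OF amod_a3]]) simp_all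

text \<open>The associator is the plain rebracketing followed by the action of \<open>\<phi>\<close>, so its properties are identities in the tensor powers of \<open>H\<close>.\<close>

lemma assoc_eq:
 assumes V: "hm V" and W: "hm W" and X: "hm X" and t: "t:.(V**W)**X"
 shows "asc V W X t = a3 V W X \<phi> (rebr K V W X t)"
proof -
 let ?T = "V**W**X" let ?f = "%t. a3 V W X \<phi> (rebr K V W X t)"
 have T: "module K ?T" using V W X by simp
 note l = assoc_lin0[OF V W X phi_closed(1)]
 have "?f t = tsum2 ?T t (%s x. ?f (pt (V**W) X s x))"
  by (rule lin2_expand[OF _ _ T l t]) (use V W X in auto)
 also have "... = tsum2 ?T t (%s x. tsum2 ?T s (%v w. tsum3 ?T \<phi> (%a b c.
    pt V (W**X) (act V a v) (pt W X (act W b w) (act X c x)))))"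
 proof (rule tsum2_cong[OF _ _ t T])
  fix s x assume s: "s:.V**W" and x: "x:.X"
  have l': "(%s. ?f (pt (V**W) X s x)) : klin K (V**W) ?T"
   by (rule klin_comp[OF lin_ptens1[OF _ _ klin_id(2) x] l]) (use V W X in auto)
  have e: "?f (pt (V**W) X s x) = tsum2 ?T s (%v w. ?f (pt (V**W) X (pt V W v w) x))"
   by (rule lin2_expand[OF _ _ T l' s]) (use V W in auto)
  also have "... = tsum2 ?T s (%v w. tsum3 ?T \<phi> (%a b c.
    pt V (W**X) (act V a v) (pt W X (act W b w) (act X c x))))"
  proof (rule tsum2_cong[OF _ _ s T])
   fix v w assume vw: "v:.V" "w:.W"
   show "?f (pt (V**W) X (pt V W v w) x) = tsum3 ?T \<phi> (%a b c.
     pt V (W**X) (act V a v) (pt W X (act W b w) (act X c x)))"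
    using a3_expand[OF V W X phi_closed(1) vw x T klin_id(2)] vw V W X x by (simp add: rebr_ptens)
   show "tsum3 ?T \<phi> (%a b c. pt V (W**X) (act V a v) (pt W X (act W b w) (act X c x))):.?T"
    by (rule tsum3_closed[OF mH mH mH phi_closed(1) T]) (use V W X vw x in auto)
  qed (use V W in auto)
  finally show ee: "?f (pt (V**W) X s x) = tsum2 ?T s (%v w. tsum3 ?T \<phi> (%a b c.
    pt V (W**X) (act V a v) (pt W X (act W b w) (act X c x))))" .
  show "tsum2 ?T s (%v w. tsum3 ?T \<phi> (%a b c.
    pt V (W**X) (act V a v) (pt W X (act W b w) (act X c x)))):.?T"
   unfolding ee[symmetric] by (rule klin_closed[OF l' s])
 qed (use V W X in auto)
 finally show ?thesis by (simp add: assoc_def Let_def)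
qed

definition "ainv V W X t = lebr K V W X (a3 V W X \<psi> t)"

lemma assoc_lin [simp]:
 assumes "hm V" "hm W" "hm X"
 shows "asc V W X : klin K ((V**W)**X) (V**W**X)"
 by (rule klin_cong[OF assoc_lin0[OF assms phi_closed(1)]]) (use assms in "simp_all add: assoc_eq")

lemma ainv_lin [simp]:
 assumes "hm V" "hm W" "hm X"
 shows "ainv V W X : klin K (V**W**X) ((V**W)**X)"
 unfolding ainv_def[abs_def]
 by (rule klin_comp[OF amodD(6)[OF amod_a3] lebr_lin]) (use assms in simp_all)

lemma assoc_closed [simp]: "hm V ==> hm W ==> hm X ==> t:.(V**W)**X ==>
  asc V W X t:.V**W**X"
 by (rule klin_closed[OF assoc_lin])

lemma ainv_closed [simp]: "hm V ==> hm W ==> hm X ==> t:.V**W**X ==>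
  ainv V W X t:.(V**W)**X"
 by (rule klin_closed[OF ainv_lin])

lemma assoc_ainv [simp]:
 assumes V: "hm V" and W: "hm W" and X: "hm X"
 shows "t:.V**W**X ==> asc V W X (ainv V W X t) = t"
  "s:.(V**W)**X ==> ainv V W X (asc V W X s) = s"
proof -
 note m = hm_module[OF V] hm_module[OF W] hm_module[OF X] and A = amod_a3[OF V W X]
 assume t: "t:.V**W**X"
 have "asc V W X (ainv V W X t) = a3 V W X \<phi> (rebr K V W X (ainv V W X t))"
  by (rule assoc_eq) (use V W X t in auto)
 also have "... = a3 V W X \<phi> (a3 V W X \<psi> t)"
  using t m by (simp add: ainv_def rebr_lebr(1)[OF m amodD(5)[OF A]])
 finally show "asc V W X (ainv V W X t) = t"
  using t by (simp add: amodD(3)[OF A, symmetric] phi_phi_inv amodD(4)[OF A])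
next
 note m = hm_module[OF V] hm_module[OF W] hm_module[OF X] and A = amod_a3[OF V W X]
 assume s: "s:.(V**W)**X"
 have r: "rebr K V W X s:.V**W**X" by (rule klin_closed[OF rebr_lin[OF m] s])
 show "ainv V W X (asc V W X s) = s"
  using s r m by (simp add: ainv_def assoc_eq[OF V W X s] amodD(3)[OF A, symmetric] phi_phi_inv amodD(4)[OF A] rebr_lebr(2))
qed

lemma hmorI: "f : klin K V W ==> (!!h v. h:.H ==> v:.V ==> f (act V h v) = act W h (f v)) ==> f : mor V W"
 by (simp add: hmor_def)

lemma hmor_lin: "f : mor V W ==> f : klin K V W"
 by (simp add: hmor_def)

lemma hmor_act: "f : mor V W ==> h:.H ==> v:.V ==> f (act V h v) = act W h (f v)"
 by (simp add: hmor_def)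

lemma act_TT:
 assumes V: "hm V" and W: "hm W" and X: "hm X" and h: "h:.H"
 shows "t:.V**W**X ==> act (T V (T W X)) h t = a3 V W X (Dr (\<Delta> h)) t"
  "s:.(V**W)**X ==>
   rebr K V W X (act (T (T V W) X) h s) = a3 V W X (Dl (\<Delta> h)) (rebr K V W X s)"
proof -
 assume t: "t:.V**W**X"
 have "act (T V (T W X)) h t = act2 K V (W**X) (act V) (act (T W X)) (\<Delta> h) t"
  by (simp add: act_T)
 also have "... = a3 V W X (Dr (\<Delta> h)) t"
  unfolding a3_def Dr_def
  by (rule act2_change[OF aH aH hm_amod[OF V] amod_T[OF W X] aH aP(1) hm_amod[OF V] amod_a2[OF W X] klin_id(1) D_lin])
   (use h t in "simp_all add: act_T a2_def")
 finally show "act (T V (T W X)) h t = a3 V W X (Dr (\<Delta> h)) t" .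
next
 assume s: "s:.(V**W)**X"
 have "act (T (T V W) X) h s = act2 K (V**W) X (act (T V W)) (act X) (\<Delta> h) s"
  by (simp add: act_T)
 also have "... = act2 K (V**W) X (act2 K V W (act V) (act W)) (act X) (tmap K P2 H \<Delta> id (\<Delta> h)) s"
  by (rule act2_change[OF aH aH amod_T[OF V W] hm_amod[OF X] aP(1) aH amod_a2[OF V W, unfolded a2_def] hm_amod[OF X] D_lin klin_id(1)])
   (use h s in "simp_all add: act_T")
 finally show "rebr K V W X (act (T (T V W) X) h s) = a3 V W X (Dl (\<Delta> h)) (rebr K V W X s)"
  unfolding a3_def Dl_def a2_def
  by (simp only:) (rule act2_rebr[OF aH aH aH hm_amod[OF V] hm_amod[OF W] hm_amod[OF X] _ s],
   rule klin_closed[OF tmap_lin[OF mH mH _ mH D_lin klin_id(1)] D_closed[OF h]], simp)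
qed

lemma assoc_hmor [simp]:
 assumes V: "hm V" and W: "hm W" and X: "hm X"
 shows "asc V W X : mor (T (T V W) X) (T V (T W X))"
proof (rule hmorI)
 show "asc V W X : klin K (T (T V W) X) (T V (T W X))" using assms by simp
 fix h s assume h: "h:.H" and "s:.T (T V W) X"
 then have s: "s:.(V**W)**X" by simp
 note m = hm_module[OF V] hm_module[OF W] hm_module[OF X] and A = amod_a3[OF V W X]
 have r: "rebr K V W X s:.V**W**X" by (rule klin_closed[OF rebr_lin[OF m] s])
 have hs: "act (T (T V W) X) h s:.(V**W)**X"
  using act_closed[of "T (T V W) X" h s] assms h s by simp
 have "asc V W X (act (T (T V W) X) h s) = a3 V W X \<phi> (a3 V W X (Dl (\<Delta> h)) (rebr K V W X s))"
  by (simp add: assoc_eq[OF V W X hs] act_TT(2)[OF V W X h s])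
 also have "... = a3 V W X (Dr (\<Delta> h)) (a3 V W X \<phi> (rebr K V W X s))"
  using coassoc[OF h] r h by (simp add: amodD(3)[OF A, symmetric])
 also have "... = act (T V (T W X)) h (asc V W X s)"
  using act_TT(1)[OF V W X h, of "a3 V W X \<phi> (rebr K V W X s)"] amodD(5)[OF A phi_closed(1) r] by (simp add: assoc_eq[OF V W X s])
 finally show "asc V W X (act (T (T V W) X) h s) = act (T V (T W X)) h (asc V W X s)" .
qed

lemma hmor_inverse:
 assumes V: "hm V" and f: "f : mor V W" and g: "g : klin K W V"
  and "!!v. v:.V ==> g (f v) = v" "!!w. w:.W ==> f (g w) = w"
 shows "g : mor W V"
proof (rule hmorI[OF g])
 fix h w assume a: "h:.H" "w:.W"
 have "g (act W h w) = g (f (act V h (g w)))"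
  using a assms(5) klin_closed[OF g] by (simp add: hmor_act[OF f])
 then show "g (act W h w) = act V h (g w)" using a assms(4) klin_closed[OF g] V by simp
qed

lemma ainv_hmor [simp]: "hm V ==> hm W ==> hm X ==> ainv V W X : mor (T V (T W X)) (T (T V W) X)"
 by (rule hmor_inverse[OF _ assoc_hmor]) simp_all

lemma a3_natural:
 assumes "hm V" "hm W" "hm X" "hm V'" "hm W'" "hm X'"
  and "f : mor V V'" "g : mor W W'" "k : mor X X'"
  and "Z:.P3" "t:.V**W**X"
 shows "tmap K V' (W'**X') f (tmap K W' X' g k) (a3 V W X Z t) =
  a3 V' W' X' Z (tmap K V' (W'**X') f (tmap K W' X' g k) t)"
proof -
 note A = hm_amod[OF assms(1)] hm_amod[OF assms(2)] hm_amod[OF assms(3)] hm_amod[OF assms(4)] hm_amod[OF assms(5)] hm_amod[OF assms(6)]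
 have i: "tmap K H H id id Y = Y" if "Y:.P2" for Y using that by (simp add: tmap_id)
 have i3: "tmap K H P2 id id Y = Y" if "Y:.P3" for Y using that by (simp add: tmap_id)
 have inner: "tmap K W' X' g k (a2 W X Y s) = a2 W' X' Y (tmap K W' X' g k s)"
  if "Y:.P2" "s:.W**X" for Y s
  using act2_tmap[OF aH aH A(2,3) aH aH A(5,6) klin_id(1) klin_id(1) hmor_lin[OF assms(8)] hmor_lin[OF assms(9)] _ _ that]
   hmor_act[OF assms(8)] hmor_act[OF assms(9)] by (simp add: a2_def i that)
 show ?thesis
  using act2_tmap[OF aH aP(1) A(1) amod_a2[OF assms(2,3)] aH aP(1) A(4) amod_a2[OF assms(5,6)] klin_id(1) klin_id(1)
    hmor_lin[OF assms(7)] tmap_lin[OF _ _ _ _ hmor_lin[OF assms(8)] hmor_lin[OF assms(9)]] _ _ assms(10,11)]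
   hmor_act[OF assms(7)] inner assms(1-6) by (simp add: a3_def i3 assms(10))
qed

lemma ainv_natural:
 assumes "hm V" "hm W" "hm X" "hm V'" "hm W'" "hm X'"
  and "f : mor V V'" "g : mor W W'" "k : mor X X'"
  and t: "t:.V**W**X"
 shows "ainv V' W' X' (tmap K V' (W'**X') f (tmap K W' X' g k) t) =
  tmap K (V'**W') X' (tmap K V' W' f g) k (ainv V W X t)"
proof -
 note m = assms(1-6)[THEN hm_module]
 note l = hmor_lin[OF assms(7)] hmor_lin[OF assms(8)] hmor_lin[OF assms(9)]
 have n: "lebr K V' W' X' (tmap K V' (W'**X') f (tmap K W' X' g k) s) =
  tmap K (V'**W') X' (tmap K V' W' f g) k (lebr K V W X s)" if s: "s:.V**W**X" for s
  by (rule tensor3_eqI[OF m(1-3) klin_comp[OF tmap_lin lebr_lin] klin_comp[OF lebr_lin tmap_lin] _ s])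
   (use m l in "simp_all add: tmap_lin lebr_ptens tmap_ptens klin_closed")
 show ?thesis
  using n amodD(5)[OF amod_a3[OF assms(1-3)] phi_closed(2) t]
  by (simp add: ainv_def a3_natural[OF assms(1-9) phi_closed(2) t, symmetric])
qed

text \<open>Each associator in the pentagon acts on four factors through one of the elements \<open>D1 \<phi>\<close>, \<open>D2 \<phi>\<close>, \<open>D3 \<phi>\<close>.\<close>

lemma a4_changes:
 assumes V: "hm V" and W: "hm W" and X: "hm X" and Y: "hm Y" and Z: "Z:.P3"
 shows "t:.V**W**X**Y ==> a3 V W (T X Y) Z t = a4 V W X Y (D3 Z) t"
  "s:.(V**W)**X**Y ==>
   rebr K V W (X**Y) (a3 (T V W) X Y Z s) = a4 V W X Y (D1 Z) (rebr K V W (X**Y) s)"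
  "u:.V**(W**X)**Y ==>
   tmap K V (W**X**Y) id (rebr K W X Y) (a3 V (T W X) Y Z u) =
   a4 V W X Y (D2 Z) (tmap K V (W**X**Y) id (rebr K W X Y) u)"
proof -
 note A = hm_amod[OF V] hm_amod[OF W] hm_amod[OF X] hm_amod[OF Y]
 note m = V[THEN hm_module] W[THEN hm_module] X[THEN hm_module] Y[THEN hm_module]
 show "a3 V W (T X Y) Z t = a4 V W X Y (D3 Z) t" if t: "t:.V**W**X**Y"
 proof -
  have "a3 V W (T X Y) Z t = act2 K V (W**X**Y) (act V) (act2 K W (X**Y) (act W) (act (T X Y))) Z t"
   by (simp add: a3_def a2_def)
  also have "... = a4 V W X Y (D3 Z) t"
   unfolding a4_def D3_def
  proof (rule act2_change[OF aH aP(1) A(1) amod_tensor[OF aH aH A(2) amod_T[OF X Y]] aH aP(2) A(1) amod_a3[OF W X Y] klin_id(1) D_lins(2) _ _ Z t])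
   show "act2 K W (X**Y) (act W) (act (T X Y)) c w = a3 W X Y (Dr c) w"
    if "c:.P2" "w:.W**X**Y" for c w
    unfolding a3_def Dr_def
    by (rule act2_change[OF aH aH A(2) amod_T[OF X Y] aH aP(1) A(2) amod_a2[OF X Y] klin_id(1) D_lin _ _ that])
     (simp_all add: act_T a2_def)
  qed simp
  finally show ?thesis .
 qed
 show "rebr K V W (X**Y) (a3 (T V W) X Y Z s) = a4 V W X Y (D1 Z) (rebr K V W (X**Y) s)"
  if s: "s:.(V**W)**X**Y"
 proof -
  have "a3 (T V W) X Y Z s = act2 K (V**W) (X**Y) (act (T V W)) (a2 X Y) Z s"
   by (simp add: a3_def)
  also have "... = act2 K (V**W) (X**Y) (act2 K V W (act V) (act W)) (a2 X Y) (tmap K P2 P2 \<Delta> id Z) s"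
   by (rule act2_change[OF aH aP(1) amod_T[OF V W] amod_a2[OF X Y] aP(1) aP(1) amod_tensor[OF aH aH A(1,2)] amod_a2[OF X Y] D_lin klin_id(1) _ _ Z s])
    (simp_all add: act_T)
  finally show ?thesis
   unfolding a4_def a3_def[of W] D1_def
   by (simp only:) (rule act2_rebr[OF aH aH aP(1) A(1,2) amod_a2[OF X Y] _ s],
    rule klin_closed[OF tmap_lin[OF mH _ _ _ D_lin klin_id(1)] Z], simp_all)
 qed
 show "tmap K V (W**X**Y) id (rebr K W X Y) (a3 V (T W X) Y Z u) =
   a4 V W X Y (D2 Z) (tmap K V (W**X**Y) id (rebr K W X Y) u)"
  if u: "u:.V**(W**X)**Y"
 proof -
  have "a3 V (T W X) Y Z u = act2 K V ((W**X)**Y) (act V) (act2 K (W**X) Y (act (T W X)) (act Y)) Z u"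
   by (simp add: a3_def a2_def)
  moreover have "tmap K V (W**X**Y) id (rebr K W X Y) ... =
    act2 K V (W**X**Y) (act V) (a3 W X Y) (tmap K H P3 id Dl Z)
     (tmap K V (W**X**Y) id (rebr K W X Y) u)"
  proof (rule act2_tmap[OF aH aP(1) A(1) amod_tensor[OF aH aH amod_T[OF W X] A(4)] aH aP(2) A(1) amod_a3[OF W X Y]
     klin_id(1) D_lins(1) klin_id(1) rebr_lin[OF m(2-4)] _ _ Z u])
   fix c w assume c: "c:.P2" and w: "w:.(W**X)**Y"
   have "act2 K (W**X) Y (act (T W X)) (act Y) c w = act2 K (W**X) Y (act2 K W X (act W) (act X)) (act Y) (tmap K P2 H \<Delta> id c) w"
    by (rule act2_change[OF aH aH amod_T[OF W X] A(4) aP(1) aH amod_tensor[OF aH aH A(2,3)] A(4) D_lin klin_id(1) _ _ c w])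
     (simp_all add: act_T)
   then show "rebr K W X Y (act2 K (W**X) Y (act (T W X)) (act Y) c w) = a3 W X Y (Dl c) (rebr K W X Y w)"
    unfolding a3_def Dl_def a2_def
    by (simp only:) (rule act2_rebr[OF aH aH aH A(2-4) _ w],
     rule klin_closed[OF tmap_lin[OF mH mH _ mH D_lin klin_id(1)] c], simp)
  qed simp
  ultimately show ?thesis by (simp add: a4_def D2_def)
 qed
qed

lemma assoc_pentagon:
 assumes V: "hm V" and W: "hm W" and X: "hm X" and Y: "hm Y" and t: "t:.((V**W)**X)**Y"
 shows "asc V W (T X Y) (asc (T V W) X Y t) =
  tmap K V (W**X**Y) id (asc W X Y)
   (asc V (T W X) Y (tmap K (V**W**X) Y (asc V W X) id t))"
proof -
 note A = hm_amod[OF V] hm_amod[OF W] hm_amod[OF X] hm_amod[OF Y]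
 note m [simp] = V[THEN hm_module] W[THEN hm_module] X[THEN hm_module] Y[THEN hm_module]
 note A4 = amod_a4[OF V W X Y]
 let ?VWX = "V**W**X" and ?WXY = "W**X**Y"
 define r where "r = rebr K V W (X**Y) (rebr K (V**W) X Y t)"
 have t1: "rebr K (V**W) X Y t:.(V**W)**X**Y"
  by (rule klin_closed[OF rebr_lin t]) simp_all
 have r: "r:.V**?WXY" unfolding r_def by (rule klin_closed[OF rebr_lin t1]) simp_all
 have s1: "asc (T V W) X Y t = a3 (T V W) X Y \<phi> (rebr K (V**W) X Y t)"
  using assoc_eq[of "T V W" X Y t] V W X Y t by simp
 have s1c: "asc (T V W) X Y t:.(V**W)**X**Y"
  using assoc_closed[of "T V W" X Y t] V W X Y t by simp
 have "asc V W (T X Y) (asc (T V W) X Y t) = a3 V W (T X Y) \<phi> (rebr K V W (X**Y) (asc (T V W) X Y t))"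
  using assoc_eq[of V W "T X Y"] V W X Y s1c by simp
 also have "... = a4 V W X Y (D3 \<phi>) (a4 V W X Y (D1 \<phi>) r)"
  unfolding s1 a4_changes(2)[OF V W X Y phi_closed(1) t1] r_def[symmetric]
  by (rule a4_changes(1)[OF V W X Y phi_closed(1) amodD(5)[OF A4 _ r]]) simp
 also have "... = a4 V W X Y (I1 \<phi> *4 D2 \<phi> *4 I4 \<phi>) r"
  using r by (simp add: amodD(3)[OF A4, symmetric] pentagon_phi)
 also have "... = a4 V W X Y (I1 \<phi>) (a4 V W X Y (D2 \<phi>) (a4 V W X Y (I4 \<phi>) r))"
  using r by (simp add: amodD(3)[OF A4] amodD(5)[OF A4] alg_closed[OF aP(3)])
 finally have lhs: "asc V W (T X Y) (asc (T V W) X Y t) = a4 V W X Y (I1 \<phi>) (a4 V W X Y (D2 \<phi>) (a4 V W X Y (I4 \<phi>) r))" .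
 define q where "q = tmap K ?VWX Y (rebr K V W X) id t"
 have q: "q:.?VWX**Y" unfolding q_def
  by (rule klin_closed[OF tmap_lin[OF _ _ _ _ rebr_lin klin_id(1)] t]) simp_all
 have a1: "tmap K ?VWX Y (asc V W X) id t = act2 K ?VWX Y (a3 V W X) (act Y) (pt P3 H \<phi> 1H) q"
 proof -
  have "tmap K ?VWX Y (asc V W X) id t = tmap K ?VWX Y (%x. a3 V W X \<phi> (rebr K V W X x)) (%x. act Y 1H (id x)) t"
   by (rule tmap_cong[OF _ _ _ _ assoc_lin0 _ _ _ t])
    (use V W X Y amodD(4)[OF A(4)] in "auto simp: assoc_eq intro!: klin_comp[OF klin_id(2) amodD(6)[OF A(4)]]")
  also have "... = tmap K ?VWX Y (a3 V W X \<phi>) (act Y 1H) q"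
   unfolding q_def
   by (rule tmap_comp[symmetric, OF _ _ _ _ _ _ rebr_lin klin_id(1) amodD(6)[OF amod_a3] amodD(6)[OF A(4)] t]) (use V W X in auto)
  also have "... = act2 K ?VWX Y (a3 V W X) (act Y) (pt P3 H \<phi> 1H) q"
   by (rule act2_ptens[symmetric, OF aP(2) aH amod_a3[OF V W X] A(4) _ _ q]) simp_all
  finally show ?thesis .
 qed
 have a1c: "tmap K ?VWX Y (asc V W X) id t:.?VWX**Y"
  by (rule klin_closed[OF tmap_lin[OF _ _ _ _ assoc_lin klin_id(1)] t]) (use V W X in simp_all)
 define q2 where "q2 = rebr K V (W**X) Y q"
 have q2: "q2:.V**(W**X)**Y" unfolding q2_def by (rule klin_closed[OF rebr_lin q]) simp_all
 have rp: "rebr K H P2 H (pt P3 H \<phi> 1H):.H**P2**H"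
  by (rule klin_closed[OF rebr_lin]) simp_all
 note A5 = amod_tensor[OF aP(1) aH amod_a2[OF W X] A(4)]
 note A6 = amod_tensor[OF aH aHP(1) A(1) A5]
 let ?a5 = "act2 K V ((W**X)**Y) (act V) (act2 K (W**X) Y (a2 W X) (act Y))"
 have a2: "rebr K V (W**X) Y (tmap K ?VWX Y (asc V W X) id t) = ?a5 (rebr K H P2 H (pt P3 H \<phi> 1H)) q2"
  unfolding a1 q2_def a3_def
  by (rule act2_rebr[OF aH aP(1) aH A(1) amod_a2[OF W X] A(4) _ q]) simp
 have q3: "tmap K V ?WXY id (rebr K W X Y) q2 = r"
  unfolding r_def q2_def q_def
 proof (rule tensor_eqI[OF _ _ klin_comp[OF klin_comp[OF tmap_lin[OF _ _ _ _ rebr_lin klin_id(1)] rebr_lin] tmap_lin[OF _ _ _ _ klin_id(1) rebr_lin]]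
    klin_comp[OF rebr_lin rebr_lin] _ t])
  fix s y assume s: "s:.(V**W)**X" and y: "y:.Y"
  note p = lin_ptens1[OF _ _ klin_id(2) y]
  show "tmap K V ?WXY id (rebr K W X Y) (rebr K V (W**X) Y (tmap K ?VWX Y (rebr K V W X) id (pt ((V**W)**X) Y s y))) =
   rebr K V W (X**Y) (rebr K (V**W) X Y (pt ((V**W)**X) Y s y))"
   by (rule tensor3_left_eqI[OF m(1-3)
     klin_comp[OF klin_comp[OF klin_comp[OF p tmap_lin[OF _ _ _ _ rebr_lin klin_id(1)]] rebr_lin] tmap_lin[OF _ _ _ _ klin_id(1) rebr_lin]]
    klin_comp[OF klin_comp[OF p rebr_lin] rebr_lin] _ s])
    (use y in "simp_all add: tmap_ptens rebr_lin klin_id rebr_ptens")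
 qed simp_all
 have a3: "tmap K V ?WXY id (rebr K W X Y) (?a5 (rebr K H P2 H (pt P3 H \<phi> 1H)) q2) = a4 V W X Y (I4 \<phi>) r"
  unfolding q3[symmetric] I4_def a4_def
 proof (rule act2_tmap[OF aH aHP(1) A(1) A5 aH aP(2) A(1) amod_a3[OF W X Y] klin_id(1) rebr_lin klin_id(1) rebr_lin _ _ rp q2])
  show "rebr K W X Y (act2 K (W**X) Y (a2 W X) (act Y) c w) = a3 W X Y (rebr K H H H c) (rebr K W X Y w)"
   if "c:.P2**H" "w:.(W**X)**Y" for c w
   unfolding a3_def a2_def by (rule act2_rebr[OF aH aH aH A(2-4) that])
 qed simp_all
 define z where "z = rebr K V (W**X) Y (tmap K ?VWX Y (asc V W X) id t)"
 have z: "z:.V**(W**X)**Y" unfolding z_def by (rule klin_closed[OF rebr_lin a1c]) simp_all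
 have zr: "tmap K V ?WXY id (rebr K W X Y) z = a4 V W X Y (I4 \<phi>) r" unfolding z_def a2 a3 ..
 have b: "asc V (T W X) Y (tmap K ?VWX Y (asc V W X) id t) = a3 V (T W X) Y \<phi> z"
  using assoc_eq[of V "T W X" Y] V W X Y a1c by (simp add: z_def)
 have zc: "a3 V (T W X) Y \<phi> z:.V**(W**X)**Y"
  using amodD(5)[OF amod_a3[of V "T W X" Y] phi_closed(1)] V W X Y z by simp
 have "tmap K V ?WXY id (asc W X Y) (a3 V (T W X) Y \<phi> z) =
   tmap K V ?WXY (%x. act V 1H (id x)) (%x. a3 W X Y \<phi> (rebr K W X Y x)) (a3 V (T W X) Y \<phi> z)"
  by (rule tmap_cong[OF _ _ _ _ _ assoc_lin0 _ _ zc])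
   (use V W X Y amodD(4)[OF A(1)] in "auto simp: assoc_eq intro!: klin_comp[OF klin_id(2) amodD(6)[OF A(1)]]")
 also have "... = tmap K V ?WXY (act V 1H) (a3 W X Y \<phi>) (tmap K V ?WXY id (rebr K W X Y) (a3 V (T W X) Y \<phi> z))"
  by (rule tmap_comp[symmetric, OF _ _ _ _ _ _ klin_id(1) rebr_lin amodD(6)[OF A(1)] amodD(6)[OF amod_a3] zc]) (use W X Y in auto)
 also have "... = tmap K V ?WXY (act V 1H) (a3 W X Y \<phi>) (a4 V W X Y (D2 \<phi>) (a4 V W X Y (I4 \<phi>) r))"
  by (simp add: a4_changes(3)[OF V W X Y phi_closed(1) z] zr)
 also have "... = a4 V W X Y (I1 \<phi>) (a4 V W X Y (D2 \<phi>) (a4 V W X Y (I4 \<phi>) r))"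
  unfolding I1_def
  using act2_ptens[OF aH aP(2) A(1) amod_a3[OF W X Y], of "1H" \<phi> "a4 V W X Y (D2 \<phi>) (a4 V W X Y (I4 \<phi>) r)"] r
  by (simp add: a4_def[symmetric] amodD(5)[OF A4])
 finally show ?thesis unfolding lhs b by simp
qed

lemma ainv_pentagon:
 assumes V: "hm V" and W: "hm W" and X: "hm X" and Y: "hm Y" and t: "t:.V**W**X**Y"
 shows "ainv (T V W) X Y (ainv V W (T X Y) t) =
  tmap K ((V**W)**X) Y (ainv V W X) id (ainv V (T W X) Y (tmap K V ((W**X)**Y) id (ainv W X Y) t))"
  (is "?a = ?b")
proof -
 note m [simp] = V[THEN hm_module] W[THEN hm_module] X[THEN hm_module] Y[THEN hm_module]
 note asms [simp] = V W X Y
 have t1: "ainv V W (T X Y) t:.(V**W)**X**Y"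
  using ainv_closed[of V W "T X Y" t] t by simp
 have a: "?a:.((V**W)**X)**Y"
  using ainv_closed[of "T V W" X Y] t1 by simp
 define u where "u = tmap K V ((W**X)**Y) id (ainv W X Y) t"
 have u: "u:.V**(W**X)**Y"
  unfolding u_def by (rule klin_closed[OF tmap_lin[OF _ _ _ _ klin_id(1) ainv_lin] t]) simp_all
 define w where "w = ainv V (T W X) Y u"
 have w: "w:.(V**W**X)**Y"
  unfolding w_def using ainv_closed[of V "T W X" Y u] u by simp
 have b: "?b:.((V**W)**X)**Y"
  unfolding u_def[symmetric] w_def[symmetric] by (rule klin_closed[OF tmap_lin[OF _ _ _ _ ainv_lin klin_id(1)] w]) simp_all
 have bb: "tmap K (V**W**X) Y (asc V W X) id ?b = w"
 proof -
  have "tmap K (V**W**X) Y (asc V W X) id ?b =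
   tmap K (V**W**X) Y (%x. asc V W X (ainv V W X x)) (%x. id (id x)) w"
   unfolding u_def[symmetric] w_def[symmetric]
   by (rule tmap_comp[OF _ _ _ _ _ _ ainv_lin klin_id(1) assoc_lin klin_id(1) w]) simp_all
  also have "... = tmap K (V**W**X) Y id id w"
   by (rule tmap_cong[OF _ _ _ _ klin_id(1) klin_id(1) _ _ w]) simp_all
  also have "... = w" by (rule tmap_id(1)[OF _ _ w]) simp_all
  finally show ?thesis .
 qed
 have "asc V (T W X) Y w = u" unfolding w_def using assoc_ainv(1)[of V "T W X" Y u] u by simp
 moreover have "tmap K V (W**X**Y) id (asc W X Y) u = t"
 proof -
  have "tmap K V (W**X**Y) id (asc W X Y) u =
   tmap K V (W**X**Y) (%x. id (id x)) (%x. asc W X Y (ainv W X Y x)) t"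
   unfolding u_def by (rule tmap_comp[OF _ _ _ _ _ _ klin_id(1) ainv_lin klin_id(1) assoc_lin t]) simp_all
  also have "... = tmap K V (W**X**Y) id id t"
   by (rule tmap_cong[OF _ _ _ _ klin_id(1) klin_id(1) _ _ t]) simp_all
  also have "... = t" by (rule tmap_id(1)[OF _ _ t]) simp_all
  finally show ?thesis .
 qed
 ultimately have "asc V W (T X Y) (asc (T V W) X Y ?b) = t"
  using assoc_pentagon[OF V W X Y b] bb by simp
 moreover have bc: "asc (T V W) X Y ?b:.(V**W)**X**Y"
  using assoc_closed[of "T V W" X Y ?b] b by simp
 ultimately have "ainv V W (T X Y) t = asc (T V W) X Y ?b"
  using assoc_ainv(2)[of V W "T X Y" "asc (T V W) X Y ?b"] by simp
 then show ?thesis using assoc_ainv(2)[of "T V W" X Y ?b] b by simp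
qed

end

context qtqh
begin

subsection \<open>Invariant elements are transparent to the associator\<close>

text \<open>An invariant factor sees only the counit of its leg of \<open>\<psi>\<close>; this is how units of algebras pass through brackets.\<close>

lemma ainv_invariant1:
 assumes V: "hm V" and W: "hm W" and X: "hm X" and u: "u:.V" and inv: "!!h. h:.H ==> act V h u = \<epsilon> h \<odot>[V] u"
  and w: "w:.W" and x: "x:.X"
 shows "ainv V W X (pt V (W**X) u (pt W X w x)) = pt (V**W) X (pt V W u w) x"
proof -
 note m [simp] = V[THEN hm_module] W[THEN hm_module] X[THEN hm_module]
 let ?s = "pt W X w x"
 have s: "?s:.W**X" using w x by simp
 have t: "pt V (W**X) u ?s:.V**W**X" using u s by simp
 have "a3 V W X \<psi> (pt V (W**X) u ?s) = pt V (W**X) u (a2 W X (N1 \<psi>) ?s)"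
 proof (rule tensor3_eqI[OF mH mH mH amodD(7)[OF amod_a3[OF V W X] t]
    lin_ptens2[OF _ _ klin_comp[OF ahom_lin[OF N_ahom(1)] amodD(7)[OF amod_a2[OF W X] s]] u] _ phi_closed(2)])
  fix a b c assume abc: "a:.H" "b:.H" "c:.H"
  have "a2 W X (\<epsilon> a \<odot>[P2] p2 b c) ?s = \<epsilon> a \<odot>[W**X] pt W X (act W b w) (act X c x)"
   using klin_smult[OF amodD(7)[OF amod_a2[OF W X] s]] abc V W X w x by (simp add: a_ptens)
  then show "a3 V W X (p3 a b c) (pt V (W**X) u ?s) =
    pt V (W**X) u (a2 W X (N1 (p3 a b c)) ?s)"
   using abc V W X u w x by (simp add: a_ptens N_ptens inv ptens_smult)
 qed simp_all
 then show ?thesis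
  using u w x amodD(4)[OF amod_a2[OF W X] s] by (simp add: ainv_def N_psi lebr_ptens)
qed

lemma ainv_invariant2:
 assumes V: "hm V" and W: "hm W" and X: "hm X" and v: "v:.V" and u: "u:.W"
  and inv: "!!h. h:.H ==> act W h u = \<epsilon> h \<odot>[W] u" and x: "x:.X"
 shows "ainv V W X (pt V (W**X) v (pt W X u x)) = pt (V**W) X (pt V W v u) x"
proof -
 note m [simp] = V[THEN hm_module] W[THEN hm_module] X[THEN hm_module]
 have t: "pt V (W**X) v (pt W X u x):.V**W**X" using u v x by simp
 have s: "pt V X v x:.V**X" using v x by simp
 note L = tmap_lin[OF m(1,3) m(1) tensor_module[OF m(2,3)] klin_id(1) lin_ptens2[OF m(2,3) klin_id(2) u]]
 have "a3 V W X \<psi> (pt V (W**X) v (pt W X u x)) =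
   tmap K V (W**X) id (%x. pt W X u x) (a2 V X (N2 \<psi>) (pt V X v x))"
 proof (rule tensor3_eqI[OF mH mH mH amodD(7)[OF amod_a3[OF V W X] t]
    klin_comp[OF klin_comp[OF ahom_lin[OF N_ahom(2)] amodD(7)[OF amod_a2[OF V X] s]] L] _ phi_closed(2)])
  fix a b c assume abc: "a:.H" "b:.H" "c:.H"
  have e: "act X (\<epsilon> b \<odot>[H] c) x = \<epsilon> b \<odot>[X] act X c x"
   using klin_smult[OF amodD(7)[OF hm_amod[OF X] x]] abc by simp
  have sc: "\<epsilon> b \<odot>[X] act X c x:.X" using e act_closed[OF X, of "\<epsilon> b \<odot>[H] c" x] abc x by simp
  have "pt W X u (\<epsilon> b \<odot>[X] act X c x) = pt W X (\<epsilon> b \<odot>[W] u) (act X c x)"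
   using abc u x X by (simp add: ptens_smult)
  then show "a3 V W X (p3 a b c) (pt V (W**X) v (pt W X u x)) =
    tmap K V (W**X) id (%x. pt W X u x) (a2 V X (N2 (p3 a b c)) (pt V X v x))"
   using abc V W X u v x sc by (simp add: a_ptens N_ptens inv e tmap_ptens klin_id lin_ptens2)
 qed
 then show ?thesis
  using u v x amodD(4)[OF amod_a2[OF V X] s] by (simp add: ainv_def N_psi lebr_ptens tmap_ptens klin_id lin_ptens2)
qed

lemma ainv_invariant3:
 assumes V: "hm V" and W: "hm W" and X: "hm X" and v: "v:.V" and w: "w:.W" and u: "u:.X"
  and inv: "!!h. h:.H ==> act X h u = \<epsilon> h \<odot>[X] u"
 shows "ainv V W X (pt V (W**X) v (pt W X w u)) = pt (V**W) X (pt V W v w) u"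
proof -
 note m [simp] = V[THEN hm_module] W[THEN hm_module] X[THEN hm_module]
 have t: "pt V (W**X) v (pt W X w u):.V**W**X" using u v w by simp
 have s: "pt V W v w:.V**W" using v w by simp
 note L = tmap_lin[OF m(1,2) m(1) tensor_module[OF m(2,3)] klin_id(1) lin_ptens1[OF m(2,3) klin_id(2) u]]
 have "a3 V W X \<psi> (pt V (W**X) v (pt W X w u)) =
   tmap K V (W**X) id (%w. pt W X w u) (a2 V W (N3 \<psi>) (pt V W v w))"
 proof (rule tensor3_eqI[OF mH mH mH amodD(7)[OF amod_a3[OF V W X] t]
    klin_comp[OF klin_comp[OF ahom_lin[OF N_ahom(3)] amodD(7)[OF amod_a2[OF V W] s]] L] _ phi_closed(2)])
  fix a b c assume abc: "a:.H" "b:.H" "c:.H"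
  have e: "act W (\<epsilon> c \<odot>[H] b) w = \<epsilon> c \<odot>[W] act W b w"
   using klin_smult[OF amodD(7)[OF hm_amod[OF W] w]] abc by simp
  have sc: "\<epsilon> c \<odot>[W] act W b w:.W" using e act_closed[OF W, of "\<epsilon> c \<odot>[H] b" w] abc w by simp
  have "pt W X (\<epsilon> c \<odot>[W] act W b w) u = pt W X (act W b w) (\<epsilon> c \<odot>[X] u)"
   using abc u w W by (simp add: ptens_smult)
  then show "a3 V W X (p3 a b c) (pt V (W**X) v (pt W X w u)) =
    tmap K V (W**X) id (%w. pt W X w u) (a2 V W (N3 (p3 a b c)) (pt V W v w))"
   using abc V W X u v w sc by (simp add: a_ptens N_ptens inv e tmap_ptens klin_id lin_ptens1)
 qed
 then show ?thesis
  using u v w amodD(4)[OF amod_a2[OF V W] s] by (simp add: ainv_def N_psi lebr_ptens tmap_ptens klin_id lin_ptens1)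
qed

subsection \<open>The braiding\<close>

lemma braid_lin0: "hm V ==> hm W ==> Z:.P2 ==>
  (%t. flip K V W (a2 V W Z t)) : klin K (V**W) (W**V)"
 by (rule klin_comp[OF amodD(6)[OF amod_a2] flip_lin]) simp_all

lemma braid_eq:
 assumes V: "hm V" and W: "hm W" and t: "t:.V**W"
 shows "br V W t = flip K V W (a2 V W R t)"
proof -
 note m [simp] = V[THEN hm_module] W[THEN hm_module]
 let ?T = "W**V"
 have "flip K V W (a2 V W R t) = tsum2 ?T t (%v w. flip K V W (a2 V W R (pt V W v w)))"
  by (rule lin2_expand[OF m _ braid_lin0[OF V W R_closed(1)] t]) simp
 also have "... = tsum2 ?T t (%v w. tsum2 ?T R (%r s. pt W V (act W s w) (act V r v)))"
 proof (rule tsum2_cong[OF m t])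
  fix v w assume vw: "v:.V" "w:.W"
  have "flip K V W (a2 V W R (pt V W v w)) = tsum2 ?T R (%r s. flip K V W (pt V W (act V r v) (act W s w)))"
   by (rule a2_expand[OF V W R_closed(1) vw _ flip_lin]) simp_all
  also have "... = tsum2 ?T R (%r s. pt W V (act W s w) (act V r v))"
   by (rule tsum2_cong[OF mH mH R_closed(1)]) (use V W vw in "simp_all add: flip_ptens")
  finally show "flip K V W (a2 V W R (pt V W v w)) = tsum2 ?T R (%r s. pt W V (act W s w) (act V r v))" .
  show "tsum2 ?T R (%r s. pt W V (act W s w) (act V r v)):.?T"
   by (rule tsum2_closed[OF mH mH R_closed(1)]) (use V W vw in simp_all)
 qed simp
 finally show ?thesis by (simp add: braid_def)
qed

lemma braid_lin [simp]:
 assumes "hm V" "hm W"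
 shows "br V W : klin K (V**W) (W**V)"
 by (rule klin_cong[OF braid_lin0[OF assms R_closed(1)]]) (use assms in "simp_all add: braid_eq")

lemma braid_closed [simp]: "hm V ==> hm W ==> t:.V**W ==> br V W t:.W**V"
 by (rule klin_closed[OF braid_lin])

lemma flip_D:
 assumes "h:.H"
 shows "flip K H H (\<Delta> h) *2 R = R *2 \<Delta> h"
proof -
 interpret P2: ring P2 by (rule alg_ring[OF aP(1)])
 have "flip K H H (\<Delta> h) = R *2 \<Delta> h *2 Ri"
  using qtqh assms by (simp add: quasitriangular_quasi_hopf_algebra_def flip_def)
 then show ?thesis using assms by (simp add: P2.m_assoc R_R_inv)
qed

lemma braid_hmor [simp]:
 assumes V: "hm V" and W: "hm W"
 shows "br V W : mor (T V W) (T W V)"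
proof (rule hmorI)
 show "br V W : klin K (T V W) (T W V)" using assms by simp
 fix h t assume h: "h:.H" and "t:.T V W"
 then have t: "t:.V**W" by simp
 note A = amod_a2[OF V W]
 have ht: "act (T V W) h t = a2 V W (\<Delta> h) t" by (simp add: act_T a2_def)
 have fD: "flip K H H (\<Delta> h):.P2" by (rule klin_closed[OF flip_lin]) (use h in simp_all)
 have ff: "flip K H H (flip K H H (\<Delta> h)) = \<Delta> h" by (rule flip_flip) (use h in simp_all)
 have "br V W (act (T V W) h t) = flip K V W (a2 V W R (a2 V W (\<Delta> h) t))"
  unfolding ht by (rule braid_eq[OF V W amodD(5)[OF A D_closed[OF h] t]])
 also have "... = flip K V W (a2 V W (flip K H H (\<Delta> h)) (a2 V W R t))"
  using flip_D[OF h] h t fD by (simp add: amodD(3)[OF A, symmetric])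
 also have "... = a2 W V (\<Delta> h) (flip K V W (a2 V W R t))"
  using act2_flip[OF aH aH hm_amod[OF V] hm_amod[OF W] fD amodD(5)[OF A R_closed(1) t]] by (simp add: a2_def ff)
 finally show "br V W (act (T V W) h t) = act (T W V) h (br V W t)"
  by (simp add: braid_eq[OF V W t] act_T a2_def)
qed

lemma braid_surj:
 assumes V: "hm V" and W: "hm W" and s: "s:.W**V"
 obtains t where "t:.V**W" "br V W t = s"
proof
 note A = amod_a2[OF V W]
 have f: "flip K W V s:.V**W" by (rule klin_closed[OF flip_lin s]) (use V W in simp_all)
 show "a2 V W Ri (flip K W V s):.V**W" by (rule amodD(5)[OF A R_closed(2) f])
 then show "br V W (a2 V W Ri (flip K W V s)) = s"
  using f V W s by (simp add: braid_eq amodD(3)[OF A, symmetric] R_R_inv amodD(4)[OF A] flip_flip)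
qed

lemma braid_inj:
 assumes V: "hm V" and W: "hm W" and t: "t:.V**W" "t':.V**W"
  and e: "br V W t = br V W t'"
 shows "t = t'"
proof -
 note A = amod_a2[OF V W]
 have "a2 V W Ri (flip K W V (br V W t)) = t" if "t:.V**W" for t
  using that V W amodD(5)[OF A R_closed(1) that]
  by (simp add: braid_eq flip_flip amodD(3)[OF A, symmetric] R_R_inv amodD(4)[OF A])
 then show ?thesis using t e by metis
qed

lemma braid_natural:
 assumes "hm V" "hm W" "hm V'" "hm W'" "f : mor V V'" "g : mor W W'" and t: "t:.V**W"
 shows "br V' W' (tmap K V' W' f g t) = tmap K W' V' g f (br V W t)"
proof -
 note m = assms(1-4)[THEN hm_module] and l = hmor_lin[OF assms(5)] hmor_lin[OF assms(6)]
 note A = assms(1-4)[THEN hm_amod]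
 have n: "flip K V' W' (tmap K V' W' f g s) = tmap K W' V' g f (flip K V W s)" if s: "s:.V**W" for s
  by (rule tensor_eqI[OF m(1,2) klin_comp[OF tmap_lin flip_lin] klin_comp[OF flip_lin tmap_lin] _ s])
   (use m l in "simp_all add: tmap_ptens flip_ptens klin_closed")
 have a: "tmap K V' W' f g (a2 V W R t) = a2 V' W' R (tmap K V' W' f g t)"
  using act2_tmap[OF aH aH A(1,2) aH aH A(3,4) klin_id(1) klin_id(1) l _ _ R_closed(1) t]
   hmor_act[OF assms(5)] hmor_act[OF assms(6)] by (simp add: a2_def tmap_id)
 have c: "tmap K V' W' f g t:.V'**W'" by (rule klin_closed[OF tmap_lin[OF m l] t])
 show ?thesis
  by (simp add: braid_eq[OF assms(3,4) c] braid_eq[OF assms(1,2) t] a[symmetric] n amodD(5)[OF amod_a2[OF assms(1,2)] _ t])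
qed

definition q23 where "q23 V W X s = tmap K V (X**W) id (flip K W X) s"
definition q12 where "q12 V W X s = rebr K W V X (tmap K (W**V) X (flip K V W) id (lebr K V W X s))"

lemma q_lin:
 assumes "module K V" "module K W" "module K X"
 shows "q23 V W X : klin K (V**W**X) (V**X**W)"
  "q12 V W X : klin K (V**W**X) (W**V**X)"
 using assms unfolding q23_def[abs_def] q12_def[abs_def]
 by (auto intro!: tmap_lin klin_id flip_lin klin_comp[OF klin_comp[OF lebr_lin tmap_lin] rebr_lin])

lemma q_ptens:
 assumes "module K V" "module K W" "module K X" "v:.V" "w:.W" "x:.X"
 shows "q23 V W X (pt V (W**X) v (pt W X w x)) = pt V (X**W) v (pt X W x w)"
  "q12 V W X (pt V (W**X) v (pt W X w x)) = pt W (V**X) w (pt V X v x)"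
 using assms by (simp_all add: q23_def q12_def tmap_ptens klin_id flip_lin flip_ptens lebr_ptens rebr_ptens)

lemma q_ahom: "q23 H H H \<in> ahom K P3 P3" "q12 H H H \<in> ahom K P3 P3"
 unfolding q23_def[abs_def] q12_def[abs_def]
 by (intro ahom_tmap ahom_id ahom_flip ahom_comp[OF ahom_comp[OF ahom_lebr ahom_tmap] ahom_rebr] aH aP)+

lemmas qH_closed [simp] = q_ahom[THEN ahom_lin, THEN klin_closed]

lemma q_q:
 assumes "module K V" "module K W" "module K X" and s: "s:.V**W**X"
 shows "q23 V X W (q23 V W X s) = s" "q12 W V X (q12 V W X s) = s"
 by (rule tensor3_eqI[OF assms(1-3) klin_comp[OF q_lin(1) q_lin(1)] klin_id(2) _ s];
   simp add: assms q_ptens)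
  (rule tensor3_eqI[OF assms(1-3) klin_comp[OF q_lin(2) q_lin(2)] klin_id(2) _ s];
   simp add: assms q_ptens)

lemma a3_q23:
 assumes V: "hm V" and W: "hm W" and X: "hm X" and Z: "Z:.P3" and s: "s:.V**W**X"
 shows "a3 V X W Z (q23 V W X s) = q23 V W X (a3 V W X (q23 H H H Z) s)"
proof -
 note A = hm_amod[OF V] hm_amod[OF W] hm_amod[OF X] and m = V[THEN hm_module] W[THEN hm_module] X[THEN hm_module]
 have Z': "q23 H H H Z:.P3" using Z by simp
 have "q23 V W X (a3 V W X (q23 H H H Z) s) = a3 V X W (tmap K H P2 id (flip K H H) (q23 H H H Z)) (q23 V W X s)"
  unfolding q23_def[of V] a3_def
 proof (rule act2_tmap[OF aH aP(1) A(1) amod_a2[OF W X] aH aP(1) A(1) amod_a2[OF X W] klin_id(1) flip_lin klin_id(1) flip_lin _ _ Z' s])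
  show "flip K W X (a2 W X c w) = a2 X W (flip K H H c) (flip K W X w)" if "c:.P2" "w:.W**X" for c w
   unfolding a2_def by (rule act2_flip[OF aH aH A(2,3) that])
 qed (simp_all add: m)
 also have "tmap K H P2 id (flip K H H) (q23 H H H Z) = Z"
  using q_q(1)[OF mH mH mH Z] by (simp add: q23_def)
 finally show ?thesis ..
qed

lemma a3_q12:
 assumes V: "hm V" and W: "hm W" and X: "hm X" and Z: "Z:.P3" and s: "s:.V**W**X"
 shows "a3 W V X Z (q12 V W X s) = q12 V W X (a3 V W X (q12 H H H Z) s)"
proof -
 note A = hm_amod[OF V] hm_amod[OF W] hm_amod[OF X] and m = V[THEN hm_module] W[THEN hm_module] X[THEN hm_module]
 define Y where "Y = q12 H H H Z"
 have Y: "Y:.P3" using Z by (simp add: Y_def)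
 have lY: "lebr K H H H Y:.P2**H" by (rule klin_closed[OF lebr_lin Y]) simp_all
 have ls: "lebr K V W X s:.(V**W)**X" by (rule klin_closed[OF lebr_lin s]) (simp_all add: m)
 have ft: "tmap K (W**V) X (flip K V W) id (lebr K V W X s):.(W**V)**X"
  by (rule klin_closed[OF tmap_lin[OF _ _ _ _ flip_lin klin_id(1)] ls]) (simp_all add: m)
 have fY: "tmap K P2 H (flip K H H) id (lebr K H H H Y):.P2**H"
  by (rule klin_closed[OF tmap_lin[OF _ _ _ _ flip_lin klin_id(1)] lY]) simp_all
 have 1: "lebr K V W X (a3 V W X Y s) = act2 K (V**W) X (a2 V W) (act X) (lebr K H H H Y) (lebr K V W X s)"
  unfolding a2_def a3_def
  using act2_lebr[OF aH aH aH A lY s] by (simp add: rebr_lebr(1)[OF mH mH mH Y])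
 have 2: "tmap K (W**V) X (flip K V W) id (act2 K (V**W) X (a2 V W) (act X) (lebr K H H H Y) (lebr K V W X s)) =
  act2 K (W**V) X (a2 W V) (act X) (tmap K P2 H (flip K H H) id (lebr K H H H Y)) (tmap K (W**V) X (flip K V W) id (lebr K V W X s))"
 proof (rule act2_tmap[OF aP(1) aH amod_a2[OF V W] A(3) aP(1) aH amod_a2[OF W V] A(3) flip_lin klin_id(1) flip_lin klin_id(1) _ _ lY ls])
  show "flip K V W (a2 V W c w) = a2 W V (flip K H H c) (flip K V W w)" if "c:.P2" "w:.V**W" for c w
   unfolding a2_def by (rule act2_flip[OF aH aH A(1,2) that])
 qed (simp_all add: m)
 have "q12 V W X (a3 V W X Y s) = a3 W V X (q12 H H H Y) (q12 V W X s)"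
  unfolding q12_def 1 2 unfolding a3_def a2_def by (rule act2_rebr[OF aH aH aH A(2,1,3) fY ft])
 moreover have "q12 H H H Y = Z" unfolding Y_def by (rule q_q(2)[OF mH mH mH Z])
 ultimately show ?thesis by (simp add: Y_def)
qed

definition "R12 = rebr K H H H (pt P2 H R 1H)"
definition "R23 = q3 1H R"

lemma R12_closed [simp]: "R12:.P3" and R23_closed [simp]: "R23:.P3"
 unfolding R12_def R23_def by (rule klin_closed[OF rebr_lin]) simp_all

lemma braid_left:
 assumes V: "hm V" and W: "hm W" and X: "hm X" and s: "s:.V**W**X"
 shows "rebr K W V X (tmap K (W**V) X (br V W) id (lebr K V W X s)) = q12 V W X (a3 V W X R12 s)"
proof -
 note A = hm_amod[OF V] hm_amod[OF W] hm_amod[OF X] and m [simp] = V[THEN hm_module] W[THEN hm_module] X[THEN hm_module]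
 have ls: "lebr K V W X s:.(V**W)**X" by (rule klin_closed[OF lebr_lin s]) simp_all
 have R1: "pt P2 H R 1H:.P2**H" by simp
 have "tmap K (W**V) X (br V W) id (lebr K V W X s) =
   tmap K (W**V) X (%x. flip K V W (a2 V W R x)) (%x. id (act X 1H x)) (lebr K V W X s)"
  by (rule tmap_cong[OF _ _ _ _ braid_lin0 _ _ _ ls])
   (use V W X amodD(4)[OF A(3)] in "auto simp: braid_eq intro!: amodD(6)[OF A(3)]")
 also have "... = tmap K (W**V) X (flip K V W) id (tmap K (V**W) X (a2 V W R) (act X 1H) (lebr K V W X s))"
  by (rule tmap_comp[symmetric, OF _ _ _ _ _ _ amodD(6)[OF amod_a2[OF V W]] amodD(6)[OF A(3)] flip_lin klin_id(1) ls]) simp_all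
 also have "tmap K (V**W) X (a2 V W R) (act X 1H) (lebr K V W X s) = lebr K V W X (a3 V W X R12 s)"
  using act2_ptens[OF aP(1) aH amod_a2[OF V W] A(3) R_closed(1) H_closed(2) ls] act2_lebr[OF aH aH aH A R1 s]
  by (simp add: a2_def a3_def R12_def)
 finally show ?thesis by (simp add: q12_def id_def)
qed

lemma braid_right:
 assumes V: "hm V" and W: "hm W" and X: "hm X" and s: "s:.V**W**X"
 shows "tmap K V (X**W) id (br W X) s = q23 V W X (a3 V W X R23 s)"
proof -
 note A = hm_amod[OF V] hm_amod[OF W] hm_amod[OF X] and m [simp] = V[THEN hm_module] W[THEN hm_module] X[THEN hm_module]
 have "tmap K V (X**W) id (br W X) s = tmap K V (X**W) (%x. id (act V 1H x)) (%x. flip K W X (a2 W X R x)) s"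
  by (rule tmap_cong[OF _ _ _ _ _ braid_lin0 _ _ s])
   (use V W X amodD(4)[OF A(1)] in "auto simp: braid_eq intro!: amodD(6)[OF A(1)]")
 also have "... = tmap K V (X**W) id (flip K W X) (tmap K V (W**X) (act V 1H) (a2 W X R) s)"
  by (rule tmap_comp[symmetric, OF _ _ _ _ _ _ amodD(6)[OF A(1)] amodD(6)[OF amod_a2[OF W X]] klin_id(1) flip_lin s]) simp_all
 also have "tmap K V (W**X) (act V 1H) (a2 W X R) s = a3 V W X R23 s"
  using act2_ptens[OF aH aP(1) A(1) amod_a2[OF W X] H_closed(2) R_closed(1) s] by (simp add: a3_def R23_def)
 finally show ?thesis by (simp add: q23_def id_def)
qed

lemma legs:
 assumes X: "X:.P3"
 shows "leg3 K H 1 2 3 X = X" "leg3 K H 1 3 2 X = q23 H H H X" "leg3 K H 2 1 3 X = q12 H H H X"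
  "leg3 K H 3 1 2 X = q23 H H H (q12 H H H X)" "leg3 K H 2 3 1 X = q12 H H H (q23 H H H X)"
proof -
 note l = q_ahom[THEN ahom_lin]
 have *: "L X = tsum3 P3 X f" if "L : klin K P3 P3"
  "!!a b c. a:.H ==> b:.H ==> c:.H ==> f a b c = L (p3 a b c)" for L f
  unfolding lin3_expand[OF mH mH mH tensor_module[OF mH tensor_module[OF mH mH]] that(1) X]
  by (rule tsum3_cong[OF mH mH mH X]) (use that(2) klin_closed[OF that(1)] in auto)
 show "leg3 K H 1 2 3 X = X" unfolding leg3_def
  by (rule *[OF klin_id(2), symmetric]) (simp add: pt3_def Let_def)
 show "leg3 K H 1 3 2 X = q23 H H H X" unfolding leg3_def
  by (rule *[OF l(1), symmetric]) (simp add: pt3_def Let_def q_ptens)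
 show "leg3 K H 2 1 3 X = q12 H H H X" unfolding leg3_def
  by (rule *[OF l(2), symmetric]) (simp add: pt3_def Let_def q_ptens)
 show "leg3 K H 3 1 2 X = q23 H H H (q12 H H H X)" unfolding leg3_def
  by (rule *[OF klin_comp[OF l(2,1)], symmetric]) (simp add: pt3_def Let_def q_ptens)
 show "leg3 K H 2 3 1 X = q12 H H H (q23 H H H X)" unfolding leg3_def
  by (rule *[OF klin_comp[OF l(1,2)], symmetric]) (simp add: pt3_def Let_def q_ptens)
qed

lemma legs2:
 "leg2 K H 1 2 R = R12" "leg2 K H 2 3 R = R23" "leg2 K H 1 3 R = q23 H H H R12" "leg2 K H 1 3 R = q12 H H H R23"
proof -
 have *: "L R = tsum2 P3 R f" if "L : klin K P2 P3"
  "!!a b. a:.H ==> b:.H ==> f a b = L (p2 a b)" for L f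
  unfolding lin2_expand[OF mH mH tensor_module[OF mH tensor_module[OF mH mH]] that(1) R_closed(1)]
  by (rule tsum2_cong[OF mH mH R_closed(1)]) (use that(2) klin_closed[OF that(1)] in auto)
 have l12: "(%R. rebr K H H H (pt P2 H R 1H)) : klin K P2 P3"
  by (rule klin_comp[OF lin_ptens1[OF _ _ klin_id(2)] rebr_lin]) simp_all
 have l23: "(%R. q3 1H R) : klin K P2 P3"
  by (rule lin_ptens2[OF _ _ klin_id(2)]) simp_all
 note q = q_ahom[THEN ahom_lin]
 show "leg2 K H 1 2 R = R12" unfolding leg2_def R12_def
  by (rule *[OF l12, symmetric]) (simp add: pt3_def Let_def rebr_ptens)
 show "leg2 K H 2 3 R = R23" unfolding leg2_def R23_def
  by (rule *[OF l23, symmetric]) (simp add: pt3_def Let_def)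
 show "leg2 K H 1 3 R = q23 H H H R12" unfolding leg2_def R12_def
  by (rule *[OF klin_comp[OF l12 q(1)], symmetric]) (simp add: pt3_def Let_def rebr_ptens q_ptens)
 show "leg2 K H 1 3 R = q12 H H H R23" unfolding leg2_def R23_def
  by (rule *[OF klin_comp[OF l23 q(2)], symmetric]) (simp add: pt3_def Let_def q_ptens)
qed

lemma hexagon_R:
 "q12 H H H (q23 H H H \<phi>) *3 Dr R = q12 H H H R23 *3 (q12 H H H \<phi> *3 (R12 *3 \<psi>))"
 "Dl R *3 \<psi> = q23 H H H (q12 H H H \<phi> *3 (R12 *3 \<psi>)) *3 R23"
proof -
 interpret P3: ring P3 by (rule alg_ring[OF aP(2)])
 have qq: "(%X. q12 H H H (q23 H H H X)) \<in> ahom K P3 P3" by (rule ahom_comp[OF q_ahom])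
 note u = ahom_inv'[OF aP(2) qq phi_unit aP(2)] ahom_inv'[OF aP(2) q_ahom(1) phi_unit aP(2)]
 have Dr: "Dr R = tsum2 P3 R (%r s. q3 r (\<Delta> s))" by (simp add: Dr_def tmap_eq)
 note [simp] = phi_inv_def[symmetric]
 have 1: "Dr R = inv\<^bsub>P3\<^esub> (q12 H H H (q23 H H H \<phi>)) *3 q12 H H H R23 *3 q12 H H H \<phi> *3 R12 *3 \<psi>"
  using qtqh unfolding Dr quasitriangular_quasi_hopf_algebra_def
  by (simp add: legs[simplified] legs2(1,2,4)[simplified])
 show "q12 H H H (q23 H H H \<phi>) *3 Dr R = q12 H H H R23 *3 (q12 H H H \<phi> *3 (R12 *3 \<psi>))"
  unfolding 1 using u(1) P3.Units_r_inv[OF u(1)] P3.Units_inv_closed[OF u(1)]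
  by (simp add: P3.m_assoc[symmetric])
 have 2: "Dl R = q23 H H H (q12 H H H \<phi>) *3 q23 H H H R12 *3 inv\<^bsub>P3\<^esub> (q23 H H H \<phi>) *3 R23 *3 \<phi>"
  using qtqh unfolding Dl_expand[OF R_closed(1)] quasitriangular_quasi_hopf_algebra_def
  by (simp add: legs[simplified] legs2(1,2,3)[simplified])
 show "Dl R *3 \<psi> = q23 H H H (q12 H H H \<phi> *3 (R12 *3 \<psi>)) *3 R23"
  unfolding 2 u(4) by (simp add: P3.m_assoc phi_phi_inv ahom_mult[OF q_ahom(1)])
qed

definition "crl V W X t = asc W V X (tmap K (W**V) X (br V W) id (ainv V W X t))"

lemma crl_a3:
 assumes V: "hm V" and W: "hm W" and X: "hm X" and t: "t:.V**W**X"
 shows "crl V W X t = q12 V W X (a3 V W X (q12 H H H \<phi> *3 (R12 *3 \<psi>)) t)"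
proof -
 interpret P3: ring P3 by (rule alg_ring[OF aP(2)])
 note m [simp] = V[THEN hm_module] W[THEN hm_module] X[THEN hm_module]
 note A = amod_a3[OF V W X]
 have s: "a3 V W X \<psi> t:.V**W**X" by (rule amodD(5)[OF A phi_closed(2) t])
 have c: "tmap K (W**V) X (br V W) id (ainv V W X t):.(W**V)**X"
  by (rule klin_closed[OF tmap_lin[OF _ _ _ _ braid_lin klin_id(1)]]) (use V W X t in simp_all)
 have "crl V W X t = a3 W V X \<phi> (rebr K W V X (tmap K (W**V) X (br V W) id (lebr K V W X (a3 V W X \<psi> t))))"
  unfolding crl_def assoc_eq[OF W V X c] by (simp add: ainv_def)
 also have "... = q12 V W X (a3 V W X (q12 H H H \<phi>) (a3 V W X R12 (a3 V W X \<psi> t)))"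
  unfolding braid_left[OF V W X s] by (rule a3_q12[OF V W X phi_closed(1) amodD(5)[OF A R12_closed s]])
 finally show ?thesis using t s by (simp add: amodD(3)[OF A])
qed

lemma braid_pair_left:
 assumes V: "hm V" and W: "hm W" and Y: "hm Y" and t: "t:.V**W**Y"
 shows "br (T V W) Y (ainv V W Y t) = crl V Y W (tmap K V (Y**W) id (br W Y) t)"
proof -
 interpret P3: ring P3 by (rule alg_ring[OF aP(2)])
 note A = hm_amod[OF V] hm_amod[OF W] hm_amod[OF Y] and m [simp] = V[THEN hm_module] W[THEN hm_module] Y[THEN hm_module]
 note A3 = amod_a3[OF V W Y]
 let ?Z = "q12 H H H \<phi> *3 (R12 *3 \<psi>)"
 have s: "a3 V W Y \<psi> t:.V**W**Y" by (rule amodD(5)[OF A3 phi_closed(2) t])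
 have u: "ainv V W Y t:.(V**W)**Y" using V W Y t by simp
 have DR: "tmap K P2 H \<Delta> id R:.P2**H" by (rule klin_closed[OF tmap_lin[OF _ _ _ _ D_lin klin_id(1)]]) simp_all
 have fl: "flip K (V**W) Y (lebr K V W Y s) = q12 V Y W (q23 V W Y s)" if s: "s:.V**W**Y" for s
  by (rule tensor3_eqI[OF m(1-3) klin_comp[OF lebr_lin flip_lin] klin_comp[OF q_lin(1) q_lin(2)] _ s])
   (simp_all add: lebr_ptens flip_ptens q_ptens)
 have "br (T V W) Y (ainv V W Y t) = flip K (V**W) Y (act2 K (V**W) Y (act (T V W)) (act Y) R (ainv V W Y t))"
  using braid_eq[of "T V W" Y "ainv V W Y t"] V W Y u by (simp add: a2_def)
 also have "act2 K (V**W) Y (act (T V W)) (act Y) R (ainv V W Y t) =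
   act2 K (V**W) Y (act2 K V W (act V) (act W)) (act Y) (tmap K P2 H \<Delta> id R) (ainv V W Y t)"
  by (rule act2_change[OF aH aH amod_T[OF V W] A(3) aP(1) aH amod_tensor[OF aH aH A(1,2)] A(3) D_lin klin_id(1) _ _ R_closed(1) u])
   (simp_all add: act_T)
 also have "... = lebr K V W Y (a3 V W Y (Dl R) (a3 V W Y \<psi> t))"
  unfolding ainv_def using act2_lebr[OF aH aH aH A DR s] by (simp add: a3_def a2_def Dl_def)
 also have "a3 V W Y (Dl R) (a3 V W Y \<psi> t) = a3 V W Y (q23 H H H ?Z *3 R23) t"
  using t hexagon_R(2) by (simp add: amodD(3)[OF A3, symmetric])
 also have "flip K (V**W) Y (lebr K V W Y ...) = q12 V Y W (q23 V W Y (a3 V W Y (q23 H H H ?Z) (a3 V W Y R23 t)))"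
  using t by (subst fl) (simp_all add: amodD(3)[OF A3] amodD(5)[OF A3])
 also have "... = q12 V Y W (a3 V Y W ?Z (q23 V W Y (a3 V W Y R23 t)))"
  by (simp add: a3_q23[OF V W Y _ amodD(5)[OF A3 R23_closed t]])
 also have "... = crl V Y W (tmap K V (Y**W) id (br W Y) t)"
  unfolding braid_right[OF V W Y t]
  by (rule crl_a3[symmetric, OF V Y W klin_closed[OF q_lin(1) amodD(5)[OF A3 R23_closed t]]]) simp_all
 finally show ?thesis .
qed

lemma braid_pair_right:
 assumes Y: "hm Y" and V: "hm V" and W: "hm W" and t: "t:.Y**V**W"
 shows "asc V W Y (br Y (T V W) t) = tmap K V (W**Y) id (br Y W) (crl Y V W t)"
proof -
 interpret P3: ring P3 by (rule alg_ring[OF aP(2)])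
 note A = hm_amod[OF V] hm_amod[OF W] hm_amod[OF Y] and m [simp] = V[THEN hm_module] W[THEN hm_module] Y[THEN hm_module]
 note A3 = amod_a3[OF Y V W]
 let ?Z = "q12 H H H \<phi> *3 (R12 *3 \<psi>)"
 have fl: "rebr K V W Y (flip K Y (V**W) s) = q23 V Y W (q12 Y V W s)" if s: "s:.Y**V**W" for s
  by (rule tensor3_eqI[OF m(3,1,2) klin_comp[OF flip_lin rebr_lin] klin_comp[OF q_lin(2) q_lin(1)] _ s])
   (simp_all add: rebr_ptens flip_ptens q_ptens)
 have d: "a3 Y V W (Dr R) t:.Y**V**W" by (rule amodD(5)[OF A3 _ t]) simp
 have "a2 Y (T V W) R t = a3 Y V W (Dr R) t"
  using act2_change[OF aH aH A(3) amod_T[OF V W] aH aP(1) A(3) amod_a2[OF V W] klin_id(1) D_lin _ _ R_closed(1) t]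
  by (simp add: act_T a2_def a3_def Dr_def)
 then have b: "br Y (T V W) t = flip K Y (V**W) (a3 Y V W (Dr R) t)"
  using braid_eq[of Y "T V W" t] V W Y t by simp
 have bc: "flip K Y (V**W) (a3 Y V W (Dr R) t):.(V**W)**Y"
  by (rule klin_closed[OF flip_lin d]) simp_all
 have q: "q12 Y V W (a3 Y V W (Dr R) t):.V**Y**W"
  by (rule klin_closed[OF q_lin(2) d]) simp_all
 have "asc V W Y (br Y (T V W) t) = a3 V W Y \<phi> (q23 V Y W (q12 Y V W (a3 Y V W (Dr R) t)))"
  unfolding b assoc_eq[OF V W Y bc] fl[OF d] ..
 also have "... = q23 V Y W (q12 Y V W (a3 Y V W (q12 H H H (q23 H H H \<phi>)) (a3 Y V W (Dr R) t)))"
  by (simp add: a3_q23[OF V Y W phi_closed(1) q] a3_q12[OF Y V W _ d])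
 also have "a3 Y V W (q12 H H H (q23 H H H \<phi>)) (a3 Y V W (Dr R) t) = a3 Y V W (q12 H H H R23) (a3 Y V W ?Z t)"
  using t hexagon_R(1) by (simp add: amodD(3)[OF A3, symmetric])
 also have "q23 V Y W (q12 Y V W ...) = q23 V Y W (a3 V Y W R23 (q12 Y V W (a3 Y V W ?Z t)))"
  by (simp add: a3_q12[OF Y V W R23_closed amodD(5)[OF A3 _ t]])
 also have "... = tmap K V (W**Y) id (br Y W) (crl Y V W t)"
  unfolding crl_a3[OF Y V W t]
  by (rule braid_right[symmetric, OF V Y W klin_closed[OF q_lin(2) amodD(5)[OF A3 _ t]]]) simp_all
 finally show ?thesis .
qed

end

context qtqh
begin

section \<open>Right-normed calculus\<close>

lemma hmor_closed: "f : mor V W ==> x:.V ==> f x:.W"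
 by (rule klin_closed[OF hmor_lin])

lemma hmor_comp: "f : mor V W ==> g : mor W X ==> (%x. g (f x)) : mor V X"
 by (intro hmorI) (auto intro: klin_comp hmor_lin simp: hmor_act hmor_closed)

lemma hmor_id: "id : mor V V" "(%x. x) : mor V V"
 by (auto intro!: hmorI klin_id)

lemma hmor_cong:
 assumes f: "f : mor V W" and V: "hm V" and e: "!!x. x:.V ==> f x = g x"
 shows "g : mor V W"
 using klin_cong[OF hmor_lin[OF f] hm_module[OF V] e] hmor_act[OF f] act_closed[OF V]
 by (intro hmorI) (auto simp: e[symmetric])

lemma hmor_tmap:
 assumes "hm V" "hm W" "hm V'" "hm W'" "f : mor V V'" "g : mor W W'"
 shows "tmap K V' W' f g : mor (T V W) (T V' W')"
proof (rule hmorI)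
 note A = assms(1-4)[THEN hm_amod] and l = hmor_lin[OF assms(5)] hmor_lin[OF assms(6)]
 show "tmap K V' W' f g : klin K (T V W) (T V' W')" using assms(1-4) by (simp add: tmap_lin l)
 fix h t assume h: "h:.H" and t: "t:.T V W"
 then show "tmap K V' W' f g (act (T V W) h t) = act (T V' W') h (tmap K V' W' f g t)"
  using act2_tmap[OF aH aH A(1,2) aH aH A(3,4) klin_id(1) klin_id(1) l _ _ D_closed[OF h], of t]
   hmor_act[OF assms(5)] hmor_act[OF assms(6)] by (simp add: act_T tmap_id)
qed

text \<open>Application of a map to the right or the left factor, and of a binary operation to the first two factors of a right-normed product. The arguments name source and target modules, so that the conditions of the rules below are determined by matching.\<close>

definition "wl V M M' g = tmap K V M' id g"
definition "wr V X M f = tmap K X M f id"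
definition "rtl V W X M f t = wr (T V W) X M f (ainv V W M t)"

lemma wl_hmor [simp]: "hm V ==> hm M ==> hm M' ==> g : mor M M' ==> wl V M M' g : mor (T V M) (T V M')"
 unfolding wl_def by (intro hmor_tmap hmor_id)

lemma wr_hmor [simp]: "hm V ==> hm X ==> hm M ==> f : mor V X ==> wr V X M f : mor (T V M) (T X M)"
 unfolding wr_def by (intro hmor_tmap hmor_id)

lemma wl_closed [simp]: "hm V ==> hm M ==> hm M' ==> g : mor M M' ==> t:.V**M ==>
  wl V M M' g t:.V**M'"
 using hmor_closed[OF wl_hmor] by fastforce

lemma wr_closed [simp]: "hm V ==> hm X ==> hm M ==> f : mor V X ==> t:.V**M ==>
  wr V X M f t:.X**M"
 using hmor_closed[OF wr_hmor] by fastforce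

lemma rtl_hmor [simp]: "hm V ==> hm W ==> hm X ==> hm M ==> f : mor (T V W) X ==>
  rtl V W X M f : mor (T V (T W M)) (T X M)"
 unfolding rtl_def[abs_def] by (intro hmor_comp[OF ainv_hmor wr_hmor]) simp_all

lemma rtl_closed [simp]: "hm V ==> hm W ==> hm X ==> hm M ==> f : mor (T V W) X ==>
  t:.V**W**M ==> rtl V W X M f t:.X**M"
 using hmor_closed[OF rtl_hmor] by fastforce

lemma crl_hmor [simp]:
 assumes "hm V" "hm W" "hm M"
 shows "crl V W M : mor (T V (T W M)) (T W (T V M))"
proof -
 have "tmap K (W**V) M (br V W) id : mor (T (T V W) M) (T (T W V) M)"
  using hmor_tmap[of "T V W" M "T W V" M "br V W" id, OF _ _ _ _ _ hmor_id(1)] assms by simp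
 then show ?thesis unfolding crl_def[abs_def]
  by (intro hmor_comp[OF hmor_comp[OF ainv_hmor] assoc_hmor]) (use assms in "simp_all add: id_def")
qed

lemma crl_closed [simp]: "hm V ==> hm W ==> hm M ==> t:.V**W**M ==>
  crl V W M t:.W**V**M"
 using hmor_closed[OF crl_hmor] by fastforce

text \<open>The equation on the carrier lets the simplifier match nested products whose fields have already been reduced.\<close>

lemma wl_in [simp]:
 "P = V**M' ==> hm V ==> hm M ==> hm M' ==> g : mor M M' ==> t:.V**M ==> wl V M M' g t:.P"
 by simp

lemma wr_in [simp]:
 "P = X**M ==> hm V ==> hm X ==> hm M ==> f : mor V X ==> t:.V**M ==> wr V X M f t:.P"
 by simp

lemma rtl_in [simp]:
 "P = X**M ==> hm V ==> hm W ==> hm X ==> hm M ==> f : mor (T V W) X ==> t:.V**W**M ==>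
  rtl V W X M f t:.P"
 by simp

lemma wl_ptens:
 assumes "hm V" "hm M" "hm M'" "g : mor M M'" "v:.V" "r:.M"
 shows "wl V M M' g (pt V M v r) = pt V M' v (g r)"
 using assms by (simp add: wl_def tmap_ptens klin_id hmor_lin)

lemma wr_ptens:
 assumes "hm V" "hm X" "hm M" "f : mor V X" "v:.V" "r:.M"
 shows "wr V X M f (pt V M v r) = pt X M (f v) r"
 using assms by (simp add: wr_def tmap_ptens klin_id hmor_lin)

lemma wl_square:
 assumes "hm V" "hm M" "hm S" "hm S'" "hm Q" "g : mor M S" "g' : mor S Q" "k : mor M S'" "k' : mor S' Q"
  and e: "!!x. x:.M ==> g' (g x) = k' (k x)" and t: "t:.V**M"
 shows "wl V S Q g' (wl V M S g t) = wl V S' Q k' (wl V M S' k t)"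
 by (rule tensor_eqI[OF _ _ klin_comp[OF hmor_lin[OF wl_hmor] hmor_lin[OF wl_hmor], simplified]
    klin_comp[OF hmor_lin[OF wl_hmor] hmor_lin[OF wl_hmor], simplified] _ t])
  (use assms in "simp_all add: wl_ptens hmor_closed")

lemma wl_comp:
 assumes "hm V" "hm M" "hm S" "hm Q" "g : mor M S" "g' : mor S Q" "k : mor M Q"
  and e: "!!x. x:.M ==> g' (g x) = k x" and t: "t:.V**M"
 shows "wl V S Q g' (wl V M S g t) = wl V M Q k t"
 by (rule tensor_eqI[OF _ _ klin_comp[OF hmor_lin[OF wl_hmor] hmor_lin[OF wl_hmor], simplified]
    hmor_lin[OF wl_hmor, simplified] _ t])
  (use assms in "simp_all add: wl_ptens hmor_closed")

lemma wl_id: "hm V ==> hm M ==> t:.V**M ==> (!!x. x:.M ==> g x = x) ==> wl V M M g t = t"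
 unfolding wl_def
 by (subst tmap_cong[OF _ _ _ _ klin_id(1) klin_id(1)]) (auto simp: tmap_id)

lemma wr_square:
 assumes "hm V" "hm M" "hm S" "hm S'" "hm Q" "g : mor V S" "g' : mor S Q" "k : mor V S'" "k' : mor S' Q"
  and e: "!!x. x:.V ==> g' (g x) = k' (k x)" and t: "t:.V**M"
 shows "wr S Q M g' (wr V S M g t) = wr S' Q M k' (wr V S' M k t)"
 by (rule tensor_eqI[OF _ _ klin_comp[OF hmor_lin[OF wr_hmor] hmor_lin[OF wr_hmor], simplified]
    klin_comp[OF hmor_lin[OF wr_hmor] hmor_lin[OF wr_hmor], simplified] _ t])
  (use assms in "simp_all add: wr_ptens hmor_closed")

lemma wr_comp:
 assumes "hm V" "hm M" "hm S" "hm Q" "g : mor V S" "g' : mor S Q" "k : mor V Q"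
  and e: "!!x. x:.V ==> g' (g x) = k x" and t: "t:.V**M"
 shows "wr S Q M g' (wr V S M g t) = wr V Q M k t"
 by (rule tensor_eqI[OF _ _ klin_comp[OF hmor_lin[OF wr_hmor] hmor_lin[OF wr_hmor], simplified]
    hmor_lin[OF wr_hmor, simplified] _ t])
  (use assms in "simp_all add: wr_ptens hmor_closed")

lemma wr_wl:
 assumes "hm V" "hm M" "hm V'" "hm M'" "f : mor V V'" "g : mor M M'" and t: "t:.V**M"
 shows "wr V V' M' f (wl V M M' g t) = wl V' M M' g (wr V V' M f t)"
 by (rule tensor_eqI[OF _ _ klin_comp[OF hmor_lin[OF wl_hmor] hmor_lin[OF wr_hmor], simplified]
    klin_comp[OF hmor_lin[OF wr_hmor] hmor_lin[OF wl_hmor], simplified] _ t])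
  (use assms in "simp_all add: wl_ptens wr_ptens hmor_closed")

lemma ainv_wl_wl:
 assumes "hm V" "hm W" "hm M" "hm M'" "k : mor M M'" "t:.V**W**M"
 shows "ainv V W M' (wl V (T W M) (T W M') (wl W M M' k) t) = wl (T V W) M M' k (ainv V W M t)"
proof -
 have "tmap K (V**W) M' (tmap K V W id id) k (ainv V W M t) = tmap K (V**W) M' id k (ainv V W M t)"
  by (rule tmap_cong[OF _ _ _ _ klin_id(1) hmor_lin[OF assms(5)] _ _ ainv_closed[OF assms(1-3,6)]])
   (use assms in "auto simp: tmap_id")
 then show ?thesis
  using ainv_natural[OF assms(1-3) assms(1,2,4) hmor_id(1) hmor_id(1) assms(5,6)] by (simp add: wl_def)
qed

lemma ainv_wl_wr:
 assumes "hm V" "hm W" "hm W'" "hm M" "q : mor W W'" "t:.V**W**M"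
 shows "ainv V W' M (wl V (T W M) (T W' M) (wr W W' M q) t) = wr (T V W) (T V W') M (wl V W W' q) (ainv V W M t)"
 using ainv_natural[OF assms(1,2,4) assms(1,3,4) hmor_id(1) assms(5) hmor_id(1) assms(6)]
 by (simp add: wl_def wr_def)

lemma ainv_wr:
 assumes "hm V" "hm W" "hm V'" "hm M" "p : mor V V'" "t:.V**W**M"
 shows "ainv V' W M (wr V V' (T W M) p t) = wr (T V W) (T V' W) M (wr V V' W p) (ainv V W M t)"
proof -
 have "tmap K V' (W**M) p (tmap K W M id id) t = tmap K V' (W**M) p id t"
  by (rule tmap_cong[OF _ _ _ _ hmor_lin[OF assms(5)] klin_id(1) _ _ assms(6)]) (use assms in "auto simp: tmap_id")
 then show ?thesis
  using ainv_natural[OF assms(1,2,4) assms(3,2,4) assms(5) hmor_id(1) hmor_id(1) assms(6)] assms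
  by (simp add: wr_def)
qed

lemma rtl_wl:
 assumes "hm V" "hm W" "hm X" "hm M" "hm M'" "f : mor (T V W) X" "k : mor M M'" "t:.V**W**M"
 shows "wl X M M' k (rtl V W X M f t) = rtl V W X M' f (wl V (T W M) (T W M') (wl W M M' k) t)"
 using assms by (simp add: rtl_def ainv_wl_wl wr_wl)

lemma rtl_post:
 assumes "hm V" "hm W" "hm X" "hm Y" "hm M" "f : mor (T V W) X" "h : mor X Y" "f' : mor (T V W) Y"
  "!!s. s:.V**W ==> h (f s) = f' s" "t:.V**W**M"
 shows "wr X Y M h (rtl V W X M f t) = rtl V W Y M f' t"
 unfolding rtl_def by (rule wr_comp[OF _ _ _ _ assms(6,7,8)]) (use assms in simp_all)

lemma rtl_pre1:
 assumes "hm V" "hm V'" "hm W" "hm X" "hm M" "p : mor V V'" "f : mor (T V' W) X" "f' : mor (T V W) X"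
  "!!s. s:.V**W ==> f (wr V V' W p s) = f' s" "t:.V**W**M"
 shows "rtl V' W X M f (wr V V' (T W M) p t) = rtl V W X M f' t"
 unfolding rtl_def ainv_wr[OF assms(1,3,2,5,6,10)]
 by (rule wr_comp[OF _ _ _ _ _ assms(7,8)]) (use assms in simp_all)

lemma rtl_pre2:
 assumes "hm V" "hm W" "hm W'" "hm X" "hm M" "q : mor W W'" "f : mor (T V W') X" "f' : mor (T V W) X"
  "!!s. s:.V**W ==> f (wl V W W' q s) = f' s" "t:.V**W**M"
 shows "rtl V W' X M f (wl V (T W M) (T W' M) (wr W W' M q) t) = rtl V W X M f' t"
 unfolding rtl_def ainv_wl_wr[OF assms(1,2,3,5,6,10)]
 by (rule wr_comp[OF _ _ _ _ _ assms(7,8)]) (use assms in simp_all)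

text \<open>The rebracketing of a fourfold right-normed product that exposes its last factor.\<close>

definition "ainv2 U V W M t = ainv U (T V W) M (wl U (T V (T W M)) (T (T V W) M) (ainv V W M) t)"

lemma ainv2_closed [simp]:
 "hm U ==> hm V ==> hm W ==> hm M ==> t:.U**V**W**M ==>
  ainv2 U V W M t:.(U**V**W)**M"
 unfolding ainv2_def using ainv_closed[of U "T V W" M] wl_closed[of U "T V (T W M)" "T (T V W) M" "ainv V W M" t] by simp

lemma ainv2_inner:
 assumes U: "hm U" and V: "hm V" and W: "hm W" and M: "hm M" and X: "hm X" and L: "hm L"
  and g: "g : mor (T V W) X" and k: "k : mor (T U X) L" and f: "f : mor (T U (T V W)) L"
  and e: "!!s. s:.U**V**W ==> k (wl U (T V W) X g s) = f s"
  and t: "t:.U**V**W**M"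
 shows "wr (T U (T V W)) L M f (ainv2 U V W M t) = rtl U X L M k (wl U (T V (T W M)) (T X M) (rtl V W X M g) t)"
proof -
 note [simp] = U V W M X L
 let ?s = "wl U (T V (T W M)) (T (T V W) M) (ainv V W M) t"
 have s: "?s:.U**(V**W)**M"
  using wl_closed[of U "T V (T W M)" "T (T V W) M" "ainv V W M" t] t by simp
 have "wl U (T V (T W M)) (T X M) (rtl V W X M g) t = wl U (T (T V W) M) (T X M) (wr (T V W) X M g) ?s"
  by (rule wl_comp[symmetric]) (use t g in "simp_all add: rtl_def")
 then have "rtl U X L M k (wl U (T V (T W M)) (T X M) (rtl V W X M g) t) = rtl U (T V W) L M f ?s"
  using rtl_pre2[of U "T V W" X L M g k f ?s] g k f e s by simp
 then show ?thesis by (simp add: rtl_def ainv2_def)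
qed

lemma ainv2_outer:
 assumes U: "hm U" and V: "hm V" and W: "hm W" and M: "hm M" and X: "hm X" and L: "hm L"
  and g: "g : mor (T U V) X" and k: "k : mor (T X W) L" and f: "f : mor (T U (T V W)) L"
  and e: "!!s. s:.U**V**W ==> k (rtl U V X W g s) = f s"
  and t: "t:.U**V**W**M"
 shows "wr (T U (T V W)) L M f (ainv2 U V W M t) = rtl X W L M k (rtl U V X (T W M) g t)"
proof -
 note [simp] = U V W M X L
 have a: "ainv U V (T W M) t:.(U**V)**W**M"
  using ainv_closed[of U V "T W M" t] t by simp
 have "ainv X W M (rtl U V X (T W M) g t) = wr (T (T U V) W) (T X W) M (wr (T U V) X W g) (ainv (T U V) W M (ainv U V (T W M) t))"
  unfolding rtl_def by (rule ainv_wr) (use g a in simp_all)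
 also have "ainv (T U V) W M (ainv U V (T W M) t) = wr (T U (T V W)) (T (T U V) W) M (ainv U V W) (ainv2 U V W M t)"
  using ainv_pentagon[OF U V W M t] by (simp add: wr_def wl_def ainv2_def)
 also have "wr (T (T U V) W) (T X W) M (wr (T U V) X W g) ... = wr (T U (T V W)) (T X W) M (rtl U V X W g) (ainv2 U V W M t)"
  by (rule wr_comp) (use t g in "simp_all add: rtl_def")
 finally have "rtl X W L M k (rtl U V X (T W M) g t) =
   wr (T X W) L M k (wr (T U (T V W)) (T X W) M (rtl U V X W g) (ainv2 U V W M t))"
  by (simp add: rtl_def)
 also have "... = wr (T U (T V W)) L M f (ainv2 U V W M t)"
  by (rule wr_comp) (use t g k f e in simp_all)
 finally show ?thesis ..
qed

text \<open>Both sides extend the same map on \<open>U \<otimes> (V \<otimes> W)\<close> along \<open>M\<close>, once rebracketed by \<open>ainv2\<close>; the pentagon makes the two rebracketings agree.\<close>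

lemma rtl_tail:
 assumes U: "hm U" and V: "hm V" and W: "hm W" and M: "hm M" and X: "hm X" and Y: "hm Y" and L: "hm L"
  and g: "g : mor (T U V) X" and k: "k : mor (T X W) L"
  and g': "g' : mor (T V W) Y" and k': "k' : mor (T U Y) L"
  and e: "!!s. s:.U**V**W ==> k (rtl U V X W g s) = k' (wl U (T V W) Y g' s)"
  and t: "t:.U**V**W**M"
 shows "rtl X W L M k (rtl U V X (T W M) g t) = rtl U Y L M k' (wl U (T V (T W M)) (T Y M) (rtl V W Y M g') t)"
proof -
 have f: "(%s. k' (wl U (T V W) Y g' s)) : mor (T U (T V W)) L"
  by (rule hmor_comp[OF wl_hmor k']) (use U V W Y g' in simp_all)
 show ?thesis
  using ainv2_outer[OF U V W M X L g k f e t] ainv2_inner[OF U V W M Y L g' k' f refl t] by simp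
qed

lemma ainv_surj:
 assumes "hm V" "hm W" "hm M" "s:.(V**W)**M"
 obtains t where "t:.V**W**M" "ainv V W M t = s"
 using assms assoc_closed[OF assms] assoc_ainv(2)[OF assms] by metis

lemma wl_surj:
 assumes "hm V" "hm M" "hm Q" "g : mor M Q" and s: "!!q. q:.Q ==> \<exists>r\<in>carrier M. g r = q"
  and t: "t:.V**Q"
 obtains u where "u:.V**M" "wl V M Q g u = t"
proof -
 have m: "module K V" "module K Q" "module K (V**M)" using assms by simp_all
 have "\<exists>u\<in>carrier (V**M). wl V M Q g u = t"
  using m(1,2) t
 proof (induction rule: tensor_induct)
  case (pure v q)
  obtain r where "r:.M" "g r = q" using s pure(2) by blast
  then show ?case using pure(1) assms by (intro bexI[of _ "pt V M v r"]) (simp_all add: wl_ptens)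
 next
  case (add X Y)
  then obtain x y where "x:.V**M" "wl V M Q g x = X" "y:.V**M" "wl V M Q g y = Y" by blast
  then show ?case using klin_add[OF hmor_lin[OF wl_hmor[OF assms(1-4)]], of x y] module_add_closed[OF m(3)]
   by (intro bexI[of _ "x +[V**M] y"]) simp_all
 qed
 then show thesis using that by blast
qed

lemma wr_surj:
 assumes "hm V" "hm M" "hm Q" "g : mor V Q" and s: "!!q. q:.Q ==> \<exists>r\<in>carrier V. g r = q"
  and t: "t:.Q**M"
 obtains u where "u:.V**M" "wr V Q M g u = t"
proof -
 have m: "module K Q" "module K M" "module K (V**M)" using assms by simp_all
 have "\<exists>u\<in>carrier (V**M). wr V Q M g u = t"
  using m(1,2) t
 proof (induction rule: tensor_induct)
  case (pure q r)
  obtain v where "v:.V" "g v = q" using s pure(1) by blast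
  then show ?case using pure(2) assms by (intro bexI[of _ "pt V M v r"]) (simp_all add: wr_ptens)
 next
  case (add X Y)
  then obtain x y where "x:.V**M" "wr V Q M g x = X" "y:.V**M" "wr V Q M g y = Y" by blast
  then show ?case using klin_add[OF hmor_lin[OF wr_hmor[OF assms(1,3,2,4)]], of x y] module_add_closed[OF m(3)]
   by (intro bexI[of _ "x +[V**M] y"]) simp_all
 qed
 then show thesis using that by blast
qed

lemma rtl_surj:
 assumes "hm V" "hm W" "hm X" "hm M" "f : mor (T V W) X" and s: "!!x. x:.X ==> \<exists>u\<in>carrier (V**W). f u = x"
  and t: "t:.X**M"
 obtains u where "u:.V**W**M" "rtl V W X M f u = t"
proof -
 obtain s where s: "s:.(V**W)**M" "wr (T V W) X M f s = t"
  using wr_surj[of "T V W" M X f t] assms by auto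
 obtain u where "u:.V**W**M" "ainv V W M u = s"
  using ainv_surj[OF assms(1,2,4) s(1)] by blast
 then show thesis using that s(2) by (simp add: rtl_def)
qed

lemma ainv2_surj:
 assumes "hm U" "hm V" "hm W" "hm M" "s:.(U**V**W)**M"
 obtains t where "t:.U**V**W**M" "ainv2 U V W M t = s"
proof -
 obtain u where u: "u:.U**(V**W)**M" "ainv U (T V W) M u = s"
  using ainv_surj[of U "T V W" M s] assms by auto
 have "!!q. q:.(V**W)**M ==> \<exists>r\<in>carrier (V**W**M). ainv V W M r = q"
  using ainv_surj[OF assms(2-4)] by metis
 then obtain t where "t:.U**V**W**M" "wl U (T V (T W M)) (T (T V W) M) (ainv V W M) t = u"
  using wl_surj[of U "T V (T W M)" "T (T V W) M" "ainv V W M" u] assms u by auto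
 then show thesis using that u by (simp add: ainv2_def)
qed

subsection \<open>Braidings\<close>

lemma braid_wl:
 assumes "hm V" "hm W" "hm W'" "g : mor W W'" "t:.V**W"
 shows "br V W' (wl V W W' g t) = wr W W' V g (br V W t)"
 using braid_natural[OF assms(1,2,1,3) hmor_id(1) assms(4,5)] by (simp add: wl_def wr_def)

lemma braid_wr:
 assumes "hm V" "hm V'" "hm W" "f : mor V V'" "t:.V**W"
 shows "br V' W (wr V V' W f t) = wl W V V' f (br V W t)"
 using braid_natural[OF assms(1,3,2,3,4) hmor_id(1) assms(5)] by (simp add: wl_def wr_def)

lemma ainv_crl:
 assumes "hm V" "hm W" "hm M" "t:.V**W**M"
 shows "ainv W V M (crl V W M t) = wr (T V W) (T W V) M (br V W) (ainv V W M t)"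
proof -
 have "wr (T V W) (T W V) M (br V W) (ainv V W M t):.(W**V)**M"
  using wr_closed[of "T V W" "T W V" M "br V W" "ainv V W M t"] assms by simp
 then show ?thesis using assms by (simp add: crl_def wr_def)
qed

lemma rtl_crl:
 assumes "hm V" "hm W" "hm X" "hm M" "f : mor (T W V) X" "f' : mor (T V W) X"
  "!!s. s:.V**W ==> f (br V W s) = f' s" "t:.V**W**M"
 shows "rtl W V X M f (crl V W M t) = rtl V W X M f' t"
 unfolding rtl_def ainv_crl[OF assms(1,2,4,8)]
 by (rule wr_comp[OF _ _ _ _ _ assms(5,6)]) (use assms in simp_all)

text \<open>The hexagon for a braiding past a product of two factors on the left.\<close>

lemma braid_rtl:
 assumes "hm V" "hm W" "hm X" "hm Y" "f : mor (T V W) X" "t:.V**W**Y"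
 shows "br X Y (rtl V W X Y f t) = wl Y (T V W) X f (crl V Y W (wl V (T W Y) (T Y W) (br W Y) t))"
proof -
 have "br X Y (rtl V W X Y f t) = wl Y (T V W) X f (br (T V W) Y (ainv V W Y t))"
  unfolding rtl_def by (rule braid_wr) (use assms in simp_all)
 then show ?thesis using braid_pair_left[OF assms(1,2,4,6)] by (simp add: wl_def)
qed

text \<open>The hexagon for a braiding past a product of two factors on the right.\<close>

lemma braid_wl_pair:
 assumes "hm Y" "hm V" "hm W" "hm X" "f : mor (T V W) X" "t:.Y**V**W"
 shows "br Y X (wl Y (T V W) X f t) = rtl V W X Y f (wl V (T Y W) (T W Y) (br Y W) (crl Y V W t))"
proof -
 have b: "br Y (T V W) t:.(V**W)**Y"
  using braid_closed[of Y "T V W" t] assms by simp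
 have "ainv V W Y (wl V (T Y W) (T W Y) (br Y W) (crl Y V W t)) = br Y (T V W) t"
  using braid_pair_right[OF assms(1-3,6)] assoc_ainv(2)[OF assms(2,3,1) b] by (simp add: wl_def)
 moreover have "br Y X (wl Y (T V W) X f t) = wr (T V W) X Y f (br Y (T V W) t)"
  by (rule braid_wl) (use assms in simp_all)
 ultimately show ?thesis by (simp add: rtl_def)
qed

lemma yang_baxter:
 assumes V: "hm V" and A: "hm A" and W: "hm W" and t: "t:.V**A**W"
 shows "wl W (T V A) (T A V) (br V A) (crl V W A (wl V (T A W) (T W A) (br A W) t)) =
  crl A W V (wl A (T V W) (T W V) (br V W) (crl V A W t))"
proof -
 have "wl W (T V A) (T A V) (br V A) (crl V W A (wl V (T A W) (T W A) (br A W) t)) =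
   wl W (T V A) (T A V) (br V A) (br (T V A) W (ainv V A W t))"
  using braid_pair_left[OF V A W t] by (simp add: wl_def)
 also have "... = br (T A V) W (wr (T V A) (T A V) W (br V A) (ainv V A W t))"
  by (rule braid_wr[symmetric]) (use V A W t in simp_all)
 also have "... = br (T A V) W (ainv A V W (crl V A W t))"
  by (simp add: ainv_crl V A W t)
 also have "... = crl A W V (wl A (T V W) (T W V) (br V W) (crl V A W t))"
  using braid_pair_left[OF A V W, of "crl V A W t"] V A W t by (simp add: wl_def)
 finally show ?thesis .
qed

end

context qtqh
begin

section \<open>Internal homs of modules\<close>

abbreviation "S \<equiv> antipode H"
abbreviation "\<alpha> \<equiv> qalpha H"
abbreviation "\<beta> \<equiv> qbeta H"

lemma S_lin: "S : klin K H H"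
 and S_one: "S 1H = 1H"
 and S_mult: "g:.H ==> h:.H ==> S (g *. h) = S h *. S g"
 and alpha_closed [simp]: "\<alpha>:.H" and beta_closed [simp]: "\<beta>:.H"
 using qh by (simp_all add: quasi_hopf_algebra_def)

lemma S_closed [simp]: "h:.H ==> S h:.H"
 by (rule klin_closed[OF S_lin])

lemma lin_act1: "hm V ==> g : klin K U H ==> v:.V ==> (%x. act V (g x) v) : klin K U V"
 by (rule klin_comp[OF _ amodD(7)[OF hm_amod]])

lemma lin_act2: "hm V ==> h:.H ==> g : klin K U V ==> (%x. act V h (g x)) : klin K U V"
 by (rule klin_comp[OF _ amodD(6)[OF hm_amod]])

lemma lin_S: "g : klin K U H ==> (%x. S (g x)) : klin K U H"
 by (rule klin_comp[OF _ S_lin])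

lemmas lins = lin_act1 lin_act2 lin_S lin_mult1[OF aH] lin_mult2[OF aH] klin_id

lemma act_mult: "hm V ==> g:.H ==> h:.H ==> v:.V ==> act V (g *. h) v = act V g (act V h v)"
 by (rule amodD(3)[OF hm_amod])

lemma act_one: "hm V ==> v:.V ==> act V 1H v = v"
 by (rule amodD(4)[OF hm_amod])

lemma act_smult: "hm V ==> h:.H ==> c:.K ==> v:.V ==>
  act V (c \<odot>[H] h) v = c \<odot>[V] act V h v" "hm V ==> h:.H ==> c:.K ==> v:.V ==>
  act V h (c \<odot>[V] v) = c \<odot>[V] act V h v"
 by (rule klin_smult[OF amodD(7)[OF hm_amod]]; simp) (rule klin_smult[OF amodD(6)[OF hm_amod]]; simp)

lemma H_smult: "c:.K ==> a:.H ==> b:.H ==> (c \<odot>[H] a) *. b = c \<odot>[H] (a *. b)"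
 "c:.K ==> a:.H ==> b:.H ==> a *. (c \<odot>[H] b) = c \<odot>[H] (a *. b)"
 using aH unfolding k_algebra_def by blast+

definition "Ma s = tsum2 H s (%a b. S a *. \<alpha> *. b)"
definition "Mb s = tsum2 H s (%a b. a *. \<beta> *. S b)"

lemma M_bilin: "bilin K H H H (%a b. S a *. \<alpha> *. b)" "bilin K H H H (%a b. a *. \<beta> *. S b)"
 by (intro bilinI lins; simp)+

lemma M_lin: "Ma : klin K P2 H" "Mb : klin K P2 H"
 unfolding Ma_def[abs_def] Mb_def[abs_def] by (intro lin_tsum2 M_bilin mH)+

lemma M_ptens: "a:.H ==> b:.H ==> Ma (p2 a b) = S a *. (\<alpha> *. b)"
 "a:.H ==> b:.H ==> Mb (p2 a b) = a *. (\<beta> *. S b)"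
 by (simp_all add: Ma_def Mb_def tsum2_ptens[OF mH mH mH M_bilin(1)] tsum2_ptens[OF mH mH mH M_bilin(2)] H_mult)

lemma M_D: "h:.H ==> Ma (\<Delta> h) = \<epsilon> h \<odot>[H] \<alpha>" "h:.H ==> Mb (\<Delta> h) = \<epsilon> h \<odot>[H] \<beta>"
 using qh by (simp_all add: quasi_hopf_algebra_def Ma_def Mb_def)

text \<open>The contractions on three legs that occur in the axioms relating the quasi-antipode and \<open>\<phi>\<close>.\<close>

definition "mm Y = tsum3 H Y (%b c d. b *. \<beta> *. S c *. \<alpha> *. d)"
definition "nn Y = tsum3 H Y (%b c d. S b *. \<alpha> *. c *. \<beta> *. S d)"

lemma mn_trilin: "trilin K H H H H (%b c d. b *. \<beta> *. S c *. \<alpha> *. d)"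
 "trilin K H H H H (%b c d. S b *. \<alpha> *. c *. \<beta> *. S d)"
 by (intro trilinI lins; simp)+

lemma mn_lin: "mm : klin K P3 H" "nn : klin K P3 H"
 unfolding mm_def[abs_def] nn_def[abs_def] by (intro lin_tsum3 mn_trilin mH)+

lemma mn_closed [simp]: "s:.P3 ==> mm s:.H" "s:.P3 ==> nn s:.H"
 by (rule klin_closed[OF mn_lin(1)], assumption) (rule klin_closed[OF mn_lin(2)])

lemma mn_ptens:
 assumes "b:.H" "c:.H" "d:.H"
 shows "mm (p3 b c d) = b *. (\<beta> *. (S c *. (\<alpha> *. d)))"
  "nn (p3 b c d) = S b *. (\<alpha> *. (c *. (\<beta> *. S d)))"
 using assms by (simp_all add: mm_def nn_def tsum3_ptens[OF mH mH mH mH mn_trilin(1)] tsum3_ptens[OF mH mH mH mH mn_trilin(2)] H_mult)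

lemma mm_phi: "mm \<phi> = 1H" and nn_psi: "nn \<psi> = 1H"
 using qh by (simp_all add: quasi_hopf_algebra_def mm_def nn_def)

lemma P3_ptens_mult:
 assumes "a:.H" "a':.H"
 shows "Y:.P2 ==> Y':.P2 ==>
   q3 a Y *3 q3 a' Y' = q3 (a *. a') (Y *2 Y')"
  "b:.H ==> b':.H ==>
   p2 a b *2 p2 a' b' = p2 (a *. a') (b *. b')"
  "Z:.P3 ==> Z':.P3 ==>
   q4 a Z *4 q4 a' Z' = q4 (a *. a') (Z *3 Z')"
 using assms by (simp_all add: tensor_mult_ptens)

lemmas lin_P3m = lin_mult1[OF aP(2)] lin_mult2[OF aP(2)]
lemmas P_closed [simp] = alg_closed[OF aP(1)] alg_closed[OF aP(2)] alg_closed[OF aP(3)]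

lemma lin_rebr1: "module K X ==> y:.X ==> (%s. rebr K H H X (pt P2 X s y)) : klin K P2 (H**H**X)"
 by (rule klin_comp[OF lin_ptens1[OF _ _ klin_id(2)] rebr_lin]) auto

lemma eps_lr_closed [simp]: "X:.P2 ==> epsr H X:.H" "X:.P2 ==> epsl H X:.H"
 by (rule klin_closed[OF epsr_lin[OF mH]], assumption) (rule klin_closed[OF epsl_lin[OF mH]])

text \<open>Absorption: an adjacent pair of legs coming from a coproduct collapses to a counit against \<open>\<alpha>\<close> or \<open>\<beta>\<close>.\<close>

lemma mm_Dr:
 assumes X: "X:.P2" and Y: "Y:.P3"
 shows "mm (Dr X *3 Y) = epsr H X *. mm Y"
proof (rule tensor_eqI[OF mH mH _ _ _ X])
 show "(%X. mm (Dr X *3 Y)) : klin K P2 H"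
  by (rule klin_comp[OF lin_P3m(1)[OF D_lins(2) Y] mn_lin(1)])
 show "(%X. epsr H X *. mm Y) : klin K P2 H" using Y by (intro lins epsr_lin mH) simp
 fix a b assume ab: "a:.H" "b:.H"
 have *: "mm (q3 a s *3 p3 p q r) = a *. (p *. (\<beta> *. (S q *. (Ma s *. r))))"
  if s: "s:.P2" and pqr: "p:.H" "q:.H" "r:.H" for s p q r
 proof (rule tensor_eqI[OF mH mH _ _ _ s])
  show "(%s. mm (q3 a s *3 p3 p q r)) : klin K P2 H"
   by (rule klin_comp[OF lin_P3m(1)[OF lin_ptens2[OF _ _ klin_id(2)]] mn_lin(1)]) (use ab pqr in simp_all)
  show "(%s. a *. (p *. (\<beta> *. (S q *. (Ma s *. r))))) : klin K P2 H"
   using ab pqr by (intro lins M_lin) simp_all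
 qed (use ab pqr in "simp add: P3_ptens_mult mn_ptens M_ptens S_mult H_mult")
 show "mm (Dr (p2 a b) *3 Y) = epsr H (p2 a b) *. mm Y"
 proof (rule tensor3_eqI[OF mH mH mH _ _ _ Y])
  show "(%Y. mm (Dr (p2 a b) *3 Y)) : klin K P3 H"
   by (rule klin_comp[OF lin_P3m(2)[OF _ klin_id(2)] mn_lin(1)]) (use ab in simp)
  show "(%Y. epsr H (p2 a b) *. mm Y) : klin K P3 H" using ab by (intro lins mn_lin) simp
 qed (use ab in "simp add: D_ptens * M_D epsr_ptens mn_ptens H_smult H_mult")
qed

lemma mm_Dl:
 assumes X: "X:.P2" and Y: "Y:.P3"
 shows "mm (Y *3 Dl X) = mm Y *. epsl H X"
proof (rule tensor_eqI[OF mH mH _ _ _ X])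
 show "(%X. mm (Y *3 Dl X)) : klin K P2 H"
  by (rule klin_comp[OF lin_P3m(2)[OF Y D_lins(1)] mn_lin(1)])
 show "(%X. mm Y *. epsl H X) : klin K P2 H" using Y by (intro lins epsl_lin mH) simp
 fix a b assume ab: "a:.H" "b:.H"
 have *: "mm (p3 p q r *3 rebr K H H H (pt P2 H s b)) = p *. (Mb s *. (S q *. (\<alpha> *. (r *. b))))"
  if s: "s:.P2" and pqr: "p:.H" "q:.H" "r:.H" for s p q r
 proof (rule tensor_eqI[OF mH mH _ _ _ s])
  show "(%s. mm (p3 p q r *3 rebr K H H H (pt P2 H s b))) : klin K P2 H"
   by (rule klin_comp[OF lin_P3m(2)[OF _ lin_rebr1] mn_lin(1)]) (use ab pqr in simp_all)
  show "(%s. p *. (Mb s *. (S q *. (\<alpha> *. (r *. b))))) : klin K P2 H"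
   using ab pqr by (intro lins M_lin) simp_all
 qed (use ab pqr in "simp add: rebr_ptens P3_ptens_mult mn_ptens M_ptens S_mult H_mult")
 show "mm (Y *3 Dl (p2 a b)) = mm Y *. epsl H (p2 a b)"
 proof (rule tensor3_eqI[OF mH mH mH _ _ _ Y])
  show "(%Y. mm (Y *3 Dl (p2 a b))) : klin K P3 H"
   by (rule klin_comp[OF lin_P3m(1)[OF klin_id(2)] mn_lin(1)]) (use ab in simp)
  show "(%Y. mm Y *. epsl H (p2 a b)) : klin K P3 H" using ab by (intro lins mn_lin) simp
 qed (use ab in "simp add: D_ptens * M_D epsl_ptens mn_ptens H_smult H_mult")
qed

lemma nn_Dl:
 assumes X: "X:.P2" and Y: "Y:.P3"
 shows "nn (Dl X *3 Y) = nn Y *. S (epsl H X)"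
proof (rule tensor_eqI[OF mH mH _ _ _ X])
 show "(%X. nn (Dl X *3 Y)) : klin K P2 H"
  by (rule klin_comp[OF lin_P3m(1)[OF D_lins(1) Y] mn_lin(2)])
 show "(%X. nn Y *. S (epsl H X)) : klin K P2 H" using Y by (intro lins epsl_lin mH) simp
 fix a b assume ab: "a:.H" "b:.H"
 have *: "nn (rebr K H H H (pt P2 H s b) *3 p3 p q r) = S p *. (Ma s *. (q *. (\<beta> *. (S r *. S b))))"
  if s: "s:.P2" and pqr: "p:.H" "q:.H" "r:.H" for s p q r
 proof (rule tensor_eqI[OF mH mH _ _ _ s])
  show "(%s. nn (rebr K H H H (pt P2 H s b) *3 p3 p q r)) : klin K P2 H"
   by (rule klin_comp[OF lin_P3m(1)[OF lin_rebr1] mn_lin(2)]) (use ab pqr in simp_all)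
  show "(%s. S p *. (Ma s *. (q *. (\<beta> *. (S r *. S b))))) : klin K P2 H"
   using ab pqr by (intro lins M_lin) simp_all
 qed (use ab pqr in "simp add: rebr_ptens P3_ptens_mult mn_ptens M_ptens S_mult H_mult")
 show "nn (Dl (p2 a b) *3 Y) = nn Y *. S (epsl H (p2 a b))"
 proof (rule tensor3_eqI[OF mH mH mH _ _ _ Y])
  show "(%Y. nn (Dl (p2 a b) *3 Y)) : klin K P3 H"
   by (rule klin_comp[OF lin_P3m(2)[OF _ klin_id(2)] mn_lin(2)]) (use ab in simp)
  show "(%Y. nn Y *. S (epsl H (p2 a b))) : klin K P3 H" using ab by (intro lins mn_lin) simp
 qed (use ab in "simp add: D_ptens * M_D epsl_ptens mn_ptens H_smult H_mult klin_smult[OF S_lin]")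
qed

lemma nn_Dr:
 assumes X: "X:.P2" and Y: "Y:.P3"
 shows "nn (Y *3 Dr X) = S (epsr H X) *. nn Y"
proof (rule tensor_eqI[OF mH mH _ _ _ X])
 show "(%X. nn (Y *3 Dr X)) : klin K P2 H"
  by (rule klin_comp[OF lin_P3m(2)[OF Y D_lins(2)] mn_lin(2)])
 show "(%X. S (epsr H X) *. nn Y) : klin K P2 H" using Y by (intro lins epsr_lin mH) simp
 fix a b assume ab: "a:.H" "b:.H"
 have *: "nn (p3 p q r *3 q3 a s) = S a *. (S p *. (\<alpha> *. (q *. (Mb s *. S r))))"
  if s: "s:.P2" and pqr: "p:.H" "q:.H" "r:.H" for s p q r
 proof (rule tensor_eqI[OF mH mH _ _ _ s])
  show "(%s. nn (p3 p q r *3 q3 a s)) : klin K P2 H"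
   by (rule klin_comp[OF lin_P3m(2)[OF _ lin_ptens2[OF _ _ klin_id(2)]] mn_lin(2)]) (use ab pqr in simp_all)
  show "(%s. S a *. (S p *. (\<alpha> *. (q *. (Mb s *. S r))))) : klin K P2 H"
   using ab pqr by (intro lins M_lin) simp_all
 qed (use ab pqr in "simp add: P3_ptens_mult mn_ptens M_ptens S_mult H_mult")
 show "nn (Y *3 Dr (p2 a b)) = S (epsr H (p2 a b)) *. nn Y"
 proof (rule tensor3_eqI[OF mH mH mH _ _ _ Y])
  show "(%Y. nn (Y *3 Dr (p2 a b))) : klin K P3 H"
   by (rule klin_comp[OF lin_P3m(1)[OF klin_id(2)] mn_lin(2)]) (use ab in simp)
  show "(%Y. S (epsr H (p2 a b)) *. nn Y) : klin K P3 H" using ab by (intro lins mn_lin) simp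
 qed (use ab in "simp add: D_ptens * M_D epsr_ptens mn_ptens H_smult H_mult klin_smult[OF S_lin]")
qed

subsection \<open>The module of linear maps\<close>

abbreviation "hh V W \<equiv> hhom K H V W"

definition "G3 V W L v Z = tsum3 W Z (%a b c. act W a (L (act V (S b *. \<alpha> *. c) v)))"
definition "g2 V W L v s = tsum2 W s (%a b. act W a (L (act V (S b) v)))"

lemma hhom_fields:
 "carrier (hh V W) = klin K V W \<inter> extensional (carrier V)"
 "ring.zero (hh V W) = (\<lambda>v\<in>carrier V. \<zero>[W])"
 "add (hh V W) = (%L M. \<lambda>v\<in>carrier V. L v +[W] M v)"
 "smult (hh V W) = (%c L. \<lambda>v\<in>carrier V. c \<odot>[W] L v)"
 "act (hh V W) h L = (\<lambda>v\<in>carrier V. g2 V W L v (\<Delta> h))"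
 by (simp_all add: hhom_def g2_def)

lemma klin_restrict: "module K V ==> f : klin K V W ==> restrict f (carrier V) : klin K V W"
 by (rule klin_cong) simp_all

lemma hhomI: "module K V ==> f : klin K V W ==> restrict f (carrier V):.hh V W"
 by (simp add: hhom_fields klin_restrict)

lemma hhomD: "L:.hh V W ==> L : klin K V W" "L:.hh V W ==> L \<in> extensional (carrier V)"
 by (simp_all add: hhom_fields)

lemma hhom_eqI: "L:.hh V W ==> M:.hh V W ==> (!!v. v:.V ==> L v = M v) ==> L = M"
 by (auto intro: extensionalityI dest: hhomD)

lemma klin_plus: "module K W ==> f : klin K V W ==> g : klin K V W ==> (%v. f v +[W] g v) : klin K V W"
proof -
 assume W: "module K W" and f: "f : klin K V W" and g: "g : klin K V W"
 interpret W: module K W by fact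
 show ?thesis using f g
  by (intro klinI) (simp_all add: klin_closed klin_add klin_smult W.smult_r_distr W.M.a_ac)
qed

lemma klin_scale: "module K W ==> f : klin K V W ==> c:.K ==> (%v. c \<odot>[W] f v) : klin K V W"
proof -
 assume W: "module K W" and f: "f : klin K V W" and c: "c:.K"
 interpret W: module K W by fact
 show ?thesis using f c
  by (intro klinI) (simp_all add: klin_closed klin_add klin_smult W.smult_r_distr W.smult_assoc1[symmetric] W.R.m_comm)
qed

lemma hhom_module:
 assumes V: "module K V" and W: "module K W"
 shows "module K (hh V W)"
proof -
 interpret V: module K V by fact
 interpret W: module K W by fact
 have z: "(%v. \<zero>[W]) : klin K V W" by (rule klinI) simp_all
 have plus: "L +[hh V W] M:.hh V W" if "L:.hh V W" "M:.hh V W" for L M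
  unfolding hhom_fields(3) by (rule hhomI[OF V klin_plus[OF W hhomD(1)[OF that(1)] hhomD(1)[OF that(2)]]])
 have scale: "c \<odot>[hh V W] L:.hh V W" if "c:.K" "L:.hh V W" for c L
  unfolding hhom_fields(4) by (rule hhomI[OF V klin_scale[OF W hhomD(1)[OF that(2)] that(1)]])
 have zero: "\<zero>[hh V W]:.hh V W" unfolding hhom_fields(2) by (rule hhomI[OF V z])
 note c = klin_closed[OF hhomD(1)]
 have ag: "abelian_group (hh V W)"
 proof (rule abelian_groupI)
  fix L M P assume L: "L:.hh V W"
  show "\<zero>[hh V W] +[hh V W] L = L"
   by (rule hhom_eqI[OF plus[OF zero L] L]) (use c[OF L] in "simp add: hhom_fields")
  show "\<exists>M\<in>carrier (hh V W). M +[hh V W] L = \<zero>[hh V W]"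
  proof
   show m: "(\<ominus>[K] \<one>[K]) \<odot>[hh V W] L:.hh V W" by (rule scale[OF _ L]) simp
   show "(\<ominus>[K] \<one>[K]) \<odot>[hh V W] L +[hh V W] L = \<zero>[hh V W]"
    by (rule hhom_eqI[OF plus[OF m L] zero]) (use c[OF L] in "simp add: hhom_fields W.smult_l_minus W.M.l_neg")
  qed
  assume M: "M:.hh V W"
  show "L +[hh V W] M = M +[hh V W] L"
   by (rule hhom_eqI[OF plus[OF L M] plus[OF M L]]) (use c[OF L] c[OF M] in "simp add: hhom_fields W.M.a_comm")
  assume P: "P:.hh V W"
  show "L +[hh V W] M +[hh V W] P = L +[hh V W] (M +[hh V W] P)"
   by (rule hhom_eqI[OF plus[OF plus[OF L M] P] plus[OF L plus[OF M P]]])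
    (use c[OF L] c[OF M] c[OF P] in "simp add: hhom_fields W.M.a_assoc")
 qed (use plus zero in auto)
 show ?thesis
 proof (rule moduleI[OF V.R.is_cring ag scale])
  show "\<one>[K] \<odot>[hh V W] L = L" if L: "L:.hh V W" for L
   by (rule hhom_eqI[OF scale[OF _ L] L]) (use c[OF L] in "simp_all add: hhom_fields")
  show "a \<odot>[hh V W] (L +[hh V W] M) = a \<odot>[hh V W] L +[hh V W] a \<odot>[hh V W] M"
   if a: "a:.K" and L: "L:.hh V W" and M: "M:.hh V W" for a L M
   by (rule hhom_eqI[OF scale[OF a plus[OF L M]] plus[OF scale[OF a L] scale[OF a M]]])
    (use c[OF L] c[OF M] a in "simp add: hhom_fields W.smult_r_distr")
  fix a b L assume a: "a:.K" and b: "b:.K" and L: "L:.hh V W"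
  have ab: "a +[K] b:.K" "a *[K] b:.K" using a b by simp_all
  show "(a +[K] b) \<odot>[hh V W] L = a \<odot>[hh V W] L +[hh V W] b \<odot>[hh V W] L"
   by (rule hhom_eqI[OF scale[OF ab(1) L] plus[OF scale[OF a L] scale[OF b L]]])
    (use c[OF L] a b in "simp add: hhom_fields W.smult_l_distr")
  show "(a *[K] b) \<odot>[hh V W] L = a \<odot>[hh V W] (b \<odot>[hh V W] L)"
   by (rule hhom_eqI[OF scale[OF ab(2) L] scale[OF a scale[OF b L]]])
    (use c[OF L] a b in "simp add: hhom_fields W.smult_assoc1")
 qed
qed

lemma eval_lin: "module K V ==> module K W ==> v:.V ==> (%L. L v) : klin K (hh V W) W"
 by (rule klinI) (auto simp: hhom_fields klin_closed)

text \<open>Linearity of a map into a module of linear maps can be tested pointwise.\<close>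

lemma hhom_linI:
 assumes V: "module K V" and W: "module K W"
  and f: "!!u. u:.U ==> (%v. f u v) : klin K V W" "!!v. v:.V ==> (%u. f u v) : klin K U W" and U: "module K U"
 shows "(%u. \<lambda>v\<in>carrier V. f u v) : klin K U (hh V W)"
proof (rule klinI)
 interpret H: module K "hh V W" by (rule hhom_module[OF V W])
 interpret U: module K U by fact
 have c: "(\<lambda>v\<in>carrier V. f u v):.hh V W" if "u:.U" for u
  by (rule hhomI[OF V f(1)[OF that]])
 show "!!u. u:.U ==> (\<lambda>v\<in>carrier V. f u v):.hh V W" by (rule c)
 show "(\<lambda>v\<in>carrier V. f (x +[U] y) v) = (\<lambda>v\<in>carrier V. f x v) +[hh V W] (\<lambda>v\<in>carrier V. f y v)"
  if "x:.U" "y:.U" for x y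
  by (rule hhom_eqI[OF c H.M.a_closed[OF c c]]) (use that klin_add[OF f(2)] in "simp_all add: hhom_fields")
 show "(\<lambda>v\<in>carrier V. f (k \<odot>[U] x) v) = k \<odot>[hh V W] (\<lambda>v\<in>carrier V. f x v)"
  if "k:.K" "x:.U" for k x
  by (rule hhom_eqI[OF c H.smult_closed[OF _ c]]) (use that klin_smult[OF f(2)] in "simp_all add: hhom_fields")
qed

context
 fixes V :: "('k, 'h, 'v, 'vv) hmod_scheme" and W :: "('k, 'h, 'w, 'ww) hmod_scheme"
 assumes V: "hm V" and W: "hm W"
begin

lemma g2_bilin: "L : klin K V W ==> v:.V ==> bilin K H H W (%a b. act W a (L (act V (S b) v)))"
 using V W by (intro bilinI lins klin_comp[of "%b. act V (S b) v" K H V L]) (simp_all add: klin_closed)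

lemma g2_lin_s: "L : klin K V W ==> v:.V ==> (%s. g2 V W L v s) : klin K P2 W"
 unfolding g2_def using W by (intro lin_tsum2 g2_bilin) simp_all

lemma g2_ptens: "L : klin K V W ==> v:.V ==> a:.H ==> b:.H ==>
  g2 V W L v (p2 a b) = act W a (L (act V (S b) v))"
 unfolding g2_def using W by (simp add: tsum2_ptens[OF _ _ _ g2_bilin])

lemma g2_lin_v: "L : klin K V W ==> s:.P2 ==> (%v. g2 V W L v s) : klin K V W"
 unfolding g2_def using V W
 by (intro lin_tsum2_fun[OF mH mH] lins klin_comp[of "%v. act V (S b) v" K V V L for b]) simp_all

lemma g2_lin_L: "v:.V ==> s:.P2 ==> (%L. g2 V W L v s) : klin K (hh V W) W"
 unfolding g2_def using V W
 by (intro lin_tsum2_fun[OF mH mH] lin_act2 eval_lin) simp_all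

lemma g2_closed: "L : klin K V W ==> v:.V ==> s:.P2 ==> g2 V W L v s:.W"
 by (rule klin_closed[OF g2_lin_s])

lemma g2_mult:
 assumes L: "L : klin K V W" and v: "v:.V" and X: "X:.P2" and Y: "Y:.P2"
 shows "g2 V W L v (X *2 Y) = g2 V W (%v. g2 V W L v Y) v X"
proof (rule bilin_eqI[OF mH mH mH mH _ _ _ X Y])
 show "bilin K P2 P2 W (%X Y. g2 V W L v (X *2 Y))"
  by (rule bilin_klin[OF mult_bilin[OF aP(1)] g2_lin_s[OF L v]])
 show "bilin K P2 P2 W (%X Y. g2 V W (%v. g2 V W L v Y) v X)"
 proof (rule bilinI)
  show "(%Y. g2 V W (%v. g2 V W L v Y) v X) : klin K P2 W" if X: "X:.P2" for X
   unfolding g2_def[of _ _ "%v. g2 V W L v Y" for Y]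
   by (intro lin_tsum2_fun[OF mH mH X] lin_act2 g2_lin_s L) (use V W v in simp_all)
  show "(%X. g2 V W (%v. g2 V W L v Y) v X) : klin K P2 W" if Y: "Y:.P2" for Y
   by (rule g2_lin_s[OF g2_lin_v[OF L Y] v])
 qed
qed (use V W v L in "simp add: P3_ptens_mult g2_ptens g2_lin_v klin_closed S_mult act_mult")

lemma hm_hhom [simp]: "hm (hh V W)"
 unfolding hmodule_amod amod_def
proof (intro conjI ballI)
 note m = hm_module[OF V] hm_module[OF W]
 show mod: "module K (hh V W)" by (rule hhom_module[OF m])
 have cl: "act (hh V W) h L:.hh V W" if "h:.H" "L:.hh V W" for h L
  unfolding hhom_fields(5) by (rule hhomI[OF m(1) g2_lin_v[OF hhomD(1)]]) (use that in simp_all)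
 show "bilin K H (hh V W) (hh V W) (act (hh V W))"
 proof (rule bilinI)
  show "act (hh V W) h : klin K (hh V W) (hh V W)" if "h:.H" for h
   unfolding hhom_fields(5)[abs_def] using that
   by (intro hhom_linI m mod g2_lin_v g2_lin_L hhomD(1)) simp_all
  show "(%h. act (hh V W) h L) : klin K H (hh V W)" if "L:.hh V W" for L
   unfolding hhom_fields(5) using that
   by (intro hhom_linI m mH g2_lin_v klin_comp[OF D_lin g2_lin_s] hhomD(1)) simp_all
 qed
 fix L assume L: "L:.hh V W"
 note l = hhomD(1)[OF L]
 show "act (hh V W) 1H L = L"
 proof (rule hhom_eqI[OF cl[OF _ L] L])
  fix v assume v: "v:.V"
  then show "act (hh V W) 1H L v = L v"
   using V W l by (simp add: hhom_fields ahom_one[OF D_ahom] tensor_one g2_ptens S_one act_one klin_closed)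
 qed simp
 fix g h assume g: "g:.H" and h: "h:.H"
 show "act (hh V W) (g *. h) L = act (hh V W) g (act (hh V W) h L)"
 proof (rule hhom_eqI[OF cl[OF _ L] cl[OF g cl[OF h L]]])
  fix v assume v: "v:.V"
  have "g2 V W (%v. g2 V W L v (\<Delta> h)) v (\<Delta> g) = g2 V W (\<lambda>v\<in>carrier V. g2 V W L v (\<Delta> h)) v (\<Delta> g)"
   unfolding g2_def[of _ _ _ _ "\<Delta> g"]
   by (rule tsum2_cong[OF mH mH D_closed[OF g]]) (use V W v h g2_closed[OF l] in simp_all)
  then show "act (hh V W) (g *. h) L v = act (hh V W) g (act (hh V W) h L) v"
   using v g h by (simp add: hhom_fields ahom_mult[OF D_ahom] g2_mult[OF l v])
 qed (use g h in simp)
qed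

subsection \<open>Evaluation\<close>

lemma G3_trilin: "L : klin K V W ==> v:.V ==> trilin K H H H W (%a b c. act W a (L (act V (S b *. \<alpha> *. c) v)))"
 using V W by (intro trilinI lins klin_comp[of _ K H V L]) (simp_all add: klin_closed)

lemma G3_lin_Z: "L : klin K V W ==> v:.V ==> (%Z. G3 V W L v Z) : klin K P3 W"
 unfolding G3_def using W by (intro lin_tsum3 G3_trilin) simp_all

lemma G3_ptens: "L : klin K V W ==> v:.V ==> a:.H ==> b:.H ==> c:.H ==>
  G3 V W L v (p3 a b c) = act W a (L (act V (S b) (act V \<alpha> (act V c v))))"
 unfolding G3_def using V W by (simp add: tsum3_ptens[OF _ _ _ _ G3_trilin] act_mult)

lemma G3_lin_v:
 assumes l: "L : klin K V W" and Z: "Z:.P3"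
 shows "(%v. G3 V W L v Z) : klin K V W"
 unfolding G3_def
 by (intro lin_tsum3_fun[OF mH mH mH Z] lin_act2[OF W] klin_comp[OF lin_act2[OF V _ klin_id(2)] l]) (use W in simp_all)

lemma G3_lin_L: "v:.V ==> Z:.P3 ==> (%L. G3 V W L v Z) : klin K (hh V W) W"
 unfolding G3_def using V W by (intro lin_tsum3_fun[OF mH mH mH] lin_act2 eval_lin) simp_all

lemma G3_closed: "L : klin K V W ==> v:.V ==> Z:.P3 ==> G3 V W L v Z:.W"
 by (rule klin_closed[OF G3_lin_Z])

lemma G3_bilin: "Z:.P3 ==> bilin K (hh V W) V W (%L v. G3 V W L v Z)"
 by (intro bilinI G3_lin_v G3_lin_L hhomD(1))

lemma heval_lin: "hev V W : klin K ((hh V W)**V) W"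
 unfolding heval_def[abs_def] G3_def[symmetric] using V W by (intro lin_tsum2 G3_bilin) simp_all

lemma heval_ptens: "L:.hh V W ==> v:.V ==> hev V W (pt (hh V W) V L v) = G3 V W L v \<phi>"
 unfolding heval_def G3_def[symmetric] using V W by (simp add: tsum2_ptens[OF _ _ _ G3_bilin])

lemma G3_Dl:
 assumes L: "L:.hh V W" and v: "v:.V" and X: "X:.P2" and Z: "Z:.P3"
 shows "G3 V W L v (Z *3 Dl X) = tsum2 W X (%h g. G3 V W (act (hh V W) h L) (act V g v) Z)"
proof -
 note l = hhomD(1)[OF L] and m = hm_module[OF V] hm_module[OF W]
 have hc: "act (hh V W) h L:.hh V W" if "h:.H" for h using that L by simp
 have bl: "bilin K H H W (%h g. G3 V W (act (hh V W) h L) (act V g v) Z)" if Z: "Z:.P3" for Z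
 proof (rule bilinI)
  show "(%g. G3 V W (act (hh V W) h L) (act V g v) Z) : klin K H W" if "h:.H" for h
   by (rule klin_comp[OF amodD(7)[OF hm_amod[OF V] v] G3_lin_v[OF hhomD(1)[OF hc[OF that]] Z]])
  show "(%h. G3 V W (act (hh V W) h L) (act V g v) Z) : klin K H W" if "g:.H" for g
   by (rule klin_comp[OF amodD(7)[OF hm_amod[OF hm_hhom] L] G3_lin_L]) (use that v V Z in simp_all)
 qed
 show ?thesis
 proof (rule tensor_eqI[OF mH mH _ lin_tsum2[OF mH mH m(2) bl[OF Z]] _ X])
  show "(%X. G3 V W L v (Z *3 Dl X)) : klin K P2 W"
   by (rule klin_comp[OF lin_P3m(2)[OF Z D_lins(1)] G3_lin_Z[OF l v]])
  fix h g assume hg: "h:.H" "g:.H"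
  have "G3 V W L v (Z *3 Dl (p2 h g)) = G3 V W (act (hh V W) h L) (act V g v) Z"
  proof (rule tensor3_eqI[OF mH mH mH klin_comp[OF lin_P3m(1)[OF klin_id(2)] G3_lin_Z[OF l v]] G3_lin_Z[OF hhomD(1)[OF hc]] _ Z])
   fix p q r assume pqr: "p:.H" "q:.H" "r:.H"
   let ?w = "act V (S q) (act V \<alpha> (act V r (act V g v)))"
   have w: "?w:.V" using V pqr hg v by simp
   have "G3 V W L v (p3 p q r *3 rebr K H H H (pt P2 H s g)) = act W p (g2 V W L ?w s)"
    if s: "s:.P2" for s
    by (rule tensor_eqI[OF mH mH klin_comp[OF lin_P3m(2)[OF _ lin_rebr1] G3_lin_Z[OF l v]] lin_act2[OF W _ g2_lin_s[OF l w]] _ s])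
     (use V W pqr hg v w l in "simp_all add: rebr_ptens P3_ptens_mult G3_ptens g2_ptens S_mult act_mult klin_closed")
   then show "G3 V W L v (p3 p q r *3 Dl (p2 h g)) =
     G3 V W (act (hh V W) h L) (act V g v) (p3 p q r)"
    using hg pqr V v w hhomD(1)[OF hc[OF hg(1)]] by (simp add: D_ptens G3_ptens) (simp add: hhom_fields)
  qed (use hg V v in simp_all)
  then show "G3 V W L v (Z *3 Dl (p2 h g)) = tsum2 W (p2 h g) (%h g. G3 V W (act (hh V W) h L) (act V g v) Z)"
   using hg m by (simp add: tsum2_ptens[OF _ _ _ bl[OF Z]])
 qed
qed

lemma G3_Dr:
 assumes l: "L : klin K V W" and v: "v:.V" and X: "X:.P2" and Z: "Z:.P3"
 shows "G3 V W L v (Dr X *3 Z) = act W (epsr H X) (G3 V W L v Z)"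
proof (rule tensor_eqI[OF mH mH klin_comp[OF lin_P3m(1)[OF D_lins(2) Z] G3_lin_Z[OF l v]] lin_act1[OF W epsr_lin[OF mH] G3_closed[OF l v Z]] _ X])
 fix a b assume ab: "a:.H" "b:.H"
 show "G3 V W L v (Dr (p2 a b) *3 Z) = act W (epsr H (p2 a b)) (G3 V W L v Z)"
 proof (rule tensor3_eqI[OF mH mH mH klin_comp[OF lin_P3m(2)[OF _ klin_id(2)] G3_lin_Z[OF l v]] lin_act2[OF W _ G3_lin_Z[OF l v]] _ Z])
  fix p q r assume pqr: "p:.H" "q:.H" "r:.H"
  have cl: "(%s. L (act V (S q) (act V (Ma s) (act V r v)))) : klin K P2 W"
   by (rule klin_comp[OF _ l]) (use V pqr v in "intro lins M_lin; simp")
  have "G3 V W L v (q3 a s *3 p3 p q r) = act W a (act W p (L (act V (S q) (act V (Ma s) (act V r v)))))"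
   if s: "s:.P2" for s
   by (rule tensor_eqI[OF mH mH klin_comp[OF lin_P3m(1)[OF lin_ptens2[OF _ _ klin_id(2)]] G3_lin_Z[OF l v]] lin_act2[OF W _ lin_act2[OF W _ cl]] _ s])
    (use V W pqr ab v l in "simp_all add: P3_ptens_mult G3_ptens M_ptens S_mult act_mult klin_closed")
  then show "G3 V W L v (Dr (p2 a b) *3 p3 p q r) =
    act W (epsr H (p2 a b)) (G3 V W L v (p3 p q r))"
   using ab pqr V W v l by (simp add: D_ptens M_D epsr_ptens G3_ptens act_smult klin_closed klin_smult)
 qed (use ab in simp_all)
qed

lemma heval_hmor [simp]: "hev V W : mor (T (hh V W) V) W"
proof (rule hmorI)
 note m = hm_module[OF V] hm_module[OF W] hm_module[OF hm_hhom]
 show "hev V W : klin K (T (hh V W) V) W" using heval_lin by simp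
 fix h t assume h: "h:.H" and "t:.T (hh V W) V"
 then have t: "t:.(hh V W)**V" by simp
 show "hev V W (act (T (hh V W) V) h t) = act W h (hev V W t)"
 proof (rule tensor_eqI[OF m(3,1) klin_comp[OF amodD(6)[OF amod_T[OF hm_hhom V] h] heval_lin] lin_act2[OF W h heval_lin] _ t])
  fix L v assume L: "L:.hh V W" and v: "v:.V"
  have "hev V W (act (T (hh V W) V) h (pt (hh V W) V L v)) =
    tsum2 W (\<Delta> h) (%a b. hev V W (pt (hh V W) V (act (hh V W) a L) (act V b v)))"
   using a2_expand[OF hm_hhom V D_closed[OF h] L v m(2) heval_lin] by (simp add: act_T a2_def)
  also have "... = tsum2 W (\<Delta> h) (%a b. G3 V W (act (hh V W) a L) (act V b v) \<phi>)"
   by (rule tsum2_cong[OF mH mH D_closed[OF h] m(2)]) (use L v V in "simp_all add: heval_ptens G3_closed hhomD(1)[OF act_closed[OF hm_hhom]]")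
  also have "... = G3 V W L v (Dr (\<Delta> h) *3 \<phi>)"
   using h L v by (simp add: G3_Dl[symmetric] coassoc)
  also have "... = act W h (hev V W (pt (hh V W) V L v))"
   using h L v by (simp add: G3_Dr[OF hhomD(1)[OF L] v] eps_D heval_ptens)
  finally show "hev V W (act (T (hh V W) V) h (pt (hh V W) V L v)) = act W h (hev V W (pt (hh V W) V L v))" .
 qed
qed

end

end

context qtqh
begin

subsection \<open>Currying\<close>

text \<open>The pentagon solved for the products in which evaluation and currying occur.\<close>

lemma P4_identities:
 "D1 \<phi> *4 I4 \<psi> = D3 \<psi> *4 (I1 \<phi> *4 D2 \<phi>)"
 "I4 \<phi> *4 D1 \<psi> = D2 \<psi> *4 (I1 \<psi> *4 D3 \<phi>)"
proof -
 interpret P4: ring P4 by (rule alg_ring[OF aP(3)])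
 have i: "f \<phi> *4 f \<psi> = \<one>[P4]" "f \<psi> *4 f \<phi> = \<one>[P4]" if "f \<in> ahom K P3 P4" for f
  using ahom_mult[OF that, of \<phi> \<psi>] ahom_mult[OF that, of \<psi> \<phi>] by (simp_all add: phi_phi_inv ahom_one[OF that])
 note i' = i[OF D1_ahom] i[OF D2_ahom] i[OF D3_ahom] i[OF I1_ahom] i[OF I4_ahom]
 have c [simp]: "a *4 (b *4 x) = x" if "a *4 b = \<one>[P4]" "a:.P4" "b:.P4" "x:.P4" for a b x
  using that by (simp add: P4.m_assoc[symmetric])
 have p: "D3 \<phi> *4 D1 \<phi> = I1 \<phi> *4 (D2 \<phi> *4 I4 \<phi>)"
  using pentagon_phi by (simp add: P4.m_assoc)
 have "D1 \<phi> *4 I4 \<psi> = D3 \<psi> *4 (D3 \<phi> *4 D1 \<phi> *4 I4 \<psi>)"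
  by (simp add: P4.m_assoc i')
 then show "D1 \<phi> *4 I4 \<psi> = D3 \<psi> *4 (I1 \<phi> *4 D2 \<phi>)"
  unfolding p by (simp add: P4.m_assoc i')
 have "I4 \<phi> *4 D1 \<psi> = D2 \<psi> *4 (I1 \<psi> *4 (I1 \<phi> *4 (D2 \<phi> *4 I4 \<phi>) *4 D1 \<psi>))"
  by (simp add: P4.m_assoc i')
 then show "I4 \<phi> *4 D1 \<psi> = D2 \<psi> *4 (I1 \<psi> *4 D3 \<phi>)"
  unfolding p[symmetric] by (simp add: P4.m_assoc i')
qed

text \<open>\<open>hcurry\<close> is the adjunct \<open>u \<mapsto> (v \<mapsto> f (\<psi>1 u \<otimes> (\<psi>2 \<beta> S \<psi>3) v))\<close>. In \<open>c3\<close> a variable replaces \<open>\<psi>\<close>, so that identities in the tensor powers of \<open>H\<close> can be checked on pure tensors.\<close>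

definition "c3 U V W f u v Z = tsum3 W Z (%p q r. f (pt U V (act U p u) (act V (q *. \<beta> *. S r) v)))"
definition "hcurry U V W f u = (\<lambda>v\<in>carrier V. c3 U V W f u v \<psi>)"

text \<open>Evaluation after currying is \<open>f\<close> applied to a value of \<open>J\<close> at a product of reassociators, so that the adjunction becomes an identity in the fourth tensor power.\<close>

definition "J U V u v X = tsum2 (U**V) X (%a Y. pt U V (act U a u) (act V (mm Y) v))"

lemma lin_P4m: "g : klin K U P4 ==> w:.P4 ==> (%x. g x *4 w) : klin K U P4"
 "w:.P4 ==> g : klin K U P4 ==> (%x. w *4 g x) : klin K U P4"
 by (rule lin_mult1[OF aP(3)], assumption+) (rule lin_mult2[OF aP(3)])

context
 fixes U :: "('k, 'h, 'u, 'uu) hmod_scheme" and V :: "('k, 'h, 'v, 'vv) hmod_scheme" and W :: "('k, 'h, 'w, 'ww) hmod_scheme"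
 assumes U: "hm U" and V: "hm V" and W: "hm W"
begin

lemma c3_trilin: "f : klin K (U**V) W ==> u:.U ==> v:.V ==>
  trilin K H H H W (%p q r. f (pt U V (act U p u) (act V (q *. \<beta> *. S r) v)))"
 using U V by (intro trilinI lins lin_ptens1 lin_ptens2 klin_comp[of _ K H "U**V" f]) simp_all

lemma c3_lin_Z: "f : klin K (U**V) W ==> u:.U ==> v:.V ==> (%Z. c3 U V W f u v Z) : klin K P3 W"
 unfolding c3_def using W by (intro lin_tsum3 c3_trilin) simp_all

lemma c3_ptens: "f : klin K (U**V) W ==> u:.U ==> v:.V ==> p:.H ==> q:.H ==> r:.H ==>
  c3 U V W f u v (p3 p q r) = f (pt U V (act U p u) (act V q (act V \<beta> (act V (S r) v))))"
 unfolding c3_def using V W by (simp add: tsum3_ptens[OF _ _ _ _ c3_trilin] act_mult)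

lemma c3_lin_u:
 assumes f: "f : klin K (U**V) W" and v: "v:.V" and Z: "Z:.P3"
 shows "(%u. c3 U V W f u v Z) : klin K U W"
 unfolding c3_def
 by (intro lin_tsum3_fun[OF mH mH mH Z] klin_comp[OF lin_ptens1[OF _ _ lin_act2[OF U _ klin_id(2)]] f]) (use U V W v in simp_all)

lemma c3_lin_v:
 assumes f: "f : klin K (U**V) W" and u: "u:.U" and Z: "Z:.P3"
 shows "(%v. c3 U V W f u v Z) : klin K V W"
 unfolding c3_def
 by (intro lin_tsum3_fun[OF mH mH mH Z] klin_comp[OF lin_ptens2[OF _ _ lin_act2[OF V _ klin_id(2)]] f]) (use U V W u in simp_all)

lemma curry_closed:
 assumes "f : klin K (U**V) W" "u:.U"
 shows "hcurry U V W f u:.hh V W"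
 unfolding hcurry_def by (rule hhomI[OF _ c3_lin_v]) (use assms V in simp_all)

lemma curry_lin: "f : klin K (U**V) W ==> hcurry U V W f : klin K U (hh V W)"
 unfolding hcurry_def[abs_def] using U V W by (intro hhom_linI c3_lin_u c3_lin_v) simp_all

lemma c3_Dl:
 assumes f: "f : mor (T U V) W" and u: "u:.U" and v: "v:.V" and X: "X:.P2" and Z: "Z:.P3"
 shows "c3 U V W f u v (Dl X *3 Z) = g2 V W (%v. c3 U V W f u v Z) v X"
proof -
 have fl: "f : klin K (U**V) W" using hmor_lin[OF f] by simp
 note cl = c3_lin_Z[OF fl u v] and gl = g2_lin_s[OF V W c3_lin_v[OF fl u Z] v]
 show ?thesis
 proof (rule tensor_eqI[OF mH mH klin_comp[OF lin_P3m(1)[OF D_lins(1) Z] cl] gl _ X])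
  fix a b assume ab: "a:.H" "b:.H"
  have bv: "act V (S b) v:.V" using V ab v by simp
  have "c3 U V W f u v (Dl (p2 a b) *3 Z) = act W a (c3 U V W f u (act V (S b) v) Z)"
  proof (rule tensor3_eqI[OF mH mH mH klin_comp[OF lin_P3m(2)[OF _ klin_id(2)] cl] lin_act2[OF W ab(1) c3_lin_Z[OF fl u bv]] _ Z])
   fix p q r assume pqr: "p:.H" "q:.H" "r:.H"
   let ?t = "pt U V (act U p u) (act V q (act V \<beta> (act V (S r) (act V (S b) v))))"
   have t: "?t:.U**V" using U V pqr ab u v by simp
   have "c3 U V W f u v (rebr K H H H (pt P2 H s b) *3 p3 p q r) = f (a2 U V s ?t)"
    if s: "s:.P2" for s
    by (rule tensor_eqI[OF mH mH klin_comp[OF lin_P3m(1)[OF lin_rebr1] cl] klin_comp[OF amodD(7)[OF amod_a2[OF U V] t] fl] _ s])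
     (use U V pqr ab u v fl in "simp_all add: rebr_ptens P3_ptens_mult c3_ptens a_ptens S_mult act_mult")
   then have "c3 U V W f u v (Dl (p2 a b) *3 p3 p q r) = f (a2 U V (\<Delta> a) ?t)"
    using ab by (simp add: D_ptens)
   also have "... = act W a (f ?t)" using hmor_act[OF f ab(1), of ?t] t by (simp add: act_T a2_def)
   finally show "c3 U V W f u v (Dl (p2 a b) *3 p3 p q r) =
     act W a (c3 U V W f u (act V (S b) v) (p3 p q r))"
    using fl u bv pqr by (simp add: c3_ptens)
  qed (use ab in simp)
  then show "c3 U V W f u v (Dl (p2 a b) *3 Z) = g2 V W (%v. c3 U V W f u v Z) v (p2 a b)"
   using ab v by (simp add: g2_ptens[OF V W c3_lin_v[OF fl u Z]])
 qed
qed

lemma c3_Dr: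
 assumes f: "f : klin K (U**V) W" and u: "u:.U" and v: "v:.V" and X: "X:.P2" and Z: "Z:.P3"
 shows "c3 U V W f u v (Z *3 Dr X) = c3 U V W f (act U (epsr H X) u) v Z"
proof -
 note cl = c3_lin_Z[OF f u v]
 show ?thesis
 proof (rule tensor_eqI[OF mH mH klin_comp[OF lin_P3m(2)[OF Z D_lins(2)] cl] klin_comp[OF lin_act1[OF U epsr_lin[OF mH] u] c3_lin_u[OF f v Z]] _ X])
  fix a b assume ab: "a:.H" "b:.H"
  have e: "act U (epsr H (p2 a b)) u = \<epsilon> b \<odot>[U] act U a u" and au: "act U a u:.U"
   and eu: "\<epsilon> b \<odot>[U] act U a u:.U"
   using U ab u act_closed[OF U, of "\<epsilon> b \<odot>[H] a" u] by (simp_all add: epsr_ptens act_smult)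
  show "c3 U V W f u v (Z *3 Dr (p2 a b)) = c3 U V W f (act U (epsr H (p2 a b)) u) v Z"
   unfolding e
  proof (rule tensor3_eqI[OF mH mH mH klin_comp[OF lin_P3m(1)[OF klin_id(2)] cl] c3_lin_Z[OF f eu v] _ Z])
   fix p q r assume pqr: "p:.H" "q:.H" "r:.H"
   have l: "(%s. f (pt U V (act U p (act U a u)) (act V q (act V (Mb s) (act V (S r) v))))) : klin K P2 W"
    by (rule klin_comp[OF lin_ptens2[OF _ _ lin_act2[OF V _ lin_act1[OF V M_lin(2)]]] f]) (use U V pqr au v in simp_all)
   have "c3 U V W f u v (p3 p q r *3 q3 a s) =
     f (pt U V (act U p (act U a u)) (act V q (act V (Mb s) (act V (S r) v))))" if s: "s:.P2" for s
    by (rule tensor_eqI[OF mH mH klin_comp[OF lin_P3m(2)[OF _ lin_ptens2[OF _ _ klin_id(2)]] cl] l _ s])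
     (use U V pqr ab u v f in "simp_all add: P3_ptens_mult c3_ptens M_ptens S_mult act_mult")
   moreover have "pt U V (act U p (act U a u)) (act V q (\<epsilon> b \<odot>[V] act V \<beta> (act V (S r) v))) =
     pt U V (act U p (\<epsilon> b \<odot>[U] act U a u)) (act V q (act V \<beta> (act V (S r) v)))"
    using U V pqr ab u v by (simp add: act_smult ptens_smult)
   ultimately show "c3 U V W f u v (p3 p q r *3 Dr (p2 a b)) =
     c3 U V W f (\<epsilon> b \<odot>[U] act U a u) v (p3 p q r)"
    using U V pqr ab v eu f by (simp add: D_ptens M_D c3_ptens[OF f eu] act_smult)
  qed (use ab in simp)
 qed
qed

lemma psi_D:
 assumes h: "h:.H"
 shows "Dl (\<Delta> h) *3 \<psi> = \<psi> *3 Dr (\<Delta> h)"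
proof -
 interpret P3: ring P3 by (rule alg_ring[OF aP(2)])
 have "\<psi> *3 (Dr (\<Delta> h) *3 \<phi>) *3 \<psi> = \<psi> *3 (\<phi> *3 Dl (\<Delta> h)) *3 \<psi>"
  by (simp add: coassoc[OF h])
 moreover have "\<psi> *3 (Dr (\<Delta> h) *3 \<phi>) *3 \<psi> = \<psi> *3 Dr (\<Delta> h)"
  using h by (simp add: P3.m_assoc phi_phi_inv)
 moreover have "\<psi> *3 (\<phi> *3 Dl (\<Delta> h)) = Dl (\<Delta> h)"
  using h by (simp add: P3.m_assoc[symmetric] phi_phi_inv)
 ultimately show ?thesis by simp
qed

lemma curry_hmor:
 assumes f: "f : mor (T U V) W"
 shows "hcurry U V W f : mor U (hh V W)"
proof (rule hmorI)
 have fl: "f : klin K (U**V) W" using hmor_lin[OF f] by simp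
 show "hcurry U V W f : klin K U (hh V W)" by (rule curry_lin[OF fl])
 fix h u assume h: "h:.H" and u: "u:.U"
 have hu: "act U h u:.U" using U h u by simp
 note c = curry_closed[OF fl]
 show "hcurry U V W f (act U h u) = act (hh V W) h (hcurry U V W f u)"
 proof (rule hhom_eqI[OF c[OF hu] act_closed[OF hm_hhom[OF V W] h c[OF u]]])
  fix v assume v: "v:.V"
  have "act (hh V W) h (hcurry U V W f u) v = g2 V W (%v. c3 U V W f u v \<psi>) v (\<Delta> h)"
  proof -
   have "g2 V W (hcurry U V W f u) v (\<Delta> h) = g2 V W (%v. c3 U V W f u v \<psi>) v (\<Delta> h)"
    unfolding g2_def
    by (rule tsum2_cong[OF mH mH D_closed[OF h]])
     (use V W v klin_closed[OF c3_lin_v[OF fl u phi_closed(2)]] in "simp_all add: hcurry_def")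
   then show ?thesis using v by (simp add: hhom_fields)
  qed
  also have "... = c3 U V W f u v (\<psi> *3 Dr (\<Delta> h))"
   using h by (simp add: c3_Dl[OF f u v, symmetric] psi_D)
  also have "... = c3 U V W f (act U h u) v \<psi>"
   using h by (simp add: c3_Dr[OF fl u v] eps_D)
  finally show "hcurry U V W f (act U h u) v = act (hh V W) h (hcurry U V W f u) v"
   using v by (simp add: hcurry_def)
 qed
qed

lemma J_bilin: "u:.U ==> v:.V ==> bilin K H P3 (U**V) (%a Y. pt U V (act U a u) (act V (mm Y) v))"
 using U V by (intro bilinI lin_ptens1 lin_ptens2 lins mn_lin) simp_all

lemma J_lin: "u:.U ==> v:.V ==> (%X. J U V u v X) : klin K P4 (U**V)"
 unfolding J_def using U V by (intro lin_tsum2 J_bilin) simp_all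

lemma J_ptens: "u:.U ==> v:.V ==> a:.H ==> Y:.P3 ==>
  J U V u v (q4 a Y) = pt U V (act U a u) (act V (mm Y) v)"
 unfolding J_def using U V by (simp add: tsum2_ptens[OF _ _ _ J_bilin])

lemma J_G3:
 assumes f: "f : mor (T U V) W" and u: "u:.U" and v: "v:.V" and X: "X:.P3" and Y: "Y:.P3"
 shows "f (J U V u v (D1 X *4 I4 Y)) = G3 V W (%v. c3 U V W f u v Y) v X"
proof -
 have fl: "f : klin K (U**V) W" using hmor_lin[OF f] by simp
 note l = klin_comp[OF J_lin[OF u v] fl] and cv = c3_lin_v[OF fl u]
 show ?thesis
 proof (rule tensor3_eqI[OF mH mH mH klin_comp[OF lin_P4m(1)[OF D_lins(3)] l] G3_lin_Z[OF V W cv[OF Y] v] _ X])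
  fix a b c assume abc: "a:.H" "b:.H" "c:.H"
  let ?w = "act V (S b) (act V \<alpha> (act V c v))"
  have w: "?w:.V" using V abc v by simp
  have "f (J U V u v (D1 (p3 a b c) *4 I4 Y)) = act W a (c3 U V W f u ?w Y)"
  proof (rule tensor3_eqI[OF mH mH mH klin_comp[OF lin_P4m(2)[OF _ D_lins(7)] l] lin_act2[OF W abc(1) c3_lin_Z[OF fl u w]] _ Y])
   fix p q r assume pqr: "p:.H" "q:.H" "r:.H"
   let ?t = "pt U V (act U p u) (act V q (act V \<beta> (act V (S r) ?w)))"
   have t: "?t:.U**V" using U V pqr u w by simp
   have "J U V u v (rebr K H H P2 (pt P2 P2 s (p2 b c)) *4 q4 p (q3 q (p2 r 1H))) = a2 U V s ?t"
    if s: "s:.P2" for s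
    by (rule tensor_eqI[OF mH mH klin_comp[OF lin_P4m(1)[OF lin_rebr1] J_lin[OF u v]] amodD(7)[OF amod_a2[OF U V] t] _ s])
     (use U V pqr abc u v in "simp_all add: rebr_ptens P3_ptens_mult J_ptens mn_ptens a_ptens S_mult H_mult act_mult")
   then have "f (J U V u v (D1 (p3 a b c) *4 I4 (p3 p q r))) = f (a2 U V (\<Delta> a) ?t)"
    using abc pqr by (simp add: D_ptens I4_ptens)
   also have "... = act W a (f ?t)" using hmor_act[OF f abc(1), of ?t] t by (simp add: act_T a2_def)
   finally show "f (J U V u v (D1 (p3 a b c) *4 I4 (p3 p q r))) =
     act W a (c3 U V W f u ?w (p3 p q r))"
    using fl u w pqr by (simp add: c3_ptens)
  qed (use abc in simp)
  then show "f (J U V u v (D1 (p3 a b c) *4 I4 Y)) = G3 V W (%v. c3 U V W f u v Y) v (p3 a b c)"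
   using abc v by (simp add: G3_ptens[OF V W cv[OF Y]])
 qed (use Y in simp)
qed

text \<open>After the counit contractions have removed both outer reassociators, what remains is the quasi-antipode axiom \<open>mm \<phi> = 1\<close>.\<close>

lemma J_value:
 assumes u: "u:.U" and v: "v:.V"
 shows "J U V u v (D3 \<psi> *4 (I1 \<phi> *4 D2 \<phi>)) = pt U V u v"
proof -
 note m = hm_module[OF U] hm_module[OF V]
 note A = amod_a2[OF U V] and Jl = J_lin[OF u v]
 have uv: "pt U V u v:.U**V" using m u v by simp
 define M where "M = tmap K U V id (act V (mm \<phi>))"
 have Ml: "M : klin K (U**V) (U**V)"
  unfolding M_def by (rule tmap_lin[OF m m klin_id(1) amodD(6)[OF hm_amod[OF V]]]) simp
 have gen: "J U V u v (D3 X *4 (I1 \<phi> *4 D2 Z)) = a2 U V (N3 X) (M (a2 U V (N2 Z) (pt U V u v)))"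
  if X: "X:.P3" and Z: "Z:.P3" for X Z
 proof (rule bilin_eqI[OF mH _ mH _ _ _ _ X Z, of "U**V"])
  show "bilin K P3 P3 (U**V) (%X Z. J U V u v (D3 X *4 (I1 \<phi> *4 D2 Z)))"
   by (intro bilinI klin_comp[OF _ Jl] lin_P4m D_lins) simp_all
  show "bilin K P3 P3 (U**V) (%X Z. a2 U V (N3 X) (M (a2 U V (N2 Z) (pt U V u v))))"
  proof (rule bilinI)
   fix X assume "X:.P3"
   then show "(%Z. a2 U V (N3 X) (M (a2 U V (N2 Z) (pt U V u v)))) : klin K P3 (U**V)"
    by (intro klin_comp[OF klin_comp[OF klin_comp[OF ahom_lin[OF N_ahom(2)] amodD(7)[OF A uv]] Ml] amodD(6)[OF A]]) simp
  next
   fix Z assume "Z:.P3"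
   then show "(%X. a2 U V (N3 X) (M (a2 U V (N2 Z) (pt U V u v)))) : klin K P3 (U**V)"
    by (intro klin_comp[OF ahom_lin[OF N_ahom(3)] amodD(7)[OF A]] klin_closed[OF Ml] amodD(5)[OF A]) (simp_all add: uv)
  qed
  fix x X' z Z' assume a: "x:.H" "X':.P2" "z:.H" "Z':.P2"
  have N: "N3 (q3 x X') = p2 x (epsr H X')" "N2 (q3 z Z') = p2 z (epsl H Z')"
   using a by (simp_all add: N3_def N2_def tmap_ptens klin_id epsl_lin epsr_lin)
  have mv: "act V (mm \<phi>) : klin K V V" by (rule amodD(6)[OF hm_amod[OF V]]) simp
  have p: "D3 (q3 x X') *4 (I1 \<phi> *4 D2 (q3 z Z')) =
   q4 (x *. z) (Dr X' *3 (\<phi> *3 Dl Z'))"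
   using a by (simp add: D_ptens I1_def P3_ptens_mult H_mult)
  show "J U V u v (D3 (q3 x X') *4 (I1 \<phi> *4 D2 (q3 z Z'))) =
   a2 U V (N3 (q3 x X')) (M (a2 U V (N2 (q3 z Z')) (pt U V u v)))"
   unfolding p N M_def using a u v U V mv
   by (simp add: J_ptens mm_Dr mm_Dl a_ptens tmap_ptens klin_id act_mult)
 qed simp_all
 have "M (pt U V u v) = pt U V u v"
  using U V u v by (simp add: M_def tmap_ptens klin_id amodD(6)[OF hm_amod[OF V]] mm_phi act_one)
 then show ?thesis
  by (simp add: gen N_psi N2_phi amodD(4)[OF A] uv)
qed

lemma heval_curry:
 assumes f: "f : mor (T U V) W" and u: "u:.U" and v: "v:.V"
 shows "hev V W (pt (hh V W) V (hcurry U V W f u) v) = f (pt U V u v)"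
proof -
 have fl: "f : klin K (U**V) W" using hmor_lin[OF f] by simp
 have "hev V W (pt (hh V W) V (hcurry U V W f u) v) = G3 V W (hcurry U V W f u) v \<phi>"
  by (rule heval_ptens[OF V W curry_closed[OF fl u] v])
 also have "... = G3 V W (%v. c3 U V W f u v \<psi>) v \<phi>"
  unfolding G3_def
  by (rule tsum3_cong[OF mH mH mH phi_closed(1)])
   (use V W v klin_closed[OF c3_lin_v[OF fl u phi_closed(2)]] in "simp_all add: hcurry_def")
 also have "... = f (pt U V u v)"
  using J_G3[OF f u v phi_closed] by (simp add: P4_identities J_value u v)
 finally show ?thesis .
qed

text \<open>A map into the internal hom is recovered from its evaluation by the same formula as currying; the other quasi-antipode axiom, \<open>nn \<psi> = 1\<close>, enters here.\<close>

lemma curry_unique: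
 assumes g: "g : mor U (hh V W)" and f: "f : klin K (U**V) W"
  and e: "!!u v. u:.U ==> v:.V ==> hev V W (pt (hh V W) V (g u) v) = f (pt U V u v)"
  and u: "u:.U"
 shows "g u = hcurry U V W f u"
proof (rule hhom_eqI[OF hmor_closed[OF g u] curry_closed[OF f u]])
 fix v assume v: "v:.V"
 note m = hm_module[OF U] hm_module[OF V] hm_module[OF W]
 let ?L = "g u"
 have L: "?L:.hh V W" by (rule hmor_closed[OF g u])
 note l = hhomD(1)[OF L]
 define E where "E = (%X. tsum2 W X (%a Y. act W a (?L (act V (nn Y) v))))"
 have Eb: "bilin K H P3 W (%a Y. act W a (?L (act V (nn Y) v)))"
  by (intro bilinI lin_act1[OF W klin_id(2)] lin_act2[OF W] klin_comp[OF lin_act1[OF V mn_lin(2) v] l]) (use V v l in "simp_all add: klin_closed")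
 have El: "E : klin K P4 W" unfolding E_def using W by (intro lin_tsum2 Eb) simp_all
 have Ep: "E (q4 a Y) = act W a (?L (act V (nn Y) v))" if "a:.H" "Y:.P3" for a Y
  unfolding E_def using W that by (simp add: tsum2_ptens[OF _ _ _ Eb])
 have hc: "act (hh V W) p ?L:.hh V W" if "p:.H" for p by (rule act_closed[OF hm_hhom[OF V W] that L])
 define F where "F = (%X p q r. G3 V W (act (hh V W) p ?L) (act V (q *. \<beta> *. S r) v) X)"
 have Ft: "trilin K H H H W (F X)" if X: "X:.P3" for X
  unfolding F_def
  by (intro trilinI klin_comp[OF _ G3_lin_v[OF V W hhomD(1)[OF hc] X]]
    klin_comp[OF amodD(7)[OF hm_amod[OF hm_hhom[OF V W]] L] G3_lin_L[OF V W _ X]] lins V) (use V v in simp_all)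
 have gen: "E (I4 X *4 D1 Z) = tsum3 W Z (F X)" if X: "X:.P3" and Z: "Z:.P3" for X Z
 proof (rule tensor3_eqI[OF mH mH mH klin_comp[OF lin_P4m(2)[OF _ D_lins(3)] El] lin_tsum3[OF mH mH mH m(3) Ft[OF X]] _ Z])
  fix p q r assume pqr: "p:.H" "q:.H" "r:.H"
  let ?w = "act V (q *. \<beta> *. S r) v"
  have w: "?w:.V" using V pqr v by simp
  have "E (I4 X *4 D1 (p3 p q r)) = G3 V W (act (hh V W) p ?L) ?w X"
  proof (rule tensor3_eqI[OF mH mH mH klin_comp[OF lin_P4m(1)[OF D_lins(7)] El] G3_lin_Z[OF V W hhomD(1)[OF hc[OF pqr(1)]] w] _ X])
   fix a b c assume abc: "a:.H" "b:.H" "c:.H"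
   let ?y = "act V (S b) (act V \<alpha> (act V c ?w))"
   have y: "?y:.V" using V abc w by simp
   have "E (q4 a (q3 b (p2 c 1H)) *4 rebr K H H P2 (pt P2 P2 s (p2 q r))) = act W a (g2 V W ?L ?y s)"
    if s: "s:.P2" for s
    by (rule tensor_eqI[OF mH mH klin_comp[OF lin_P4m(2)[OF _ lin_rebr1] El] lin_act2[OF W abc(1) g2_lin_s[OF V W l y]] _ s])
     (use V W pqr abc v l y in "simp_all add: rebr_ptens P3_ptens_mult Ep mn_ptens g2_ptens S_mult H_mult act_mult klin_closed")
   then show "E (I4 (p3 a b c) *4 D1 (p3 p q r)) =
     G3 V W (act (hh V W) p ?L) ?w (p3 a b c)"
    using abc pqr w y by (simp add: D_ptens I4_ptens G3_ptens[OF V W hhomD(1)[OF hc]]) (simp add: hhom_fields)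
  qed (use pqr in simp)
  then show "E (I4 X *4 D1 (p3 p q r)) = tsum3 W (p3 p q r) (F X)"
   using pqr W by (simp add: tsum3_ptens[OF mH mH mH m(3) Ft[OF X]]) (simp add: F_def)
 qed (use X in simp)
 have val: "E (D2 X *4 (I1 \<psi> *4 D3 Z)) = g2 V W (%w. g2 V W ?L w (N3 Z)) v (N2 X)"
  if X: "X:.P3" and Z: "Z:.P3" for X Z
 proof (rule bilin_eqI[OF mH _ mH _ _ _ _ X Z, of W])
  show "bilin K P3 P3 W (%X Z. E (D2 X *4 (I1 \<psi> *4 D3 Z)))"
   by (intro bilinI klin_comp[OF _ El] lin_P4m D_lins) simp_all
  show "bilin K P3 P3 W (%X Z. g2 V W (%w. g2 V W ?L w (N3 Z)) v (N2 X))"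
  proof (rule bilinI)
   fix X assume X: "X:.P3"
   show "(%Z. g2 V W (%w. g2 V W ?L w (N3 Z)) v (N2 X)) : klin K P3 W"
    unfolding g2_def[of _ _ "%w. g2 V W ?L w (N3 Z)" for Z]
    by (intro lin_tsum2_fun[OF mH mH N_closed(2)[OF X]] lin_act2[OF W] klin_comp[OF ahom_lin[OF N_ahom(3)] g2_lin_s[OF V W l]])
     (use V W v in simp_all)
  next
   fix Z assume Z: "Z:.P3"
   show "(%X. g2 V W (%w. g2 V W ?L w (N3 Z)) v (N2 X)) : klin K P3 W"
    by (rule klin_comp[OF ahom_lin[OF N_ahom(2)] g2_lin_s[OF V W g2_lin_v[OF V W l N_closed(3)[OF Z]] v]])
  qed
  fix x X' z Z' assume a: "x:.H" "X':.P2" "z:.H" "Z':.P2"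
  have N: "N2 (q3 x X') = p2 x (epsl H X')" "N3 (q3 z Z') = p2 z (epsr H Z')"
   using a by (simp_all add: N3_def N2_def tmap_ptens klin_id epsl_lin epsr_lin)
  have p: "D2 (q3 x X') *4 (I1 \<psi> *4 D3 (q3 z Z')) =
   q4 (x *. z) (Dl X' *3 (\<psi> *3 Dr Z'))"
   using a by (simp add: D_ptens I1_def P3_ptens_mult H_mult)
  have zz: "p2 z (epsr H Z'):.P2" using a by simp
  show "E (D2 (q3 x X') *4 (I1 \<psi> *4 D3 (q3 z Z'))) =
   g2 V W (%w. g2 V W ?L w (N3 (q3 z Z'))) v (N2 (q3 x X'))"
   unfolding p N using a v V W l
   by (simp add: Ep nn_Dl nn_Dr nn_psi H_mult g2_ptens[OF V W g2_lin_v[OF V W l zz]] g2_ptens[OF V W l] act_mult klin_closed)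
 qed simp_all
 have "hcurry U V W f u v = tsum3 W \<psi> (F \<phi>)"
  unfolding hcurry_def c3_def restrict_apply'[OF v]
 proof (rule tsum3_cong[OF mH mH mH phi_closed(2) m(3)])
  fix p q r assume pqr: "p:.H" "q:.H" "r:.H"
  have pu: "act U p u:.U" and w: "act V (q *. \<beta> *. S r) v:.V" using U V pqr u v by simp_all
  show "f (pt U V (act U p u) (act V (q *. \<beta> *. S r) v)) = F \<phi> p q r"
   unfolding e[OF pu w, symmetric] hmor_act[OF g pqr(1) u] F_def by (rule heval_ptens[OF V W hc[OF pqr(1)] w])
  show "F \<phi> p q r:.W" unfolding F_def by (rule G3_closed[OF V W hhomD(1)[OF hc[OF pqr(1)]] w phi_closed(1)])
 qed
 also have "... = g2 V W (%w. g2 V W ?L w (N3 \<phi>)) v (N2 \<psi>)"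
  using gen[OF phi_closed] val[OF phi_closed(2,1)] by (simp add: P4_identities(2))
 also have "... = ?L v"
 proof -
  have "g2 V W (%w. g2 V W ?L w \<one>[P2]) v \<one>[P2] = g2 V W ?L v (\<one>[P2] *2 \<one>[P2])"
   by (rule g2_mult[OF V W l v, symmetric]) simp_all
  then show ?thesis using V W v l
   by (simp add: N_phi N_psi alg_mult[OF aP(1)]) (simp add: tensor_one g2_ptens S_one act_one klin_closed)
 qed
 finally show "?L v = hcurry U V W f u v" ..
qed

lemma heval_curry_wr:
 assumes f: "f : mor (T U V) W" and t: "t:.U**V"
 shows "hev V W (wr U (hh V W) V (hcurry U V W f) t) = f t"
proof (rule tensor_eqI[OF _ _ klin_comp[OF hmor_lin[OF wr_hmor] hmor_lin[OF heval_hmor], simplified] hmor_lin[OF f, simplified] _ t])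
 show "hcurry U V W f : mor U (hh V W)" by (rule curry_hmor[OF f])
qed (use U V W f in "simp_all add: wr_ptens curry_hmor heval_curry")

text \<open>Equivariance of the maps matters: it is what lets \<open>H\<close> act on the argument of the evaluation.\<close>

lemma heval_separates:
 assumes g: "g : mor U (hh V W)" and g': "g' : mor U (hh V W)"
  and e: "!!t. t:.U**V ==> hev V W (wr U (hh V W) V g t) = hev V W (wr U (hh V W) V g' t)"
  and u: "u:.U"
 shows "g u = g' u"
proof -
 let ?f = "%t. hev V W (wr U (hh V W) V g' t)"
 have f: "?f : klin K (U**V) W"
  using klin_comp[OF hmor_lin[OF wr_hmor[OF U hm_hhom[OF V W] V g']] hmor_lin[OF heval_hmor[OF V W]]] by simp
 have p: "hev V W (wr U (hh V W) V k (pt U V u v)) = hev V W (pt (hh V W) V (k u) v)"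
  if "k : mor U (hh V W)" "u:.U" "v:.V" for k u v
  using that U V W by (simp add: wr_ptens)
 have "g u = hcurry U V W ?f u"
  by (rule curry_unique[OF g f _ u]) (use e[of "pt U V a b" for a b] p[OF g] U V in "simp")
 moreover have "g' u = hcurry U V W ?f u"
  by (rule curry_unique[OF g' f _ u]) (use p[OF g'] in simp)
 ultimately show ?thesis by simp
qed

end

subsection \<open>Composition\<close>

lemma hcomp_spec:
 assumes V: "hm V" and W: "hm W" and X: "hm X"
 shows "hcomp K H V W X \<in> hmor K H (T (hh W X) (hh V W)) (hh V X)"
  "t:.tensor K (hh W X) (tensor K (hh V W) V) ==>
   heval K H V X (rtl (hh W X) (hh V W) (hh V X) V (hcomp K H V W X) t) =
   heval K H W X (wl (hh W X) (T (hh V W) V) W (heval K H V W) t)"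
proof -
 note h = hm_hhom[OF V W] hm_hhom[OF W X] hm_hhom[OF V X]
 let ?D = "T (hh W X) (hh V W)"
 let ?E = "%t. heval K H W X (tmap K (hh W X) W id (heval K H V W) (asc (hh W X) (hh V W) V t))"
 have D: "hm ?D" using h by simp
 have E: "?E \<in> hmor K H (T ?D V) X"
  by (rule hmor_comp[OF hmor_comp[OF assoc_hmor hmor_tmap[OF _ _ _ _ hmor_id(1) heval_hmor]] heval_hmor]) (use h V W X in simp_all)
 define m where "m = restrict (hcurry ?D V X ?E) (carrier ?D)"
 have mh: "m \<in> hmor K H ?D (hh V X)"
  by (rule hmor_cong[OF curry_hmor[OF D V X E] D]) (simp add: m_def)
 have me: "heval K H V X (wr ?D (hh V X) V m t) = ?E t" if t: "t:.tensor K (tensor K (hh W X) (hh V W)) V" for t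
 proof -
  have "wr ?D (hh V X) V m t = wr ?D (hh V X) V (hcurry ?D V X ?E) t"
   unfolding wr_def
   by (rule tmap_cong[OF _ _ _ _ hmor_lin[OF curry_hmor[OF D V X E]] klin_id(1)]) (use t V h D in "simp_all add: m_def")
  then show ?thesis using heval_curry_wr[OF D V X E] t by simp
 qed
 have "hcomp K H V W X = m"
  unfolding hcomp_def
 proof (rule the_equality)
  show "m \<in> hmor K H ?D (hh V X) \<and> m \<in> extensional (carrier ?D) \<and>
   (\<forall>t\<in>carrier (T ?D V). heval K H V X (tmap K (hh V X) V m id t) = ?E t)"
   using mh me by (simp add: m_def wr_def)
  fix n assume n: "n \<in> hmor K H ?D (hh V X) \<and> n \<in> extensional (carrier ?D) \<and>
   (\<forall>t\<in>carrier (T ?D V). heval K H V X (tmap K (hh V X) V n id t) = ?E t)"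
  show "n = m"
  proof (rule extensionalityI)
   show "n x = m x" if "x:.?D" for x
    by (rule heval_separates[OF D V X _ mh _ that]) (use n me in "auto simp: wr_def")
  qed (use n in "auto simp: m_def")
 qed
 then show "hcomp K H V W X \<in> hmor K H ?D (hh V X)" using mh by simp
 show "heval K H V X (rtl (hh W X) (hh V W) (hh V X) V (hcomp K H V W X) t) =
   heval K H W X (wl (hh W X) (T (hh V W) V) W (heval K H V W) t)"
  if t: "t:.tensor K (hh W X) (tensor K (hh V W) V)"
  unfolding rtl_def \<open>hcomp K H V W X = m\<close>
  using t h V by (simp add: me wl_def)
qed

end

section \<open>Quotients of modules\<close>

definition hsub :: "('k, 'r) ring_scheme => ('k, 'h, 'm) quasi_hopf_data_scheme => ('k, 'h, 'v, 'n) hmod_scheme => 'v set => bool" where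
 "hsub K H V N \<longleftrightarrow> N \<subseteq> carrier V \<and> \<zero>[V] \<in> N \<and> (\<forall>x\<in>N. \<forall>y\<in>N. x +[V] y \<in> N) \<and>
   (\<forall>c\<in>carrier K. \<forall>x\<in>N. c \<odot>[V] x \<in> N) \<and> (\<forall>h\<in>carrier H. \<forall>x\<in>N. act V h x \<in> N)"

context qtqh
begin

lemma hsubD:
 assumes "hsub K H V N"
 shows "x \<in> N ==> x:.V" "\<zero>[V] \<in> N" "x \<in> N ==> y \<in> N ==> x +[V] y \<in> N"
  "c:.K ==> x \<in> N ==> c \<odot>[V] x \<in> N" "h:.H ==> x \<in> N ==> act V h x \<in> N"
 using assms unfolding hsub_def by blast+

lemma hmor_diff:
 assumes V: "hm V" and W: "hm W" and f: "f : mor V W" and g: "g : mor V W"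
 shows "(%x. f x \<ominus>[W] g x) : mor V W"
proof -
 interpret W: module K W using W by simp
 have e: "f x \<ominus>[W] g x = f x +[W] (\<ominus>[K] \<one>[K]) \<odot>[W] g x" if "x:.V" for x
  using that hmor_closed[OF g] by (simp add: W.smult_l_minus a_minus_def)
 have s: "(%x. (\<ominus>[K] \<one>[K]) \<odot>[W] g x) : klin K V W"
  by (rule klin_scale[OF _ hmor_lin[OF g]]) (use W in simp_all)
 have "(%x. f x +[W] (\<ominus>[K] \<one>[K]) \<odot>[W] g x) : mor V W"
 proof (rule hmorI[OF klin_plus[OF _ hmor_lin[OF f] s]])
  fix h v assume h: "h:.H" and v: "v:.V"
  have "(\<ominus>[K] \<one>[K]) \<odot>[W] act W h (g v) = act W h ((\<ominus>[K] \<one>[K]) \<odot>[W] g v)"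
   using act_smult(2)[OF W h, of "\<ominus>[K] \<one>[K]" "g v"] hmor_closed[OF g v] by simp
  then show "f (act V h v) +[W] (\<ominus>[K] \<one>[K]) \<odot>[W] g (act V h v) = act W h (f v +[W] (\<ominus>[K] \<one>[K]) \<odot>[W] g v)"
   using h v hmor_closed[OF f v] hmor_closed[OF g v]
   by (simp add: hmor_act[OF f] hmor_act[OF g] klin_add[OF amodD(6)[OF hm_amod[OF W] h]])
 qed (use W in simp)
 from hmor_cong[OF this V e[symmetric]] show ?thesis .
qed

lemma hsub_image:
 assumes U: "hm U" and V: "hm V" and d: "d : mor U V"
 shows "hsub K H V (d ` carrier U)"
 unfolding hsub_def
proof (intro conjI ballI)
 note m = hm_module[OF U] hm_module[OF V] and l = hmor_lin[OF d]
 show "d ` carrier U \<subseteq> carrier V" using hmor_closed[OF d] by blast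
 show "\<zero>[V] \<in> d ` carrier U" using klin_zero[OF m l] module_zero_closed[OF m(1)] by force
 show "x +[V] y \<in> d ` carrier U" if "x \<in> d ` carrier U" "y \<in> d ` carrier U" for x y
  using that klin_add[OF l, symmetric] module_add_closed[OF m(1)] by auto
 show "c \<odot>[V] x \<in> d ` carrier U" if "c:.K" "x \<in> d ` carrier U" for c x
  using that klin_smult[OF l, symmetric] module.smult_closed[OF m(1)] by auto
 show "act V h x \<in> d ` carrier U" if "h:.H" "x \<in> d ` carrier U" for h x
  using that hmor_act[OF d, symmetric] act_closed[OF U] by auto
qed

context
 fixes V :: "('k, 'h, 'v, 'vv) hmod_scheme" and N
 assumes V: "hm V" and N: "hsub K H V N"
begin

lemma hsub_abelian_subgroup: "abelian_subgroup N V"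
proof -
 interpret module K V using V by simp
 have neg: "\<ominus>[V] x \<in> N" if "x \<in> N" for x
  using hsubD(4)[OF N, of "\<ominus>[K] \<one>[K]" x] that hsubD(1)[OF N that] by (simp add: smult_l_minus)
 have "subgroup N (add_monoid V)"
  by (rule add.subgroupI) (use hsubD[OF N] neg in "auto simp: a_inv_def")
 then show ?thesis by (intro abelian_subgroupI3 additive_subgroup.intro M.abelian_group_axioms)
qed

lemma quot_eq_iff:
 assumes "t:.V" "t':.V"
 shows "N +>\<^bsub>V\<^esub> t = N +>\<^bsub>V\<^esub> t' \<longleftrightarrow> t \<ominus>[V] t' \<in> N"
proof -
 interpret abelian_subgroup N V by (rule hsub_abelian_subgroup)
 show ?thesis
  using a_rcos_module[OF assms(2,1)] a_repr_independence'[OF _ assms(2)] a_rcos_self[OF assms(1)]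
  by (auto simp: a_minus_def)
qed

lemma quot_fields:
 "Z:.QM V N \<longleftrightarrow> (\<exists>t\<in>carrier V. Z = N +>\<^bsub>V\<^esub> t)" "\<zero>[QM V N] = N"
 "Z +[QM V N] Y = Z <+>\<^bsub>V\<^esub> Y" "c \<odot>[QM V N] Z = N +>\<^bsub>V\<^esub> (c \<odot>[V] rep Z)" "act (QM V N) h Z = N +>\<^bsub>V\<^esub> act V h (rep Z)"
 by (auto simp: quotient_hmod_def A_RCOSETS_def RCOSETS_def a_r_coset_def)

lemma quot_rep:
 assumes t: "t:.V"
 shows "rep (N +>\<^bsub>V\<^esub> t):.V" "N +>\<^bsub>V\<^esub> rep (N +>\<^bsub>V\<^esub> t) = N +>\<^bsub>V\<^esub> t" "rep (N +>\<^bsub>V\<^esub> t) \<ominus>[V] t \<in> N"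
proof -
 interpret abelian_subgroup N V by (rule hsub_abelian_subgroup)
 have r: "rep (N +>\<^bsub>V\<^esub> t) \<in> N +>\<^bsub>V\<^esub> t" unfolding rep_def by (rule someI) (rule a_rcos_self[OF t])
 then show c: "rep (N +>\<^bsub>V\<^esub> t):.V" using a_elemrcos_carrier[OF t] by blast
 show "N +>\<^bsub>V\<^esub> rep (N +>\<^bsub>V\<^esub> t) = N +>\<^bsub>V\<^esub> t" using a_repr_independence'[OF r t] by simp
 then show "rep (N +>\<^bsub>V\<^esub> t) \<ominus>[V] t \<in> N" using quot_eq_iff[OF c t] by simp
qed

lemma quot_ops:
 assumes t: "t:.V"
 shows "t':.V ==> (N +>\<^bsub>V\<^esub> t) +[QM V N] (N +>\<^bsub>V\<^esub> t') = N +>\<^bsub>V\<^esub> (t +[V] t')"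
  "c:.K ==> c \<odot>[QM V N] (N +>\<^bsub>V\<^esub> t) = N +>\<^bsub>V\<^esub> (c \<odot>[V] t)"
  "h:.H ==> act (QM V N) h (N +>\<^bsub>V\<^esub> t) = N +>\<^bsub>V\<^esub> act V h t"
proof -
 interpret abelian_subgroup N V by (rule hsub_abelian_subgroup)
 note r = quot_rep[OF t] and m = hm_module[OF V]
 show "t':.V ==> (N +>\<^bsub>V\<^esub> t) +[QM V N] (N +>\<^bsub>V\<^esub> t') = N +>\<^bsub>V\<^esub> (t +[V] t')"
  using a_rcos_sum[OF t] by (simp add: quot_fields)
 show "c \<odot>[QM V N] (N +>\<^bsub>V\<^esub> t) = N +>\<^bsub>V\<^esub> (c \<odot>[V] t)" if c: "c:.K"
 proof -
  have l: "(%x. c \<odot>[V] x) : klin K V V" by (rule klin_scale[OF m klin_id(2) c])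
  have "c \<odot>[V] rep (N +>\<^bsub>V\<^esub> t) \<ominus>[V] c \<odot>[V] t \<in> N"
   using hsubD(4)[OF N c r(3)] klin_minus[OF m m l r(1) t] by simp
  then show ?thesis using r(1) t c m by (simp add: quot_fields quot_eq_iff module.smult_closed)
 qed
 show "act (QM V N) h (N +>\<^bsub>V\<^esub> t) = N +>\<^bsub>V\<^esub> act V h t" if h: "h:.H"
 proof -
  have "act V h (rep (N +>\<^bsub>V\<^esub> t)) \<ominus>[V] act V h t \<in> N"
   using hsubD(5)[OF N h r(3)] klin_minus[OF m m amodD(6)[OF hm_amod[OF V] h] r(1) t] by simp
  then show ?thesis using r(1) t h V by (simp add: quot_fields quot_eq_iff)
 qed
qed

lemma quot_closed: "t:.V ==> N +>\<^bsub>V\<^esub> t:.QM V N"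
 by (auto simp: quot_fields)

lemma quot_hm: "hm (QM V N)"
proof -
 note m = hm_module[OF V]
 interpret V: module K V by (rule m)
 interpret abelian_subgroup N V by (rule hsub_abelian_subgroup)
 have z: "\<zero>[QM V N] = N +>\<^bsub>V\<^esub> \<zero>[V]" using V.M.a_coset_add_zero[OF a_subset] by (simp add: quot_fields)
 note ops = quot_ops and cl = quot_closed
 have ex: "\<exists>t\<in>carrier V. Z = N +>\<^bsub>V\<^esub> t" if "Z:.QM V N" for Z
  using that quot_fields(1) by blast
 have ag: "abelian_group (QM V N)"
 proof (rule abelian_groupI)
  fix X Y Z assume c: "X:.QM V N" "Y:.QM V N" "Z:.QM V N"
  from ex[OF c(1)] ex[OF c(2)] ex[OF c(3)] obtain x y z' where
   x: "x:.V" "X = N +>\<^bsub>V\<^esub> x" and y: "y:.V" "Y = N +>\<^bsub>V\<^esub> y" and z': "z':.V" "Z = N +>\<^bsub>V\<^esub> z'" by blast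
  show "X +[QM V N] Y +[QM V N] Z = X +[QM V N] (Y +[QM V N] Z)"
   using x(1) y(1) z'(1) by (simp add: ops x(2) y(2) z'(2) V.M.a_assoc)
 next
  fix X Y assume c: "X:.QM V N" "Y:.QM V N"
  from ex[OF c(1)] ex[OF c(2)] obtain x y where
   x: "x:.V" "X = N +>\<^bsub>V\<^esub> x" and y: "y:.V" "Y = N +>\<^bsub>V\<^esub> y" by blast
  show "X +[QM V N] Y:.QM V N"
   using x(1) y(1) by (simp add: ops x(2) y(2) cl)
  show "X +[QM V N] Y = Y +[QM V N] X"
   using x(1) y(1) V.M.a_comm[OF x(1) y(1)] by (simp add: ops x(2) y(2))
 next
  fix X assume c: "X:.QM V N"
  from ex[OF c] obtain x where x: "x:.V" "X = N +>\<^bsub>V\<^esub> x" by blast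
  show "\<zero>[QM V N] +[QM V N] X = X" using x(1) by (simp add: z ops x(2))
  show "\<exists>Y\<in>carrier (QM V N). Y +[QM V N] X = \<zero>[QM V N]"
   by (rule bexI[of _ "N +>\<^bsub>V\<^esub> (\<ominus>[V] x)"]) (use x(1) in "simp_all add: z ops cl x(2) V.M.l_neg")
 next
  show "\<zero>[QM V N]:.QM V N" by (simp add: z cl)
 qed
 have mod: "module K (QM V N)"
  by (rule moduleI[OF V.R.is_cring ag])
   (auto dest!: ex simp: ops cl V.smult_l_distr V.smult_r_distr V.smult_assoc1)
 show ?thesis
  unfolding hmodule_amod amod_def
 proof (intro conjI ballI mod)
  show "bilin K H (QM V N) (QM V N) (act (QM V N))"
   by (intro bilinI klinI)
    (auto dest!: ex simp: ops cl V act_smult klin_add[OF amodD(6)[OF hm_amod[OF V]]] klin_add[OF amodD(7)[OF hm_amod[OF V]]]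
     module_add_closed[OF mH])
 qed (auto dest!: ex simp: ops cl V act_mult act_one)
qed

lemma quot_hmor: "(%t. N +>\<^bsub>V\<^esub> t) : mor V (QM V N)"
 by (intro hmorI klinI) (simp_all add: quot_closed quot_ops)

lemma quot_lift:
 assumes "module K P" "f : klin K V P" "!!n. n \<in> N ==> f n = \<zero>[P]" "t:.V"
 shows "f (rep (N +>\<^bsub>V\<^esub> t)) = f t"
proof -
 interpret P: module K P by fact
 note r = quot_rep[OF assms(4)] and m = hm_module[OF V]
 have "f (rep (N +>\<^bsub>V\<^esub> t)) \<ominus>[P] f t = \<zero>[P]"
  using assms(3)[OF r(3)] klin_minus[OF m assms(1,2) r(1) assms(4)] by simp
 then have "f (rep (N +>\<^bsub>V\<^esub> t)) +[P] \<ominus>[P] f t = \<zero>[P]" by (simp add: a_minus_def)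
 from P.M.minus_equality[OF this] show ?thesis
  using klin_closed[OF assms(2)] assms(4) r(1) by simp
qed

end

lemma klin_descend:
 assumes "module K V" and p: "p : klin K V Q" and s: "!!z. z:.Q ==> \<exists>v\<in>carrier V. p v = z"
  and F: "F : klin K V X" and e: "!!v. v:.V ==> f (p v) = F v"
 shows "f : klin K Q X"
proof (rule klinI)
 interpret module K V by fact
 show "f x:.X" if "x:.Q" for x using s[OF that] e klin_closed[OF F] by fastforce
 show "f (x +[Q] y) = f x +[X] f y" if x: "x:.Q" and y: "y:.Q" for x y
 proof -
  obtain a b where ab: "a:.V" "p a = x" "b:.V" "p b = y" using s[OF x] s[OF y] by blast
  have "f (p (a +[V] b)) = f (p a) +[X] f (p b)" using ab(1,3) klin_add[OF F] by (simp only: e add.m_closed monoid_record_simps)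
  then show ?thesis using ab(1,3) by (simp add: klin_add[OF p] ab(2,4))
 qed
 show "f (c \<odot>[Q] x) = c \<odot>[X] f x" if c: "c:.K" and x: "x:.Q" for c x
 proof -
  obtain a where ab: "a:.V" "p a = x" using s[OF x] by blast
  have "f (p (c \<odot>[V] a)) = c \<odot>[X] f (p a)" using ab(1) c klin_smult[OF F] by (simp only: e smult_closed)
  then show ?thesis using ab(1) c by (simp add: klin_smult[OF p] ab(2))
 qed
qed

lemma hmor_descend:
 assumes "hm V" and p: "p \<in> hmor K H V Q" and s: "!!z. z:.Q ==> \<exists>v\<in>carrier V. p v = z"
  and F: "F \<in> hmor K H V X" and e: "!!v. v:.V ==> f (p v) = F v"
 shows "f \<in> hmor K H Q X"
proof (rule hmorI[OF klin_descend[OF hm_module[OF assms(1)] hmor_lin[OF p] s hmor_lin[OF F] e]])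
 show "f (act Q h x) = act X h (f x)" if h: "h:.H" and x: "x:.Q" for h x
 proof -
  obtain a where ab: "a:.V" "p a = x" using s[OF x] by blast
  have "f (p (act V h a)) = act X h (f (p a))"
   using ab(1) h assms(1) by (simp add: e hmor_act[OF F])
  then show ?thesis using ab(1) h by (simp add: hmor_act[OF p] ab(2))
 qed
qed

lemma klin_ptens:
 assumes "module K V" "module K W" "f : klin K (tensor K V W) P"
 shows "v:.V ==> (%w. f (ptens K V W v w)) : klin K W P" "w:.W ==> (%v. f (ptens K V W v w)) : klin K V P"
 using ptens_bilin[OF assms(1,2)] klin_comp[OF _ assms(3)] unfolding bilin_def by blast+

lemma wl_lin: "hm V ==> hm M ==> hm M' ==> g \<in> hmor K H M M' ==> wl V M M' g : klin K (tensor K V M) (tensor K V M')"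
 using hmor_lin[OF wl_hmor] by fastforce

lemma wr_lin: "hm V ==> hm X ==> hm M ==> f \<in> hmor K H V X ==> wr V X M f : klin K (tensor K V M) (tensor K X M)"
 using hmor_lin[OF wr_hmor] by fastforce

lemma rtl_lin: "hm V ==> hm W ==> hm X ==> hm M ==> f \<in> hmor K H (T V W) X ==>
  rtl V W X M f : klin K (tensor K V (tensor K W M)) (tensor K X M)"
 using hmor_lin[OF rtl_hmor] by fastforce

lemma hmor_lin_T: "f \<in> hmor K H (T V W) X ==> f : klin K (tensor K V W) X"
 using hmor_lin by fastforce

lemma rtl_expand:
 assumes V: "hm V" and W: "hm W" and X: "hm X" and M: "hm M" and f: "f \<in> hmor K H (T V W) X" and g: "g : klin K (tensor K X M) P"
  and P: "module K P" and v: "v:.V" and w: "w:.W" and m: "m:.M"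
 shows "g (rtl V W X M f (ptens K V (tensor K W M) v (ptens K W M w m))) =
  tsum3 P \<psi> (%a b c. g (ptens K X M (f (ptens K V W (act V a v) (act W b w))) (act M c m)))"
proof -
 let ?L = "%t. g (wr (T V W) X M f (lebr K V W M t))"
 have L: "?L : klin K (tensor K V (tensor K W M)) P"
  by (rule klin_comp[OF lebr_lin klin_comp[OF wr_lin[of "T V W" X M f, simplified] g]]) (use V W X M f in simp_all)
 have "?L (a3 V W M \<psi> (ptens K V (tensor K W M) v (ptens K W M w m))) =
   tsum3 P \<psi> (%a b c. ?L (ptens K V (tensor K W M) (act V a v) (ptens K W M (act W b w) (act M c m))))"
  by (rule a3_expand[OF V W M phi_closed(2) v w m P L])
 also have "... = tsum3 P \<psi> (%a b c. g (ptens K X M (f (ptens K V W (act V a v) (act W b w))) (act M c m)))"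
  by (rule tsum3_cong[OF mH mH mH phi_closed(2) P])
   (use V W X M f v w m hmor_closed[OF f] klin_closed[OF g] wr_ptens[of "T V W" X M f] in "simp_all add: lebr_ptens")
 finally show ?thesis by (simp add: rtl_def ainv_def)
qed

lemma assoc_expand:
 assumes V: "hm V" and W: "hm W" and M: "hm M" and g: "g : klin K (tensor K V (tensor K W M)) P"
  and P: "module K P" and v: "v:.V" and w: "w:.W" and m: "m:.M"
 shows "g (asc V W M (ptens K (tensor K V W) M (ptens K V W v w) m)) =
  tsum3 P \<phi> (%a b c. g (ptens K V (tensor K W M) (act V a v) (ptens K W M (act W b w) (act M c m))))"
proof -
 have "asc V W M (ptens K (tensor K V W) M (ptens K V W v w) m) = a3 V W M \<phi> (ptens K V (tensor K W M) v (ptens K W M w m))"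
  using V W M v w m by (simp add: assoc_eq rebr_ptens)
 then show ?thesis using a3_expand[OF V W M phi_closed(1) v w m P g] by simp
qed

end

section \<open>Bimodules\<close>

locale qtqh_algebra = qtqh K H for K :: "'k ring" and H :: "('k, 'h) quasi_hopf_data" +
 fixes A :: "('k, 'h, 'a) halg"
 assumes algA: "algebra_in K H A"
begin

abbreviation "u1 \<equiv> eta A \<one>[K]"
abbreviation "bm V \<equiv> bimodule K H A V"
abbreviation "sb V \<equiv> sym_bimodule K H A V"

lemma hA [simp]: "hm A" and mu_hmor [simp]: "mu A : mor (T A A) A"
 using algA by (simp_all add: algebra_in_def)

lemma eta_hmor: "eta A : mor (hunit K H) A"
 using algA by (simp add: algebra_in_def)

lemma hunit_fields: "carrier (hunit K H) = carrier K" "smult (hunit K H) = monoid.mult K" "act (hunit K H) h c = \<epsilon> h *[K] c"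
 by (simp_all add: hunit_def module.extend_def hmod.fields_def base_module_def)

lemma u1_closed [simp]: "u1:.A"
proof -
 interpret cring K by (rule cringK)
 show ?thesis using hmor_closed[OF eta_hmor, of "\<one>[K]"] by (simp add: hunit_fields)
qed

lemma u1_inv: "h:.H ==> act A h u1 = \<epsilon> h \<odot>[A] u1"
proof -
 interpret cring K by (rule cringK)
 assume h: "h:.H"
 have "act A h u1 = eta A (\<epsilon> h *[K] \<one>[K])"
  using hmor_act[OF eta_hmor h, of "\<one>[K]"] by (simp add: hunit_fields)
 also have "... = \<epsilon> h \<odot>[A] u1"
  using klin_smult[OF hmor_lin[OF eta_hmor], of "\<epsilon> h" "\<one>[K]"] h by (simp add: hunit_fields)
 finally show ?thesis .
qed

lemma bimod_rr_iff:
 assumes V: "hm V" and r: "rmap V : mor (T V A) V"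
 shows "(\<forall>v\<in>carrier V. \<forall>a\<in>carrier A. \<forall>a'\<in>carrier A. rmul K A V (rmul K A V v a) a' =
     tsum3 V \<phi> (%p q r. rmul K A V (act V p v) (amul K A (act A q a) (act A r a')))) \<longleftrightarrow>
  (\<forall>t\<in>carrier (V**A**A). rmap V (rtl V A V A (rmap V) t) = rmap V (wl V (T A A) A (mu A) t))"
proof -
 note m = hm_module[OF V] hm_module[OF hA]
 let ?L = "%t. rmap V (wl V (T A A) A (mu A) t)" and ?R = "%s. rmap V (wr (T V A) V A (rmap V) s)"
 have L: "?L : klin K (V**A**A) V"
  using klin_comp[OF wl_lin hmor_lin_T[OF r], of "T A A" "mu A"] V by simp
 have R: "?R : klin K ((V**A)**A) V"
  using klin_comp[OF wr_lin hmor_lin_T[OF r], of "T V A" "rmap V"] V r by simp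
 have LA: "(%s. ?L (asc V A A s)) : klin K ((V**A)**A) V"
  by (rule klin_comp[OF assoc_lin L]) (use V in simp_all)
 have pure: "?L (asc V A A (pt (V**A) A (pt V A v a) a')) =
   tsum3 V \<phi> (%p q r. rmul K A V (act V p v) (amul K A (act A q a) (act A r a')))"
   "?R (pt (V**A) A (pt V A v a) a') = rmul K A V (rmul K A V v a) a'"
  if "v:.V" "a:.A" "a':.A" for v a a'
 proof -
  show "?L (asc V A A (pt (V**A) A (pt V A v a) a')) =
   tsum3 V \<phi> (%p q r. rmul K A V (act V p v) (amul K A (act A q a) (act A r a')))"
   unfolding assoc_expand[OF V hA hA L m(1) that]
   by (rule tsum3_cong[OF mH mH mH phi_closed(1) m(1)])
    (use that V r wl_ptens[of V "T A A" A "mu A"] hmor_closed[OF r] hmor_closed[OF mu_hmor] in "simp_all add: rmul_def amul_def")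
  show "?R (pt (V**A) A (pt V A v a) a') = rmul K A V (rmul K A V v a) a'"
   using that V r wr_ptens[of "T V A" V A "rmap V" "pt V A v a" a'] by (simp add: rmul_def)
 qed
 have "(\<forall>v\<in>carrier V. \<forall>a\<in>carrier A. \<forall>a'\<in>carrier A. rmul K A V (rmul K A V v a) a' =
     tsum3 V \<phi> (%p q r. rmul K A V (act V p v) (amul K A (act A q a) (act A r a')))) \<longleftrightarrow>
    (\<forall>s\<in>carrier ((V**A)**A). ?R s = ?L (asc V A A s))" (is "?a \<longleftrightarrow> ?b")
 proof
  assume a: ?a
  show ?b
   by (intro ballI, rule tensor3_left_eqI[OF m(1,2,2) R LA]) (use a pure in simp_all)
 next
  assume b: ?b
  show ?a using b pure m by simp
 qed
 also have "... \<longleftrightarrow> (\<forall>t\<in>carrier (V**A**A). ?R (ainv V A A t) = ?L t)" (is "_ \<longleftrightarrow> ?c")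
  using V by (metis assoc_ainv assoc_closed ainv_closed hA)
 finally show ?thesis by (simp add: rtl_def)
qed

lemma bimod_ll_iff:
 assumes V: "hm V" and l: "lmap V : mor (T A V) V"
 shows "(\<forall>v\<in>carrier V. \<forall>a\<in>carrier A. \<forall>a'\<in>carrier A. lmul K A V a (lmul K A V a' v) =
     tsum3 V \<psi> (%p q r. lmul K A V (amul K A (act A p a) (act A q a')) (act V r v))) \<longleftrightarrow>
  (\<forall>t\<in>carrier (A**A**V). lmap V (wl A (T A V) V (lmap V) t) = lmap V (rtl A A A V (mu A) t))"
proof -
 note m = hm_module[OF V] hm_module[OF hA]
 have L: "(%t. lmap V (wl A (T A V) V (lmap V) t)) : klin K (A**A**V) V"
  using klin_comp[OF wl_lin hmor_lin_T[OF l], of "T A V" "lmap V"] V l by simp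
 have R: "(%t. lmap V (rtl A A A V (mu A) t)) : klin K (A**A**V) V"
  using klin_comp[OF rtl_lin hmor_lin_T[OF l], of A A "mu A"] V l by simp
 have l': "lmap V : klin K (A**V) V" using hmor_lin[OF l] by simp
 have pure: "lmap V (rtl A A A V (mu A) (pt A (A**V) a (pt A V a' v))) =
   tsum3 V \<psi> (%p q r. lmul K A V (amul K A (act A p a) (act A q a')) (act V r v))"
   "lmap V (wl A (T A V) V (lmap V) (pt A (A**V) a (pt A V a' v))) = lmul K A V a (lmul K A V a' v)"
  if "v:.V" "a:.A" "a':.A" for v a a'
  using that V l rtl_expand[OF hA hA hA V mu_hmor l' m(1), of a a' v] wl_ptens[of A "T A V" V "lmap V" a "pt A V a' v"]
  by (simp_all add: lmul_def amul_def)
 show ?thesis (is "?a \<longleftrightarrow> ?b")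
 proof
  assume a: ?a
  show ?b
   by (intro ballI, rule tensor3_eqI[OF m(2,2,1) L R]) (use a pure in simp_all)
 next
  assume b: ?b
  show ?a using b pure m by simp
 qed
qed

lemma bimod_lr_iff:
 assumes V: "hm V" and l: "lmap V : mor (T A V) V" and r: "rmap V : mor (T V A) V"
 shows "(\<forall>v\<in>carrier V. \<forall>a\<in>carrier A. \<forall>a'\<in>carrier A. lmul K A V a (rmul K A V v a') =
     tsum3 V \<psi> (%p q r. rmul K A V (lmul K A V (act A p a) (act V q v)) (act A r a'))) \<longleftrightarrow>
  (\<forall>t\<in>carrier (A**V**A). lmap V (wl A (T V A) V (rmap V) t) = rmap V (rtl A V V A (lmap V) t))"
proof -
 note m = hm_module[OF V] hm_module[OF hA]
 have L: "(%t. lmap V (wl A (T V A) V (rmap V) t)) : klin K (A**V**A) V"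
  using klin_comp[OF wl_lin hmor_lin_T[OF l], of "T V A" "rmap V"] V l r by simp
 have R: "(%t. rmap V (rtl A V V A (lmap V) t)) : klin K (A**V**A) V"
  using klin_comp[OF rtl_lin hmor_lin_T[OF r], of A V "lmap V"] V l r by simp
 have r': "rmap V : klin K (V**A) V" using hmor_lin[OF r] by simp
 have pure: "rmap V (rtl A V V A (lmap V) (pt A (V**A) a (pt V A v a'))) =
   tsum3 V \<psi> (%p q r. rmul K A V (lmul K A V (act A p a) (act V q v)) (act A r a'))"
   "lmap V (wl A (T V A) V (rmap V) (pt A (V**A) a (pt V A v a'))) = lmul K A V a (rmul K A V v a')"
  if "v:.V" "a:.A" "a':.A" for v a a'
  using that V l r rtl_expand[OF hA V V hA l r' m(1), of a v a'] wl_ptens[of A "T V A" V "rmap V" a "pt V A v a'"]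
  by (simp_all add: lmul_def rmul_def)
 show ?thesis (is "?a \<longleftrightarrow> ?b")
 proof
  assume a: ?a
  show ?b
   by (intro ballI, rule tensor3_eqI[OF m(2,1,2) L R]) (use a pure in simp_all)
 next
  assume b: ?b
  show ?a using b pure m by simp
 qed
qed

lemma bimod_iff:
 "bm V \<longleftrightarrow> hm V \<and> lmap V : mor (T A V) V \<and> rmap V : mor (T V A) V \<and>
  (\<forall>t\<in>carrier (V**A**A). rmap V (rtl V A V A (rmap V) t) = rmap V (wl V (T A A) A (mu A) t)) \<and>
  (\<forall>t\<in>carrier (A**A**V). lmap V (wl A (T A V) V (lmap V) t) = lmap V (rtl A A A V (mu A) t)) \<and>
  (\<forall>t\<in>carrier (A**V**A). lmap V (wl A (T V A) V (rmap V) t) = rmap V (rtl A V V A (lmap V) t)) \<and>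
  (\<forall>v\<in>carrier V. lmap V (pt A V u1 v) = v \<and> rmap V (pt V A v u1) = v)"
 unfolding bimodule_def lmul_def[of K A V u1] rmul_def[of K A V _ u1]
 using bimod_rr_iff[of V] bimod_ll_iff[of V] bimod_lr_iff[of V] by blast

lemma sym_iff:
 "sb V \<longleftrightarrow> bm V \<and> (\<forall>t\<in>carrier (A**V). rmap V (br A V t) = lmap V t) \<and>
  (\<forall>t\<in>carrier (V**A). lmap V (br V A t) = rmap V t)"
 by (simp add: sym_bimodule_def)

lemma sb_simps [simp]:
 assumes "sb V"
 shows "hm V" "lmap V : mor (T A V) V" "rmap V : mor (T V A) V"
 using assms unfolding sym_iff bimod_iff by blast+

lemma rmap_closed [simp]: "sb V ==> t:.V**A ==> rmap V t:.V"
 using hmor_closed[OF sb_simps(3)] by fastforce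

lemma sb_laws:
 assumes "sb V"
 shows "t:.V**A**A ==> rmap V (rtl V A V A (rmap V) t) = rmap V (wl V (T A A) A (mu A) t)"
  "t':.A**A**V ==> lmap V (wl A (T A V) V (lmap V) t') = lmap V (rtl A A A V (mu A) t')"
  "s:.A**V**A ==> lmap V (wl A (T V A) V (rmap V) s) = rmap V (rtl A V V A (lmap V) s)"
  "v:.V ==> lmap V (pt A V u1 v) = v" "v:.V ==> rmap V (pt V A v u1) = v"
  "x:.A**V ==> rmap V (br A V x) = lmap V x"
  "y:.V**A ==> lmap V (br V A y) = rmap V y"
 using assms unfolding sym_iff bimod_iff by blast+

end

section \<open>The tensor product over A\<close>

context qtqh_algebra
begin

abbreviation "BT V W \<equiv> btensor K H A V W"
abbreviation "pj V W \<equiv> bproj K H A V W"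

definition "pm V \<longleftrightarrow> hm V \<and> lmap V : mor (T A V) V \<and> rmap V : mor (T V A) V"

lemma pm_simps [simp]:
 assumes "pm V"
 shows "hm V" "lmap V : mor (T A V) V" "rmap V : mor (T V A) V"
 using assms unfolding pm_def by blast+

lemma sb_pm [simp]: "sb V ==> pm V"
 unfolding pm_def using sb_simps by blast

lemma null_image: "btensor_null K H A V W = (%t. wr (T V A) V W (rmap V) t \<ominus>[T V W] wl V (T A W) W (lmap W) (asc V A W t)) ` carrier (T (T V A) W)"
 unfolding btensor_null_def wr_def wl_def by auto

lemma null_hsub:
 assumes "pm V" "pm W"
 shows "hsub K H (T V W) (btensor_null K H A V W)"
 unfolding null_image
 by (rule hsub_image[OF _ _ hmor_diff[OF _ _ wr_hmor hmor_comp[OF assoc_hmor wl_hmor]]]) (use assms in simp_all)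

lemma BT_fields:
 "carrier (BT V W) = carrier (quotient_hmod (T V W) (btensor_null K H A V W))"
 "add (BT V W) = add (quotient_hmod (T V W) (btensor_null K H A V W))"
 "ring.zero (BT V W) = ring.zero (quotient_hmod (T V W) (btensor_null K H A V W))"
 "smult (BT V W) = smult (quotient_hmod (T V W) (btensor_null K H A V W))"
 "act (BT V W) = act (quotient_hmod (T V W) (btensor_null K H A V W))"
 by (simp_all add: btensor_def Let_def btensor_hmod_def hmod.defs)

lemma hm_BT [simp]:
 assumes "pm V" "pm W"
 shows "hm (BT V W)"
 by (rule hm_fields_cong[OF quot_hm[OF _ null_hsub] BT_fields]) (use assms in simp_all)

lemma pj_hmor [simp]:
 assumes "pm V" "pm W"
 shows "pj V W : mor (T V W) (BT V W)"
 using quot_hmor[OF _ null_hsub[OF assms]] assms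
 unfolding hmor_def klin_fields_cong(2)[OF BT_fields(1,2,4)] BT_fields bproj_def[abs_def] by simp

lemma pj_closed [simp]: "pm V ==> pm W ==> t:.V**W ==> pj V W t:.BT V W"
 using hmor_closed[OF pj_hmor] by fastforce

lemma pj_surj:
 assumes "pm V" "pm W" "Z:.BT V W"
 shows "\<exists>t\<in>carrier (V**W). pj V W t = Z"
 using assms quot_fields(1)[OF _ null_hsub[OF assms(1,2)], of Z] unfolding BT_fields bproj_def by simp blast

text \<open>The defining relation: the middle factor may act on either neighbour.\<close>

lemma pj_balanced:
 assumes "pm V" "pm W" and t: "t:.V**A**W"
 shows "pj V W (rtl V A V W (rmap V) t) = pj V W (wl V (T A W) W (lmap W) t)"
proof -
 have "wr (T V A) V W (rmap V) (ainv V A W t) \<ominus>[T V W] wl V (T A W) W (lmap W) (asc V A W (ainv V A W t)) \<in> btensor_null K H A V W"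
  unfolding null_image by (rule imageI) (use assms in simp)
 then show ?thesis
  using assms unfolding bproj_def by (subst quot_eq_iff[OF _ null_hsub]) (simp_all add: rtl_def)
qed

text \<open>A balanced map takes the same value on any representative of a class, in particular on the chosen one.\<close>

lemma balanced_rep:
 assumes V: "pm V" and W: "pm W" and P: "module K P" and f: "f : klin K (V**W) P"
  and b: "!!s. s:.V**A**W ==> f (rtl V A V W (rmap V) s) = f (wl V (T A W) W (lmap W) s)"
  and t: "t:.V**W"
 shows "f (rep (pj V W t)) = f t"
 unfolding bproj_def
proof (rule quot_lift[OF _ null_hsub[OF V W] P])
 interpret P: module K P by (rule P)
 fix n assume "n \<in> btensor_null K H A V W"
 then obtain s where s: "s:.T (T V A) W"
  and n: "n = wr (T V A) V W (rmap V) s \<ominus>[T V W] wl V (T A W) W (lmap W) (asc V A W s)" unfolding null_image by blast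
 have c: "asc V A W s:.V**A**W" "wr (T V A) V W (rmap V) s:.V**W" 
  "wl V (T A W) W (lmap W) (asc V A W s):.V**W" using s V W by simp_all
 have "f n = f (wr (T V A) V W (rmap V) s) \<ominus>[P] f (wl V (T A W) W (lmap W) (asc V A W s))"
  unfolding n by (rule klin_minus[OF _ P]) (use f c V W in simp_all)
 also have "... = \<zero>[P]"
  using b[OF c(1)] s V W klin_closed[OF f c(3)] by (simp add: rtl_def a_minus_def P.M.r_neg)
 finally show "f n = \<zero>[P]" .
qed (use f t V W in simp_all)

lemma rep_closed:
 assumes V: "pm V" and W: "pm W" and Z: "Z:.BT V W"
 shows "rep Z:.V**W" "pj V W (rep Z) = Z"
proof -
 obtain t where t: "t:.V**W" "pj V W t = Z" using pj_surj[OF V W Z] by blast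
 show "rep Z:.V**W" "pj V W (rep Z) = Z"
  using quot_rep[OF _ null_hsub[OF V W], of t] t V W unfolding bproj_def by auto
qed

text \<open>Morphisms out of the tensor product over \<open>A\<close>, possibly with a spectator factor.\<close>

lemma BT_descend:
 assumes V: "pm V" and W: "pm W" and P: "hm P" and f: "f : mor (T V W) P"
  and b: "!!s. s:.V**A**W ==> f (rtl V A V W (rmap V) s) = f (wl V (T A W) W (lmap W) s)"
 shows "(%Z. f (rep Z)) : mor (BT V W) P" "t:.V**W ==> f (rep (pj V W t)) = f t"
proof -
 show e: "f (rep (pj V W t)) = f t" if "t:.V**W" for t
  by (rule balanced_rep[OF V W hm_module[OF P] hmor_lin_T[OF f] b that])
 show "(%Z. f (rep Z)) : mor (BT V W) P"
  by (rule hmor_descend[OF _ pj_hmor[OF V W] _ f]) (use e V W pj_surj[OF V W] in simp_all)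
qed

lemma descend_left:
 assumes M: "hm M" and U: "hm U" and Q: "hm Q" and P: "hm P" and p: "p : mor U Q" and s: "!!z. z:.Q ==> \<exists>u\<in>carrier U. p u = z"
  and f: "f : mor (T M U) P" and e: "!!m u. m:.M ==> u:.U ==> g m (p u) = f (pt M U m u)"
 shows "(%t. tsum2 P t g) : mor (T M Q) P" "t:.M**U ==> tsum2 P (wl M U Q p t) g = f t"
proof -
 note m [simp] = M[THEN hm_module] U[THEN hm_module] Q[THEN hm_module] P[THEN hm_module]
 have fl: "f : klin K (M**U) P" by (rule hmor_lin_T[OF f])
 note l = klin_ptens[OF m(1,2) fl]
 have g: "bilin K M Q P g"
 proof (rule bilinI)
  show "(%w. g x w) : klin K Q P" if "x:.M" for x
   by (rule klin_descend[OF m(2) hmor_lin[OF p] s l(1)[OF that]]) (use e that in simp_all)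
  fix z assume "z:.Q"
  then obtain u where u: "u:.U" "p u = z" using s by blast
  show "(%x. g x z) : klin K M P" by (rule klin_cong[OF l(2)[OF u(1)]]) (use u e in auto)
 qed
 have L: "(%t. tsum2 P t g) : klin K (M**Q) P" by (rule lin_tsum2[OF _ _ _ g]) simp_all
 show v: "tsum2 P (wl M U Q p t) g = f t" if "t:.M**U" for t
  by (rule tensor_eqI[OF _ _ klin_comp[OF wl_lin[OF M U Q p] L] fl _ that])
   (use e M U Q p hmor_closed[OF p] wl_ptens[of M U Q p] tsum2_ptens[OF _ _ _ g] in simp_all)
 show "(%t. tsum2 P t g) : mor (T M Q) P"
 proof (rule hmor_descend[OF _ wl_hmor[OF M U Q p] _ f])
  show "\<exists>v\<in>carrier (T M U). wl M U Q p v = z" if "z:.T M Q" for z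
   using wl_surj[OF M U Q p s, of z] that by auto
 qed (use v M U Q in simp_all)
qed

lemma descend_right:
 assumes M: "hm M" and U: "hm U" and Q: "hm Q" and P: "hm P" and p: "p : mor U Q" and s: "!!z. z:.Q ==> \<exists>u\<in>carrier U. p u = z"
  and f: "f : mor (T U M) P" and e: "!!m u. m:.M ==> u:.U ==> g (p u) m = f (pt U M u m)"
 shows "(%t. tsum2 P t g) : mor (T Q M) P" "t:.U**M ==> tsum2 P (wr U Q M p t) g = f t"
proof -
 note m [simp] = M[THEN hm_module] U[THEN hm_module] Q[THEN hm_module] P[THEN hm_module]
 have fl: "f : klin K (U**M) P" by (rule hmor_lin_T[OF f])
 note l = klin_ptens[OF m(2,1) fl]
 have g: "bilin K Q M P g"
 proof (rule bilinI)
  show "(%w. g w x) : klin K Q P" if "x:.M" for x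
   by (rule klin_descend[OF m(2) hmor_lin[OF p] s l(2)[OF that]]) (use e that in simp_all)
  fix z assume "z:.Q"
  then obtain u where u: "u:.U" "p u = z" using s by blast
  show "(%x. g z x) : klin K M P" by (rule klin_cong[OF l(1)[OF u(1)]]) (use u e in auto)
 qed
 have L: "(%t. tsum2 P t g) : klin K (Q**M) P" by (rule lin_tsum2[OF _ _ _ g]) simp_all
 show v: "tsum2 P (wr U Q M p t) g = f t" if "t:.U**M" for t
  by (rule tensor_eqI[OF _ _ klin_comp[OF wr_lin[OF U Q M p] L] fl _ that])
   (use e M U Q p hmor_closed[OF p] wr_ptens[of U Q M p] tsum2_ptens[OF _ _ _ g] in simp_all)
 show "(%t. tsum2 P t g) : mor (T Q M) P"
 proof (rule hmor_descend[OF _ wr_hmor[OF U Q M p] _ f])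
  show "\<exists>v\<in>carrier (T U M). wr U Q M p v = z" if "z:.T Q M" for z
   using wr_surj[OF U M Q p s, of z] that by auto
 qed (use v M U Q in simp_all)
qed

text \<open>In right-normed form the balancedness conditions with a spectator read as follows.\<close>

lemma BT_left:
 assumes M: "hm M" and V: "pm V" and W: "pm W" and P: "hm P" and f: "f : mor (T M (T V W)) P"
  and b: "!!x. x:.M**V**A**W ==>
   f (wl M (T V (T A W)) (T V W) (rtl V A V W (rmap V)) x) = f (wl M (T V (T A W)) (T V W) (wl V (T A W) W (lmap W)) x)"
  and g: "!!m Z. m:.M ==> Z:.BT V W ==> g m Z = f (pt M (V**W) m (rep Z))"
 shows "(%t. tsum2 P t g) : mor (T M (BT V W)) P"
  "t:.M**V**W ==> tsum2 P (wl M (T V W) (BT V W) (pj V W) t) g = f t"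
proof -
 have e: "g m (pj V W u) = f (pt M (T V W) m u)" if m: "m:.M" and u: "u:.T V W" for m u
 proof -
  have "(%u. f (pt M (V**W) m u)) : klin K (V**W) P"
   by (rule klin_ptens(1)[OF _ _ _ m]) (use hmor_lin_T[OF f] M V W in simp_all)
  then have "f (pt M (V**W) m (rep (pj V W u))) = f (pt M (V**W) m u)"
  proof (rule balanced_rep[OF V W hm_module[OF P]])
   fix s assume "s:.V**A**W"
   then show "f (pt M (V**W) m (rtl V A V W (rmap V) s)) = f (pt M (V**W) m (wl V (T A W) W (lmap W) s))"
    using b[of "pt M (V**A**W) m s"] m M V W
     wl_ptens[of M "T V (T A W)" "T V W" "rtl V A V W (rmap V)"] wl_ptens[of M "T V (T A W)" "T V W" "wl V (T A W) W (lmap W)"] by simp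
  qed (use u in simp)
  then show ?thesis using m u V W by (simp add: g)
 qed
 show "(%t. tsum2 P t g) : mor (T M (BT V W)) P"
  by (rule descend_left(1)[OF M _ _ P pj_hmor _ f e]) (use V W pj_surj[OF V W] in simp_all)
 show "t:.M**V**W ==> tsum2 P (wl M (T V W) (BT V W) (pj V W) t) g = f t"
  by (rule descend_left(2)[OF M _ _ P pj_hmor _ f e]) (use V W pj_surj[OF V W] in simp_all)
qed

lemma BT_right:
 assumes M: "hm M" and V: "pm V" and W: "pm W" and P: "hm P" and f: "f : mor (T V (T W M)) P"
  and b: "!!y. y:.V**A**W**M ==>
   f (rtl V A V (T W M) (rmap V) y) = f (wl V (T A (T W M)) (T W M) (rtl A W W M (lmap W)) y)"
  and g: "!!m Z. m:.M ==> Z:.BT V W ==> g Z m = f (asc V W M (pt (V**W) M (rep Z) m))"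
 shows "(%t. tsum2 P t g) : mor (T (BT V W) M) P"
  "t:.V**W**M ==> tsum2 P (rtl V W (BT V W) M (pj V W) t) g = f t"
proof -
 have VW: "hm V" "hm W" using V W by simp_all
 have i: "(%x. x) : mor (T V W) (T V W)" by (rule hmor_id(2))
 have ii: "asc V W M (rtl V W (T V W) M (%x. x) t) = t" if "t:.V**W**M" for t
  using that VW M unfolding rtl_def wr_def by (simp add: tmap_id[unfolded id_def] id_def)
 have f': "(%s. f (asc V W M s)) : mor (T (T V W) M) P"
  by (rule hmor_comp[OF assoc_hmor f]) (use VW M in simp_all)
 have e: "g (pj V W u) m = f (asc V W M (pt (T V W) M u m))" if m: "m:.M" and u: "u:.T V W" for m u
 proof -
  have "(%u. f (asc V W M (pt (V**W) M u m))) : klin K (V**W) P"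
   by (rule klin_ptens(2)[OF _ _ _ m]) (use hmor_lin_T[OF f'] M V W in simp_all)
  then have "f (asc V W M (pt (V**W) M (rep (pj V W u)) m)) = f (asc V W M (pt (V**W) M u m))"
  proof (rule balanced_rep[OF V W hm_module[OF P]])
   fix s assume s: "s:.V**A**W"
   then have "pt (V**A**W) M s m:.(V**A**W)**M" using m VW M by simp
   then obtain y where y: "y:.V**A**W**M" and ye: "ainv2 V A W M y = pt (V**A**W) M s m"
    using ainv2_surj[of V A W M] VW M by auto
   have "pt (V**W) M (rtl V A V W (rmap V) s) m = wr (T V (T A W)) (T V W) M (rtl V A V W (rmap V)) (ainv2 V A W M y)"
    unfolding ye using s m VW V M wr_ptens[of "T V (T A W)" "T V W" M "rtl V A V W (rmap V)" s m] by simp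
   also have "... = rtl V W (T V W) M (%x. x) (rtl V A V (T W M) (rmap V) y)"
    by (rule ainv2_outer[OF VW(1) hA VW(2) M VW(1) _ _ i]) (use y VW V in simp_all)
   finally have 1: "asc V W M (pt (V**W) M (rtl V A V W (rmap V) s) m) = rtl V A V (T W M) (rmap V) y"
    using ii[of "rtl V A V (T W M) (rmap V) y"] y VW V M by simp
   have "pt (V**W) M (wl V (T A W) W (lmap W) s) m = wr (T V (T A W)) (T V W) M (wl V (T A W) W (lmap W)) (ainv2 V A W M y)"
    unfolding ye using s m VW W M wr_ptens[of "T V (T A W)" "T V W" M "wl V (T A W) W (lmap W)" s m] by simp
   also have "... = rtl V W (T V W) M (%x. x) (wl V (T A (T W M)) (T W M) (rtl A W W M (lmap W)) y)"
    by (rule ainv2_inner[OF VW(1) hA VW(2) M VW(2) _ _ i]) (use y VW W in simp_all)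
   finally have 2: "asc V W M (pt (V**W) M (wl V (T A W) W (lmap W) s) m) = wl V (T A (T W M)) (T W M) (rtl A W W M (lmap W)) y"
    using ii[of "wl V (T A (T W M)) (T W M) (rtl A W W M (lmap W)) y"] y VW W M
     by simp
   show "f (asc V W M (pt (V**W) M (rtl V A V W (rmap V) s) m)) = f (asc V W M (pt (V**W) M (wl V (T A W) W (lmap W) s) m))"
    unfolding 1 2 by (rule b[OF y])
  qed (use u in simp)
  then show ?thesis using m u V W by (simp add: g)
 qed
 show "(%t. tsum2 P t g) : mor (T (BT V W) M) P"
  by (rule descend_right(1)[OF M _ _ P pj_hmor _ f' e]) (use V W pj_surj[OF V W] in simp_all)
 assume t: "t:.V**W**M"
 have "tsum2 P (wr (T V W) (BT V W) M (pj V W) (ainv V W M t)) g = f (asc V W M (ainv V W M t))"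
  by (rule descend_right(2)[OF M _ _ P pj_hmor _ f' e]) (use V W pj_surj[OF V W] t M in simp_all)
 then show "tsum2 P (rtl V W (BT V W) M (pj V W) t) g = f t" using t M V W by (simp add: rtl_def)
qed

end

context qtqh_algebra
begin

lemma BT_target: "tsum2 (btensor_hmod K H A V W) = tsum2 (BT V W)"
 by (rule tsum2_target_cong) (simp_all add: BT_fields btensor_hmod_def)

lemma BT_tsum3: "tsum3 (btensor_hmod K H A V W) = tsum3 (BT V W)"
 by (simp add: fun_eq_iff tsum3_def BT_target)

text \<open>The left action passes to the quotient because left and right actions on \<open>V\<close> commute.\<close>

lemma BT_lmap_balanced:
 assumes V: "sb V" and W: "sb W" and x: "x:.A**V**A**W"
 shows "pj V W (rtl A V V W (lmap V) (wl A (T V (T A W)) (T V W) (rtl V A V W (rmap V)) x)) =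
  pj V W (rtl A V V W (lmap V) (wl A (T V (T A W)) (T V W) (wl V (T A W) W (lmap W)) x))"
proof -
 have "rtl A V V W (lmap V) (wl A (T V (T A W)) (T V W) (rtl V A V W (rmap V)) x) = rtl V A V W (rmap V) (rtl A V V (T A W) (lmap V) x)"
  by (rule rtl_tail[symmetric]) (use V W x sb_laws(3)[OF V] in simp_all)
 also have "pj V W ... = pj V W (wl V (T A W) W (lmap W) (rtl A V V (T A W) (lmap V) x))"
  using V W x by (simp add: pj_balanced)
 also have "... = pj V W (rtl A V V W (lmap V) (wl A (T V (T A W)) (T V W) (wl V (T A W) W (lmap W)) x))"
  using V W x by (simp add: rtl_wl)
 finally show ?thesis .
qed

lemma BT_lmap:
 assumes V: "sb V" and W: "sb W"
 shows "lmap (BT V W) : mor (T A (BT V W)) (BT V W)"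
  "s:.A**V**W ==> lmap (BT V W) (wl A (T V W) (BT V W) (pj V W) s) = pj V W (rtl A V V W (lmap V) s)"
proof -
 let ?f = "%s. pj V W (rtl A V V W (lmap V) s)"
 let ?g = "%a Z. tsum2 (BT V W) (rep Z) (%v w. tsum3 (BT V W) \<psi> (%p q r.
      bpt K H A V W (lmul K A V (act A p a) (act V q v)) (act W r w)))"
 have d: "lmap (BT V W) = (%t. tsum2 (BT V W) t ?g)"
  by (subst btensor_def) (simp add: Let_def hmod.defs bimod.defs BT_target BT_tsum3)
 have f: "?f : mor (T A (T V W)) (BT V W)" by (rule hmor_comp[OF rtl_hmor pj_hmor]) (use V W in simp_all)
 have g: "?g a Z = ?f (pt A (V**W) a (rep Z))" if a: "a:.A" and Z: "Z:.BT V W" for a Z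
 proof -
  have l: "(%u. ?f (pt A (V**W) a u)) : klin K (V**W) (BT V W)"
   by (rule klin_ptens(1)[OF _ _ _ a]) (use hmor_lin_T[OF f] V W in simp_all)
  have p: "?f (pt A (V**W) a (pt V W v w)) = tsum3 (BT V W) \<psi> (%p q r.
      bpt K H A V W (lmul K A V (act A p a) (act V q v)) (act W r w))" if "v:.V" "w:.W" for v w
   using that V W a rtl_expand[OF hA _ _ _ _ hmor_lin_T[OF pj_hmor], of V V W "lmap V"] by (simp add: bpt_def lmul_def)
  have "?f (pt A (V**W) a (rep Z)) = tsum2 (BT V W) (rep Z) (%v w. ?f (pt A (V**W) a (pt V W v w)))"
   by (rule lin2_expand[OF _ _ _ l rep_closed(1)]) (use V W Z in simp_all)
  also have "... = ?g a Z"
   by (rule tsum2_cong[OF _ _ rep_closed(1)[OF _ _ Z], symmetric])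
    (use V W klin_closed[OF l] in "simp_all add: p[symmetric]")
  finally show ?thesis by simp
 qed
 note b = BT_left[OF hA _ _ _ f BT_lmap_balanced[OF V W] g]
 show "lmap (BT V W) : mor (T A (BT V W)) (BT V W)" unfolding d by (rule b(1)) (use V W in simp_all)
 show "s:.A**V**W ==> lmap (BT V W) (wl A (T V W) (BT V W) (pj V W) s) = ?f s"
  unfolding d by (rule b(2)) (use V W in simp_all)
qed

lemma BT_rmap:
 assumes V: "sb V" and W: "sb W"
 shows "rmap (BT V W) : mor (T (BT V W) A) (BT V W)"
  "s:.V**W**A ==> rmap (BT V W) (rtl V W (BT V W) A (pj V W) s) = pj V W (wl V (T W A) W (rmap W) s)"
proof -
 let ?f = "%s. pj V W (wl V (T W A) W (rmap W) s)"
 let ?g = "%Z a. tsum2 (BT V W) (rep Z) (%v w. tsum3 (BT V W) \<phi> (%p q r.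
      bpt K H A V W (act V p v) (rmul K A W (act W q w) (act A r a))))"
 have d: "rmap (BT V W) = (%t. tsum2 (BT V W) t ?g)"
  by (subst btensor_def) (simp add: Let_def hmod.defs bimod.defs BT_target BT_tsum3)
 have f: "?f : mor (T V (T W A)) (BT V W)" by (rule hmor_comp[OF wl_hmor pj_hmor]) (use V W in simp_all)
 have fa: "(%s. ?f (asc V W A s)) : klin K ((V**W)**A) (BT V W)"
  by (rule klin_comp[OF assoc_lin hmor_lin_T[OF f, simplified]]) (use V W in simp_all)
 have g: "?g Z a = ?f (asc V W A (pt (V**W) A (rep Z) a))" if a: "a:.A" and Z: "Z:.BT V W" for a Z
 proof -
  have l: "(%u. ?f (asc V W A (pt (V**W) A u a))) : klin K (V**W) (BT V W)"
   by (rule klin_ptens(2)[OF _ _ _ a]) (use fa V W in simp_all)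
  have p: "?f (asc V W A (pt (V**W) A (pt V W v w) a)) = tsum3 (BT V W) \<phi> (%p q r.
      bpt K H A V W (act V p v) (rmul K A W (act W q w) (act A r a)))" if vw: "v:.V" "w:.W" for v w
  proof -
   have "?f (asc V W A (pt (V**W) A (pt V W v w) a)) =
     tsum3 (BT V W) \<phi> (%p q r. ?f (pt V (W**A) (act V p v) (pt W A (act W q w) (act A r a))))"
    by (rule assoc_expand) (use V W hmor_lin_T[OF f] vw a in simp_all)
   also have "... = tsum3 (BT V W) \<phi> (%p q r. bpt K H A V W (act V p v) (rmul K A W (act W q w) (act A r a)))"
    by (rule tsum3_cong[OF mH mH mH phi_closed(1)])
     (use V W vw a wl_ptens[of V "T W A" W "rmap W"] in "simp_all add: bpt_def rmul_def")
   finally show ?thesis .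
  qed
  have "?f (asc V W A (pt (V**W) A (rep Z) a)) = tsum2 (BT V W) (rep Z) (%v w. ?f (asc V W A (pt (V**W) A (pt V W v w) a)))"
   by (rule lin2_expand[OF _ _ _ l rep_closed(1)]) (use V W Z in simp_all)
  also have "... = ?g Z a"
   by (rule tsum2_cong[OF _ _ rep_closed(1)[OF _ _ Z], symmetric]) (use V W klin_closed[OF l] in "simp_all add: p[symmetric]")
  finally show ?thesis by simp
 qed
 have bal: "?f (rtl V A V (T W A) (rmap V) y) = ?f (wl V (T A (T W A)) (T W A) (rtl A W W A (lmap W)) y)"
  if y: "y:.V**A**W**A" for y
 proof -
  have "?f (rtl V A V (T W A) (rmap V) y) = pj V W (rtl V A V W (rmap V) (wl V (T A (T W A)) (T A W) (wl A (T W A) W (rmap W)) y))"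
   using V W y by (simp add: rtl_wl)
  also have "... = pj V W (wl V (T A W) W (lmap W) (wl V (T A (T W A)) (T A W) (wl A (T W A) W (rmap W)) y))"
   using V W y by (simp add: pj_balanced)
  also have "... = ?f (wl V (T A (T W A)) (T W A) (rtl A W W A (lmap W)) y)"
   by (rule arg_cong[OF wl_square]) (use V W y sb_laws(3)[OF W] in simp_all)
  finally show ?thesis .
 qed
 note b = BT_right[OF hA _ _ _ f bal g]
 show "rmap (BT V W) : mor (T (BT V W) A) (BT V W)" unfolding d by (rule b(1)) (use V W in simp_all)
 show "s:.V**W**A ==> rmap (BT V W) (rtl V W (BT V W) A (pj V W) s) = ?f s"
  unfolding d by (rule b(2)) (use V W in simp_all)
qed

lemma pm_BT [simp]: "sb V ==> sb W ==> pm (BT V W)"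
 unfolding pm_def by (intro conjI hm_BT sb_pm BT_lmap(1) BT_rmap(1))

lemma BT_rtl_surj:
 assumes "sb V" "sb W" "hm M" "t:.(BT V W)**M"
 obtains u where "u:.V**W**M" "rtl V W (BT V W) M (pj V W) u = t"
 by (rule rtl_surj[OF _ _ _ assms(3) pj_hmor pj_surj assms(4)]) (use assms in simp_all)

lemma BT_wl_surj:
 assumes "sb V" "sb W" "hm M" "t:.M**(BT V W)"
 obtains u where "u:.M**V**W" "wl M (T V W) (BT V W) (pj V W) u = t"
 by (rule wl_surj[OF assms(3) _ _ pj_hmor _ assms(4)]) (use assms pj_surj[of V W] that in auto)

text \<open>All laws are checked on representatives, where they reduce to the laws of \<open>V\<close> (for left actions) or of \<open>W\<close> (for right actions); symmetry moves the algebra across \<open>V\<close>, through the relation, and across \<open>W\<close>.\<close>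

lemma BT_sb:
 assumes V: "sb V" and W: "sb W"
 shows "sb (BT V W)"
proof -
 let ?B = "BT V W" let ?p = "pj V W" let ?l = "lmap ?B" and ?r = "rmap ?B"
 note VW [simp] = V W and L = BT_lmap(2)[OF V W] and R = BT_rmap(2)[OF V W]
 note laws = sb_laws[OF V] sb_laws[OF W]
 have rr: "?r (rtl ?B A ?B A ?r t) = ?r (wl ?B (T A A) A (mu A) t)" if t: "t:.?B**A**A" for t
 proof -
  obtain y where y: "y:.V**W**A**A" "rtl V W ?B (T A A) ?p y = t"
   using BT_rtl_surj[OF V W, of "T A A" t] t by auto
  have "rtl ?B A ?B A ?r (rtl V W ?B (T A A) ?p y) = rtl V W ?B A ?p (wl V (T W (T A A)) (T W A) (rtl W A W A (rmap W)) y)"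
   by (rule rtl_tail) (use y R in simp_all)
  moreover have "?p (wl V (T W A) W (rmap W) (wl V (T W (T A A)) (T W A) (rtl W A W A (rmap W)) y)) =
    ?p (wl V (T W A) W (rmap W) (wl V (T W (T A A)) (T W A) (wl W (T A A) A (mu A)) y))"
   by (rule arg_cong[OF wl_square]) (use y laws in simp_all)
  ultimately show ?thesis
   using y(1) R wl_closed[of V "T W (T A A)" "T W A" "wl W (T A A) A (mu A)" y]
   unfolding y(2)[symmetric] by (simp add: rtl_wl)
 qed
 have ll: "?l (wl A (T A ?B) ?B ?l t) = ?l (rtl A A A ?B (mu A) t)" if t: "t:.A**A**?B" for t
 proof -
  have s: "\<exists>u\<in>carrier (T A (T V W)). wl A (T V W) ?B ?p u = z" if "z:.T A ?B" for z
   using BT_wl_surj[OF V W hA, of z] that by auto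
  obtain x where x: "x:.A**A**V**W" "wl A (T A (T V W)) (T A ?B) (wl A (T V W) ?B ?p) x = t"
   by (rule wl_surj[OF hA _ _ _ s, where t = t and Q = "T A ?B"]) (use t in simp_all)
  have 1: "wl A (T A ?B) ?B ?l (wl A (T A (T V W)) (T A ?B) (wl A (T V W) ?B ?p) x) =
    wl A (T V W) ?B ?p (wl A (T A (T V W)) (T V W) (rtl A V V W (lmap V)) x)"
   by (rule wl_square) (use x L in simp_all)
  have 2: "rtl A V V W (lmap V) (wl A (T A (T V W)) (T V W) (rtl A V V W (lmap V)) x) = rtl A V V W (lmap V) (rtl A A A (T V W) (mu A) x)"
   by (rule rtl_tail[symmetric]) (use x laws in simp_all)
  show ?thesis
   using x(1) L rtl_closed[of A A A "T V W" "mu A" x]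
   unfolding x(2)[symmetric] 1 by (simp add: 2 rtl_wl[symmetric])
 qed
 have lr: "?l (wl A (T ?B A) ?B ?r t) = ?r (rtl A ?B ?B A ?l t)" if t: "t:.A**?B**A" for t
 proof -
  have s: "\<exists>u\<in>carrier (T V (T W A)). rtl V W ?B A ?p u = z" if "z:.T ?B A" for z
   using BT_rtl_surj[OF V W hA, of z] that by auto
  obtain x where x: "x:.A**V**W**A" "wl A (T V (T W A)) (T ?B A) (rtl V W ?B A ?p) x = t"
   by (rule wl_surj[OF hA _ _ _ s, where t = t and Q = "T ?B A"]) (use t in simp_all)
  have 1: "wl A (T ?B A) ?B ?r (wl A (T V (T W A)) (T ?B A) (rtl V W ?B A ?p) x) =
    wl A (T V W) ?B ?p (wl A (T V (T W A)) (T V W) (wl V (T W A) W (rmap W)) x)"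
   by (rule wl_square) (use x R in simp_all)
  have 2: "rtl A ?B ?B A ?l (wl A (T V (T W A)) (T ?B A) (rtl V W ?B A ?p) x) = rtl V W ?B A ?p (rtl A V V (T W A) (lmap V) x)"
   by (rule rtl_tail[symmetric]) (use x L in simp_all)
  show ?thesis
   using x(1) L R rtl_closed[of A V V "T W A" "lmap V" x]
   unfolding x(2)[symmetric] 1 2 by (simp add: rtl_wl[symmetric])
 qed
 have unit: "?l (pt A ?B u1 Z) = Z \<and> ?r (pt ?B A Z u1) = Z" if Z: "Z:.?B" for Z
 proof -
  obtain t where t: "t:.V**W" "?p t = Z" using pj_surj[of V W Z] Z by auto
  have "rtl A V V W (lmap V) (pt A (V**W) u1 t) = t"
   by (rule tensor_eqI[OF _ _ klin_ptens(1)[OF _ _ rtl_lin u1_closed] klin_id(2) _ t(1)])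
    (use laws u1_inv u1_closed wr_ptens[of "T A V" V W "lmap V"] in "simp_all add: rtl_def ainv_invariant1")
  moreover have "wl V (T W A) W (rmap W) (asc V W A (pt (V**W) A t u1)) = t"
  proof (rule tensor_eqI[OF _ _ klin_ptens(2)[OF _ _ klin_comp[OF assoc_lin wl_lin[of V "T W A" W "rmap W", simplified]] u1_closed] klin_id(2) _ t(1)])
   fix v w assume vw: "v:.V" "w:.W"
   have "asc V W A (pt (V**W) A (pt V W v w) u1) = pt V (W**A) v (pt W A w u1)"
    using ainv_invariant3[OF _ _ hA vw u1_closed u1_inv] assoc_ainv(1)[of V W A "pt V (W**A) v (pt W A w u1)"] vw u1_closed by simp
   then show "wl V (T W A) W (rmap W) (asc V W A (pt (V**W) A (pt V W v w) u1)) = pt V W v w"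
    using vw u1_closed laws wl_ptens[of V "T W A" W "rmap W"] by simp
  qed (use u1_closed in simp_all)
  moreover have "pt A ?B u1 Z = wl A (T V W) ?B ?p (pt A (V**W) u1 t)"
   using t u1_closed wl_ptens[of A "T V W" ?B ?p u1 t] by simp
  moreover have "pt ?B A Z u1 = rtl V W ?B A ?p (asc V W A (pt (V**W) A t u1))"
   using t u1_closed wr_ptens[of "T V W" ?B A ?p t u1] by (simp add: rtl_def)
  ultimately show ?thesis using t L R u1_closed by simp
 qed
 have s1: "?r (br A ?B t) = ?l t" if t: "t:.A**?B" for t
 proof -
  obtain s where s: "s:.A**V**W" "wl A (T V W) ?B ?p s = t" by (rule BT_wl_surj[OF V W hA t])
  let ?c = "crl A V W s"
  have "?r (br A ?B (wl A (T V W) ?B ?p s)) = ?p (wl V (T W A) W (rmap W) (wl V (T A W) (T W A) (br A W) ?c))"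
   using s(1) R by (simp add: braid_wl_pair)
  also have "... = ?p (wl V (T A W) W (lmap W) ?c)" by (rule arg_cong[OF wl_comp]) (use s laws in simp_all)
  also have "... = ?p (rtl V A V W (rmap V) ?c)" using s by (simp add: pj_balanced)
  also have "... = ?p (rtl A V V W (lmap V) s)" by (rule arg_cong[OF rtl_crl]) (use s laws in simp_all)
  finally show ?thesis using s(1) L unfolding s(2)[symmetric] by simp
 qed
 have s2: "?l (br ?B A t) = ?r t" if t: "t:.?B**A" for t
 proof -
  obtain y where y: "y:.V**W**A" "rtl V W ?B A ?p y = t" by (rule BT_rtl_surj[OF V W hA t])
  let ?b = "wl V (T W A) (T A W) (br W A) y"
  have b: "?b:.V**A**W" using y(1) by simp
  have "?l (br ?B A (rtl V W ?B A ?p y)) = ?p (rtl A V V W (lmap V) (crl V A W ?b))"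
   using y(1) b L by (simp add: braid_rtl)
  also have "... = ?p (rtl V A V W (rmap V) ?b)" by (rule arg_cong[OF rtl_crl]) (use b laws in simp_all)
  also have "... = ?p (wl V (T A W) W (lmap W) ?b)" using b by (simp add: pj_balanced)
  also have "... = ?p (wl V (T W A) W (rmap W) y)" by (rule arg_cong[OF wl_comp]) (use y laws in simp_all)
  finally show ?thesis using y(1) R unfolding y(2)[symmetric] by simp
 qed
 show ?thesis
  unfolding sym_iff bimod_iff
  by (intro conjI ballI pm_simps[OF pm_BT[OF V W]] rr ll lr s1 s2 conjunct1[OF unit] conjunct2[OF unit])
qed

end

section \<open>The monoidal structure\<close>

context qtqh_algebra
begin

subsection \<open>Bimodule morphisms\<close>

lemma bimor_laws:
 assumes V: "pm V" and W: "pm W" and f: "f \<in> bimor K H A V W"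
 shows "f : mor V W" "t:.A**V ==> f (lmap V t) = lmap W (wl A V W f t)"
  "s:.V**A ==> f (rmap V s) = rmap W (wr V W A f s)"
proof -
 show h: "f : mor V W" using f by (simp add: bimor_def)
 show "f (lmap V t) = lmap W (wl A V W f t)" if t: "t:.A**V"
  by (rule tensor_eqI[OF _ _ klin_comp[OF hmor_lin_T hmor_lin[OF h]] klin_comp[OF wl_lin hmor_lin_T] _ t])
   (use V W h f in "simp_all add: bimor_def lmul_def wl_ptens")
 show "f (rmap V s) = rmap W (wr V W A f s)" if s: "s:.V**A"
  by (rule tensor_eqI[OF _ _ klin_comp[OF hmor_lin_T hmor_lin[OF h]] klin_comp[OF wr_lin hmor_lin_T] _ s])
   (use V W h f in "simp_all add: bimor_def rmul_def wr_ptens")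
qed

lemma bimorI:
 assumes V: "hm V" and W: "hm W" and h: "f : mor V W"
  and l: "!!t. t:.A**V ==> f (lmap V t) = lmap W (wl A V W f t)"
  and r: "!!s. s:.V**A ==> f (rmap V s) = rmap W (wr V W A f s)"
 shows "f \<in> bimor K H A V W"
 unfolding bimor_def lmul_def rmul_def using V W h hA l[of "pt A V _ _"] r[of "pt V A _ _"] by (auto simp: wl_ptens wr_ptens)

text \<open>An inverse function of a bijective bimodule morphism is automatically a morphism.\<close>

lemma bimod_isoI:
 assumes V: "pm V" and W: "pm W" and f: "f \<in> bimor K H A V W" and g: "!!w. w:.W ==> g w:.V"
  and gf: "!!v. v:.V ==> g (f v) = v" and fg: "!!w. w:.W ==> f (g w) = w"
 shows "bimod_iso K H A V W f"
proof -
 have h: "f : mor V W" using f by (simp add: bimor_def)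
 have gh: "g : mor W V"
  by (rule hmor_descend[OF _ h _ hmor_id(2)]) (use V g fg gf in auto)
 have "g (lmul K A W a w) = lmul K A V a (g w) \<and> g (rmul K A W w a) = rmul K A V (g w) a"
  if aw: "a:.A" "w:.W" for a w
 proof -
  have c: "lmul K A V a (g w):.V" "rmul K A V (g w) a:.V"
   unfolding lmul_def rmul_def using hmor_closed[OF pm_simps(2)[OF V]] hmor_closed[OF pm_simps(3)[OF V]] aw g V by simp_all
  have "lmul K A W a w = f (lmul K A V a (g w))" "rmul K A W w a = f (rmul K A V (g w) a)"
   using f aw g fg by (simp_all add: bimor_def)
  then show ?thesis using gf c by simp
 qed
 then have "g \<in> bimor K H A W V" using gh by (simp add: bimor_def)
 then show ?thesis using f gf fg by (auto simp: bimod_iso_def)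
qed

subsection \<open>The unit object\<close>

abbreviation "U \<equiv> unit_bimod A"

lemma unit_fields [simp]:
 "carrier U = carrier A" "add U = add A" "ring.zero U = ring.zero A" "smult U = smult A" "act U = act A" "lmap U = mu A" "rmap U = mu A"
 "monoid.mult U = monoid.mult A" "one U = one A"
 by (simp_all add: unit_bimod_def hmod.defs bimod.defs)

lemma unit_reduce [simp]:
 "pt U W = pt A W" "pt W U = pt W A" "U**W = A**W" "W**U = W**A"
 "klin K U W = klin K A W" "klin K W U = klin K W A"
 by (simp_all add: tensor_fields_cong[of U A] klin_fields_cong[of U A])

lemma unit_reduce2 [simp]:
 "tmap K U W = tmap K A W" "tmap K W U = tmap K W A" "mor U X = mor A X" "mor X U = mor X A"
 "tsum2 U = tsum2 A"
 by (simp_all add: fun_eq_iff tmap_def hmor_def tsum2_target_cong[of U A])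

lemma unit_reduce3 [simp]:
 "T U W = T A W" "T W U = T W A" "wl U M M' = wl A M M'" "wl V M U g = wl V M A g" "wr V U M = wr V A M" "wr V X U = wr V X A"
 "br U W = br A W" "br W U = br W A"
 by (simp_all add: fun_eq_iff htensor_def wl_def wr_def braid_def)

lemma unit_ainv [simp]: "ainv U V W = ainv A V W" "ainv V U W = ainv V A W" "ainv V W U = ainv V W A"
 by (simp_all add: fun_eq_iff ainv_def a3_def a2_def act2_def[abs_def] lebr_def)

lemma unit_rtl [simp]: "rtl U W X M = rtl A W X M" "rtl V U X M = rtl V A X M" "rtl V W U M = rtl V W A M" "rtl V W X U = rtl V W X A"
 by (simp_all add: fun_eq_iff rtl_def wr_def)

lemma hm_unit [simp]: "hm U"
 by (rule hm_fields_cong[OF hA]) simp_all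

text \<open>Associativity rewritten with \<open>\<psi>\<close> gives the two remaining bimodule laws; symmetry is braided commutativity.\<close>

lemma unit_symmetric:
 assumes bc: "braided_commutative K H A"
 shows "sb U"
proof -
 note m [simp] = hm_module[OF hA]
 have as: "amul K A (amul K A a a') a'' = tsum3 A \<phi> (%p q r. amul K A (act A p a) (amul K A (act A q a') (act A r a'')))"
  if "a:.A" "a':.A" "a'':.A" for a a' a''
  using algA that by (simp add: algebra_in_def)
 have t3: "tsum3 U = tsum3 A" by (simp add: fun_eq_iff tsum3_def)
 have lm: "lmul K A U = amul K A" "rmul K A U = amul K A" by (simp_all add: fun_eq_iff lmul_def rmul_def amul_def)
 have rr: "mu A (rtl A A A A (mu A) t) = mu A (wl A (T A A) A (mu A) t)" if "t:.A**A**A" for t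
  using bimod_rr_iff[of U] as that by (simp add: lm t3)
 have as': "amul K A a (amul K A a' a'') = tsum3 A \<psi> (%p q r. amul K A (amul K A (act A p a) (act A q a')) (act A r a''))"
  if a: "a:.A" "a':.A" "a'':.A" for a a' a''
  using rr[of "pt A (A**A) a (pt A A a' a'')"] a
   rtl_expand[OF hA hA hA hA mu_hmor hmor_lin_T[OF mu_hmor] m a] wl_ptens[of A "T A A" A "mu A" a "pt A A a' a''"]
  by (simp add: amul_def)
 have "bm U" using as as' algA by (simp add: bimodule_def algebra_in_def lm t3)
 then show ?thesis using bc by (simp add: sym_iff braided_commutative_def)
qed

subsection \<open>Functoriality\<close>

text \<open>\<open>f \<otimes> g\<close> split into its two one-sided factors, which have separate exchange rules.\<close>

definition "tm V V' W W' f g t = wl V' W W' g (wr V V' W f t)"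

lemma tm_hmor [simp]:
 assumes "hm V" "hm W" "hm V'" "hm W'" "f : mor V V'" "g : mor W W'"
 shows "tm V V' W W' f g : mor (T V W) (T V' W')"
 unfolding tm_def[abs_def] by (rule hmor_comp[OF wr_hmor wl_hmor]) (use assms in simp_all)

lemma tm_closed [simp]:
 assumes "hm V" "hm W" "hm V'" "hm W'" "f : mor V V'" "g : mor W W'" "t:.V**W"
 shows "tm V V' W W' f g t:.V'**W'"
 unfolding tm_def using assms by simp

lemma tm_tmap:
 assumes "hm V" "hm W" "hm V'" "hm W'" "f : mor V V'" "g : mor W W'" "t:.V**W"
 shows "tmap K V' W' f g t = tm V V' W W' f g t"
 by (rule tensor_eqI[OF _ _ tmap_lin hmor_lin_T[OF tm_hmor, simplified] _ assms(7)])
  (use assms hmor_closed[OF assms(5)] hmor_closed[OF assms(6)] hmor_lin in "simp_all add: tm_def wl_ptens wr_ptens tmap_ptens hmor_lin")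

lemma tm_rtl:
 assumes V: "pm V" and W: "hm W" and V': "pm V'" and W': "hm W'" and M: "hm M" and f: "f : mor V V'" and g: "g : mor W W'"
  and h: "h : mor (T M V) V" and h': "h' : mor (T M V') V'"
  and e: "!!t. t:.M**V ==> f (h t) = h' (wl M V V' f t)"
  and t: "t:.M**V**W"
 shows "tm V V' W W' f g (rtl M V V W h t) = rtl M V' V' W' h' (wl M (T V W) (T V' W') (tm V V' W W' f g) t)"
proof -
 have hh: "(%t. f (h t)) : mor (T M V) V'" by (rule hmor_comp[OF h f])
 have 1: "wr V V' W f (rtl M V V W h t) = rtl M V V' W (%t. f (h t)) t"
  by (rule rtl_post) (use V W V' M f h hh t in simp_all)
 also have "... = rtl M V' V' W h' (wl M (T V W) (T V' W) (wr V V' W f) t)"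
  by (rule rtl_pre2[symmetric]) (use V W V' M f h' hh t e in simp_all)
 finally have 1: "wr V V' W f (rtl M V V W h t) = rtl M V' V' W h' (wl M (T V W) (T V' W) (wr V V' W f) t)" .
 have 2: "wl M (T V' W) (T V' W') (wl V' W W' g) (wl M (T V W) (T V' W) (wr V V' W f) t) = wl M (T V W) (T V' W') (tm V V' W W' f g) t"
  by (rule wl_comp) (use V W V' W' M f g t in "simp_all add: tm_def")
 show ?thesis unfolding tm_def[of _ _ _ _ _ _ "rtl M V V W h t"] 1
  using 2 rtl_wl[of M V' V' W W' h' g "wl M (T V W) (T V' W) (wr V V' W f) t"] V W V' W' M f g h' t by simp
qed

lemma tm_wl:
 assumes V: "hm V" and W: "pm W" and V': "hm V'" and W': "pm W'" and M: "hm M" and f: "f : mor V V'" and g: "g : mor W W'"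
  and h: "h : mor (T W M) W" and h': "h' : mor (T W' M) W'"
  and e: "!!t. t:.W**M ==> g (h t) = h' (wr W W' M g t)"
  and t: "t:.V**W**M"
 shows "tm V V' W W' f g (wl V (T W M) W h t) = wl V' (T W' M) W' h' (tm V V' (T W M) (T W' M) f (wr W W' M g) t)"
proof -
 have "wl V' W W' g (wl V' (T W M) W h (wr V V' (T W M) f t)) = wl V' (T W' M) W' h' (wl V' (T W M) (T W' M) (wr W W' M g) (wr V V' (T W M) f t))"
  by (rule wl_square) (use assms in simp_all)
 then show ?thesis using assms wr_wl[of V "T W M" V' W f h t] by (simp add: tm_def)
qed

lemma bmap_pj:
 assumes V: "sb V" and W: "sb W" and V': "sb V'" and W': "sb W'" and f: "f \<in> bimor K H A V V'" and g: "g \<in> bimor K H A W W'"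
 shows "bmp A V' W' f g : mor (BT V W) (BT V' W')"
  "t:.V**W ==> bmp A V' W' f g (pj V W t) = pj V' W' (tm V V' W W' f g t)"
proof -
 note F = bimor_laws[OF sb_pm[OF V] sb_pm[OF V'] f] and G = bimor_laws[OF sb_pm[OF W] sb_pm[OF W'] g]
 note s [simp] = V W V' W' F(1) G(1)
 let ?h = "%t. pj V' W' (tm V V' W W' f g t)"
 have h: "?h : mor (T V W) (BT V' W')" by (rule hmor_comp[OF tm_hmor pj_hmor]) simp_all
 have b: "?h (rtl V A V W (rmap V) s) = ?h (wl V (T A W) W (lmap W) s)" if s: "s:.V**A**W" for s
 proof -
  let ?s = "wr V V' (T A W) f s"
  let ?t = "wl V' (T A W) (T A W') (wl A W W' g) ?s"
  have c: "?s:.V'**A**W" "?t:.V'**A**W'"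
   using s by simp_all
  have fr: "(%t. f (rmap V t)) : mor (T V A) V'" by (rule hmor_comp[OF _ F(1)]) simp
  have "wr V V' W f (rtl V A V W (rmap V) s) = rtl V A V' W (%t. f (rmap V t)) s"
   by (rule rtl_post) (use s fr in simp_all)
  also have "... = rtl V' A V' W (rmap V') ?s"
   by (rule rtl_pre1[symmetric]) (use s fr F(3) in simp_all)
  finally have "tm V V' W W' f g (rtl V A V W (rmap V) s) = rtl V' A V' W' (rmap V') ?t"
   using c by (simp add: tm_def rtl_wl)
  moreover have "wl V' (T A W') W' (lmap W') ?t = wl V' W W' g (wl V' (T A W) W (lmap W) ?s)"
   by (rule wl_square) (use c G(2) in simp_all)
  moreover have "wl V' (T A W) W (lmap W) ?s = wr V V' W f (wl V (T A W) W (lmap W) s)"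
   by (rule wr_wl[symmetric]) (use s in simp_all)
  ultimately show ?thesis using c by (simp add: pj_balanced tm_def)
 qed
 have r: "bmp A V' W' f g Z = ?h (rep Z)" if "Z:.BT V W" for Z
  using rep_closed(1)[OF _ _ that] tm_tmap[of V W V' W' f g] by (simp add: bmap_def)
 show "bmp A V' W' f g : mor (BT V W) (BT V' W')"
  by (rule hmor_cong[OF BT_descend(1)[OF _ _ _ h b]]) (use r in simp_all)
 show "bmp A V' W' f g (pj V W t) = ?h t" if "t:.V**W"
  using r BT_descend(2)[OF _ _ _ h b that] that by simp
qed

lemma bmap_bimor:
 assumes V: "sb V" and W: "sb W" and V': "sb V'" and W': "sb W'" and f: "f \<in> bimor K H A V V'" and g: "g \<in> bimor K H A W W'"
 shows "bmp A V' W' f g \<in> bimor K H A (BT V W) (BT V' W')"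
proof -
 note F = bimor_laws[OF sb_pm[OF V] sb_pm[OF V'] f] and G = bimor_laws[OF sb_pm[OF W] sb_pm[OF W'] g]
 note s [simp] = V W V' W' F(1) G(1)
 let ?b = "bmp A V' W' f g" let ?B = "BT V W" let ?B' = "BT V' W'"
 note P = bmap_pj[OF V W V' W' f g]
 note L = BT_lmap(2)[OF V W] BT_lmap(2)[OF V' W'] and R = BT_rmap(2)[OF V W] BT_rmap(2)[OF V' W']
 show ?thesis
 proof (rule bimorI)
  fix t assume "t:.A**?B"
  then obtain s where s: "s:.A**V**W" "wl A (T V W) ?B (pj V W) s = t" by (rule BT_wl_surj[OF V W hA])
  have "wl A ?B ?B' ?b (wl A (T V W) ?B (pj V W) s) = wl A (T V' W') ?B' (pj V' W') (wl A (T V W) (T V' W') (tm V V' W W' f g) s)"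
   by (rule wl_square) (use s(1) P in simp_all)
  then show "?b (lmap ?B t) = lmap ?B' (wl A ?B ?B' ?b t)"
   using s(1) L P tm_rtl[of V W V' W' A f g "lmap V" "lmap V'" s] F(2) wl_closed[of A "T V W" "T V' W'" "tm V V' W W' f g" s]
   unfolding s(2)[symmetric] by simp
 next
  fix t assume "t:.?B**A"
  then obtain y where y: "y:.V**W**A" "rtl V W ?B A (pj V W) y = t" by (rule BT_rtl_surj[OF V W hA])
  let ?q = "%t. pj V' W' (tm V V' W W' f g t)" let ?z = "tm V V' (T W A) (T W' A) f (wr W W' A g) y"
  have q: "?q : mor (T V W) ?B'" "(%t. pj V' W' (wl V' W W' g t)) : mor (T V' W) ?B'"
   by (rule hmor_comp[OF tm_hmor pj_hmor] hmor_comp[OF wl_hmor pj_hmor]; simp)+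
  have "wr ?B ?B' A ?b (rtl V W ?B A (pj V W) y) = rtl V W ?B' A ?q y"
   by (rule rtl_post) (use y q P in simp_all)
  also have "... = rtl V' W ?B' A (%t. pj V' W' (wl V' W W' g t)) (wr V V' (T W A) f y)"
   by (rule rtl_pre1[symmetric]) (use y q in "simp_all add: tm_def")
  also have "... = rtl V' W' ?B' A (pj V' W') ?z" unfolding tm_def
   by (rule rtl_pre2[symmetric]) (use y q in simp_all)
  finally show "?b (rmap ?B t) = rmap ?B' (wr ?B ?B' A ?b t)"
   using y(1) R P tm_wl[of V W V' W' A f g "rmap W" "rmap W'" y] G(3) tm_closed[of V "T W A" V' "T W' A" f "wr W W' A g" y]
   unfolding y(2)[symmetric] by simp
 qed (use P(1) in simp_all)
qed

lemma bimor_id: "id \<in> bimor K H A V V"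
 unfolding bimor_def using hmor_id(1) by simp

lemma bimor_comp: "f \<in> bimor K H A V W ==> g \<in> bimor K H A W X ==> g \<circ> f \<in> bimor K H A V X"
 unfolding bimor_def using hmor_comp[of f V W g X] hmor_closed[of f V W] by (simp add: o_def)

lemma bmap_id:
 assumes "sb V" "sb W" "Z:.BT V W"
 shows "bmp A V W id id Z = Z"
 using rep_closed[OF sb_pm[OF assms(1)] sb_pm[OF assms(2)] assms(3)] assms by (simp add: bmap_def tmap_id)

lemma bmap_comp:
 assumes V: "sb V" and W: "sb W" and V': "sb V'" and W': "sb W'" and V'': "sb V''" and W'': "sb W''" 
  and f: "f \<in> bimor K H A V V'" and g: "g \<in> bimor K H A W W'" and f': "f' \<in> bimor K H A V' V''" and g': "g' \<in> bimor K H A W' W''"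
  and Z: "Z:.BT V W"
 shows "bmp A V'' W'' (f' \<circ> f) (g' \<circ> g) Z = bmp A V'' W'' f' g' (bmp A V' W' f g Z)"
proof -
 obtain t where t: "t:.V**W" "pj V W t = Z" using pj_surj[of V W Z] V W Z by auto
 note h = f[THEN bimor_laws(1)[rotated 2]] g[THEN bimor_laws(1)[rotated 2]] f'[THEN bimor_laws(1)[rotated 2]] g'[THEN bimor_laws(1)[rotated 2]]
  bimor_comp[OF f f', THEN bimor_laws(1)[rotated 2]] bimor_comp[OF g g', THEN bimor_laws(1)[rotated 2]]
 have "tm V V'' W W'' (f' \<circ> f) (g' \<circ> g) t = tm V' V'' W' W'' f' g' (tm V V' W W' f g t)"
  by (rule tensor_eqI[OF _ _ hmor_lin_T[OF tm_hmor, simplified] klin_comp[OF hmor_lin_T[OF tm_hmor, simplified] hmor_lin_T[OF tm_hmor, simplified]] _ t(1)])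
   (use V W V' W' V'' W'' h hmor_closed in "simp_all add: tm_def wl_ptens wr_ptens hmor_closed[of f V V'] hmor_closed[of g W W'] hmor_closed[of f' V' V'']")
 then show ?thesis
  using t(1) V W V' W' V'' W'' h bmap_pj(2)[OF V W V' W' f g] bmap_pj(2)[OF V' W' V'' W'' f' g'] bmap_pj(2)[OF V W V'' W'' bimor_comp[OF f f'] bimor_comp[OF g g']]
  unfolding t(2)[symmetric] by simp
qed

end

context qtqh_algebra
begin

subsection \<open>The associator\<close>

lemma tri_left:
 assumes V: "sb V" and W: "sb W" and X: "sb X" and Z: "Z:.BT (BT V W) X"
 obtains y where "y:.V**W**X" "pj (BT V W) X (rtl V W (BT V W) X (pj V W) y) = Z"
proof -
 obtain t where t: "t:.(BT V W)**X" "pj (BT V W) X t = Z"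
  using pj_surj[OF _ _ Z] V W X by auto
 then obtain y where "y:.V**W**X" "rtl V W (BT V W) X (pj V W) y = t"
  using BT_rtl_surj[OF V W _ t(1)] X by auto
 then show ?thesis using that t by blast
qed

lemma tri_right:
 assumes V: "sb V" and W: "sb W" and X: "sb X" and Z: "Z:.BT V (BT W X)"
 obtains y where "y:.V**W**X" "pj V (BT W X) (wl V (T W X) (BT W X) (pj W X) y) = Z"
proof -
 obtain t where t: "t:.V**(BT W X)" "pj V (BT W X) t = Z"
  using pj_surj[OF _ _ Z] V W X by auto
 then obtain y where "y:.V**W**X" "wl V (T W X) (BT W X) (pj W X) y = t"
  using BT_wl_surj[OF W X _ t(1)] V by auto
 then show ?thesis using that t by blast
qed

lemma bassoc_pj:
 assumes V: "sb V" and W: "sb W" and X: "sb X"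
 shows "bas A V W X : mor (BT (BT V W) X) (BT V (BT W X))"
  "y:.V**W**X ==> bas A V W X (pj (BT V W) X (rtl V W (BT V W) X (pj V W) y)) =
   pj V (BT W X) (wl V (T W X) (BT W X) (pj W X) y)"
proof -
 note s [simp] = V W X BT_sb[OF V W] BT_sb[OF W X]
 let ?B = "BT V W" let ?C = "BT W X" let ?Q = "BT V (BT W X)"
 let ?f = "%s. pj V ?C (wl V (T W X) ?C (pj W X) s)"
 let ?G = "%Y x. tsum2 ?Q (rep Y) (%v w. tsum3 ?Q \<phi> (%p q r. bpt K H A V ?C (act V p v) (bpt K H A W X (act W q w) (act X r x))))"
 let ?L = "%t. tsum2 ?Q t ?G"
 have f: "?f : mor (T V (T W X)) ?Q" by (rule hmor_comp[OF wl_hmor pj_hmor]) simp_all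
 have fa: "(%s. ?f (asc V W X s)) : klin K ((V**W)**X) ?Q"
  by (rule klin_comp[OF assoc_lin hmor_lin_T[OF f, simplified]]) simp_all
 have g: "?G Y x = ?f (asc V W X (pt (V**W) X (rep Y) x))" if x: "x:.X" and Y: "Y:.?B" for x Y
 proof -
  have l: "(%u. ?f (asc V W X (pt (V**W) X u x))) : klin K (V**W) ?Q"
   by (rule klin_ptens(2)[OF _ _ _ x]) (use fa in simp_all)
  have p: "?f (asc V W X (pt (V**W) X (pt V W v w) x)) =
    tsum3 ?Q \<phi> (%p q r. bpt K H A V ?C (act V p v) (bpt K H A W X (act W q w) (act X r x)))"
   if vw: "v:.V" "w:.W" for v w
  proof -
   have "?f (asc V W X (pt (V**W) X (pt V W v w) x)) =
     tsum3 ?Q \<phi> (%p q r. ?f (pt V (W**X) (act V p v) (pt W X (act W q w) (act X r x))))"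
    by (rule assoc_expand) (use hmor_lin_T[OF f] vw x in simp_all)
   also have "... = tsum3 ?Q \<phi> (%p q r. bpt K H A V ?C (act V p v) (bpt K H A W X (act W q w) (act X r x)))"
    by (rule tsum3_cong[OF mH mH mH phi_closed(1)])
     (use vw x wl_ptens[of V "T W X" ?C "pj W X"] in "simp_all add: bpt_def")
   finally show ?thesis .
  qed
  have "?f (asc V W X (pt (V**W) X (rep Y) x)) = tsum2 ?Q (rep Y) (%v w. ?f (asc V W X (pt (V**W) X (pt V W v w) x)))"
   by (rule lin2_expand[OF _ _ _ l rep_closed(1)]) (use Y in simp_all)
  also have "... = ?G Y x"
   by (rule tsum2_cong[OF _ _ rep_closed(1)[OF _ _ Y], symmetric]) (use klin_closed[OF l] in "simp_all add: p[symmetric]")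
  finally show ?thesis by simp
 qed
 have bal: "?f (rtl V A V (T W X) (rmap V) y) = ?f (wl V (T A (T W X)) (T W X) (rtl A W W X (lmap W)) y)"
  if y: "y:.V**A**W**X" for y
 proof -
  have "wl V (T A ?C) ?C (lmap ?C) (wl V (T A (T W X)) (T A ?C) (wl A (T W X) ?C (pj W X)) y) =
    wl V (T W X) ?C (pj W X) (wl V (T A (T W X)) (T W X) (rtl A W W X (lmap W)) y)"
   by (rule wl_square) (use y BT_lmap(2)[OF W X] in simp_all)
  then show ?thesis using y by (simp add: rtl_wl pj_balanced)
 qed
 have L: "?L : mor (T ?B X) ?Q" "t:.V**W**X ==> ?L (rtl V W ?B X (pj V W) t) = ?f t" for t
  by (rule BT_right[OF _ _ _ _ f bal g]; simp)+
 have b: "?L (rtl ?B A ?B X (rmap ?B) s) = ?L (wl ?B (T A X) X (lmap X) s)" if s: "s:.?B**A**X" for s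
 proof -
  obtain y where y: "y:.V**W**A**X" "rtl V W ?B (T A X) (pj V W) y = s"
   using BT_rtl_surj[OF V W, of "T A X" s] s by auto
  have "rtl ?B A ?B X (rmap ?B) (rtl V W ?B (T A X) (pj V W) y) = rtl V W ?B X (pj V W) (wl V (T W (T A X)) (T W X) (rtl W A W X (rmap W)) y)"
   by (rule rtl_tail) (use y BT_rmap(2)[OF V W] in simp_all)
  moreover have "wl V (T W X) ?C (pj W X) (wl V (T W (T A X)) (T W X) (rtl W A W X (rmap W)) y) =
    wl V (T W X) ?C (pj W X) (wl V (T W (T A X)) (T W X) (wl W (T A X) X (lmap X)) y)"
   by (rule wl_square) (use y in "simp_all add: pj_balanced")
  ultimately show ?thesis using y(1) L(2) unfolding y(2)[symmetric] by (simp add: rtl_wl)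
 qed
 have e: "bas A V W X = (%Z. ?L (rep Z))" by (simp add: fun_eq_iff bassoc_def Let_def)
 show "bas A V W X : mor (BT ?B X) ?Q"
  unfolding e by (rule BT_descend(1)[OF _ _ _ L(1) b]) simp_all
 show "bas A V W X (pj ?B X (rtl V W ?B X (pj V W) y)) = ?f y" if y: "y:.V**W**X"
  unfolding e using BT_descend(2)[OF _ _ _ L(1) b, of "rtl V W ?B X (pj V W) y"] L(2)[OF y] y by simp
qed

text \<open>The formula for the inverse is well defined by the same two descent steps, taken in the opposite order.\<close>

lemma bassoc_inverse:
 assumes V: "sb V" and W: "sb W" and X: "sb X"
 shows "\<exists>g. \<forall>y\<in>carrier (V**W**X). g (pj V (BT W X) (wl V (T W X) (BT W X) (pj W X) y)) =
   pj (BT V W) X (rtl V W (BT V W) X (pj V W) y)"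
proof -
 note s [simp] = V W X BT_sb[OF V W] BT_sb[OF W X]
 let ?B = "BT V W" let ?C = "BT W X" let ?Q = "BT (BT V W) X"
 let ?f = "%s. pj ?B X (rtl V W ?B X (pj V W) s)"
 let ?L = "%t. tsum2 ?Q t (%m Z. ?f (pt V (W**X) m (rep Z)))"
 have f: "?f : mor (T V (T W X)) ?Q" by (rule hmor_comp[OF rtl_hmor pj_hmor]) simp_all
 have bal: "?f (wl V (T W (T A X)) (T W X) (rtl W A W X (rmap W)) x) = ?f (wl V (T W (T A X)) (T W X) (wl W (T A X) X (lmap X)) x)"
  if x: "x:.V**W**A**X" for x
 proof -
  have "rtl ?B A ?B X (rmap ?B) (rtl V W ?B (T A X) (pj V W) x) = rtl V W ?B X (pj V W) (wl V (T W (T A X)) (T W X) (rtl W A W X (rmap W)) x)"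
   by (rule rtl_tail) (use x BT_rmap(2)[OF V W] in simp_all)
  then have "?f (wl V (T W (T A X)) (T W X) (rtl W A W X (rmap W)) x) = pj ?B X (wl ?B (T A X) X (lmap X) (rtl V W ?B (T A X) (pj V W) x))"
   using x pj_balanced[of ?B X "rtl V W ?B (T A X) (pj V W) x"] by simp
  then show ?thesis using x by (simp add: rtl_wl)
 qed
 have L: "?L : mor (T V ?C) ?Q" "t:.V**W**X ==> ?L (wl V (T W X) ?C (pj W X) t) = ?f t" for t
  by (rule BT_left[OF _ _ _ _ f bal refl]; simp)+
 have b: "?L (rtl V A V ?C (rmap V) s) = ?L (wl V (T A ?C) ?C (lmap ?C) s)" if s: "s:.V**A**?C" for s
 proof -
  have sj: "\<exists>u\<in>carrier (T A (T W X)). wl A (T W X) ?C (pj W X) u = z" if "z:.T A ?C" for z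
   using BT_wl_surj[OF W X hA, of z] that by auto
  obtain x where x: "x:.V**A**W**X" "wl V (T A (T W X)) (T A ?C) (wl A (T W X) ?C (pj W X)) x = s"
   by (rule wl_surj[OF _ _ _ _ sj, where t = s and Q = "T A ?C" and V = V]) (use s in simp_all)
  have "rtl V A V ?C (rmap V) (wl V (T A (T W X)) (T A ?C) (wl A (T W X) ?C (pj W X)) x) = wl V (T W X) ?C (pj W X) (rtl V A V (T W X) (rmap V) x)"
   by (rule rtl_wl[symmetric]) (use x in simp_all)
  moreover have "wl V (T A ?C) ?C (lmap ?C) (wl V (T A (T W X)) (T A ?C) (wl A (T W X) ?C (pj W X)) x) =
    wl V (T W X) ?C (pj W X) (wl V (T A (T W X)) (T W X) (rtl A W W X (lmap W)) x)"
   by (rule wl_square) (use x BT_lmap(2)[OF W X] in simp_all)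
  moreover have "rtl V W ?B X (pj V W) (rtl V A V (T W X) (rmap V) x) = rtl V W ?B X (pj V W) (wl V (T A (T W X)) (T W X) (rtl A W W X (lmap W)) x)"
   by (rule rtl_tail) (use x in "simp_all add: pj_balanced")
  ultimately show ?thesis using x(1) L(2) unfolding x(2)[symmetric] by simp
 qed
 show ?thesis
 proof (intro exI ballI)
  fix y assume y: "y:.V**W**X"
  show "?L (rep (pj V ?C (wl V (T W X) ?C (pj W X) y))) = ?f y"
   using BT_descend(2)[OF _ _ _ L(1) b, of "wl V (T W X) ?C (pj W X) y"] L(2)[OF y] y by simp
 qed
qed

lemma bassoc_inv_pj:
 assumes V: "sb V" and W: "sb W" and X: "sb X" and y: "y:.V**W**X"
 shows "bassoc_inv K H A V W X (pj V (BT W X) (wl V (T W X) (BT W X) (pj W X) y)) = pj (BT V W) X (rtl V W (BT V W) X (pj V W) y)"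
proof -
 obtain g where g: "!!y. y:.V**W**X ==> g (pj V (BT W X) (wl V (T W X) (BT W X) (pj W X) y)) =
   pj (BT V W) X (rtl V W (BT V W) X (pj V W) y)" using bassoc_inverse[OF V W X] by blast
 have "g (bas A V W X Z) = Z" if "Z:.BT (BT V W) X" for Z
  using tri_left[OF V W X that] g bassoc_pj(2)[OF V W X] by metis
 then have i: "inj_on (bas A V W X) (carrier (BT (BT V W) X))" by (rule inj_on_inverseI)
 show ?thesis
  unfolding bassoc_inv_def bassoc_pj(2)[OF V W X y, symmetric]
  by (rule inv_into_f_f[OF i]) (use V W X y BT_sb[OF V W] in simp)
qed

lemma bassoc_iso:
 assumes V: "sb V" and W: "sb W" and X: "sb X"
 shows "bas A V W X \<in> bimor K H A (BT (BT V W) X) (BT V (BT W X))"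
  "bimod_iso K H A (BT (BT V W) X) (BT V (BT W X)) (bas A V W X)"
proof -
 note s [simp] = V W X BT_sb[OF V W] BT_sb[OF W X]
 let ?B = "BT V W" let ?C = "BT W X" let ?S = "BT ?B X" let ?Q = "BT V ?C" let ?a = "bas A V W X"
 note a = bassoc_pj[OF V W X]
 let ?p = "%u. pj ?B X (rtl V W ?B X (pj V W) u)"
 let ?q = "%u. pj V ?C (wl V (T W X) ?C (pj W X) u)"
 let ?w = "%u. ?a (pj ?B X u)"
 show bi: "?a \<in> bimor K H A ?S ?Q"
 proof (rule bimorI)
  fix t assume t: "t:.A**?S"
  have sj: "\<exists>u\<in>carrier (T V (T W X)). pj ?B X (rtl V W ?B X (pj V W) u) = z" if "z:.?S" for z
   using tri_left[OF V W X that] by (metis htensor_fields(1) htensor_reduce(2))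
  have h: "?p : mor (T V (T W X)) ?S" by (rule hmor_comp[OF rtl_hmor pj_hmor]) simp_all
  have h': "?q : mor (T V (T W X)) ?Q" by (rule hmor_comp[OF wl_hmor pj_hmor]) simp_all
  obtain x where x: "x:.A**V**W**X" "wl A (T V (T W X)) ?S ?p x = t"
   by (rule wl_surj[OF hA _ _ h sj t]) simp_all
  have 1: "wl A (T V (T W X)) ?S ?p x = wl A (T ?B X) ?S (pj ?B X) (wl A (T V (T W X)) (T ?B X) (rtl V W ?B X (pj V W)) x)"
   by (rule wl_comp[symmetric]) (use x h in simp_all)
  have 2: "rtl A ?B ?B X (lmap ?B) (wl A (T V (T W X)) (T ?B X) (rtl V W ?B X (pj V W)) x) = rtl V W ?B X (pj V W) (rtl A V V (T W X) (lmap V) x)"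
   by (rule rtl_tail[symmetric]) (use x BT_lmap(2)[OF V W] in simp_all)
  have 3: "wl A ?S ?Q ?a (wl A (T V (T W X)) ?S ?p x) = wl A (T V (T W X)) ?Q ?q x"
   by (rule wl_comp) (use x h h' a in simp_all)
  have 4: "... = wl A (T V ?C) ?Q (pj V ?C) (wl A (T V (T W X)) (T V ?C) (wl V (T W X) ?C (pj W X)) x)"
   by (rule wl_comp[symmetric]) (use x h' in simp_all)
  have "?a (lmap ?S t) = ?a (pj ?B X (rtl V W ?B X (pj V W) (rtl A V V (T W X) (lmap V) x)))"
   unfolding x(2)[symmetric] 1 using x(1) BT_lmap(2)[of ?B X] 2 by simp
  also have "... = pj V ?C (rtl A V V ?C (lmap V) (wl A (T V (T W X)) (T V ?C) (wl V (T W X) ?C (pj W X)) x))"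
   using a(2)[of "rtl A V V (T W X) (lmap V) x"] x(1) by (simp add: rtl_wl)
  also have "... = lmap ?Q (wl A ?S ?Q ?a t)"
   unfolding x(2)[symmetric] 3 4 using x(1) BT_lmap(2)[of V ?C] by simp
  finally show "?a (lmap ?S t) = lmap ?Q (wl A ?S ?Q ?a t)" .
 next
  fix t assume t: "t:.?S**A"
  obtain z where z: "z:.?B**X**A" "rtl ?B X ?S A (pj ?B X) z = t"
   by (rule BT_rtl_surj[OF _ _ hA t]) simp_all
  obtain y where y: "y:.V**W**X**A" "rtl V W ?B (T X A) (pj V W) y = z"
   using BT_rtl_surj[OF V W, of "T X A" z] z by auto
  have ap: "?w : mor (T ?B X) ?Q" by (rule hmor_comp[OF pj_hmor a(1)]) simp_all
  have 1: "wr ?S ?Q A ?a (rtl ?B X ?S A (pj ?B X) z) = rtl ?B X ?Q A ?w z"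
   by (rule rtl_post) (use z a(1) ap in simp_all)
  have 2: "rtl ?B X ?Q A ?w (rtl V W ?B (T X A) (pj V W) y) = rtl V ?C ?Q A (pj V ?C) (wl V (T W (T X A)) (T ?C A) (rtl W X ?C A (pj W X)) y)"
   by (rule rtl_tail) (use y a(2) ap in simp_all)
  have 3: "wl V (T ?C A) ?C (rmap ?C) (wl V (T W (T X A)) (T ?C A) (rtl W X ?C A (pj W X)) y) =
    wl V (T W X) ?C (pj W X) (wl V (T W (T X A)) (T W X) (wl W (T X A) X (rmap X)) y)"
   by (rule wl_square) (use y BT_rmap(2)[OF W X] in simp_all)
  have "?a (rmap ?S t) = pj V ?C (wl V (T W X) ?C (pj W X) (wl V (T W (T X A)) (T W X) (wl W (T X A) X (rmap X)) y))"
   using y(1) BT_rmap(2)[of ?B X] a(2) unfolding z(2)[symmetric] y(2)[symmetric] by (simp add: rtl_wl)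
  also have "... = rmap ?Q (wr ?S ?Q A ?a t)"
   unfolding z(2)[symmetric] 1 unfolding y(2)[symmetric] 2 using y(1) BT_rmap(2)[of V ?C] 3 by simp
  finally show "?a (rmap ?S t) = rmap ?Q (wr ?S ?Q A ?a t)" .
 qed (use a in simp_all)
 have g: "bassoc_inv K H A V W X Z:.?S \<and> ?a (bassoc_inv K H A V W X Z) = Z" if Z: "Z:.?Q" for Z
  by (rule tri_right[OF V W X Z]) (use bassoc_inv_pj[OF V W X] a(2) in auto)
 have g': "bassoc_inv K H A V W X (?a Z) = Z" if Z: "Z:.?S" for Z
  by (rule tri_left[OF V W X Z]) (use bassoc_inv_pj[OF V W X] a(2) in auto)
 show "bimod_iso K H A ?S ?Q ?a"
  by (rule bimod_isoI[OF _ _ bi, of "bassoc_inv K H A V W X"]) (use g g' in auto)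
qed

end

locale qtqh_commutative = qtqh_algebra +
 assumes bc: "braided_commutative K H A"
begin

lemma sb_unit [simp]: "sb U"
 by (rule unit_symmetric[OF bc])

subsection \<open>The unitors\<close>

lemma lunitor_pj:
 assumes V: "sb V"
 shows "lunitor V : mor (BT U V) V" "t:.A**V ==> lunitor V (pj U V t) = lmap V t"
proof -
 have f: "lmap V : mor (T U V) V" using V by simp
 have b: "lmap V (rtl U A U V (rmap U) s) = lmap V (wl U (T A V) V (lmap V) s)" if "s:.U**A**V" for s
  using sb_laws(2)[OF V] that by simp
 note d = BT_descend[OF sb_pm[OF sb_unit] sb_pm[OF V] sb_simps(1)[OF V] f b]
 have e: "lunitor V = (%Z. lmap V (rep Z))" by (simp add: fun_eq_iff lunitor_def)
 show "lunitor V : mor (BT U V) V" unfolding e by (rule d(1))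
 show "t:.A**V ==> lunitor V (pj U V t) = lmap V t" unfolding e using d(2)[of t] by simp
qed

lemma runitor_pj:
 assumes V: "sb V"
 shows "runitor V : mor (BT V U) V" "t:.V**A ==> runitor V (pj V U t) = rmap V t"
proof -
 have f: "rmap V : mor (T V U) V" using V by simp
 have b: "rmap V (rtl V A V U (rmap V) s) = rmap V (wl V (T A U) U (lmap U) s)" if "s:.V**A**U" for s
  using sb_laws(1)[OF V] that by simp
 note d = BT_descend[OF sb_pm[OF V] sb_pm[OF sb_unit] sb_simps(1)[OF V] f b]
 have e: "runitor V = (%Z. rmap V (rep Z))" by (simp add: fun_eq_iff runitor_def)
 show "runitor V : mor (BT V U) V" unfolding e by (rule d(1))
 show "t:.V**A ==> runitor V (pj V U t) = rmap V t" unfolding e using d(2)[of t] by simp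
qed

text \<open>The inverse is \<open>v \<mapsto> 1 \<otimes>\<^sub>A v\<close>; invariance of the unit makes the relation read \<open>1 \<otimes>\<^sub>A av = a \<otimes>\<^sub>A v\<close>.\<close>

lemma lunitor_iso:
 assumes V: "sb V"
 shows "lunitor V \<in> bimor K H A (BT U V) V" "bimod_iso K H A (BT U V) V (lunitor V)"
proof -
 note s [simp] = V u1_closed BT_sb[OF sb_unit V] and l = lunitor_pj[OF V] and laws = sb_laws[OF V]
 let ?B = "BT U V"
 have L: "s:.A**A**V ==> lmap ?B (wl A (T A V) ?B (pj U V) s) = pj U V (rtl A A A V (mu A) s)"
  and R: "y:.A**V**A ==> rmap ?B (rtl A V ?B A (pj U V) y) = pj U V (wl A (T V A) V (rmap V) y)" for s y
  using BT_lmap(2)[OF sb_unit V, of s] BT_rmap(2)[OF sb_unit V, of y] by simp_all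
 have p: "pj U V : mor (T A V) ?B" using pj_hmor[of U V] by simp
 have pc: "t:.A**V ==> pj U V t:.?B" for t using pj_closed[of U V t] by simp
 have sj: "\<exists>t\<in>carrier (A**V). pj U V t = Z" if "Z:.?B" for Z using pj_surj[of U V Z] that by simp
 show bi: "lunitor V \<in> bimor K H A ?B V"
 proof (rule bimorI)
  fix t assume "t:.A**?B"
  then obtain s where s: "s:.A**A**V" "wl A (T A V) ?B (pj U V) s = t"
   using BT_wl_surj[OF sb_unit V hA, of t] by auto
  have "wl A ?B V (lunitor V) (wl A (T A V) ?B (pj U V) s) = wl A (T A V) V (lmap V) s" by (rule wl_comp) (use s l p in simp_all)
  then show "lunitor V (lmap ?B t) = lmap V (wl A ?B V (lunitor V) t)"
   using s(1) l L laws(2) unfolding s(2)[symmetric] by simp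
 next
  fix t assume "t:.?B**A"
  then obtain y where y: "y:.A**V**A" "rtl A V ?B A (pj U V) y = t"
   using BT_rtl_surj[OF sb_unit V hA, of t] by auto
  have "wr ?B V A (lunitor V) (rtl A V ?B A (pj U V) y) = rtl A V V A (lmap V) y" by (rule rtl_post) (use y l p in simp_all)
  then show "lunitor V (rmap ?B t) = rmap V (wr ?B V A (lunitor V) t)"
   using y(1) l R laws(3) unfolding y(2)[symmetric] by simp
 qed (use l in simp_all)
 have 1: "pj U V (pt A V u1 (lunitor V Z)) = Z" if Z: "Z:.?B" for Z
 proof -
  obtain t where t: "t:.A**V" "pj U V t = Z" using sj[OF Z] by blast
  have "pj U V (pt A V u1 (lmap V t)) = pj U V t"
  proof (rule tensor_eqI[OF _ _ klin_comp[OF klin_comp[OF hmor_lin_T[OF sb_simps(2)[OF V]] lin_ptens2[OF _ _ klin_id(2)]] hmor_lin_T[OF p]] hmor_lin_T[OF p] _ t(1)])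
   fix a v assume av: "a:.A" "v:.V"
   let ?t = "pt A (A**V) u1 (pt A V a v)"
   have "wl A (T A V) V (lmap V) ?t = pt A V u1 (lmap V (pt A V a v))"
    using av wl_ptens[of A "T A V" V "lmap V"] by simp
   moreover have "rtl A A A V (mu A) ?t = pt A V a v"
    using av ainv_invariant1[OF hA hA _ u1_closed u1_inv av] wr_ptens[of "T A A" A V "mu A" "pt A A u1 a" v] sb_laws(4)[OF sb_unit, of a]
    by (simp add: rtl_def)
   ultimately show "pj U V (pt A V u1 (lmap V (pt A V a v))) = pj U V (pt A V a v)"
    using pj_balanced[of U V ?t] av by simp
  qed simp_all
  then show ?thesis using t(1) l unfolding t(2)[symmetric] by simp
 qed
 show "bimod_iso K H A ?B V (lunitor V)"
  by (rule bimod_isoI[OF _ _ bi, where g = "%v. pj U V (pt A V u1 v)"]) (use 1 l laws pc in simp_all)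
qed

lemma runitor_iso:
 assumes V: "sb V"
 shows "runitor V \<in> bimor K H A (BT V U) V" "bimod_iso K H A (BT V U) V (runitor V)"
proof -
 note s [simp] = V u1_closed BT_sb[OF V sb_unit] and l = runitor_pj[OF V] and laws = sb_laws[OF V]
 let ?B = "BT V U"
 have L: "s:.A**V**A ==> lmap ?B (wl A (T V A) ?B (pj V U) s) = pj V U (rtl A V V A (lmap V) s)"
  and R: "y:.V**A**A ==> rmap ?B (rtl V A ?B A (pj V U) y) = pj V U (wl V (T A A) A (mu A) y)" for s y
  using BT_lmap(2)[OF V sb_unit, of s] BT_rmap(2)[OF V sb_unit, of y] by simp_all
 have p: "pj V U : mor (T V A) ?B" using pj_hmor[of V U] by simp
 have pc: "t:.V**A ==> pj V U t:.?B" for t using pj_closed[of V U t] by simp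
 have sj: "\<exists>t\<in>carrier (V**A). pj V U t = Z" if "Z:.?B" for Z using pj_surj[of V U Z] that by simp
 show bi: "runitor V \<in> bimor K H A ?B V"
 proof (rule bimorI)
  fix t assume "t:.A**?B"
  then obtain s where s: "s:.A**V**A" "wl A (T V A) ?B (pj V U) s = t"
   using BT_wl_surj[OF V sb_unit hA, of t] by auto
  have "wl A ?B V (runitor V) (wl A (T V A) ?B (pj V U) s) = wl A (T V A) V (rmap V) s" by (rule wl_comp) (use s l p in simp_all)
  then show "runitor V (lmap ?B t) = lmap V (wl A ?B V (runitor V) t)"
   using s(1) l L laws(3) unfolding s(2)[symmetric] by simp
 next
  fix t assume "t:.?B**A"
  then obtain y where y: "y:.V**A**A" "rtl V A ?B A (pj V U) y = t"
   using BT_rtl_surj[OF V sb_unit hA, of t] by auto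
  have "wr ?B V A (runitor V) (rtl V A ?B A (pj V U) y) = rtl V A V A (rmap V) y" by (rule rtl_post) (use y l p in simp_all)
  then show "runitor V (rmap ?B t) = rmap V (wr ?B V A (runitor V) t)"
   using y(1) l R laws(1) unfolding y(2)[symmetric] by simp
 qed (use l in simp_all)
 have 1: "pj V U (pt V A (runitor V Z) u1) = Z" if Z: "Z:.?B" for Z
 proof -
  obtain t where t: "t:.V**A" "pj V U t = Z" using sj[OF Z] by blast
  have "pj V U (pt V A (rmap V t) u1) = pj V U t"
  proof (rule tensor_eqI[OF _ _ klin_comp[OF klin_comp[OF hmor_lin_T[OF sb_simps(3)[OF V]] lin_ptens1[OF _ _ klin_id(2)]] hmor_lin_T[OF p]] hmor_lin_T[OF p] _ t(1)])
   fix v a assume av: "v:.V" "a:.A"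
   let ?t = "pt V (A**A) v (pt A A a u1)"
   have "rtl V A V A (rmap V) ?t = pt V A (rmap V (pt V A v a)) u1"
    using av ainv_invariant3[OF _ hA hA av u1_closed u1_inv] wr_ptens[of "T V A" V A "rmap V" "pt V A v a" u1] by (simp add: rtl_def)
   moreover have "wl V (T A A) A (mu A) ?t = pt V A v a"
    using av wl_ptens[of V "T A A" A "mu A" v "pt A A a u1"] sb_laws(5)[OF sb_unit, of a] by simp
   ultimately show "pj V U (pt V A (rmap V (pt V A v a)) u1) = pj V U (pt V A v a)"
    using pj_balanced[of V U ?t] av by simp
  qed simp_all
  then show ?thesis using t(1) l unfolding t(2)[symmetric] by simp
 qed
 show "bimod_iso K H A ?B V (runitor V)"
  by (rule bimod_isoI[OF _ _ bi, where g = "%v. pj V U (pt V A v u1)"]) (use 1 l laws pc in simp_all)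
qed

subsection \<open>Naturality and coherence\<close>

lemma lunitor_natural:
 assumes V: "sb V" and V': "sb V'" and f: "f \<in> bimor K H A V V'" and Z: "Z:.BT U V"
 shows "lunitor V' (bmp A U V' id f Z) = f (lunitor V Z)"
proof -
 note F = bimor_laws[OF sb_pm[OF V] sb_pm[OF V'] f]
 obtain t where t: "t:.A**V" "pj U V t = Z" using pj_surj[of U V Z] V Z by auto
 have "bmp A U V' id f (pj U V t) = pj U V' (wl A V V' f t)"
  using bmap_pj(2)[OF sb_unit V sb_unit V' bimor_id f, of t] t V V' by (simp add: tm_def wr_def tmap_id id_def[symmetric])
 then show ?thesis using t V V' lunitor_pj[OF V] lunitor_pj[OF V'] F unfolding t(2)[symmetric] by simp
qed

lemma runitor_natural:
 assumes V: "sb V" and V': "sb V'" and f: "f \<in> bimor K H A V V'" and Z: "Z:.BT V U"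
 shows "runitor V' (bmp A V' U f id Z) = f (runitor V Z)"
proof -
 note F = bimor_laws[OF sb_pm[OF V] sb_pm[OF V'] f]
 obtain t where t: "t:.V**A" "pj V U t = Z" using pj_surj[of V U Z] V Z by auto
 have "bmp A V' U f id (pj V U t) = pj V' U (wr V V' A f t)"
  using bmap_pj(2)[OF V sb_unit V' sb_unit f bimor_id, of t] t V V' F by (simp add: tm_def wl_def tmap_id id_def[symmetric])
 then show ?thesis using t V V' runitor_pj[OF V] runitor_pj[OF V'] F unfolding t(2)[symmetric] by simp
qed

lemma bmap_left:
 assumes V: "sb V" and W: "sb W" and V': "sb V'" and f: "f \<in> bimor K H A V V'" and t: "t:.V**W"
 shows "bmp A V' W f id (pj V W t) = pj V' W (wr V V' W f t)"
proof -
 have "wl V' W W id (wr V V' W f t) = wr V V' W f t" by (rule wl_id) (use assms bimor_laws(1)[OF _ _ f] in simp_all)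
 then show ?thesis using bmap_pj(2)[OF V W V' W f bimor_id t] by (simp add: tm_def)
qed

lemma bmap_right:
 assumes V: "sb V" and W: "sb W" and W': "sb W'" and f: "f \<in> bimor K H A W W'" and t: "t:.V**W"
 shows "bmp A V W' id f (pj V W t) = pj V W' (wl V W W' f t)"
 using bmap_pj(2)[OF V W V W' bimor_id f t] assms by (simp add: tm_def wr_def tmap_id)

lemma bassoc_natural:
 assumes V: "sb V" and W: "sb W" and X: "sb X" and V': "sb V'" and W': "sb W'" and X': "sb X'"
  and f: "f \<in> bimor K H A V V'" and g: "g \<in> bimor K H A W W'" and h: "h \<in> bimor K H A X X'" and Z: "Z:.BT (BT V W) X"
 shows "bas A V' W' X' (bmp A (BT V' W') X' (bmp A V' W' f g) h Z) =
  bmp A V' (BT W' X') f (bmp A W' X' g h) (bas A V W X Z)"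
proof -
 note s [simp] = V W X V' W' X' BT_sb[OF V W] BT_sb[OF W X] BT_sb[OF V' W'] BT_sb[OF W' X']
  bimor_laws(1)[OF _ _ f] bimor_laws(1)[OF _ _ g] bimor_laws(1)[OF _ _ h]
 let ?B = "BT V W" let ?C = "BT W X" let ?B' = "BT V' W'" let ?C' = "BT W' X'"
 let ?b = "bmp A V' W' f g" let ?c = "bmp A W' X' g h" let ?q = "%t. pj V' W' (tm V V' W W' f g t)"
 note b = bmap_pj[OF V W V' W' f g] and c = bmap_pj[OF W X W' X' g h]
 note bb = bmap_pj(2)[OF BT_sb[OF V W] X BT_sb[OF V' W'] X' bmap_bimor[OF V W V' W' f g] h]
  and cc = bmap_pj(2)[OF V BT_sb[OF W X] V' BT_sb[OF W' X'] f bmap_bimor[OF W X W' X' g h]]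
 obtain y where y: "y:.V**W**X" "pj ?B X (rtl V W ?B X (pj V W) y) = Z" by (rule tri_left[OF V W X Z])
 let ?z = "tm V V' (T W X) (T W' X') f (tm W W' X X' g h) y" let ?y = "wr V V' (T W X) f y"
 have q: "?q : mor (T V W) ?B'" "(%t. pj V' W' (wl V' W W' g t)) : mor (T V' W) ?B'"
  by (rule hmor_comp[OF tm_hmor pj_hmor] hmor_comp[OF wl_hmor pj_hmor]; simp)+
 have z: "?z:.V'**W'**X'" using y(1) tm_closed[of V "T W X" V' "T W' X'" f "tm W W' X X' g h" y] by simp
 have "wr ?B ?B' X ?b (rtl V W ?B X (pj V W) y) = rtl V W ?B' X ?q y"
  by (rule rtl_post) (use y q b in simp_all)
 also have "... = rtl V' W ?B' X (%t. pj V' W' (wl V' W W' g t)) ?y"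
  by (rule rtl_pre1[symmetric]) (use y q in "simp_all add: tm_def")
 also have "... = rtl V' W' ?B' X (pj V' W') (wl V' (T W X) (T W' X) (wr W W' X g) ?y)"
  by (rule rtl_pre2[symmetric]) (use y q in simp_all)
 finally have "tm ?B ?B' X X' ?b h (rtl V W ?B X (pj V W) y) = rtl V' W' ?B' X' (pj V' W') (wl V' (T W' X) (T W' X') (wl W' X X' h) (wl V' (T W X) (T W' X) (wr W W' X g) ?y))"
  using y by (simp add: tm_def rtl_wl)
 also have "wl V' (T W' X) (T W' X') (wl W' X X' h) (wl V' (T W X) (T W' X) (wr W W' X g) ?y) = ?z"
  unfolding tm_def[of V V' "T W X"] by (rule wl_comp) (use y in "simp_all add: tm_def")
 finally have 1: "tm ?B ?B' X X' ?b h (rtl V W ?B X (pj V W) y) = rtl V' W' ?B' X' (pj V' W') ?z" .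
 have "wl V' ?C ?C' ?c (wl V' (T W X) ?C (pj W X) ?y) = wl V' (T W' X') ?C' (pj W' X') (wl V' (T W X) (T W' X') (tm W W' X X' g h) ?y)"
  by (rule wl_square) (use y c in simp_all)
 then have 2: "tm V V' ?C ?C' f ?c (wl V (T W X) ?C (pj W X) y) = wl V' (T W' X') ?C' (pj W' X') ?z"
  using y(1) wr_wl[of V "T W X" V' ?C f "pj W X" y] by (simp add: tm_def)
 show ?thesis
  unfolding y(2)[symmetric] using y(1) bb cc 1 2 bassoc_pj(2)[OF V W X y(1)] bassoc_pj(2)[OF V' W' X' z] by simp
qed

lemma pentagon_holds:
 assumes V: "sb V" and W: "sb W" and X: "sb X" and Y: "sb Y"
 shows "pentagon K H A V W X Y"
 unfolding pentagon_def
proof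
 note BS = BT_sb
 note s [simp] = V W X Y BS[OF V W] BS[OF W X] BS[OF X Y] BS[OF BS[OF V W] X] BS[OF V BS[OF W X]] BS[OF W BS[OF X Y]] BS[OF BS[OF W X] Y]
 let ?VW = "BT V W" let ?WX = "BT W X" let ?XY = "BT X Y"
 let ?a = "bas A V W X"
 let ?r = "%u. pj ?WX Y (rtl W X ?WX Y (pj W X) u)"
 let ?s = "%u. pj W ?XY (wl W (T X Y) ?XY (pj X Y) u)"
 let ?w = "%u. ?a (pj ?VW X u)"
 fix Z assume "Z:.BT (BT ?VW X) Y"
 then obtain z where z: "z:.?VW**X**Y" "pj (BT ?VW X) Y (rtl ?VW X (BT ?VW X) Y (pj ?VW X) z) = Z"
  using tri_left[OF BS[OF V W] X Y] by blast
 obtain y where y: "y:.V**W**X**Y" "rtl V W ?VW (T X Y) (pj V W) y = z"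
  using BT_rtl_surj[OF V W, of "T X Y" z] z by auto
 have ap: "?w : mor (T ?VW X) (BT V ?WX)" by (rule hmor_comp[OF pj_hmor bassoc_pj(1)]) simp_all
 have h: "?s : mor (T W (T X Y)) (BT W ?XY)" by (rule hmor_comp[OF wl_hmor pj_hmor]) simp_all
 have 1: "wl ?VW (T X Y) ?XY (pj X Y) z = rtl V W ?VW ?XY (pj V W) (wl V (T W (T X Y)) (T W ?XY) (wl W (T X Y) ?XY (pj X Y)) y)"
  unfolding y(2)[symmetric] using y(1) by (simp add: rtl_wl)
 have 2: "wl V (T W ?XY) (BT W ?XY) (pj W ?XY) (wl V (T W (T X Y)) (T W ?XY) (wl W (T X Y) ?XY (pj X Y)) y) =
   wl V (T W (T X Y)) (BT W ?XY) ?s y"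
  by (rule wl_comp) (use y h in simp_all)
 have L: "bas A V W ?XY (bas A ?VW X Y Z) = pj V (BT W ?XY) (wl V (T W (T X Y)) (BT W ?XY) ?s y)"
  unfolding z(2)[symmetric] bassoc_pj(2)[OF BS[OF V W] X Y z(1)] 1 2[symmetric] by (rule bassoc_pj(2)) (use y in simp_all)
 have "wr (BT ?VW X) (BT V ?WX) Y ?a (rtl ?VW X (BT ?VW X) Y (pj ?VW X) z) = rtl ?VW X (BT V ?WX) Y ?w z"
  by (rule rtl_post) (use z bassoc_pj(1)[OF V W X] ap in simp_all)
 also have "... = rtl V ?WX (BT V ?WX) Y (pj V ?WX) (wl V (T W (T X Y)) (T ?WX Y) (rtl W X ?WX Y (pj W X)) y)"
  unfolding y(2)[symmetric] by (rule rtl_tail) (use y bassoc_pj(2)[OF V W X] ap in simp_all)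
 finally have 3: "bmp A (BT V ?WX) Y ?a id Z = pj (BT V ?WX) Y (rtl V ?WX (BT V ?WX) Y (pj V ?WX) (wl V (T W (T X Y)) (T ?WX Y) (rtl W X ?WX Y (pj W X)) y))"
  unfolding z(2)[symmetric] using z(1) bmap_left[OF _ Y _ bassoc_iso(1)[OF V W X]] by simp
 have hr: "?r : mor (T W (T X Y)) (BT ?WX Y)" by (rule hmor_comp[OF rtl_hmor pj_hmor]) simp_all
 have 4: "bas A V ?WX Y (bmp A (BT V ?WX) Y ?a id Z) = pj V (BT ?WX Y) (wl V (T W (T X Y)) (BT ?WX Y) ?r y)"
 proof -
  have "wl V (T ?WX Y) (BT ?WX Y) (pj ?WX Y) (wl V (T W (T X Y)) (T ?WX Y) (rtl W X ?WX Y (pj W X)) y) =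
    wl V (T W (T X Y)) (BT ?WX Y) ?r y"
   by (rule wl_comp) (use y hr in simp_all)
  then show ?thesis unfolding 3 using bassoc_pj(2)[OF V _ Y, of ?WX "wl V (T W (T X Y)) (T ?WX Y) (rtl W X ?WX Y (pj W X)) y"] y by simp
 qed
 have "wl V (BT ?WX Y) (BT W ?XY) (bas A W X Y) (wl V (T W (T X Y)) (BT ?WX Y) ?r y) =
   wl V (T W (T X Y)) (BT W ?XY) ?s y"
  by (rule wl_comp) (use y h hr bassoc_pj[OF W X Y] in simp_all)
 then show "bas A V W ?XY (bas A ?VW X Y Z) = bmp A V (BT W ?XY) id (bas A W X Y) (bas A V ?WX Y (bmp A (BT V ?WX) Y ?a id Z))"
  unfolding L 4 using y(1) hr bmap_right[OF V _ _ bassoc_iso(1)[OF W X Y], of "wl V (T W (T X Y)) (BT ?WX Y) ?r y"]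
  by simp
qed

lemma triangle_holds:
 assumes V: "sb V" and W: "sb W"
 shows "triangle K H A V W"
 unfolding triangle_def
proof
 note s [simp] = V W BT_sb[OF V sb_unit] BT_sb[OF sb_unit W]
 let ?B = "BT V U" let ?C = "BT U W"
 have p: "pj V U : mor (T V A) ?B" "pj U W : mor (T A W) ?C" using pj_hmor[of V U] pj_hmor[of U W] by simp_all
 fix Z assume "Z:.BT ?B W"
 then obtain y where "y:.V**U**W" "pj ?B W (rtl V U ?B W (pj V U) y) = Z" by (rule tri_left[OF V sb_unit W])
 then have y: "y:.V**A**W" "pj ?B W (rtl V A ?B W (pj V U) y) = Z" by simp_all
 have 1: "wr ?B V W (runitor V) (rtl V A ?B W (pj V U) y) = rtl V A V W (rmap V) y"
  by (rule rtl_post) (use y p runitor_pj[OF V] in simp_all)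
 have 2: "wl V ?C W (lunitor W) (wl V (T A W) ?C (pj U W) y) = wl V (T A W) W (lmap W) y"
  by (rule wl_comp) (use y p lunitor_pj[OF W] in simp_all)
 have 3: "bas A V U W Z = pj V ?C (wl V (T A W) ?C (pj U W) y)"
  using bassoc_pj(2)[OF V sb_unit W, of y] y by simp
 have "bmp A V W id (lunitor W) (bas A V U W Z) = pj V W (wl V (T A W) W (lmap W) y)"
  unfolding 3 2[symmetric] by (rule bmap_right[OF V _ W lunitor_iso(1)[OF W]]) (use y p in simp_all)
 also have "... = pj V W (rtl V A V W (rmap V) y)" using y by (simp add: pj_balanced)
 also have "... = bmp A V W (runitor V) id Z"
  unfolding y(2)[symmetric] 1[symmetric] by (rule bmap_left[OF _ W V runitor_iso(1)[OF V], symmetric]) (use y p in simp_all)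
 finally show "bmp A V W id (lunitor W) (bas A V U W Z) = bmp A V W (runitor V) id Z" .
qed

end

section \<open>The braiding\<close>

context qtqh_commutative
begin

lemma crl_surj:
 assumes V: "hm V" and W: "hm W" and M: "hm M" and c: "c:.W**V**M"
 obtains t where "t:.V**W**M" "crl V W M t = c"
proof -
 have a: "ainv W V M c:.(T W V)**M" using assms by simp
 obtain u where u: "u:.(T V W)**M" "wr (T V W) (T W V) M (br V W) u = ainv W V M c"
  using wr_surj[OF _ M _ braid_hmor[OF V W] _ a] braid_surj[OF V W] V W by (metis hm_T htensor_fields(1))
 obtain t where t: "t:.V**W**M" "ainv V W M t = u" using ainv_surj[OF V W M, of u] u(1) by auto
 have "ainv W V M (crl V W M t) = ainv W V M c" using ainv_crl[OF V W M t(1)] t(2) u(2) by simp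
 then have "asc W V M (ainv W V M (crl V W M t)) = asc W V M (ainv W V M c)" by simp
 then have "crl V W M t = c" using assms t(1) by simp
 then show ?thesis using that t(1) by blast
qed

text \<open>The braiding exchanges the two ways in which the middle factor of \<open>V \<otimes> A \<otimes> W\<close> can act; this is
 the Yang--Baxter equation together with symmetry of the bimodules.\<close>

definition "flip3 V W s = wl W (T V A) (T A V) (br V A) (crl V W A (wl V (T A W) (T W A) (br A W) s))"

lemma flip3_closed [simp]:
 assumes "hm V" "hm W" "s:.V**A**W"
 shows "flip3 V W s:.W**A**V"
 unfolding flip3_def using assms crl_closed[of V W A "wl V (T A W) (T W A) (br A W) s"] by simp

lemma flip3_surj:
 assumes V: "hm V" and W: "hm W" and y: "y:.W**A**V"
 obtains s where "s:.V**A**W" "flip3 V W s = y"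
proof -
 have b: "\<exists>u\<in>carrier (T V A). br V A u = z" if "z:.T A V" for z
  using braid_surj[OF V hA, of z] that by auto
 obtain c where c: "c:.W**(T V A)" "wl W (T V A) (T A V) (br V A) c = y"
  by (rule wl_surj[OF W _ _ _ b, where t = y and Q = "T A V"]) (use y V in simp_all)
 obtain t where t: "t:.V**W**A" "crl V W A t = c"
  by (rule crl_surj[OF V W hA, of c]) (use c in simp_all)
 have b': "\<exists>u\<in>carrier (T A W). br A W u = z" if "z:.T W A" for z
  using braid_surj[OF hA W, of z] that by auto
 obtain s where s: "s:.V**(T A W)" "wl V (T A W) (T W A) (br A W) s = t"
  by (rule wl_surj[OF V _ _ _ b', where t = t and Q = "T W A"]) (use t W in simp_all)
 show ?thesis by (rule that[of s]) (use s c t in "simp_all add: flip3_def")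
qed

text \<open>The two ends of the relation are exchanged: acting on the left neighbour before braiding is acting on the right neighbour afterwards.\<close>

lemma braid_balanced:
 assumes V: "sb V" and W: "sb W" and s: "s:.V**A**W"
 shows "br V W (rtl V A V W (rmap V) s) = wl W (T A V) V (lmap V) (flip3 V W s)"
  "br V W (wl V (T A W) W (lmap W) s) = rtl W A W V (rmap W) (flip3 V W s)"
proof -
 let ?c = "crl V W A (wl V (T A W) (T W A) (br A W) s)" let ?d = "wl A (T V W) (T W V) (br V W) (crl V A W s)"
 have c: "?c:.W**V**A" using V W s crl_closed[of V W A "wl V (T A W) (T W A) (br A W) s"] by simp
 have "wl W (T A V) V (lmap V) (flip3 V W s) = wl W (T V A) V (rmap V) ?c"
  unfolding flip3_def by (rule wl_comp) (use V W c sb_laws(7)[OF V] in simp_all)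
 then show "br V W (rtl V A V W (rmap V) s) = wl W (T A V) V (lmap V) (flip3 V W s)"
  using V W s by (simp add: braid_rtl)
 have "flip3 V W s = crl A W V ?d" unfolding flip3_def by (rule yang_baxter) (use V W s in simp_all)
 then have "rtl W A W V (rmap W) (flip3 V W s) = rtl A W W V (lmap W) ?d"
  by simp (rule rtl_crl, use V W s sb_laws(6)[OF W] in simp_all)
 then show "br V W (wl V (T A W) W (lmap W) s) = rtl W A W V (rmap W) (flip3 V W s)"
  using V W s by (simp add: braid_wl_pair)
qed

lemma bbraid_pj:
 assumes V: "sb V" and W: "sb W"
 shows "bbr A V W : mor (BT V W) (BT W V)"
  "t:.V**W ==> bbr A V W (pj V W t) = pj W V (br V W t)"
proof -
 let ?f = "%t. pj W V (br V W t)"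
 have f: "?f : mor (T V W) (BT W V)" by (rule hmor_comp[OF braid_hmor pj_hmor]) (use V W in simp_all)
 have b: "?f (rtl V A V W (rmap V) s) = ?f (wl V (T A W) W (lmap W) s)" if "s:.V**A**W" for s
  using braid_balanced[OF V W that] that V W by (simp add: pj_balanced)
 note d = BT_descend[OF _ _ _ f b]
 have e: "bbr A V W = (%Z. ?f (rep Z))" by (simp add: fun_eq_iff bbraid_def)
 show "bbr A V W : mor (BT V W) (BT W V)" unfolding e by (rule d(1)) (use V W in simp_all)
 show "t:.V**W ==> bbr A V W (pj V W t) = ?f t" unfolding e by (rule d(2)) (use V W in simp_all)
qed

text \<open>The inverse braiding of modules descends because \<open>flip3\<close> is onto, so every relation for \<open>(W, V)\<close> comes from one for \<open>(V, W)\<close>.\<close>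

lemma bbraid_inverse:
 assumes V: "sb V" and W: "sb W"
 shows "\<exists>g. \<forall>t\<in>carrier (V**W). g (pj W V (br V W t)) = pj V W t"
proof -
 let ?i = "inv_into (carrier (V**W)) (br V W)"
 have "inj_on (br V W) (carrier (V**W))"
  by (rule inj_onI) (use braid_inj[of V W] V W in simp)
 then have i: "?i (br V W t) = t" if "t:.V**W" for t using inv_into_f_f that by fast
 have ih: "?i : mor (T W V) (T V W)"
 proof (rule hmor_descend[OF _ braid_hmor _ hmor_id(2)])
  show "\<exists>v\<in>carrier (T V W). br V W v = z" if "z:.T W V" for z
   by (rule braid_surj[of V W z]) (use V W that in auto)
 qed (use V W i in simp_all)
 let ?f = "%t. pj V W (?i t)"
 have f: "?f : mor (T W V) (BT V W)" by (rule hmor_comp[OF ih pj_hmor]) (use V W in simp_all)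
 have b: "?f (rtl W A W V (rmap W) y) = ?f (wl W (T A V) V (lmap V) y)" if y: "y:.W**A**V" for y
 proof -
  obtain s where s: "s:.V**A**W" "flip3 V W s = y" using flip3_surj[OF _ _ y] V W by auto
  show ?thesis
   using braid_balanced[OF V W s(1)] i[of "rtl V A V W (rmap V) s"] i[of "wl V (T A W) W (lmap W) s"] s(1) V W
   unfolding s(2) by (simp add: pj_balanced)
 qed
 show ?thesis
  using BT_descend(2)[OF _ _ _ f b] i V W by (intro exI[of _ "%Z. ?f (rep Z)"]) simp
qed

lemma bbraid_iso:
 assumes V: "sb V" and W: "sb W"
 shows "bbr A V W \<in> bimor K H A (BT V W) (BT W V)" "bimod_iso K H A (BT V W) (BT W V) (bbr A V W)"
proof -
 note s [simp] = V W BT_sb[OF V W] BT_sb[OF W V]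
 let ?B = "BT V W" let ?C = "BT W V" let ?b = "bbr A V W"
 note b = bbraid_pj[OF V W]
 have l: "?b (lmap ?B t) = lmap ?C (wl A ?B ?C ?b t)" if t: "t:.A**?B" for t
 proof -
  obtain s where s: "s:.A**V**W" "wl A (T V W) ?B (pj V W) s = t" by (rule BT_wl_surj[OF V W hA t])
  let ?s = "wl A (T V W) (T W V) (br V W) s"
  have "wl A ?B ?C ?b (wl A (T V W) ?B (pj V W) s) = wl A (T W V) ?C (pj W V) ?s" by (rule wl_square) (use s b in simp_all)
  then have R: "lmap ?C (wl A ?B ?C ?b t) = pj W V (rtl A W W V (lmap W) ?s)"
   unfolding s(2)[symmetric] using s(1) BT_lmap(2)[OF W V, of ?s] by simp
  have "rtl A W W V (lmap W) ?s = rtl W A W V (rmap W) (crl A W V ?s)"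
   by (rule rtl_crl[symmetric]) (use s sb_laws(6)[OF W] in simp_all)
  then have "pj W V (rtl A W W V (lmap W) ?s) = pj W V (wl W (T A V) V (lmap V) (crl A W V ?s))"
   using pj_balanced[of W V "crl A W V ?s"] crl_closed[of A W V ?s] s(1) by simp
  then show ?thesis unfolding R using s(1) b BT_lmap(2)[OF V W, of s] unfolding s(2)[symmetric] by (simp add: braid_rtl)
 qed
 have r: "?b (rmap ?B t) = rmap ?C (wr ?B ?C A ?b t)" if t: "t:.?B**A" for t
 proof -
  obtain y where y: "y:.V**W**A" "rtl V W ?B A (pj V W) y = t" by (rule BT_rtl_surj[OF V W hA t])
  let ?c = "crl V W A y"
  have pb: "(%t. pj W V (br V W t)) : mor (T V W) ?C" by (rule hmor_comp[OF braid_hmor pj_hmor]) simp_all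
  have "wr ?B ?C A ?b (rtl V W ?B A (pj V W) y) = rtl V W ?C A (%t. pj W V (br V W t)) y"
   by (rule rtl_post) (use y b pb in simp_all)
  also have "... = rtl W V ?C A (pj W V) ?c" by (rule rtl_crl[symmetric]) (use y pb in simp_all)
  finally have R: "rmap ?C (wr ?B ?C A ?b t) = pj W V (wl W (T V A) V (rmap V) ?c)"
   unfolding y(2)[symmetric] using y(1) BT_rmap(2)[OF W V, of ?c] by simp
  have "pj W V (rtl W A W V (rmap W) (wl W (T V A) (T A V) (br V A) ?c)) = pj W V (wl W (T A V) V (lmap V) (wl W (T V A) (T A V) (br V A) ?c))"
   by (rule pj_balanced) (use y in simp_all)
  also have "... = pj W V (wl W (T V A) V (rmap V) ?c)"
   by (rule arg_cong[OF wl_comp]) (use y sb_laws(7)[OF V] in simp_all)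
  finally show ?thesis unfolding R using y(1) b BT_rmap(2)[OF V W, of y] unfolding y(2)[symmetric] by (simp add: braid_wl_pair)
 qed
 show bi: "?b \<in> bimor K H A ?B ?C" by (rule bimorI[OF _ _ b(1) l r]) simp_all
 obtain g where g: "!!t. t:.V**W ==> g (pj W V (br V W t)) = pj V W t" using bbraid_inverse[OF V W] by blast
 have sj: "\<exists>t\<in>carrier (V**W). pj W V (br V W t) = Z" if Z: "Z:.?C" for Z
 proof -
  obtain u where u: "u:.W**V" "pj W V u = Z" using pj_surj[OF _ _ Z] by auto
  show ?thesis by (rule braid_surj[OF _ _ u(1)]) (use u in auto)
 qed
 show "bimod_iso K H A ?B ?C ?b"
 proof (rule bimod_isoI[OF _ _ bi, of g])
  show "g w:.?B" "?b (g w) = w" if "w:.?C" for w using sj[OF that] g b(2) by auto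
  show "g (?b v) = v" if "v:.?B" for v using pj_surj[OF _ _ that] g b(2) by auto
 qed simp_all
qed

lemma bbraid_natural:
 assumes V: "sb V" and W: "sb W" and V': "sb V'" and W': "sb W'" and f: "f \<in> bimor K H A V V'" and g: "g \<in> bimor K H A W W'"
  and Z: "Z:.BT V W"
 shows "bbr A V' W' (bmp A V' W' f g Z) = bmp A W' V' g f (bbr A V W Z)"
proof -
 note s [simp] = V W V' W' bimor_laws(1)[OF _ _ f] bimor_laws(1)[OF _ _ g]
 obtain t where t: "t:.V**W" "pj V W t = Z" using pj_surj[OF _ _ Z] by auto
 have "br V' W' (tm V V' W W' f g t) = tm W W' V V' g f (br V W t)"
  using t(1) by (simp add: tm_def braid_wl braid_wr wr_wl)
 then show ?thesis
  using t(1) bmap_pj(2)[OF V W V' W' f g] bmap_pj(2)[OF W V W' V' g f] bbraid_pj(2)[OF V W] bbraid_pj(2)[OF V' W']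
  unfolding t(2)[symmetric] by simp
qed

lemma bbraid_formula:
 assumes V: "sb V" and W: "sb W" and v: "v:.V" and w: "w:.W"
 shows "bbr A V W (bpt K H A V W v w) = tsum2 (BT W V) R (%r s. bpt K H A W V (act W s w) (act V r v))"
proof -
 let ?L = "%Z. pj W V (flip K V W (a2 V W Z (pt V W v w)))"
 have l: "?L : klin K P2 (BT W V)"
  by (rule klin_comp[OF klin_comp[OF amodD(7)[OF amod_a2] flip_lin] hmor_lin_T[OF pj_hmor]]) (use assms in simp_all)
 have p: "?L (p2 r s) = bpt K H A W V (act W s w) (act V r v)" if "r:.H" "s:.H" for r s
  using that assms by (simp add: a_ptens flip_ptens bpt_def)
 have "bbr A V W (bpt K H A V W v w) = ?L R"
  using assms by (simp add: bpt_def bbraid_pj braid_eq)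
 also have "... = tsum2 (BT W V) R (%r s. ?L (p2 r s))"
  by (rule lin2_expand[OF mH mH _ l R_closed(1)]) (use V W in simp)
 also have "... = tsum2 (BT W V) R (%r s. bpt K H A W V (act W s w) (act V r v))"
  by (rule tsum2_cong[OF mH mH R_closed(1)]) (use p klin_closed[OF l] V W in "simp_all add: p[symmetric]")
 finally show ?thesis .
qed

lemma hexagons_hold:
 assumes V: "sb V" and W: "sb W" and X: "sb X"
 shows "hexagon1 K H A V W X" "hexagon2 K H A V W X"
proof -
 note BS = BT_sb
 note s [simp] = V W X BS[OF V W] BS[OF W V] BS[OF V X] BS[OF X V] BS[OF W X] BS[OF X W]
 show "hexagon1 K H A V W X"
  unfolding hexagon1_def
 proof
  fix Z assume "Z:.BT (BT V W) X"
  then obtain y where y: "y:.V**W**X" "pj (BT V W) X (rtl V W (BT V W) X (pj V W) y) = Z"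
   by (rule tri_left[OF V W X])
  let ?c = "crl V W X y"
  let ?d = "wl W (T V X) (T X V) (br V X) ?c"
  have "bbr A V (BT W X) (bas A V W X Z) = pj (BT W X) V (rtl W X (BT W X) V (pj W X) ?d)"
   unfolding y(2)[symmetric] using y(1) by (simp add: bassoc_pj bbraid_pj braid_wl_pair)
  then have L: "bas A W X V (bbr A V (BT W X) (bas A V W X Z)) = pj W (BT X V) (wl W (T X V) (BT X V) (pj X V) ?d)"
   using y(1) by (simp add: bassoc_pj)
  have pb: "(%t. pj W V (br V W t)) : mor (T V W) (BT W V)" "(%t. pj X V (br V X t)) : mor (T V X) (BT X V)"
   by (rule hmor_comp[OF braid_hmor pj_hmor]; simp)+
  have "wr (BT V W) (BT W V) X (bbr A V W) (rtl V W (BT V W) X (pj V W) y) = rtl V W (BT W V) X (%t. pj W V (br V W t)) y"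
   by (rule rtl_post) (use y pb bbraid_pj[OF V W] in simp_all)
  also have "... = rtl W V (BT W V) X (pj W V) ?c" by (rule rtl_crl[symmetric]) (use y pb in simp_all)
  finally have "bmp A (BT W V) X (bbr A V W) id Z = pj (BT W V) X (rtl W V (BT W V) X (pj W V) ?c)"
   unfolding y(2)[symmetric] using y(1) bmap_left[OF BS[OF V W] X BS[OF W V] bbraid_iso(1)[OF V W]] by simp
  then have "bas A W V X (bmp A (BT W V) X (bbr A V W) id Z) = pj W (BT V X) (wl W (T V X) (BT V X) (pj V X) ?c)"
   using y(1) by (simp add: bassoc_pj)
  moreover have "wl W (BT V X) (BT X V) (bbr A V X) (wl W (T V X) (BT V X) (pj V X) ?c) = wl W (T X V) (BT X V) (pj X V) ?d"
   by (rule wl_square) (use y bbraid_pj[OF V X] in simp_all)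
  ultimately show "bas A W X V (bbr A V (BT W X) (bas A V W X Z)) = bmp A W (BT X V) id (bbr A V X)
    (bas A W V X (bmp A (BT W V) X (bbr A V W) id Z))"
   unfolding L using y(1) bmap_right[OF W BS[OF V X] BS[OF X V] bbraid_iso(1)[OF V X], of "wl W (T V X) (BT V X) (pj V X) ?c"] by simp
 qed
 show "hexagon2 K H A V W X"
  unfolding hexagon2_def
 proof
  fix Z assume "Z:.BT V (BT W X)"
  then obtain y where y: "y:.V**W**X" "pj V (BT W X) (wl V (T W X) (BT W X) (pj W X) y) = Z"
   by (rule tri_right[OF V W X])
  let ?d = "wl V (T W X) (T X W) (br W X) y"
  let ?c = "crl V X W ?d"
  have d: "?d:.V**X**W" using y(1) by simp
  have c: "?c:.X**V**W" using d by simp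
  have "bbr A (BT V W) X (bassoc_inv K H A V W X Z) = pj X (BT V W) (wl X (T V W) (BT V W) (pj V W) ?c)"
   unfolding y(2)[symmetric] using y(1) by (simp add: bassoc_inv_pj bbraid_pj braid_rtl)
  then have L: "bassoc_inv K H A X V W (bbr A (BT V W) X (bassoc_inv K H A V W X Z)) = pj (BT X V) W (rtl X V (BT X V) W (pj X V) ?c)"
   using c by (simp add: bassoc_inv_pj)
  have pb: "(%t. pj X V (br V X t)) : mor (T V X) (BT X V)"
   by (rule hmor_comp[OF braid_hmor pj_hmor]) simp_all
  have "wl V (BT W X) (BT X W) (bbr A W X) (wl V (T W X) (BT W X) (pj W X) y) = wl V (T X W) (BT X W) (pj X W) ?d"
   by (rule wl_square) (use y bbraid_pj[OF W X] in simp_all)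
  then have "bmp A V (BT X W) id (bbr A W X) Z = pj V (BT X W) (wl V (T X W) (BT X W) (pj X W) ?d)"
   unfolding y(2)[symmetric] using y(1) bmap_right[OF V BS[OF W X] BS[OF X W] bbraid_iso(1)[OF W X], of "wl V (T W X) (BT W X) (pj W X) y"] by simp
  then have "bassoc_inv K H A V X W (bmp A V (BT X W) id (bbr A W X) Z) = pj (BT V X) W (rtl V X (BT V X) W (pj V X) ?d)"
   using d by (simp add: bassoc_inv_pj)
  moreover have "wr (BT V X) (BT X V) W (bbr A V X) (rtl V X (BT V X) W (pj V X) ?d) = rtl V X (BT X V) W (%t. pj X V (br V X t)) ?d"
   by (rule rtl_post) (use d pb bbraid_pj[OF V X] in simp_all)
  moreover have "... = rtl X V (BT X V) W (pj X V) ?c" by (rule rtl_crl[symmetric]) (use d pb in simp_all)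
  ultimately show "bassoc_inv K H A X V W (bbr A (BT V W) X (bassoc_inv K H A V W X Z)) =
    bmp A (BT X V) W (bbr A V X) id (bassoc_inv K H A V X W (bmp A V (BT X W) id (bbr A W X) Z))"
   unfolding L using d bmap_left[OF BS[OF V X] W BS[OF X V] bbraid_iso(1)[OF V X], of "rtl V X (BT V X) W (pj V X) ?d"] by simp
 qed
qed

end

section \<open>The internal hom\<close>

context qtqh
begin

lemma hm_sub:
 assumes V: "hm V" and N: "hsub K H V (carrier B)"
  and f: "add B = add V" "ring.zero B = ring.zero V" "smult B = smult V" "act B = act V"
 shows "hm B" "(%x. x) : mor B V" "g : mor X V ==> (!!x. x:.X ==> g x:.B) ==> g : mor X B"
proof -
 note c = hsubD[OF N] and m = hm_module[OF V]
 interpret V: module K V by (rule m)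
 have neg: "\<ominus>[V] x:.B" if "x:.B" for x
  using c(4)[of "\<ominus>[K] \<one>[K]" x] that c(1)[OF that] by (simp add: V.smult_l_minus)
 have ag: "abelian_group B"
 proof (rule abelian_groupI)
  show "\<exists>y\<in>carrier B. y +[B] x = \<zero>[B]" if "x:.B" for x
   by (rule bexI[OF _ neg[OF that]]) (use c that V.M.l_neg in "simp add: f")
 qed (use c in "simp_all add: f V.M.a_ac")
 have mod: "module K B"
  by (rule moduleI[OF V.R.is_cring ag]) (use c in "simp_all add: f V.smult_l_distr V.smult_r_distr V.smult_assoc1")
 show "hm B"
  unfolding hmodule_def
 proof (intro conjI ballI mod)
  show "act B h : klin K B B" if "h:.H" for h
   by (rule klinI) (use that c act_smult[OF V] klin_add[OF amodD(6)[OF hm_amod[OF V]]] in "simp_all add: f")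
  show "(%h. act B h v) : klin K H B" if "v:.B" for v
   by (rule klinI) (use that c act_smult[OF V] klin_add[OF amodD(7)[OF hm_amod[OF V]]] in "simp_all add: f")
 qed (use c V in "simp_all add: f act_mult act_one")
 show "(%x. x) : mor B V"
  by (intro hmorI klinI) (use c in "simp_all add: f")
 show "g : mor X B" if "g : mor X V" "!!x. x:.X ==> g x:.B"
  using that by (auto simp: hmor_def klin_def f)
qed

end

context qtqh_algebra
begin

abbreviation "hb V W \<equiv> bhom K H A V W"

lemma bhom_fields [simp]:
 "carrier (hb V W) = carrier (hh V W)" "add (hb V W) = add (hh V W)" "ring.zero (hb V W) = ring.zero (hh V W)"
 "smult (hb V W) = smult (hh V W)" "act (hb V W) = act (hh V W)" "monoid.mult (hb V W) = monoid.mult (hh V W)" "one (hb V W) = one (hh V W)"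
 by (simp_all add: bhom_def hmod.defs bimod.defs)

lemma bhom_reduce [simp]:
 "pt (hb V W) X = pt (hh V W) X" "pt X (hb V W) = pt X (hh V W)"
 "(hb V W)**X = (hh V W)**X" "X**(hb V W) = X**(hh V W)"
 "klin K (hb V W) X = klin K (hh V W) X" "klin K X (hb V W) = klin K X (hh V W)"
 by (simp_all add: tensor_fields_cong[of "hb V W" "hh V W"] klin_fields_cong[of "hb V W" "hh V W"])

lemma bhom_reduce2 [simp]:
 "tmap K (hb V W) Y = tmap K (hh V W) Y" "tmap K Y (hb V W) = tmap K Y (hh V W)"
 "mor (hb V W) X = mor (hh V W) X" "mor X (hb V W) = mor X (hh V W)"
 by (simp_all add: fun_eq_iff tmap_def hmor_def)

lemma bhom_reduce3 [simp]:
 "T (hb V W) X = T (hh V W) X" "T X (hb V W) = T X (hh V W)" "wl (hb V W) = wl (hh V W)" "ainv (hb V W) = ainv (hh V W)"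
 by (simp_all add: fun_eq_iff htensor_def wl_def ainv_def a3_def a2_def act2_def[abs_def] lebr_def)

lemma bhom_rtl [simp]: "rtl (hb V W) X Y M = rtl (hh V W) X Y M" "rtl X Z (hb V W) M = rtl X Z (hh V W) M"
 by (simp_all add: fun_eq_iff rtl_def wr_def)

lemma hm_hb [simp]: "hm V ==> hm W ==> hm (hb V W)"
 by (rule hm_fields_cong[OF hm_hhom]) simp_all

lemma lhat_hmor:
 assumes W: "sb W"
 shows "lhat K H A W : mor A (hh W W)"
  "t:.A**W ==> hev W W (wr A (hh W W) W (lhat K H A W) t) = lmap W t"
proof -
 have e: "lhat K H A W = hcurry A W W (lmap W)"
  by (simp add: fun_eq_iff lhat_def hcurry_def c3_def lmul_def)
 show "lhat K H A W : mor A (hh W W)"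
  "t:.A**W ==> hev W W (wr A (hh W W) W (lhat K H A W) t) = lmap W t"
  unfolding e using curry_hmor[of A W W "lmap W"] heval_curry_wr[of A W W "lmap W" t] W by simp_all
qed

text \<open>The actions on the internal hom are characterised by their evaluations.\<close>

lemma bhom_actions:
 assumes V: "sb V" and W: "sb W"
 shows "lmap (hb V W) : mor (T A (hh V W)) (hh V W)"
  "rmap (hb V W) : mor (T (hh V W) A) (hh V W)"
  "s:.A**(hh V W)**V ==>
   hev V W (rtl A (hh V W) (hh V W) V (lmap (hb V W)) s) = lmap W (wl A (T (hh V W) V) W (hev V W) s)"
  "t:.(hh V W)**A**V ==>
   hev V W (rtl (hh V W) A (hh V W) V (rmap (hb V W)) t) = hev V W (wl (hh V W) (T A V) V (lmap V) t)"
  "a:.A ==> L:.hh V W ==>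
   lmap (hb V W) (pt A (hh V W) a L) = hcomp K H V W W (pt (hh W W) (hh V W) (lhat K H A W a) L)"
  "a:.A ==> L:.hh V W ==>
   rmap (hb V W) (pt (hh V W) A L a) = hcomp K H V V W (pt (hh V W) (hh V V) L (lhat K H A V a))"
proof -
 note s [simp] = V W lhat_hmor(1) hcomp_spec(1)
 let ?h = "hh V W" let ?w = "hh W W" let ?v = "hh V V"
 let ?l = "%t. hcomp K H V W W (wr A ?w ?h (lhat K H A W) t)" and ?r = "%t. hcomp K H V V W (wl ?h A ?v (lhat K H A V) t)"
 have l: "?l : mor (T A ?h) ?h" by (rule hmor_comp[OF wr_hmor hcomp_spec(1)]) simp_all
 have r: "?r : mor (T ?h A) ?h" by (rule hmor_comp[OF wl_hmor hcomp_spec(1)]) simp_all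
 have m: "module K ?h" by simp
 have le: "lmap (hb V W) t = ?l t" if t: "t:.A**?h" for t
 proof -
  have "?l t = tsum2 ?h t (%a b. ?l (pt A ?h a b))"
   by (rule lin2_expand[OF _ m m hmor_lin_T[OF l] t]) simp
  also have "... = tsum2 ?h t (%a L. hcomp K H V W W (pt ?w ?h (lhat K H A W a) L))"
   by (rule tsum2_cong[OF _ m t m]) (use hmor_closed[OF lhat_hmor(1)[OF W]] hmor_closed[OF hcomp_spec(1)[of V W W]] in "simp_all add: wr_ptens")
  finally show ?thesis by (simp add: bhom_def hmod.defs bimod.defs)
 qed
 have re: "rmap (hb V W) t = ?r t" if t: "t:.?h**A" for t
 proof -
  have "?r t = tsum2 ?h t (%a b. ?r (pt ?h A a b))"
   by (rule lin2_expand[OF m _ m hmor_lin_T[OF r] t]) simp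
  also have "... = tsum2 ?h t (%L a. hcomp K H V V W (pt ?h ?v L (lhat K H A V a)))"
   by (rule tsum2_cong[OF m _ t m]) (use hmor_closed[OF lhat_hmor(1)[OF V]] hmor_closed[OF hcomp_spec(1)[of V V W]] in "simp_all add: wl_ptens")
  finally show ?thesis by (simp add: bhom_def hmod.defs bimod.defs)
 qed
 show "a:.A ==> L:.?h ==> lmap (hb V W) (pt A ?h a L) = hcomp K H V W W (pt ?w ?h (lhat K H A W a) L)"
  using le by (simp add: wr_ptens)
 show "a:.A ==> L:.?h ==> rmap (hb V W) (pt ?h A L a) = hcomp K H V V W (pt ?h ?v L (lhat K H A V a))"
  using re by (simp add: wl_ptens)
 show L: "lmap (hb V W) : mor (T A ?h) ?h" by (rule hmor_cong[OF l]) (use le in simp_all)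
 show R: "rmap (hb V W) : mor (T ?h A) ?h" by (rule hmor_cong[OF r]) (use re in simp_all)
 show "hev V W (rtl A ?h ?h V (lmap (hb V W)) s) = lmap W (wl A (T ?h V) W (hev V W) s)"
  if s: "s:.A**?h**V"
 proof -
  have "rtl A ?h ?h V (lmap (hb V W)) s = rtl ?w ?h ?h V (hcomp K H V W W) (wr A ?w (T ?h V) (lhat K H A W) s)"
   by (rule rtl_pre1[symmetric]) (use L le s in simp_all)
  then have "hev V W (rtl A ?h ?h V (lmap (hb V W)) s) = hev W W (wr A ?w W (lhat K H A W) (wl A (T ?h V) W (hev V W) s))"
   using hcomp_spec(2)[of V W W "wr A ?w (T ?h V) (lhat K H A W) s"] s wr_wl[of A "T ?h V" ?w W "lhat K H A W" "hev V W" s] by simp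
  then show ?thesis using lhat_hmor(2)[OF W] s by simp
 qed
 show "hev V W (rtl ?h A ?h V (rmap (hb V W)) t) = hev V W (wl ?h (T A V) V (lmap V) t)"
  if t: "t:.?h**A**V"
 proof -
  have "rtl ?h A ?h V (rmap (hb V W)) t = rtl ?h ?v ?h V (hcomp K H V V W) (wl ?h (T A V) (T ?v V) (wr A ?v V (lhat K H A V)) t)"
   by (rule rtl_pre2[symmetric]) (use R re t in simp_all)
  moreover have "wl ?h (T ?v V) V (hev V V) (wl ?h (T A V) (T ?v V) (wr A ?v V (lhat K H A V)) t) = wl ?h (T A V) V (lmap V) t"
   by (rule wl_comp) (use t lhat_hmor(2)[OF V] in simp_all)
  ultimately show ?thesis
   using hcomp_spec(2)[of V V W "wl ?h (T A V) (T ?v V) (wr A ?v V (lhat K H A V)) t"] t by simp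
 qed
qed

lemma pm_hb: "sb V ==> sb W ==> pm (hb V W)"
 using bhom_actions(1,2)[of V W] by (simp add: pm_def)

lemma beval_hb:
 assumes V: "sb V" and W: "sb W" and t: "t:.(hh V W)**V"
 shows "beval K H V W (pj (hb V W) V t) = hev V W t"
 unfolding beval_def
proof (rule BT_descend(2)[OF pm_hb[OF V W] sb_pm[OF V] sb_simps(1)[OF W]])
 fix s assume "s:.(hb V W)**A**V"
 then show "hev V W (rtl (hb V W) A (hb V W) V (rmap (hb V W)) s) = hev V W (wl (hb V W) (T A V) V (lmap V) s)"
  using bhom_actions(4)[OF V W, of s] by simp
qed (use V W t in simp_all)

text \<open>The two morphisms whose equaliser is the internal hom of bimodules, before currying.\<close>

definition "F1 V W t = hev V W (wl (hh V W) (T V A) V (rmap V) t)"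
definition "F2 V W t = rmap W (rtl (hh V W) V W A (hev V W) t)"

lemma F_hmor:
 assumes "sb V" "sb W"
 shows "F1 V W : mor (T (hh V W) (T V A)) W" "F2 V W : mor (T (hh V W) (T V A)) W"
 unfolding F1_def[abs_def] F2_def[abs_def]
 by (rule hmor_comp[OF wl_hmor heval_hmor] hmor_comp[OF rtl_hmor sb_simps(3)]; use assms in simp)+

lemma hom_f_eq:
 assumes V: "sb V" and W: "sb W" and L: "L:.hh V W" and t: "t:.V**A"
 shows "hom_f1 K H A V W L t = F1 V W (pt (hh V W) (V**A) L t)"
  "hom_f2 K H A V W L t = F2 V W (pt (hh V W) (V**A) L t)"
proof -
 note s [simp] = V W
 note F = F_hmor[OF V W]
 have m: "module K V" "module K A" "module K W" by simp_all
 have l: "(%t. F1 V W (pt (hh V W) (V**A) L t)) : klin K (V**A) W"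
  "(%t. F2 V W (pt (hh V W) (V**A) L t)) : klin K (V**A) W"
  by (rule klin_ptens(1)[OF _ _ _ L]; use hmor_lin_T[OF F(1)] hmor_lin_T[OF F(2)] in simp)+
 have p1: "F1 V W (pt (hh V W) (V**A) L (pt V A v a)) = beval K H V W (bpt K H A (hb V W) V L (rmul K A V v a))"
  if "v:.V" "a:.A" for v a
  using that L wl_ptens[of "hh V W" "T V A" V "rmap V" L] by (simp add: F1_def bpt_def rmul_def beval_hb)
 have p2: "F2 V W (pt (hh V W) (V**A) L (pt V A v a)) = tsum3 W \<psi> (%p q r.
    rmul K A W (beval K H V W (bpt K H A (hb V W) V (act (hb V W) p L) (act V q v))) (act A r a))"
  if va: "v:.V" "a:.A" for v a
 proof -
  have "F2 V W (pt (hh V W) (V**A) L (pt V A v a)) = tsum3 W \<psi> (%p q r.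
    rmap W (pt W A (hev V W (pt (hh V W) V (act (hh V W) p L) (act V q v))) (act A r a)))"
   unfolding F2_def by (rule rtl_expand) (use va L hmor_lin_T[OF sb_simps(3)[OF W]] in simp_all)
  also have "... = tsum3 W \<psi> (%p q r. rmul K A W (beval K H V W (bpt K H A (hb V W) V (act (hb V W) p L) (act V q v))) (act A r a))"
   by (rule tsum3_cong[OF mH mH mH phi_closed(2) m(3)])
    (use va L hmor_closed[OF heval_hmor[of V W]] in "simp_all add: bpt_def rmul_def beval_hb")
  finally show ?thesis .
 qed
 show "hom_f1 K H A V W L t = F1 V W (pt (hh V W) (V**A) L t)"
  unfolding hom_f1_def lin2_expand[OF m l(1) t]
  by (rule tsum2_cong[OF m(1,2) t m(3)]) (use klin_closed[OF l(1)] in "simp_all add: p1[symmetric]")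
 show "hom_f2 K H A V W L t = F2 V W (pt (hh V W) (V**A) L t)"
  unfolding hom_f2_def lin2_expand[OF m l(2) t]
  by (rule tsum2_cong[OF m(1,2) t m(3)]) (use klin_closed[OF l(2)] in "simp_all add: p2[unfolded bhom_fields, symmetric]")
qed

lemma hom_D_curry:
 assumes V: "sb V" and W: "sb W" and F: "F : mor (T (hh V W) (T V A)) W"
  and f: "!!L t. L:.hh V W ==> t:.V**A ==> f L t = F (pt (hh V W) (V**A) L t)"
  and L: "L:.hh V W"
 shows "hom_D K H A V W f L = hcurry (hh V W) (T V A) W F L"
 unfolding hom_D_def hcurry_def c3_def
proof (rule restrict_ext)
 note s [simp] = V W
 fix t assume t: "t:.T V A"
 have a: "act (T V A) h t:.V**A" if "h:.H" for h using act_closed[of "T V A" h t] that t by simp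
 show "tsum3 W \<psi> (%p q r. f (act (hb V W) p L) (act (T V A) (q *. \<beta> *. S r) t)) =
   tsum3 W \<psi> (%p q r. F (pt (hh V W) (T V A) (act (hh V W) p L) (act (T V A) (q *. \<beta> *. S r) t)))"
  by (rule tsum3_cong[OF mH mH mH phi_closed(2)])
   (use t L f a hmor_closed[OF F] in simp_all)
qed

abbreviation "Bh V W \<equiv> bihom K H A V W"

lemma bihom_fields:
 assumes V: "sb V" and W: "sb W"
 shows "L:.Bh V W \<longleftrightarrow> L:.hh V W \<and> hcurry (hh V W) (T V A) W (F1 V W) L = hcurry (hh V W) (T V A) W (F2 V W) L"
  "add (Bh V W) = add (hh V W)" "ring.zero (Bh V W) = ring.zero (hh V W)" "smult (Bh V W) = smult (hh V W)" "act (Bh V W) = act (hh V W)"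
  "lmap (Bh V W) = lmap (hb V W)" "rmap (Bh V W) = rmap (hb V W)"
 using hom_D_curry[OF V W F_hmor(1)[OF V W] hom_f_eq(1)[OF V W]] hom_D_curry[OF V W F_hmor(2)[OF V W] hom_f_eq(2)[OF V W]]
 by (auto simp: bihom_def)

lemma bihom_sub:
 assumes V: "sb V" and W: "sb W"
 shows "hsub K H (hh V W) (carrier (Bh V W))"
proof -
 note s [simp] = V W
 note D = curry_hmor[OF _ _ _ F_hmor(1)[OF V W]] curry_hmor[OF _ _ _ F_hmor(2)[OF V W]]
 have D: "hcurry (hh V W) (T V A) W (F1 V W) : mor (hh V W) (hh (T V A) W)" "hcurry (hh V W) (T V A) W (F2 V W) : mor (hh V W) (hh (T V A) W)"
  by (rule curry_hmor[OF _ _ _ F_hmor(1)[OF V W]] curry_hmor[OF _ _ _ F_hmor(2)[OF V W]]; simp)+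
 have m: "module K (hh V W)" "module K (hh (T V A) W)" by simp_all
 interpret module K "hh V W" by (rule m)
 show ?thesis
  unfolding hsub_def
  by (auto simp: bihom_fields[OF V W] klin_add[OF hmor_lin[OF D(1)]] klin_add[OF hmor_lin[OF D(2)]]
    klin_smult[OF hmor_lin[OF D(1)]] klin_smult[OF hmor_lin[OF D(2)]] hmor_act[OF D(1)] hmor_act[OF D(2)]
    klin_zero[OF m hmor_lin[OF D(1)]] klin_zero[OF m hmor_lin[OF D(2)]])
qed

lemma bihom_hm:
 assumes V: "sb V" and W: "sb W"
 shows "hm (Bh V W)" "(%x. x) : mor (Bh V W) (hh V W)"
  "g : mor X (hh V W) ==> (!!x. x:.X ==> g x:.Bh V W) ==> g : mor X (Bh V W)"
 by (rule hm_sub[OF hm_hhom bihom_sub[OF V W] bihom_fields(2-5)[OF V W]]; use V W in simp)+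

text \<open>Currying is injective, so the kernel condition may be tested on evaluations.\<close>

lemma bihom_range:
 assumes V: "sb V" and W: "sb W" and X: "hm X" and g: "g : mor X (hh V W)"
  and e: "!!t. t:.X**V**A ==> F1 V W (wr X (hh V W) (T V A) g t) = F2 V W (wr X (hh V W) (T V A) g t)"
 shows "g : mor X (Bh V W)"
proof (rule bihom_hm(3)[OF V W g])
 note s [simp] = V W X g
 let ?D = "%F. hcurry (hh V W) (T V A) W F"
 have m: "hm (hh V W)" "hm (T V A)" "hm W" by simp_all
 note F = F_hmor[OF V W]
 note D = curry_hmor[OF m F(1)] curry_hmor[OF m F(2)] and c = heval_curry_wr[OF m F(1)] heval_curry_wr[OF m F(2)]
 note Dg = hmor_comp[OF g D(1)] hmor_comp[OF g D(2)]
 fix u assume u: "u:.X"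
 have w: "hev (T V A) W (wr X (hh (T V A) W) (T V A) (%u. ?D F (g u)) t) = hev (T V A) W (wr (hh V W) (hh (T V A) W) (T V A) (?D F) (wr X (hh V W) (T V A) g t))"
  if "?D F : mor (hh V W) (hh (T V A) W)" "t:.X**V**A" for F t
  by (rule arg_cong[OF wr_comp[symmetric]]) (use that hmor_comp[OF g that(1)] in simp_all)
 have "?D (F1 V W) (g u) = ?D (F2 V W) (g u)"
  by (rule heval_separates[OF X m(2,3) Dg _ u]) (use w D c e in simp)
 then show "g u:.Bh V W" using u hmor_closed[OF g] by (simp add: bihom_fields[OF V W])
qed

lemma bihom_kernel:
 assumes V: "sb V" and W: "sb W" and t: "t:.(Bh V W)**V**A"
 shows "F1 V W (wr (Bh V W) (hh V W) (T V A) (%x. x) t) = F2 V W (wr (Bh V W) (hh V W) (T V A) (%x. x) t)"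
proof -
 note s [simp] = V W bihom_hm(1,2)[OF V W]
 have m: "hm (hh V W)" "hm (T V A)" "hm W" by simp_all
 note F = F_hmor[OF V W]
 note D = curry_hmor[OF m F(1)] curry_hmor[OF m F(2)] and c = heval_curry_wr[OF m F(1)] heval_curry_wr[OF m F(2)]
 have "wr (hh V W) (hh (T V A) W) (T V A) (hcurry (hh V W) (T V A) W (F1 V W)) (wr (Bh V W) (hh V W) (T V A) (%x. x) t) =
   wr (hh V W) (hh (T V A) W) (T V A) (hcurry (hh V W) (T V A) W (F2 V W)) (wr (Bh V W) (hh V W) (T V A) (%x. x) t)"
  by (rule wr_square) (use t D in "simp_all add: bihom_fields(1)[OF V W]")
 then show ?thesis using c[of "wr (Bh V W) (hh V W) (T V A) (%x. x) t"] t by simp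
qed

end

context qtqh_algebra
begin

definition "ev V W t = hev V W (wr (Bh V W) (hh V W) V (%x. x) t)"

lemma ev_hmor [simp]:
 assumes "sb V" "sb W"
 shows "ev V W : mor (T (Bh V W) V) W"
 unfolding ev_def[abs_def] by (rule hmor_comp[OF wr_hmor heval_hmor]) (use assms bihom_hm(1,2)[OF assms] in simp_all)

lemma heval_bihom:
 assumes V: "sb V" and W: "sb W" and t: "t:.(Bh V W)**V"
 shows "hev V W t = ev V W t"
proof -
 note s [simp] = V W bihom_hm(1,2)[OF V W]
 have i: "L:.hh V W" if "L:.Bh V W" for L using that by (simp add: bihom_fields(1)[OF V W])
 have m: "module K (Bh V W)" "module K V" "module K W" by simp_all
 have p: "ev V W (pt (Bh V W) V L v) = G3 V W L v \<phi>" if "L:.Bh V W" "v:.V" for L v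
  using that i by (simp add: ev_def wr_ptens heval_ptens)
 have "ev V W t = tsum2 W t (%L v. ev V W (pt (Bh V W) V L v))"
  by (rule lin2_expand[OF m hmor_lin_T[OF ev_hmor[OF V W]] t])
 also have "... = tsum2 W t (%L v. G3 V W L v \<phi>)"
  by (rule tsum2_cong[OF m(1,2) t m(3)]) (use p hmor_closed[OF ev_hmor[OF V W]] in "simp_all add: p[symmetric]")
 finally show ?thesis by (simp add: heval_def G3_def)
qed

lemma ev_separates:
 assumes V: "sb V" and W: "sb W" and X: "hm X" and f: "f : mor X (Bh V W)" and g: "g : mor X (Bh V W)"
  and e: "!!t. t:.X**V ==> ev V W (wr X (Bh V W) V f t) = ev V W (wr X (Bh V W) V g t)" and x: "x:.X"
 shows "f x = g x"
proof -
 note s [simp] = V W X f g bihom_hm(1,2)[OF V W]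
 have h: "h : mor X (hh V W)" if "h : mor X (Bh V W)" for h
  using hmor_comp[OF that bihom_hm(2)[OF V W]] .
 have w: "ev V W (wr X (Bh V W) V k t) = hev V W (wr X (hh V W) V k t)" if "k : mor X (Bh V W)" "t:.X**V" for k t
  unfolding ev_def by (rule arg_cong[OF wr_comp]) (use that h in simp_all)
 show ?thesis by (rule heval_separates[OF X _ _ h[OF f] h[OF g] _ x]) (use w e in simp_all)
qed

text \<open>The kernel condition in the form in which it enters the arguments: right linearity of the evaluation.\<close>

lemma ev_kernel:
 assumes V: "sb V" and W: "sb W" and t: "t:.(Bh V W)**V**A"
 shows "ev V W (wl (Bh V W) (T V A) V (rmap V) t) = rmap W (rtl (Bh V W) V W A (ev V W) t)"
proof -
 note s [simp] = V W bihom_hm(1,2)[OF V W]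
 let ?i = "%x. x"
 have "F1 V W (wr (Bh V W) (hh V W) (T V A) ?i t) = ev V W (wl (Bh V W) (T V A) V (rmap V) t)"
  using t wr_wl[of "Bh V W" "T V A" "hh V W" V ?i "rmap V" t] by (simp add: F1_def ev_def)
 moreover have "rtl (hh V W) V W A (hev V W) (wr (Bh V W) (hh V W) (T V A) ?i t) = rtl (Bh V W) V W A (ev V W) t"
  by (rule rtl_pre1) (use t in "simp_all add: ev_def")
 ultimately show ?thesis using bihom_kernel[OF V W t] by (simp add: F2_def)
qed

lemma bihom_actions:
 assumes V: "sb V" and W: "sb W"
 shows "lmap (Bh V W) : mor (T A (Bh V W)) (Bh V W)" "rmap (Bh V W) : mor (T (Bh V W) A) (Bh V W)"
  "s:.A**(Bh V W)**V ==>
   ev V W (rtl A (Bh V W) (Bh V W) V (lmap (Bh V W)) s) = lmap W (wl A (T (Bh V W) V) W (ev V W) s)"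
  "t:.(Bh V W)**A**V ==>
   ev V W (rtl (Bh V W) A (Bh V W) V (rmap (Bh V W)) t) = ev V W (wl (Bh V W) (T A V) V (lmap V) t)"
proof -
 note s [simp] = V W bihom_hm(1,2)[OF V W] and lawsV = sb_laws[OF V] and lawsW = sb_laws[OF W]
 let ?h = "hh V W" let ?B = "Bh V W" let ?i = "%x. x" let ?e = "ev V W" let ?ev = "hev V W"
 let ?l = "%t. lmap (hb V W) (wl A ?B ?h ?i t)" and ?r = "%t. rmap (hb V W) (wr ?B ?h A ?i t)"
 note a = bhom_actions[OF V W]
 have i: "L:.?h" if "L:.?B" for L using that by (simp add: bihom_fields(1)[OF V W])
 have m: "module K ?B" "module K ?h" by simp_all
 have l: "?l : mor (T A ?B) ?h" by (rule hmor_comp[OF wl_hmor a(1)]) simp_all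
 have r: "?r : mor (T ?B A) ?h" by (rule hmor_comp[OF wr_hmor a(2)]) simp_all
 have le: "lmap ?B t = ?l t" if t: "t:.A**?B" for t
 proof -
  have "?l t = tsum2 ?h t (%a L. ?l (pt A ?B a L))" by (rule lin2_expand[OF _ m hmor_lin_T[OF l] t]) simp
  also have "... = tsum2 ?h t (%a L. hcomp K H V W W (pt (hh W W) ?h (lhat K H A W a) L))"
   by (rule tsum2_cong[OF _ m(1) t m(2)])
    (use i a(5) hmor_closed[OF a(1)] in "simp_all add: wl_ptens a(5)[symmetric]")
  finally show ?thesis by (simp add: bihom_fields(6)[OF V W] bhom_def hmod.defs bimod.defs)
 qed
 have re: "rmap ?B t = ?r t" if t: "t:.?B**A" for t
 proof -
  have "?r t = tsum2 ?h t (%L a. ?r (pt ?B A L a))" by (rule lin2_expand[OF m(1) _ m(2) hmor_lin_T[OF r] t]) simp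
  also have "... = tsum2 ?h t (%L a. hcomp K H V V W (pt ?h (hh V V) L (lhat K H A V a)))"
   by (rule tsum2_cong[OF m(1) _ t m(2)])
    (use i a(6) hmor_closed[OF a(2)] in "simp_all add: wr_ptens a(6)[symmetric]")
  finally show ?thesis by (simp add: bihom_fields(7)[OF V W] bhom_def hmod.defs bimod.defs)
 qed
 have lam: "?ev (rtl A ?B ?h V ?l s) = lmap W (wl A (T ?B V) W ?e s)" if s: "s:.A**?B**V" for s
 proof -
  have "rtl A ?B ?h V ?l s = rtl A ?h ?h V (lmap (hb V W)) (wl A (T ?B V) (T ?h V) (wr ?B ?h V ?i) s)"
   by (rule rtl_pre2[symmetric]) (use s l a(1) in simp_all)
  moreover have "wl A (T ?h V) W ?ev (wl A (T ?B V) (T ?h V) (wr ?B ?h V ?i) s) = wl A (T ?B V) W ?e s"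
   by (rule wl_comp) (use s in "simp_all add: ev_def")
  ultimately show ?thesis using a(3)[of "wl A (T ?B V) (T ?h V) (wr ?B ?h V ?i) s"] s by simp
 qed
 have rho: "?ev (rtl ?B A ?h V ?r s) = ?e (wl ?B (T A V) V (lmap V) s)" if s: "s:.?B**A**V" for s
 proof -
  have "rtl ?B A ?h V ?r s = rtl ?h A ?h V (rmap (hb V W)) (wr ?B ?h (T A V) ?i s)"
   by (rule rtl_pre1[symmetric]) (use s r a(2) in simp_all)
  then show ?thesis using a(4)[of "wr ?B ?h (T A V) ?i s"] s wr_wl[of ?B "T A V" ?h V ?i "lmap V" s] by (simp add: ev_def)
 qed
 have lB: "?l : mor (T A ?B) ?B"
 proof (rule bihom_range[OF V W _ l])
  fix t assume t: "t:.(T A ?B)**V**A"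
  obtain y where y: "y:.A**?B**V**A" "ainv A ?B (T V A) y = t"
   using ainv_surj[of A ?B "T V A" t] t by auto
  have w: "wr (T A ?B) ?h (T V A) ?l t = rtl A ?B ?h (T V A) ?l y" unfolding rtl_def y(2) ..
  have "F1 V W (rtl A ?B ?h (T V A) ?l y) = lmap W (wl A (T ?B V) W ?e (wl A (T ?B (T V A)) (T ?B V) (wl ?B (T V A) V (rmap V)) y))"
   using y(1) l lam by (simp add: F1_def rtl_wl)
  also have "... = lmap W (wl A (T W A) W (rmap W) (wl A (T ?B (T V A)) (T W A) (rtl ?B V W A ?e) y))"
   by (rule arg_cong[OF wl_square]) (use y ev_kernel[OF V W] in simp_all)
  also have "... = rmap W (rtl A W W A (lmap W) (wl A (T ?B (T V A)) (T W A) (rtl ?B V W A ?e) y))"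
   using y(1) lawsW(3) by simp
  also have "rtl A W W A (lmap W) (wl A (T ?B (T V A)) (T W A) (rtl ?B V W A ?e) y) = rtl ?h V W A ?ev (rtl A ?B ?h (T V A) ?l y)"
   by (rule rtl_tail[symmetric]) (use y l lam in simp_all)
  finally show "F1 V W (wr (T A ?B) ?h (T V A) ?l t) = F2 V W (wr (T A ?B) ?h (T V A) ?l t)" unfolding w by (simp add: F2_def)
 qed simp
 have rB: "?r : mor (T ?B A) ?B"
 proof (rule bihom_range[OF V W _ r])
  fix t assume t: "t:.(T ?B A)**V**A"
  obtain y where y: "y:.?B**A**V**A" "ainv ?B A (T V A) y = t"
   using ainv_surj[of ?B A "T V A" t] t by auto
  have w: "wr (T ?B A) ?h (T V A) ?r t = rtl ?B A ?h (T V A) ?r y" unfolding rtl_def y(2) ..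
  have "F1 V W (rtl ?B A ?h (T V A) ?r y) = ?e (wl ?B (T A V) V (lmap V) (wl ?B (T A (T V A)) (T A V) (wl A (T V A) V (rmap V)) y))"
   using y(1) r rho by (simp add: F1_def rtl_wl)
  also have "... = ?e (wl ?B (T V A) V (rmap V) (wl ?B (T A (T V A)) (T V A) (rtl A V V A (lmap V)) y))"
   by (rule arg_cong[OF wl_square]) (use y lawsV(3) in simp_all)
  also have "... = rmap W (rtl ?B V W A ?e (wl ?B (T A (T V A)) (T V A) (rtl A V V A (lmap V)) y))"
   using y(1) ev_kernel[OF V W] by simp
  also have "rtl ?B V W A ?e (wl ?B (T A (T V A)) (T V A) (rtl A V V A (lmap V)) y) = rtl ?h V W A ?ev (rtl ?B A ?h (T V A) ?r y)"
   by (rule rtl_tail[symmetric]) (use y r rho in simp_all)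
  finally show "F1 V W (wr (T ?B A) ?h (T V A) ?r t) = F2 V W (wr (T ?B A) ?h (T V A) ?r t)" unfolding w by (simp add: F2_def)
 qed simp
 show L: "lmap ?B : mor (T A ?B) ?B" by (rule hmor_cong[OF lB]) (use le in simp_all)
 show R: "rmap ?B : mor (T ?B A) ?B" by (rule hmor_cong[OF rB]) (use re in simp_all)
 show "?e (rtl A ?B ?B V (lmap ?B) s) = lmap W (wl A (T ?B V) W ?e s)" if s: "s:.A**?B**V"
 proof -
  have "wr ?B ?h V ?i (rtl A ?B ?B V (lmap ?B) s) = rtl A ?B ?h V ?l s"
   by (rule rtl_post) (use s L l le in simp_all)
  then show ?thesis using lam[OF s] by (simp add: ev_def)
 qed
 show "?e (rtl ?B A ?B V (rmap ?B) t) = ?e (wl ?B (T A V) V (lmap V) t)" if t: "t:.?B**A**V"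
 proof -
  have "wr ?B ?h V ?i (rtl ?B A ?B V (rmap ?B) t) = rtl ?B A ?h V ?r t"
   by (rule rtl_post) (use t R r re in simp_all)
  then show ?thesis using rho[OF t] by (simp add: ev_def)
 qed
qed

text \<open>The unit is invariant, hence inserting it is a morphism although a general element of \<open>A\<close> would not give one.\<close>

lemma unit_insert:
 assumes V: "hm V"
 shows "(%v. pt A V u1 v) : mor V (T A V)" "(%v. pt V A v u1) : mor V (T V A)"
proof -
 note m = hm_module[OF hA] hm_module[OF V] and u = u1_closed
 have e: "act (T A V) h (pt A V u1 v) = pt A V u1 (act V h v) \<and> act (T V A) h (pt V A v u1) = pt V A (act V h v) u1"
  if h: "h:.H" and v: "v:.V" for h v
 proof -
  have k: "(%X. act V (epsl H X) v) : klin K P2 V" "(%X. act V (epsr H X) v) : klin K P2 V"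
   by (rule klin_comp[OF epsl_lin amodD(7)[OF hm_amod[OF V] v]] klin_comp[OF epsr_lin amodD(7)[OF hm_amod[OF V] v]]; simp)+
  have "a2 A V (\<Delta> h) (pt A V u1 v) = pt A V u1 (act V (epsl H (\<Delta> h)) v)"
  proof (rule tensor_eqI[OF mH mH amodD(7)[OF amod_a2[OF hA V]] lin_ptens2[OF m k(1) u]])
   fix a b assume ab: "a:.H" "b:.H"
   then show "a2 A V (p2 a b) (pt A V u1 v) = pt A V u1 (act V (epsl H (p2 a b)) v)"
    using u v V by (simp add: a_ptens u1_inv epsl_ptens ptens_smult act_smult)
  qed (use u v V h in simp_all)
  moreover have "a2 V A (\<Delta> h) (pt V A v u1) = pt V A (act V (epsr H (\<Delta> h)) v) u1"
  proof (rule tensor_eqI[OF mH mH amodD(7)[OF amod_a2[OF V hA]] lin_ptens1[OF m(2,1) k(2) u]])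
   fix a b assume ab: "a:.H" "b:.H"
   then show "a2 V A (p2 a b) (pt V A v u1) = pt V A (act V (epsr H (p2 a b)) v) u1"
    using u v V by (simp add: a_ptens u1_inv epsr_ptens ptens_smult act_smult)
  qed (use u v V h in simp_all)
  ultimately show ?thesis using h by (simp add: act_T a2_def[symmetric] eps_D)
 qed
 show "(%v. pt A V u1 v) : mor V (T A V)"
  by (rule hmorI) (use lin_ptens2[OF m klin_id(2) u] e in simp_all)
 show "(%v. pt V A v u1) : mor V (T V A)"
  by (rule hmorI) (use lin_ptens1[OF m(2,1) klin_id(2) u] e in simp_all)
qed

text \<open>Both sides of each law are morphisms into the internal hom, so they are compared by evaluation. Right linearity of the evaluation turns symmetry of \<open>V\<close> and \<open>W\<close> into symmetry of the hom.\<close>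

lemma bihom_symmetric:
 assumes V: "sb V" and W: "sb W"
 shows "sb (Bh V W)"
proof -
 let ?B = "Bh V W" let ?e = "ev V W" let ?l = "lmap ?B" and ?r = "rmap ?B"
 note a = bihom_actions[OF V W]
 note s [simp] = V W bihom_hm(1,2)[OF V W] a(1,2) u1_closed and lawsV = sb_laws[OF V] and lawsW = sb_laws[OF W]
 note sep = ev_separates[OF V W]
 let ?f1 = "%x. ?r (rtl ?B A ?B A ?r x)"
 let ?g1 = "%x. ?r (wl ?B (T A A) A (mu A) x)"
 let ?f2 = "%x. ?l (wl A (T A ?B) ?B ?l x)"
 let ?g2 = "%x. ?l (rtl A A A ?B (mu A) x)"
 let ?f3 = "%x. ?l (wl A (T ?B A) ?B ?r x)"
 let ?g3 = "%x. ?r (rtl A ?B ?B A ?l x)"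
 let ?fu = "%L. ?l (pt A ?B u1 L)"
 let ?gu = "%L. ?r (pt ?B A L u1)"
 let ?u = "%v. pt A V u1 v"
 let ?fb = "%x. ?r (br A ?B x)"
 let ?gb = "%x. ?l (br ?B A x)"
 have rr: "?r (rtl ?B A ?B A ?r x) = ?r (wl ?B (T A A) A (mu A) x)" if x: "x:.?B**A**A" for x
 proof (rule sep[of "T ?B (T A A)"])
  show f: "?f1 : mor (T ?B (T A A)) ?B" by (rule hmor_comp[OF rtl_hmor a(2)]) simp_all
  show g: "?g1 : mor (T ?B (T A A)) ?B" by (rule hmor_comp[OF wl_hmor a(2)]) simp_all
  fix t assume "t:.(T ?B (T A A))**V"
  then obtain y where y: "y:.?B**A**A**V" "ainv2 ?B A A V y = t" using ainv2_surj[of ?B A A V] by auto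
  have 1: "wr (T ?B (T A A)) ?B V ?f1 (ainv2 ?B A A V y) = rtl ?B A ?B V ?r (rtl ?B A ?B (T A V) ?r y)"
   by (rule ainv2_outer) (use y f in simp_all)
  have 2: "wr (T ?B (T A A)) ?B V ?g1 (ainv2 ?B A A V y) = rtl ?B A ?B V ?r (wl ?B (T A (T A V)) (T A V) (rtl A A A V (mu A)) y)"
   by (rule ainv2_inner) (use y g in simp_all)
  have 3: "wl ?B (T A V) V (lmap V) (wl ?B (T A (T A V)) (T A V) (wl A (T A V) V (lmap V)) y) =
    wl ?B (T A V) V (lmap V) (wl ?B (T A (T A V)) (T A V) (rtl A A A V (mu A)) y)"
   by (rule wl_square) (use y lawsV(2) in simp_all)
  show "?e (wr (T ?B (T A A)) ?B V ?f1 t) = ?e (wr (T ?B (T A A)) ?B V ?g1 t)"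
   unfolding y(2)[symmetric] 1 2 using y(1) a(4) 3 by (simp add: rtl_wl)
 qed (use x in simp_all)
 have ll: "?l (wl A (T A ?B) ?B ?l x) = ?l (rtl A A A ?B (mu A) x)" if x: "x:.A**A**?B" for x
 proof (rule sep[of "T A (T A ?B)"])
  show f: "?f2 : mor (T A (T A ?B)) ?B" by (rule hmor_comp[OF wl_hmor a(1)]) simp_all
  show g: "?g2 : mor (T A (T A ?B)) ?B" by (rule hmor_comp[OF rtl_hmor a(1)]) simp_all
  fix t assume "t:.(T A (T A ?B))**V"
  then obtain y where y: "y:.A**A**?B**V" "ainv2 A A ?B V y = t" using ainv2_surj[of A A ?B V] by auto
  have 1: "wr (T A (T A ?B)) ?B V ?f2 (ainv2 A A ?B V y) = rtl A ?B ?B V ?l (wl A (T A (T ?B V)) (T ?B V) (rtl A ?B ?B V ?l) y)"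
   by (rule ainv2_inner) (use y f in simp_all)
  have 2: "wr (T A (T A ?B)) ?B V ?g2 (ainv2 A A ?B V y) = rtl A ?B ?B V ?l (rtl A A A (T ?B V) (mu A) y)"
   by (rule ainv2_outer) (use y g in simp_all)
  have 3: "wl A (T ?B V) W ?e (wl A (T A (T ?B V)) (T ?B V) (rtl A ?B ?B V ?l) y) = wl A (T A W) W (lmap W) (wl A (T A (T ?B V)) (T A W) (wl A (T ?B V) W ?e) y)"
   by (rule wl_square) (use y a(3) in simp_all)
  show "?e (wr (T A (T A ?B)) ?B V ?f2 t) = ?e (wr (T A (T A ?B)) ?B V ?g2 t)"
   unfolding y(2)[symmetric] 1 2 using y(1) a(3) 3 lawsW(2)[of "wl A (T A (T ?B V)) (T A W) (wl A (T ?B V) W ?e) y"] by (simp add: rtl_wl)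
 qed (use x in simp_all)
 have lr: "?l (wl A (T ?B A) ?B ?r x) = ?r (rtl A ?B ?B A ?l x)" if x: "x:.A**?B**A" for x
 proof (rule sep[of "T A (T ?B A)"])
  show f: "?f3 : mor (T A (T ?B A)) ?B" by (rule hmor_comp[OF wl_hmor a(1)]) simp_all
  show g: "?g3 : mor (T A (T ?B A)) ?B" by (rule hmor_comp[OF rtl_hmor a(2)]) simp_all
  fix t assume "t:.(T A (T ?B A))**V"
  then obtain y where y: "y:.A**?B**A**V" "ainv2 A ?B A V y = t" using ainv2_surj[of A ?B A V] by auto
  have 1: "wr (T A (T ?B A)) ?B V ?f3 (ainv2 A ?B A V y) = rtl A ?B ?B V ?l (wl A (T ?B (T A V)) (T ?B V) (rtl ?B A ?B V ?r) y)"
   by (rule ainv2_inner) (use y f in simp_all)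
  have 2: "wr (T A (T ?B A)) ?B V ?g3 (ainv2 A ?B A V y) = rtl ?B A ?B V ?r (rtl A ?B ?B (T A V) ?l y)"
   by (rule ainv2_outer) (use y g in simp_all)
  have 3: "wl A (T ?B V) W ?e (wl A (T ?B (T A V)) (T ?B V) (rtl ?B A ?B V ?r) y) = wl A (T ?B V) W ?e (wl A (T ?B (T A V)) (T ?B V) (wl ?B (T A V) V (lmap V)) y)"
   by (rule wl_square) (use y a(4) in simp_all)
  show "?e (wr (T A (T ?B A)) ?B V ?f3 t) = ?e (wr (T A (T ?B A)) ?B V ?g3 t)"
   unfolding y(2)[symmetric] 1 2 using y(1) a(3,4) 3 by (simp add: rtl_wl)
 qed (use x in simp_all)
 note ui = unit_insert[OF bihom_hm(1)[OF V W]]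
 have f: "?fu : mor ?B ?B" by (rule hmor_comp[OF ui(1) a(1)])
 have g: "?gu : mor ?B ?B" by (rule hmor_comp[OF ui(2) a(2)])
 have el: "wr ?B ?B V ?fu t = rtl A ?B ?B V ?l (pt A (?B**V) u1 t)"
  and er: "wl ?B (T A V) V (lmap V) (wl ?B V (T A V) ?u t) = t"
  and eg: "wr ?B ?B V ?gu t = rtl ?B A ?B V ?r (wl ?B V (T A V) ?u t)"
  if t: "t:.?B**V" for t
 proof -
  have m: "module K ?B" "module K V" "module K A" by simp_all
  show "wr ?B ?B V ?fu t = rtl A ?B ?B V ?l (pt A (?B**V) u1 t)"
   by (rule tensor_eqI[OF m(1,2) wr_lin[OF _ _ _ f] klin_ptens(1)[OF _ _ rtl_lin] _ t])
    (use f wr_ptens[of "T A ?B" ?B V ?l] in "simp_all add: wr_ptens rtl_def ainv_invariant1 u1_inv")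
  show "wl ?B (T A V) V (lmap V) (wl ?B V (T A V) ?u t) = t"
   using wl_comp[of ?B V "T A V" V "%v. pt A V u1 v" "lmap V" "%x. x" t] unit_insert(1)[of V] hmor_id(2)[of V] t lawsV(4) wl_id[of ?B V t "%x. x"] by simp
  have "(%t. rtl ?B A ?B V ?r (wl ?B V (T A V) ?u t)) : mor (T ?B V) (T ?B V)"
   by (rule hmor_comp[OF wl_hmor rtl_hmor]) (use unit_insert(1)[of V] in simp_all)
  then have k: "(%t. rtl ?B A ?B V ?r (wl ?B V (T A V) ?u t)) : klin K (?B**V) (?B**V)"
   using hmor_lin by fastforce
  show "wr ?B ?B V ?gu t = rtl ?B A ?B V ?r (wl ?B V (T A V) ?u t)"
   by (rule tensor_eqI[OF m(1,2) wr_lin[OF _ _ _ g] k _ t])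
    (use g wr_ptens[of "T ?B A" ?B V ?r] unit_insert(1)[of V] in "simp_all add: wr_ptens wl_ptens rtl_def ainv_invariant2 u1_inv")
 qed
 have unit: "?l (pt A ?B u1 L) = L \<and> ?r (pt ?B A L u1) = L" if L: "L:.?B" for L
 proof
  have i: "wr ?B ?B V (%L. L) t = t" if "t:.?B**V" for t
   using that by (simp add: wr_def tmap_id[unfolded id_def] id_def)
  show "?l (pt A ?B u1 L) = L"
  proof (rule sep[OF _ f hmor_id(2) _ L])
   fix t assume t: "t:.?B**V"
   have "wl A (T ?B V) W ?e (pt A (?B**V) u1 t) = pt A W u1 (?e t)"
    using t wl_ptens[of A "T ?B V" W ?e u1 t] by simp
   then show "?e (wr ?B ?B V ?fu t) = ?e (wr ?B ?B V (%L. L) t)"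
    using t a(3)[of "pt A (?B**V) u1 t"] lawsW(4)[of "?e t"] hmor_closed[OF ev_hmor[OF V W], of t] by (simp add: el i)
  qed simp
  show "?r (pt ?B A L u1) = L"
  proof (rule sep[OF _ g hmor_id(2) _ L])
   fix t assume t: "t:.?B**V"
   show "?e (wr ?B ?B V ?gu t) = ?e (wr ?B ?B V (%L. L) t)"
    using t a(4)[of "wl ?B V (T A V) ?u t"] unit_insert(1)[of V] er by (simp add: eg i)
  qed simp
 qed
 have s1: "?r (br A ?B x) = ?l x" if x: "x:.A**?B" for x
 proof (rule sep[of "T A ?B"])
  show f: "?fb : mor (T A ?B) ?B" by (rule hmor_comp[OF braid_hmor a(2)]) simp_all
  fix t assume "t:.(T A ?B)**V"
  then obtain y where y: "y:.A**?B**V" "ainv A ?B V y = t" using ainv_surj[of A ?B V] by auto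
  let ?c = "crl A ?B V y"
  have "wr (T A ?B) ?B V ?fb t = rtl A ?B ?B V ?fb y" unfolding rtl_def y(2) ..
  also have "... = rtl ?B A ?B V ?r ?c" by (rule rtl_crl[symmetric]) (use y f in simp_all)
  also have "?e ... = ?e (wl ?B (T A V) V (lmap V) ?c)" using y a(4) by simp
  also have "... = ?e (wl ?B (T V A) V (rmap V) (wl ?B (T A V) (T V A) (br A V) ?c))"
   by (rule arg_cong[OF wl_comp[symmetric]]) (use y lawsV(6) in simp_all)
  also have "... = rmap W (rtl ?B V W A ?e (wl ?B (T A V) (T V A) (br A V) ?c))"
   using y by (simp add: ev_kernel)
  also have "rtl ?B V W A ?e (wl ?B (T A V) (T V A) (br A V) ?c) = br A W (wl A (T ?B V) W ?e y)"
   using y by (simp add: braid_wl_pair)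
  also have "rmap W ... = ?e (rtl A ?B ?B V ?l y)" using y a(3) lawsW(6) by simp
  finally show "?e (wr (T A ?B) ?B V ?fb t) = ?e (wr (T A ?B) ?B V ?l t)" unfolding rtl_def y(2) .
 qed (use x in simp_all)
 have s2: "?l (br ?B A x) = ?r x" if x: "x:.?B**A" for x
 proof (rule sep[of "T ?B A"])
  show f: "?gb : mor (T ?B A) ?B" by (rule hmor_comp[OF braid_hmor a(1)]) simp_all
  fix t assume "t:.(T ?B A)**V"
  then obtain y where y: "y:.?B**A**V" "ainv ?B A V y = t" using ainv_surj[of ?B A V] by auto
  have bs: "\<exists>u\<in>carrier (T V A). br V A u = z" if "z:.T A V" for z using braid_surj[of V A z] that by auto
  obtain z where z: "z:.?B**(T V A)" "wl ?B (T V A) (T A V) (br V A) z = y"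
   by (rule wl_surj[OF _ _ _ _ bs, where t = y and Q = "T A V" and V = ?B]) (use y in simp_all)
  let ?c = "crl ?B A V y"
  have "wr (T ?B A) ?B V ?gb t = rtl ?B A ?B V ?gb y" unfolding rtl_def y(2) ..
  also have "... = rtl A ?B ?B V ?l ?c" by (rule rtl_crl[symmetric]) (use y f in simp_all)
  also have "?e ... = lmap W (wl A (T ?B V) W ?e ?c)" using y a(3) by simp
  also have "wl A (T ?B V) W ?e ?c = br W A (rtl ?B V W A ?e z)"
   using z by (simp add: braid_rtl z(2)[symmetric])
  also have "lmap W ... = ?e (wl ?B (T V A) V (rmap V) z)" using z(1) lawsW(7) by (simp add: ev_kernel)
  also have "... = ?e (wl ?B (T A V) V (lmap V) y)"
   unfolding z(2)[symmetric] by (rule arg_cong[OF wl_comp[symmetric]]) (use z lawsV(7) in simp_all)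
  also have "... = ?e (rtl ?B A ?B V ?r y)" using y a(4) by simp
  finally show "?e (wr (T ?B A) ?B V ?gb t) = ?e (wr (T ?B A) ?B V ?r t)" unfolding rtl_def y(2) .
 qed (use x in simp_all)
 show ?thesis
  unfolding sym_iff bimod_iff
  by (intro conjI ballI s(3) a(1,2) rr ll lr s1 s2 conjunct1[OF unit] conjunct2[OF unit])
qed

lemma beval_pj:
 assumes V: "sb V" and W: "sb W"
 shows "beval K H V W : mor (BT (Bh V W) V) W" "t:.(Bh V W)**V ==> beval K H V W (pj (Bh V W) V t) = ev V W t"
proof -
 note B = bihom_symmetric[OF V W]
 note d = BT_descend[OF sb_pm[OF B] sb_pm[OF V] sb_simps(1)[OF W] ev_hmor[OF V W] bihom_actions(4)[OF V W]]
 have e: "beval K H V W Z = ev V W (rep Z)" if "Z:.BT (Bh V W) V" for Z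
  using heval_bihom[OF V W rep_closed(1)[OF _ _ that]] B V by (simp add: beval_def)
 show "beval K H V W : mor (BT (Bh V W) V) W" by (rule hmor_cong[OF d(1)]) (use e B V in simp_all)
 show "t:.(Bh V W)**V ==> beval K H V W (pj (Bh V W) V t) = ev V W t"
  using e[of "pj (Bh V W) V t"] d(2)[of t] B V by simp
qed

lemma beval_bimor:
 assumes V: "sb V" and W: "sb W"
 shows "beval K H V W \<in> bimor K H A (BT (Bh V W) V) W"
proof -
 let ?B = "Bh V W" let ?T = "BT ?B V" let ?e = "ev V W" let ?b = "beval K H V W"
 note s [simp] = V W bihom_symmetric[OF V W] and b = beval_pj[OF V W] and a = bihom_actions[OF V W]
 show ?thesis
 proof (rule bimorI)
  fix t assume "t:.A**?T"
  then obtain s where s: "s:.A**?B**V" "wl A (T ?B V) ?T (pj ?B V) s = t"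
   using BT_wl_surj[of ?B V A t] by auto
  have "wl A ?T W ?b (wl A (T ?B V) ?T (pj ?B V) s) = wl A (T ?B V) W ?e s" by (rule wl_comp) (use s b in simp_all)
  then show "?b (lmap ?T t) = lmap W (wl A ?T W ?b t)"
   unfolding s(2)[symmetric] using s(1) BT_lmap(2)[of ?B V s] b(2) a(3) by simp
 next
  fix t assume "t:.?T**A"
  then obtain y where y: "y:.?B**V**A" "rtl ?B V ?T A (pj ?B V) y = t"
   using BT_rtl_surj[of ?B V A t] by auto
  have "wr ?T W A ?b (rtl ?B V ?T A (pj ?B V) y) = rtl ?B V W A ?e y" by (rule rtl_post) (use y b in simp_all)
  then show "?b (rmap ?T t) = rmap W (wr ?T W A ?b t)"
   unfolding y(2)[symmetric] using y(1) BT_rmap(2)[of ?B V y] b(2) ev_kernel[OF V W] by simp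
 qed (use b in simp_all)
qed

text \<open>The adjunct of a bimodule morphism is the curried map; it lands in the kernel because \<open>f\<close> is right linear.\<close>

lemma bihom_universal:
 assumes X: "sb X" and V: "sb V" and W: "sb W" and f: "f \<in> bimor K H A (BT X V) W"
 shows "\<exists>!g. g \<in> bimor K H A X (Bh V W) \<and> g \<in> extensional (carrier X) \<and>
  (\<forall>Z\<in>carrier (BT X V). beval K H V W (bmp A (Bh V W) V g id Z) = f Z)"
proof -
 let ?B = "Bh V W" let ?h = "hh V W" let ?T = "BT X V" let ?e = "ev V W" let ?ev = "hev V W"
 note s [simp] = X V W bihom_symmetric[OF V W] BT_sb[OF X V] and a = bihom_actions[OF V W] and i = bihom_hm(2)[OF V W]
 note F = bimor_laws[OF _ _ f, simplified]
 let ?f = "%t. f (pj X V t)"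
 have fp: "?f : mor (T X V) W" by (rule hmor_comp[OF pj_hmor F(1)]) simp_all
 define g where "g = restrict (hcurry X V W ?f) (carrier X)"
 have gh: "g : mor X ?h" by (rule hmor_cong[OF curry_hmor[OF _ _ _ fp]]) (simp_all add: g_def)
 have ge: "?ev (wr X ?h V g t) = ?f t" if t: "t:.X**V" for t
 proof -
  have "wr X ?h V g t = wr X ?h V (hcurry X V W ?f) t"
   by (rule tensor_eqI[OF _ _ wr_lin[OF _ _ _ gh] wr_lin[OF _ _ _ curry_hmor[OF _ _ _ fp]] _ t])
    (use gh curry_hmor[OF _ _ _ fp] in "simp_all add: wr_ptens g_def")
  then show ?thesis using heval_curry_wr[OF _ _ _ fp t] by simp
 qed
 have gB: "g : mor X ?B"
 proof (rule bihom_range[OF V W _ gh])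
  fix t assume t: "t:.X**V**A"
  have "F1 V W (wr X ?h (T V A) g t) = ?ev (wr X ?h V g (wl X (T V A) V (rmap V) t))"
   using t gh wr_wl[of X "T V A" ?h V g "rmap V" t] by (simp add: F1_def)
  also have "... = f (rmap ?T (rtl X V ?T A (pj X V) t))" using t BT_rmap(2)[OF X V] by (simp add: ge)
  also have "... = rmap W (wr ?T W A f (rtl X V ?T A (pj X V) t))" using t F by simp
  also have "wr ?T W A f (rtl X V ?T A (pj X V) t) = rtl X V W A ?f t" by (rule rtl_post) (use t F fp in simp_all)
  also have "... = rtl ?h V W A ?ev (wr X ?h (T V A) g t)"
   by (rule rtl_pre1[symmetric]) (use t gh fp ge in simp_all)
  finally show "F1 V W (wr X ?h (T V A) g t) = F2 V W (wr X ?h (T V A) g t)" by (simp add: F2_def)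
 qed simp
 have ee: "?e (wr X ?B V k t) = ?ev (wr X ?h V k t)" if "k : mor X ?B" "t:.X**V" for k t
  unfolding ev_def by (rule arg_cong[OF wr_comp]) (use that i hmor_comp[OF that(1) i] in simp_all)
 have gE: "?e (wr X ?B V g t) = ?f t" if "t:.X**V" for t using ee[OF gB that] ge[OF that] by simp
 let ?gl = "%x. g (lmap X x)" and ?lg = "%x. lmap ?B (wl A X ?B g x)" and ?gr = "%x. g (rmap X x)" and ?rg = "%x. rmap ?B (wr X ?B A g x)"
 have gl: "g (lmap X x) = lmap ?B (wl A X ?B g x)" if x: "x:.A**X" for x
 proof (rule ev_separates[OF V W, of "T A X" "?gl" "?lg"])
  show p: "?gl : mor (T A X) ?B" by (rule hmor_comp[OF _ gB]) simp
  show q: "?lg : mor (T A X) ?B" by (rule hmor_comp[OF wl_hmor a(1)]) (use gB in simp_all)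
  fix t assume "t:.(T A X)**V"
  then obtain y where y: "y:.A**X**V" "ainv A X V y = t" using ainv_surj[of A X V] by auto
  have "rtl A X ?B V ?gl y = wr X ?B V g (rtl A X X V (lmap X) y)"
   by (rule rtl_post[symmetric]) (use y p gB in simp_all)
  then have "?e (rtl A X ?B V ?gl y) = lmap W (wl A ?T W f (wl A (T X V) ?T (pj X V) y))"
   using y F(2)[of "wl A (T X V) ?T (pj X V) y"] BT_lmap(2)[OF X V, of y] by (simp add: gE)
  also have "wl A ?T W f (wl A (T X V) ?T (pj X V) y) = wl A (T ?B V) W ?e (wl A (T X V) (T ?B V) (wr X ?B V g) y)"
   by (rule wl_square) (use y F gB gE in simp_all)
  also have "lmap W ... = ?e (rtl A ?B ?B V (lmap ?B) (wl A (T X V) (T ?B V) (wr X ?B V g) y))" using y gB a(1,3) by simp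
  also have "rtl A ?B ?B V (lmap ?B) (wl A (T X V) (T ?B V) (wr X ?B V g) y) = rtl A X ?B V ?lg y"
   by (rule rtl_pre2) (use y gB a(1) q in simp_all)
  finally show "?e (wr (T A X) ?B V ?gl t) = ?e (wr (T A X) ?B V ?lg t)"
   unfolding rtl_def y(2) .
 qed (use x in simp_all)
 have gr: "g (rmap X x) = rmap ?B (wr X ?B A g x)" if x: "x:.X**A" for x
 proof (rule ev_separates[OF V W, of "T X A" "?gr" "?rg"])
  show p: "?gr : mor (T X A) ?B" by (rule hmor_comp[OF _ gB]) simp
  show q: "?rg : mor (T X A) ?B" by (rule hmor_comp[OF wr_hmor a(2)]) (use gB in simp_all)
  fix t assume "t:.(T X A)**V"
  then obtain y where y: "y:.X**A**V" "ainv X A V y = t" using ainv_surj[of X A V] by auto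
  have "rtl X A ?B V ?gr y = wr X ?B V g (rtl X A X V (rmap X) y)"
   by (rule rtl_post[symmetric]) (use y p gB in simp_all)
  then have "?e (rtl X A ?B V ?gr y) = ?e (wr X ?B V g (wl X (T A V) V (lmap V) y))"
   using y by (simp add: gE pj_balanced)
  also have "... = ?e (rtl ?B A ?B V (rmap ?B) (wr X ?B (T A V) g y))"
   using y gB a(2,4) wr_wl[of X "T A V" ?B V g "lmap V" y] by simp
  also have "rtl ?B A ?B V (rmap ?B) (wr X ?B (T A V) g y) = rtl X A ?B V ?rg y"
   by (rule rtl_pre1) (use y gB a(2) q in simp_all)
  finally show "?e (wr (T X A) ?B V ?gr t) = ?e (wr (T X A) ?B V ?rg t)"
   unfolding rtl_def y(2) .
 qed (use x in simp_all)
 have gb: "g \<in> bimor K H A X ?B" by (rule bimorI[OF _ _ gB gl gr]) simp_all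
 have be: "beval K H V W (bmp A ?B V k id (pj X V t)) = ?e (wr X ?B V k t)"
  if k: "k \<in> bimor K H A X ?B" and t: "t:.X**V" for k t
 proof -
  have "wl ?B V V id (wr X ?B V k t) = wr X ?B V k t" by (rule wl_id) (use t bimor_laws(1)[OF _ _ k] in simp_all)
  then show ?thesis using bmap_pj(2)[OF X V _ V k bimor_id t] beval_pj(2)[OF V W] t bimor_laws(1)[OF _ _ k] by (simp add: tm_def)
 qed
 show ?thesis
 proof (rule ex1I[of _ g])
  show "g \<in> bimor K H A X ?B \<and> g \<in> extensional (carrier X) \<and> (\<forall>Z\<in>carrier ?T. beval K H V W (bmp A ?B V g id Z) = f Z)"
  proof (intro conjI ballI gb)
   show "g \<in> extensional (carrier X)" by (simp add: g_def)
   fix Z assume "Z:.?T"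
   then obtain t where "t:.X**V" "pj X V t = Z" using pj_surj[of X V Z] by auto
   then show "beval K H V W (bmp A ?B V g id Z) = f Z" using be[OF gb] gE by auto
  qed
  fix k assume k: "k \<in> bimor K H A X ?B \<and> k \<in> extensional (carrier X) \<and> (\<forall>Z\<in>carrier ?T. beval K H V W (bmp A ?B V k id Z) = f Z)"
  then have kb: "k \<in> bimor K H A X ?B" by blast
  have kh: "k : mor X ?B" using bimor_laws(1)[OF _ _ kb] by simp
  show "k = g"
  proof (rule extensionalityI[of _ "carrier X"])
   fix x assume x: "x:.X"
   show "k x = g x"
    by (rule ev_separates[OF V W _ kh gB _ x]) (use k be[OF kb] gE in "simp_all add: be[OF kb, symmetric]")
  qed (use k in "simp_all add: g_def")
 qed
qed

end

theorem theorem5p19: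
 fixes K :: "'k ring"
  and H :: "('k, 'h) quasi_hopf_data"
  and A :: "('k, 'h, 'a) halg"
 assumes "cring K"
  and "quasitriangular_quasi_hopf_algebra K H"
  and "algebra_in K H A"
  and "braided_commutative K H A"
 shows
  \<comment> \<open>the braiding of H-modules descends to the tensor product over A, with the explicit formula for it\<close>
  "(\<forall>(V :: ('k, 'h, 'a, 'v) bimod) (W :: ('k, 'h, 'a, 'w) bimod).
    sym_bimodule K H A V \<and> sym_bimodule K H A W \<longrightarrow>
     (\<forall>t\<in>carrier (htensor K H V W).
       bbraid K H A V W (bproj K H A V W t) = bproj K H A W V (braid K H V W t)) \<and>
     (\<forall>v\<in>carrier V. \<forall>w\<in>carrier W.
       bbraid K H A V W (bpt K H A V W v w) =
       tsum2 (btensor K H A W V) (rmatrix H) (\<lambda>r s. bpt K H A W V (s \<triangleright>\<^bsub>W\<^esub> w) (r \<triangleright>\<^bsub>V\<^esub> v))))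
   \<comment> \<open>symmetric bimodules form a category\<close>
   \<and> (\<forall>V :: ('k, 'h, 'a, 'v) bimod. sym_bimodule K H A V \<longrightarrow> id \<in> bimor K H A V V)
   \<and> (\<forall>(V :: ('k, 'h, 'a, 'v) bimod) (W :: ('k, 'h, 'a, 'w) bimod) (X :: ('k, 'h, 'a, 'x) bimod) f g.
     sym_bimodule K H A V \<and> sym_bimodule K H A W \<and> sym_bimodule K H A X \<and>
     f \<in> bimor K H A V W \<and> g \<in> bimor K H A W X \<longrightarrow> g \<circ> f \<in> bimor K H A V X)
   \<comment> \<open>it is stable under the unit object, the tensor product and the internal hom\<close>
   \<and> sym_bimodule K H A (unit_bimod A)
   \<and> (\<forall>(V :: ('k, 'h, 'a, 'v) bimod) (W :: ('k, 'h, 'a, 'w) bimod).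
     sym_bimodule K H A V \<and> sym_bimodule K H A W \<longrightarrow>
      sym_bimodule K H A (btensor K H A V W) \<and> sym_bimodule K H A (bihom K H A V W))
   \<comment> \<open>the tensor product is a bifunctor\<close>
   \<and> (\<forall>(V :: ('k, 'h, 'a, 'v) bimod) (W :: ('k, 'h, 'a, 'w) bimod).
     sym_bimodule K H A V \<and> sym_bimodule K H A W \<longrightarrow>
     (\<forall>Z\<in>carrier (btensor K H A V W). bmap K H A V W id id Z = Z))
   \<and> (\<forall>(V :: ('k, 'h, 'a, 'v) bimod) (W :: ('k, 'h, 'a, 'w) bimod)
      (V' :: ('k, 'h, 'a, 'v1) bimod) (W' :: ('k, 'h, 'a, 'w1) bimod) f g.
     sym_bimodule K H A V \<and> sym_bimodule K H A W \<and> sym_bimodule K H A V' \<and> sym_bimodule K H A W' \<and>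
     f \<in> bimor K H A V V' \<and> g \<in> bimor K H A W W' \<longrightarrow>
     bmap K H A V' W' f g \<in> bimor K H A (btensor K H A V W) (btensor K H A V' W'))
   \<and> (\<forall>(V :: ('k, 'h, 'a, 'v) bimod) (W :: ('k, 'h, 'a, 'w) bimod)
      (V' :: ('k, 'h, 'a, 'v1) bimod) (W' :: ('k, 'h, 'a, 'w1) bimod)
      (V'' :: ('k, 'h, 'a, 'v2) bimod) (W'' :: ('k, 'h, 'a, 'w2) bimod) f g f' g'.
     sym_bimodule K H A V \<and> sym_bimodule K H A W \<and> sym_bimodule K H A V' \<and> sym_bimodule K H A W' \<and>
     sym_bimodule K H A V'' \<and> sym_bimodule K H A W'' \<and>
     f \<in> bimor K H A V V' \<and> g \<in> bimor K H A W W' \<and>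
     f' \<in> bimor K H A V' V'' \<and> g' \<in> bimor K H A W' W'' \<longrightarrow>
     (\<forall>Z\<in>carrier (btensor K H A V W).
       bmap K H A V'' W'' (f' \<circ> f) (g' \<circ> g) Z =
       bmap K H A V'' W'' f' g' (bmap K H A V' W' f g Z)))
   \<comment> \<open>associator and unitors are natural isomorphisms\<close>
   \<and> (\<forall>(V :: ('k, 'h, 'a, 'v) bimod) (W :: ('k, 'h, 'a, 'w) bimod) (X :: ('k, 'h, 'a, 'x) bimod).
     sym_bimodule K H A V \<and> sym_bimodule K H A W \<and> sym_bimodule K H A X \<longrightarrow>
     bimod_iso K H A (btensor K H A (btensor K H A V W) X) (btensor K H A V (btensor K H A W X))
      (bassoc K H A V W X))
   \<and> (\<forall>V :: ('k, 'h, 'a, 'v) bimod. sym_bimodule K H A V \<longrightarrow>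
     bimod_iso K H A (btensor K H A (unit_bimod A) V) V (lunitor V) \<and>
     bimod_iso K H A (btensor K H A V (unit_bimod A)) V (runitor V))
   \<and> (\<forall>(V :: ('k, 'h, 'a, 'v) bimod) (W :: ('k, 'h, 'a, 'w) bimod) (X :: ('k, 'h, 'a, 'x) bimod)
      (V' :: ('k, 'h, 'a, 'v1) bimod) (W' :: ('k, 'h, 'a, 'w1) bimod) (X' :: ('k, 'h, 'a, 'x1) bimod) f g h.
     sym_bimodule K H A V \<and> sym_bimodule K H A W \<and> sym_bimodule K H A X \<and>
     sym_bimodule K H A V' \<and> sym_bimodule K H A W' \<and> sym_bimodule K H A X' \<and>
     f \<in> bimor K H A V V' \<and> g \<in> bimor K H A W W' \<and> h \<in> bimor K H A X X' \<longrightarrow>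
     (\<forall>Z\<in>carrier (btensor K H A (btensor K H A V W) X).
       bassoc K H A V' W' X' (bmap K H A (btensor K H A V' W') X' (bmap K H A V' W' f g) h Z) =
       bmap K H A V' (btensor K H A W' X') f (bmap K H A W' X' g h) (bassoc K H A V W X Z)))
   \<and> (\<forall>(V :: ('k, 'h, 'a, 'v) bimod) (V' :: ('k, 'h, 'a, 'v1) bimod) f.
     sym_bimodule K H A V \<and> sym_bimodule K H A V' \<and> f \<in> bimor K H A V V' \<longrightarrow>
     (\<forall>Z\<in>carrier (btensor K H A (unit_bimod A) V).
       lunitor V' (bmap K H A (unit_bimod A) V' id f Z) = f (lunitor V Z)) \<and>
     (\<forall>Z\<in>carrier (btensor K H A V (unit_bimod A)).
       runitor V' (bmap K H A V' (unit_bimod A) f id Z) = f (runitor V Z)))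
   \<comment> \<open>coherence\<close>
   \<and> (\<forall>(V :: ('k, 'h, 'a, 'v) bimod) (W :: ('k, 'h, 'a, 'w) bimod)
      (X :: ('k, 'h, 'a, 'x) bimod) (Y :: ('k, 'h, 'a, 'y) bimod).
     sym_bimodule K H A V \<and> sym_bimodule K H A W \<and> sym_bimodule K H A X \<and> sym_bimodule K H A Y \<longrightarrow>
     pentagon K H A V W X Y)
   \<and> (\<forall>(V :: ('k, 'h, 'a, 'v) bimod) (W :: ('k, 'h, 'a, 'w) bimod).
     sym_bimodule K H A V \<and> sym_bimodule K H A W \<longrightarrow> triangle K H A V W)
   \<comment> \<open>closedness: the internal hom with its evaluation is right adjoint to the tensor product\<close>
   \<and> (\<forall>(V :: ('k, 'h, 'a, 'v) bimod) (W :: ('k, 'h, 'a, 'w) bimod).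
     sym_bimodule K H A V \<and> sym_bimodule K H A W \<longrightarrow>
     beval K H V W \<in> bimor K H A (btensor K H A (bihom K H A V W) V) W)
   \<and> (\<forall>(U :: ('k, 'h, 'a, 'u) bimod) (V :: ('k, 'h, 'a, 'v) bimod) (W :: ('k, 'h, 'a, 'w) bimod) f.
     sym_bimodule K H A U \<and> sym_bimodule K H A V \<and> sym_bimodule K H A W \<and>
     f \<in> bimor K H A (btensor K H A U V) W \<longrightarrow>
     (\<exists>!g. g \<in> bimor K H A U (bihom K H A V W) \<and> g \<in> extensional (carrier U) \<and>
       (\<forall>Z\<in>carrier (btensor K H A U V).
        beval K H V W (bmap K H A (bihom K H A V W) V g id Z) = f Z)))
   \<comment> \<open>the descended braiding is a natural isomorphism satisfying both hexagon identities\<close>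
   \<and> (\<forall>(V :: ('k, 'h, 'a, 'v) bimod) (W :: ('k, 'h, 'a, 'w) bimod).
     sym_bimodule K H A V \<and> sym_bimodule K H A W \<longrightarrow>
     bimod_iso K H A (btensor K H A V W) (btensor K H A W V) (bbraid K H A V W))
   \<and> (\<forall>(V :: ('k, 'h, 'a, 'v) bimod) (W :: ('k, 'h, 'a, 'w) bimod)
      (V' :: ('k, 'h, 'a, 'v1) bimod) (W' :: ('k, 'h, 'a, 'w1) bimod) f g.
     sym_bimodule K H A V \<and> sym_bimodule K H A W \<and> sym_bimodule K H A V' \<and> sym_bimodule K H A W' \<and>
     f \<in> bimor K H A V V' \<and> g \<in> bimor K H A W W' \<longrightarrow>
     (\<forall>Z\<in>carrier (btensor K H A V W).
       bbraid K H A V' W' (bmap K H A V' W' f g Z) = bmap K H A W' V' g f (bbraid K H A V W Z)))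
   \<and> (\<forall>(V :: ('k, 'h, 'a, 'v) bimod) (W :: ('k, 'h, 'a, 'w) bimod) (X :: ('k, 'h, 'a, 'x) bimod).
     sym_bimodule K H A V \<and> sym_bimodule K H A W \<and> sym_bimodule K H A X \<longrightarrow>
     hexagon1 K H A V W X \<and> hexagon2 K H A V W X)"
proof -
 have bc: "qtqh_commutative K H A"
  by (intro qtqh_commutative.intro qtqh_algebra.intro qtqh.intro qtqh_algebra_axioms.intro qtqh_commutative_axioms.intro assms)
 interpret qtqh_commutative K H A by (rule bc)
 show ?thesis
  apply (intro conjI allI impI; (elim conjE)?)
  subgoal for V W by (intro conjI ballI; (elim conjE)?) (rule bbraid_pj(2); simp)
  subgoal for V W by (intro ballI; (elim conjE)?) (rule bbraid_formula; assumption)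
  subgoal by (rule bimor_id)
  subgoal by (rule bimor_comp)
  subgoal by (rule sb_unit)
  subgoal by (rule BT_sb)
  subgoal by (rule bihom_symmetric)
  subgoal by (intro ballI) (rule bmap_id)
  subgoal by (rule bmap_bimor)
  subgoal by (intro ballI) (rule bmap_comp)
  subgoal by (rule bassoc_iso(2))
  subgoal by (rule lunitor_iso(2))
  subgoal by (rule runitor_iso(2))
  subgoal by (intro ballI) (rule bassoc_natural)
  subgoal by (intro ballI) (rule lunitor_natural)
  subgoal by (intro ballI) (rule runitor_natural)
  subgoal by (rule pentagon_holds)
  subgoal by (rule triangle_holds)
  subgoal by (rule beval_bimor)
  subgoal by (rule bihom_universal)
  subgoal by (rule bbraid_iso(2))
  subgoal by (intro ballI) (rule bbraid_natural)
  subgoal by (rule hexagons_hold(1))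
  subgoal by (rule hexagons_hold(2))
  done
qed

end
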